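(* Let $\mathcal{M}=\left(\mathfrak{L}(\mathbf{F}_{11/3})\otimes R_0\right)\rtimes_\gamma\mathbb{Z}_3$ be the crossed product described in the context, with implementing unitary $v$. Let $\beta_\mu\in\operatorname{Ct}(\mathcal{M})\cap\overline{\operatorname{Int}(\mathcal{M})}$ be the automorphism of $\mathcal{M}$ defined by $$\beta_\mu\left(\sum_{k=0}^2a_kv^k\right)=\sum_{k=0}^2\left(\mathrm{Id}\otimes(\operatorname{Ad}(U_0^* )\,\beta)\right)(a_k)\,v^k,\qquad a_k\in\mathfrak{L}(\mathbf{F}_{11/3})\otimes R_0,$$ and let $\sigma=\xi(\beta_\mu)\in\chi(\mathcal{M})$ be its class in $\operatorname{Out}(\mathcal{M})$. Then the Jones invariant of $\sigma$ is $\varkappa(\sigma)=e^{2\pi i/9}$.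
   Context: Connes invariant: for a II$_1$ factor $M$ with separable predual and trace norm $\|x\|_2=\tau(x^*x)^{1/2}$, $\operatorname{Int}(M)$ is the group of inner automorphisms and $\overline{\operatorname{Int}(M)}$ its closure in $\operatorname{Aut}(M)$ for pointwise $\|\cdot\|_2$-convergence. A bounded sequence $(x_n)$ in $M$ is central if $\|[x_n,y]\|_2\to0$ for all $y\in M$; $\operatorname{Ct}(M)$ is the group of $\phi\in\operatorname{Aut}(M)$ with $\|\phi(x_n)-x_n\|_2\to0$ for every central sequence $(x_n)$. Let $\xi:\operatorname{Aut}(M)\to\operatorname{Out}(M)=\operatorname{Aut}(M)/\operatorname{Int}(M)$ be the quotient map, and $\chi(M)=(\operatorname{Ct}(M)\cap\overline{\operatorname{Int}(M)})/\operatorname{Int}(M)$. Jones invariant: a central sequence $(x_n)$ is hypercentral if $\|[x_n,y_n]\|_2\to0$ for every central sequence $(y_n)$, and trivial if $\|x_n-\tau(x_n)1\|_2\to0$. If $M$ has no non-trivial hypercentral sequences and $\theta\in\chi(M)$, choose $\phi\in\operatorname{Ct}(M)\cap\overline{\operatorname{Int}(M)}$ with $\xi(\phi)=\theta$ and unitaries $u_n\in M$ with $\phi=\lim_n\operatorname{Ad}u_n$; there is a scalar $\lambda_\phi\in\mathbb{T}$ with $\lim_n\|\phi(u_n)-\lambda_\phi u_n\|_2=0$, independent of choices, and $\varkappa(\theta)=\lambda_\phi$. Notation: $\epsilon=e^{2\pi i/3}$, $\delta=e^{2\pi i/9}$; $\operatorname{Ad}(w)(x)=wxw^*$; $S''$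 is the von Neumann algebra generated by $S$. $\mathfrak{L}(\mathbf{F}_t)$, $t>1$ real, denotes the interpolated free group factors of Dykema and Rădulescu. Model of $\mathfrak{L}(\mathbf{F}_{11/3})$: it is $\{X_1,X_2,X_3,u\}''$ with a faithful normal trace for which $X_1,X_2,X_3,u$ are free, each $X_i$ is semicircular, and $u=\sum_{j=1}^3\epsilon^j e_j$ is a unitary of order 3 with spectral projections $e_j$ of trace $1/3$. The automorphism $\alpha$ of it is given by $\alpha(X_1)=X_2$, $\alpha(X_2)=X_3$, $\alpha(X_3)=uX_1u^*$, $\alpha(u)=\epsilon u$; one has $\alpha^3=\operatorname{Ad}u$. Model of the hyperfinite II$_1$ factor: let $(U_k)_{k\in\mathbb{Z}}$ be unitaries of order 9, $U_k=\sum_{j=1}^9 e^{2\pi i j/9}U_k^{(j)}$ with spectral projections $U_k^{(j)}$ of trace $1/9$, and let $g=\sum_{j=1}^3\epsilon^j g_j$ be a unitary of order 3 with spectral projections $g_j$ of trace $1/3$, such that: $U_kgU_k^*=\bar\epsilon g$ for $k\in\{0,-1\}$ and $U_kgU_k^*=g$ for other $k$; $U_kU_{k+1}U_k^*=\delta U_{k+1}$ for all $k$; $U_iU_j=U_jU_i$ if $|i-j|\ge 2$. The (faithful normal) trace on the generated von Neumann algebra vanishes on each non-trivial monomial in $g$ and the $U_k$ (i.e. each ordered monomial $g^aU_{k_1}^{a_1}\cdots U_{k_r}^{a_r}$, $k_1<\dots<k_r$, $0\le a\le 2$, $0\le a_i\le 8$, with not all exponents zero). Put $R_0=\{g,U_0,U_1,U_2,\dots\}''$,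 which is a copy of the hyperfinite II$_1$ factor, and $\beta=\operatorname{Ad}(U_{-1})|_{R_0}$, so $\beta(g)=\bar\epsilon g$, $\beta(U_0)=\delta U_0$, $\beta(U_k)=U_k$ for $k\ge1$, and $\beta^3=\operatorname{Ad}g$. The action: for $l=1,2,3$ let $E_l=\sum_{1\le i,j\le3,\ i+j\equiv l \bmod 3}e_i\otimes g_j$, and $W=\bar\delta E_1+\bar\delta^2E_2+E_3$, a cube root of $u^*\otimes g^*$ fixed by $\alpha\otimes\beta$. Then $\gamma=\operatorname{Ad}(W)\circ(\alpha\otimes\beta)$ satisfies $\gamma^3=\mathrm{id}$ and defines an action of $\mathbb{Z}_3$ on $\mathfrak{L}(\mathbf{F}_{11/3})\otimes R_0$. The crossed product $\mathcal{M}$ is generated by $\mathfrak{L}(\mathbf{F}_{11/3})\otimes R_0$ and the unitary $v$ with $v^3=1$, $vxv^*=\gamma(x)$. *)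

theory Defs
  imports "HOL-Analysis.Analysis" "HOL-Algebra.Bij" "HOL-Algebra.Coset"
begin

section \<open>Complex Hilbert spaces\<close>

class scaleC =
  fixes scaleC :: "complex \<Rightarrow> 'a \<Rightarrow> 'a"  (infixr \<open>*\<^sub>C\<close> 75)

text \<open>The inner product \<open>cinner\<close> is linear in the first argument.\<close>

class complex_hilbert_space = real_inner + banach + scaleC +
  fixes cinner :: "'a \<Rightarrow> 'a \<Rightarrow> complex"
  assumes scaleC_add_right: "c *\<^sub>C (x + y) = c *\<^sub>C x + c *\<^sub>C y"
    and scaleC_add_left: "(c + d) *\<^sub>C x = c *\<^sub>C x + d *\<^sub>C x"
    and scaleC_scaleC: "c *\<^sub>C d *\<^sub>C x = (c * d) *\<^sub>C x"
    and scaleR_scaleC: "r *\<^sub>R x = complex_of_real r *\<^sub>C x"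
    and cinner_add_left: "cinner (x + y) z = cinner x z + cinner y z"
    and cinner_scaleC_left: "cinner (c *\<^sub>C x) y = c * cinner x y"
    and cinner_commute: "cinner x y = cnj (cinner y x)"
    and inner_cinner: "inner x y = Re (cinner x y)"

instantiation prod :: (complex_hilbert_space, complex_hilbert_space) complex_hilbert_space
begin

definition "c *\<^sub>C p = (c *\<^sub>C fst p, c *\<^sub>C snd p)"

definition "cinner p q = cinner (fst p) (fst q) + cinner (snd p) (snd q)"

instance
proof
  fix c d :: complex and r :: real and x y z :: "'a \<times> 'b"
  show "c *\<^sub>C (x + y) = c *\<^sub>C x + c *\<^sub>C y"
    by (simp add: scaleC_prod_def scaleC_add_right)
  show "(c + d) *\<^sub>C x = c *\<^sub>C x + d *\<^sub>C x"
    by (simp add: scaleC_prod_def scaleC_add_left)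
  show "c *\<^sub>C d *\<^sub>C x = (c * d) *\<^sub>C x"
    by (simp add: scaleC_prod_def scaleC_scaleC)
  show "r *\<^sub>R x = complex_of_real r *\<^sub>C x"
    by (simp add: scaleC_prod_def scaleR_prod_def scaleR_scaleC)
  show "cinner (x + y) z = cinner x z + cinner y z"
    by (simp add: cinner_prod_def cinner_add_left)
  show "cinner (c *\<^sub>C x) y = c * cinner x y"
    by (simp add: cinner_prod_def scaleC_prod_def cinner_scaleC_left distrib_left)
  have "cinner a b = cnj (cinner b a)" for a b :: 'a by (rule cinner_commute)
  moreover have "cinner a b = cnj (cinner b a)" for a b :: 'b by (rule cinner_commute)
  ultimately show "cinner x y = cnj (cinner y x)"
    unfolding cinner_prod_def by (metis complex_cnj_add)
  show "inner x y = Re (cinner x y)"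
    by (simp add: cinner_prod_def inner_prod_def inner_cinner)
qed

end


section \<open>Bounded operators\<close>

typedef (overloaded) 'h bop =
  "{f :: 'h::complex_hilbert_space \<Rightarrow> 'h. bounded_linear f \<and> (\<forall>c x. f (c *\<^sub>C x) = c *\<^sub>C f x)}"
  morphisms bop_apply Bop
proof
  have "(0::'h) = c *\<^sub>C 0" for c
    using scaleC_add_right[of c "0::'h" 0] by simp
  then show "(\<lambda>x. 0) \<in> {f :: 'h \<Rightarrow> 'h. bounded_linear f \<and> (\<forall>c x. f (c *\<^sub>C x) = c *\<^sub>C f x)}"
    by simp
qed

setup_lifting type_definition_bop

notation bop_apply (infixl \<open>\<cdot>\<close> 90)

lemma scaleC_zero: "c *\<^sub>C (0::'h::complex_hilbert_space) = 0"
  using scaleC_add_right[of c "0::'h" 0] by simp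

lemma scaleC_minus: "c *\<^sub>C (- x :: 'h::complex_hilbert_space) = - (c *\<^sub>C x)"
  using scaleC_add_right[of c x "- x"] scaleC_zero[of c]
  by (metis add.right_inverse add_eq_0_iff)

lemma norm_scaleC: "norm (c *\<^sub>C x :: 'h::complex_hilbert_space) = cmod c * norm x"
proof -
  have "cinner (c *\<^sub>C x) (c *\<^sub>C x) = c * (cnj c * cinner x x)"
    by (metis cinner_commute cinner_scaleC_left complex_cnj_mult)
  then have "inner (c *\<^sub>C x) (c *\<^sub>C x) = (cmod c)\<^sup>2 * inner x x"
    unfolding cmod_power2 by (simp add: inner_cinner) (simp add: power2_eq_square algebra_simps)
  then show ?thesis
    by (simp add: norm_eq_sqrt_inner real_sqrt_mult)
qed

lemma bounded_linear_scaleC: "bounded_linear (\<lambda>x. c *\<^sub>C x :: 'h::complex_hilbert_space)"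
  by (rule bounded_linear_intro[where K = "cmod c"])
    (simp_all add: scaleC_add_right scaleR_scaleC scaleC_scaleC norm_scaleC mult.commute)

instantiation bop :: (complex_hilbert_space) "{ring, monoid_mult, scaleC}"
begin

lift_definition zero_bop :: "'a bop" is "\<lambda>x. 0" by (simp add: scaleC_zero)

lift_definition one_bop :: "'a bop" is "\<lambda>x. x" by simp

lift_definition plus_bop :: "'a bop \<Rightarrow> 'a bop \<Rightarrow> 'a bop" is "\<lambda>f g x. f x + g x"
  by (simp add: bounded_linear_add scaleC_add_right)

lift_definition uminus_bop :: "'a bop \<Rightarrow> 'a bop" is "\<lambda>f x. - f x"
  by (simp add: bounded_linear_minus scaleC_minus)

lift_definition minus_bop :: "'a bop \<Rightarrow> 'a bop \<Rightarrow> 'a bop" is "\<lambda>f g x. f x - g x"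
  by (simp add: bounded_linear_sub)
    (metis add_uminus_conv_diff scaleC_add_right scaleC_minus)

lift_definition times_bop :: "'a bop \<Rightarrow> 'a bop \<Rightarrow> 'a bop" is "\<lambda>f g x. f (g x)"
  by (simp add: bounded_linear_compose)

lift_definition scaleC_bop :: "complex \<Rightarrow> 'a bop \<Rightarrow> 'a bop" is "\<lambda>c f x. c *\<^sub>C f x"
  by (simp add: bounded_linear_compose[OF bounded_linear_scaleC] scaleC_scaleC mult.commute)

instance
  by standard
    (transfer; simp add: algebra_simps fun_eq_iff linear_simps)+

end

definition adj :: "'h::complex_hilbert_space bop \<Rightarrow> 'h bop" where
  "adj x = (THE y. \<forall>\<xi> \<eta>. cinner (x \<cdot> \<xi>) \<eta> = cinner \<xi> (y \<cdot> \<eta>))"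

definition opnorm :: "'h::complex_hilbert_space bop \<Rightarrow> real" where
  "opnorm x = onorm (bop_apply x)"

definition Ad :: "'h::complex_hilbert_space bop \<Rightarrow> 'h bop \<Rightarrow> 'h bop" where
  "Ad w x = w * x * adj w"


section \<open>Von Neumann algebras and traces\<close>

definition commutant :: "'h::complex_hilbert_space bop set \<Rightarrow> 'h bop set" where
  "commutant S = {y. \<forall>x\<in>S. x * y = y * x}"

text \<open>The von Neumann algebra generated by a set is the bicommutant of its self-adjoint
  enlargement.\<close>

definition vN_gen :: "'h::complex_hilbert_space bop set \<Rightarrow> 'h bop set" where
  "vN_gen S = commutant (commutant (S \<union> adj ` S))"

text \<open>Normality means ultraweak continuity.\<close>

definition normal_functional ::
  "'h::complex_hilbert_space bop set \<Rightarrow> ('h bop \<Rightarrow> complex) \<Rightarrow> bool" where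
  "normal_functional M \<omega> \<longleftrightarrow>
    (\<exists>\<xi> \<eta> :: nat \<Rightarrow> 'h.
      summable (\<lambda>n. (norm (\<xi> n))\<^sup>2) \<and> summable (\<lambda>n. (norm (\<eta> n))\<^sup>2) \<and>
      (\<forall>x\<in>M. \<omega> x = (\<Sum>n. cinner (x \<cdot> \<xi> n) (\<eta> n))))"

definition normal_map ::
  "'h::complex_hilbert_space bop set \<Rightarrow> ('h bop \<Rightarrow> 'h bop) \<Rightarrow> bool" where
  "normal_map M \<phi> \<longleftrightarrow> (\<forall>\<omega>. normal_functional M \<omega> \<longrightarrow> normal_functional M (\<omega> \<circ> \<phi>))"

definition faithful_normal_trace ::
  "'h::complex_hilbert_space bop set \<Rightarrow> ('h bop \<Rightarrow> complex) \<Rightarrow> bool" where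
  "faithful_normal_trace M \<tau> \<longleftrightarrow>
    (\<forall>x\<in>M. \<forall>y\<in>M. \<tau> (x + y) = \<tau> x + \<tau> y) \<and>
    (\<forall>c. \<forall>x\<in>M. \<tau> (c *\<^sub>C x) = c * \<tau> x) \<and>
    (\<forall>x\<in>M. \<forall>y\<in>M. \<tau> (x * y) = \<tau> (y * x)) \<and>
    \<tau> 1 = 1 \<and>
    (\<forall>x\<in>M. \<tau> (adj x * x) \<in> \<real> \<and> Re (\<tau> (adj x * x)) \<ge> 0) \<and>
    (\<forall>x\<in>M. \<tau> (adj x * x) = 0 \<longrightarrow> x = 0) \<and>
    normal_functional M \<tau>"

definition norm2 :: "('h::complex_hilbert_space bop \<Rightarrow> complex) \<Rightarrow> 'h bop \<Rightarrow> real" where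
  "norm2 \<tau> x = sqrt (Re (\<tau> (adj x * x)))"

definition unitaries :: "'h::complex_hilbert_space bop set \<Rightarrow> 'h bop set" where
  "unitaries M = {w \<in> M. adj w * w = 1 \<and> w * adj w = 1}"


section \<open>Automorphisms and the Connes invariant\<close>

text \<open>As in \<open>HOL-Algebra.Bij\<close>, automorphisms are extensional functions on the algebra.\<close>

definition Aut :: "'h::complex_hilbert_space bop set \<Rightarrow> ('h bop \<Rightarrow> 'h bop) set" where
  "Aut M = {\<phi> \<in> Bij M.
    (\<forall>x\<in>M. \<forall>y\<in>M. \<phi> (x + y) = \<phi> x + \<phi> y) \<and>
    (\<forall>c. \<forall>x\<in>M. \<phi> (c *\<^sub>C x) = c *\<^sub>C \<phi> x) \<and>
    (\<forall>x\<in>M. \<forall>y\<in>M. \<phi> (x * y) = \<phi> x * \<phi> y) \<and>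
    (\<forall>x\<in>M. \<phi> (adj x) = adj (\<phi> x))}"

definition AutGroup :: "'h::complex_hilbert_space bop set \<Rightarrow> ('h bop \<Rightarrow> 'h bop) monoid" where
  "AutGroup M = BijGroup M \<lparr>carrier := Aut M\<rparr>"

definition Inn :: "'h::complex_hilbert_space bop set \<Rightarrow> ('h bop \<Rightarrow> 'h bop) set" where
  "Inn M = {restrict (Ad w) M | w. w \<in> unitaries M}"

definition OutGroup :: "'h::complex_hilbert_space bop set \<Rightarrow> ('h bop \<Rightarrow> 'h bop) set monoid" where
  "OutGroup M = AutGroup M Mod Inn M"

definition quotient_xi ::
  "'h::complex_hilbert_space bop set \<Rightarrow> ('h bop \<Rightarrow> 'h bop) \<Rightarrow> ('h bop \<Rightarrow> 'h bop) set" where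
  "quotient_xi M \<phi> = Inn M #>\<^bsub>AutGroup M\<^esub> \<phi>"

text \<open>Closure in the topology of pointwise convergence for the trace norm.\<close>

definition Inn_closure ::
  "'h::complex_hilbert_space bop set \<Rightarrow> ('h bop \<Rightarrow> complex) \<Rightarrow> ('h bop \<Rightarrow> 'h bop) set" where
  "Inn_closure M \<tau> = {\<phi> \<in> Aut M.
    \<forall>F \<epsilon>. finite F \<and> F \<subseteq> M \<and> \<epsilon> > 0 \<longrightarrow> (\<exists>\<psi>\<in>Inn M. \<forall>x\<in>F. norm2 \<tau> (\<phi> x - \<psi> x) < \<epsilon>)}"

definition central_sequence ::
  "'h::complex_hilbert_space bop set \<Rightarrow> ('h bop \<Rightarrow> complex) \<Rightarrow> (nat \<Rightarrow> 'h bop) \<Rightarrow> bool" where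
  "central_sequence M \<tau> x \<longleftrightarrow>
    (\<forall>n. x n \<in> M) \<and> (\<exists>C. \<forall>n. opnorm (x n) \<le> C) \<and>
    (\<forall>y\<in>M. (\<lambda>n. norm2 \<tau> (x n * y - y * x n)) \<longlonglongrightarrow> 0)"

definition Ct ::
  "'h::complex_hilbert_space bop set \<Rightarrow> ('h bop \<Rightarrow> complex) \<Rightarrow> ('h bop \<Rightarrow> 'h bop) set" where
  "Ct M \<tau> = {\<phi> \<in> Aut M.
    \<forall>x. central_sequence M \<tau> x \<longrightarrow> (\<lambda>n. norm2 \<tau> (\<phi> (x n) - x n)) \<longlonglongrightarrow> 0}"

definition ChiGroup ::
  "'h::complex_hilbert_space bop set \<Rightarrow> ('h bop \<Rightarrow> complex) \<Rightarrow> ('h bop \<Rightarrow> 'h bop) set monoid" where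
  "ChiGroup M \<tau> = (AutGroup M \<lparr>carrier := Ct M \<tau> \<inter> Inn_closure M \<tau>\<rparr>) Mod Inn M"


section \<open>The Jones invariant\<close>

text \<open>The scalar attached to a choice of representative \<open>\<phi>\<close> of the class \<open>\<theta>\<close> and of unitaries
  \<open>w n\<close> with \<open>\<phi> = lim Ad (w n)\<close>. The definite description makes the independence of these choices
  part of every statement about the value of the invariant; the absence of non-trivial
  hypercentral sequences is what guarantees that such a scalar exists for every class.\<close>

definition jones_kappa ::
  "'h::complex_hilbert_space bop set \<Rightarrow> ('h bop \<Rightarrow> complex) \<Rightarrow> ('h bop \<Rightarrow> 'h bop) set \<Rightarrow> complex" where
  "jones_kappa M \<tau> \<theta> = (THE z. cmod z = 1 \<and>
    (\<exists>\<phi> w. \<phi> \<in> Ct M \<tau> \<inter> Inn_closure M \<tau> \<and> quotient_xi M \<phi> = \<theta> \<and>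
      (\<forall>n. w n \<in> unitaries M) \<and>
      (\<forall>x\<in>M. (\<lambda>n. norm2 \<tau> (Ad (w n) x - \<phi> x)) \<longlonglongrightarrow> 0) \<and>
      (\<lambda>n. norm2 \<tau> (\<phi> (w n) - z *\<^sub>C w n)) \<longlonglongrightarrow> 0))"


section \<open>Free probability\<close>

inductive_set star_alg :: "'h::complex_hilbert_space bop set \<Rightarrow> 'h bop set"
  for S where
  gen: "x \<in> S \<Longrightarrow> x \<in> star_alg S"
| one: "1 \<in> star_alg S"
| add: "x \<in> star_alg S \<Longrightarrow> y \<in> star_alg S \<Longrightarrow> x + y \<in> star_alg S"
| mult: "x \<in> star_alg S \<Longrightarrow> y \<in> star_alg S \<Longrightarrow> x * y \<in> star_alg S"
| scale: "x \<in> star_alg S \<Longrightarrow> c *\<^sub>C x \<in> star_alg S"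
| adj: "x \<in> star_alg S \<Longrightarrow> adj x \<in> star_alg S"

definition free_family ::
  "('h::complex_hilbert_space bop \<Rightarrow> complex) \<Rightarrow> 'i set \<Rightarrow> ('i \<Rightarrow> 'h bop set) \<Rightarrow> bool" where
  "free_family \<tau> I B \<longleftrightarrow>
    (\<forall>is xs. length xs = length is \<and> is \<noteq> [] \<and> set is \<subseteq> I \<and> distinct_adj is \<and>
      (\<forall>j<length is. xs ! j \<in> B (is ! j) \<and> \<tau> (xs ! j) = 0) \<longrightarrow> \<tau> (prod_list xs) = 0)"

text \<open>Centred semicircle law of some radius \<open>r\<close>, through its moments.\<close>

definition semicircular ::
  "('h::complex_hilbert_space bop \<Rightarrow> complex) \<Rightarrow> 'h bop \<Rightarrow> bool" where
  "semicircular \<tau> x \<longleftrightarrow> adj x = x \<and>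
    (\<exists>r>0. \<forall>n. \<tau> (x ^ n) =
      complex_of_real (integral {-r..r} (\<lambda>t. t ^ n * (2 / (pi * r\<^sup>2) * sqrt (r\<^sup>2 - t\<^sup>2)))))"

text \<open>\<open>w\<close> is a unitary of order \<open>n\<close> with spectral projections \<open>p 1, \<dots>, p n\<close> of trace \<open>1/n\<close>.\<close>

definition uniform_unitary ::
  "('h::complex_hilbert_space bop \<Rightarrow> complex) \<Rightarrow> nat \<Rightarrow> 'h bop \<Rightarrow> (nat \<Rightarrow> 'h bop) \<Rightarrow> bool" where
  "uniform_unitary \<tau> n w p \<longleftrightarrow>
    (\<forall>j\<in>{1..n}. adj (p j) = p j \<and> p j * p j = p j \<and> \<tau> (p j) = 1 / of_nat n) \<and>
    (\<forall>i\<in>{1..n}. \<forall>j\<in>{1..n}. i \<noteq> j \<longrightarrow> p i * p j = 0) \<and>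
    (\<Sum>j=1..n. p j) = 1 \<and>
    w = (\<Sum>j=1..n. cis (2 * pi * real j / real n) *\<^sub>C p j)"


section \<open>Tensor products and crossed products\<close>

definition hilbert_tensor ::
  "('h::complex_hilbert_space \<Rightarrow> 'k::complex_hilbert_space \<Rightarrow> 'l::complex_hilbert_space) \<Rightarrow> bool" where
  "hilbert_tensor t \<longleftrightarrow>
    (\<forall>a a' b. t (a + a') b = t a b + t a' b) \<and>
    (\<forall>a b b'. t a (b + b') = t a b + t a b') \<and>
    (\<forall>c a b. t (c *\<^sub>C a) b = c *\<^sub>C t a b) \<and>
    (\<forall>c a b. t a (c *\<^sub>C b) = c *\<^sub>C t a b) \<and>
    (\<forall>a b a' b'. cinner (t a b) (t a' b') = cinner a a' * cinner b b') \<and>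
    closure (span {t a b | a b. True}) = UNIV"

definition op_tensor ::
  "('h::complex_hilbert_space \<Rightarrow> 'k::complex_hilbert_space \<Rightarrow> 'l::complex_hilbert_space) \<Rightarrow>
    'h bop \<Rightarrow> 'k bop \<Rightarrow> 'l bop" where
  "op_tensor t x y = (THE z. \<forall>a b. z \<cdot> t a b = t (x \<cdot> a) (y \<cdot> b))"

definition vN_tensor ::
  "('h::complex_hilbert_space \<Rightarrow> 'k::complex_hilbert_space \<Rightarrow> 'l::complex_hilbert_space) \<Rightarrow>
    'h bop set \<Rightarrow> 'k bop set \<Rightarrow> 'l bop set" where
  "vN_tensor t A B = vN_gen {op_tensor t x y | x y. x \<in> A \<and> y \<in> B}"

definition tensor_aut ::
  "('h::complex_hilbert_space \<Rightarrow> 'k::complex_hilbert_space \<Rightarrow> 'l::complex_hilbert_space) \<Rightarrow>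
    'h bop set \<Rightarrow> 'k bop set \<Rightarrow> ('h bop \<Rightarrow> 'h bop) \<Rightarrow> ('k bop \<Rightarrow> 'k bop) \<Rightarrow>
    ('l bop \<Rightarrow> 'l bop) \<Rightarrow> bool" where
  "tensor_aut t A B \<phi> \<psi> \<Phi> \<longleftrightarrow>
    \<Phi> \<in> Aut (vN_tensor t A B) \<and> normal_map (vN_tensor t A B) \<Phi> \<and>
    (\<forall>x\<in>A. \<forall>y\<in>B. \<Phi> (op_tensor t x y) = op_tensor t (\<phi> x) (\<psi> y))"

text \<open>The crossed product by an automorphism \<open>\<gamma>\<close> with \<open>\<gamma>\<^sup>3 = id\<close> acts on three copies of the Hilbert
  space, indexed by \<open>k = 0, 1, 2\<close>, by \<open>(\<pi>(x) \<xi>)(k) = \<gamma>\<^sup>-\<^sup>k(x) \<xi>(k)\<close> and \<open>(v \<xi>)(k) = \<xi>(k - 1)\<close>, so that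
  \<open>v \<pi>(x) v\<^sup>* = \<pi>(\<gamma>(x))\<close>. Negative powers of \<open>\<gamma>\<close> are written as \<open>\<gamma>\<^sup>-\<^sup>1 = \<gamma>\<^sup>2\<close> and \<open>\<gamma>\<^sup>-\<^sup>2 = \<gamma>\<close>.\<close>

lift_definition diag3 ::
  "'l::complex_hilbert_space bop \<Rightarrow> 'l bop \<Rightarrow> 'l bop \<Rightarrow> ('l \<times> 'l \<times> 'l) bop" is
  "\<lambda>x y z (\<xi>0, \<xi>1, \<xi>2). (x \<xi>0, y \<xi>1, z \<xi>2)"
  by (auto simp: scaleC_prod_def case_prod_unfold
      intro!: bounded_linear_Pair bounded_linear_compose[OF _ bounded_linear_fst]
        bounded_linear_compose[OF _ bounded_linear_compose[OF bounded_linear_fst bounded_linear_snd]]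
        bounded_linear_compose[OF _ bounded_linear_compose[OF bounded_linear_snd bounded_linear_snd]])

lift_definition crossed_v :: "('l::complex_hilbert_space \<times> 'l \<times> 'l) bop" is
  "\<lambda>(\<xi>0, \<xi>1, \<xi>2). (\<xi>2, \<xi>0, \<xi>1)"
  by (auto simp: scaleC_prod_def case_prod_unfold
      intro!: bounded_linear_Pair bounded_linear_fst bounded_linear_compose[OF bounded_linear_fst bounded_linear_snd]
        bounded_linear_compose[OF bounded_linear_snd bounded_linear_snd])

definition crossed_pi ::
  "('l::complex_hilbert_space bop \<Rightarrow> 'l bop) \<Rightarrow> 'l bop \<Rightarrow> ('l \<times> 'l \<times> 'l) bop" where
  "crossed_pi \<gamma> x = diag3 x (\<gamma> (\<gamma> x)) (\<gamma> x)"

definition crossed_product ::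
  "'l::complex_hilbert_space bop set \<Rightarrow> ('l bop \<Rightarrow> 'l bop) \<Rightarrow> ('l \<times> 'l \<times> 'l) bop set" where
  "crossed_product N \<gamma> = vN_gen (crossed_pi \<gamma> ` N \<union> {crossed_v})"


section \<open>The models\<close>

text \<open>The interpolated free group factor of parameter 11/3, generated by \<open>X 1, X 2, X 3, u\<close>.\<close>

definition LF_alg :: "(nat \<Rightarrow> 'h::complex_hilbert_space bop) \<Rightarrow> 'h bop \<Rightarrow> 'h bop set" where
  "LF_alg X u = vN_gen {X 1, X 2, X 3, u}"

definition LF_model ::
  "(nat \<Rightarrow> 'h::complex_hilbert_space bop) \<Rightarrow> 'h bop \<Rightarrow> (nat \<Rightarrow> 'h bop) \<Rightarrow> ('h bop \<Rightarrow> complex) \<Rightarrow> bool" where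
  "LF_model X u e \<tau> \<longleftrightarrow>
    faithful_normal_trace (LF_alg X u) \<tau> \<and>
    (\<forall>i\<in>{1..3}. semicircular \<tau> (X i)) \<and>
    uniform_unitary \<tau> 3 u e \<and>
    free_family \<tau> {0..3} (\<lambda>i. star_alg {if i = 0 then u else X i})"

definition LF_auto ::
  "(nat \<Rightarrow> 'h::complex_hilbert_space bop) \<Rightarrow> 'h bop \<Rightarrow> ('h bop \<Rightarrow> 'h bop) \<Rightarrow> bool" where
  "LF_auto X u \<alpha> \<longleftrightarrow> \<alpha> \<in> Aut (LF_alg X u) \<and>
    \<alpha> (X 1) = X 2 \<and> \<alpha> (X 2) = X 3 \<and> \<alpha> (X 3) = u * X 1 * adj u \<and> \<alpha> u = cis (2 * pi / 3) *\<^sub>C u"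

definition R_alg :: "'k::complex_hilbert_space bop \<Rightarrow> (int \<Rightarrow> 'k bop) \<Rightarrow> 'k bop set" where
  "R_alg g U = vN_gen (insert g (range U))"

definition R0_alg :: "'k::complex_hilbert_space bop \<Rightarrow> (int \<Rightarrow> 'k bop) \<Rightarrow> 'k bop set" where
  "R0_alg g U = vN_gen (insert g (U ` {0..}))"

definition R_model ::
  "'k::complex_hilbert_space bop \<Rightarrow> (nat \<Rightarrow> 'k bop) \<Rightarrow> (int \<Rightarrow> 'k bop) \<Rightarrow> (int \<Rightarrow> nat \<Rightarrow> 'k bop) \<Rightarrow>
    ('k bop \<Rightarrow> complex) \<Rightarrow> bool" where
  "R_model g gp U Up \<tau> \<longleftrightarrow>
    faithful_normal_trace (R_alg g U) \<tau> \<and>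
    uniform_unitary \<tau> 3 g gp \<and>
    (\<forall>k. uniform_unitary \<tau> 9 (U k) (Up k)) \<and>
    (\<forall>k. U k * g * adj (U k) = (if k \<in> {0, -1} then cnj (cis (2 * pi / 3)) *\<^sub>C g else g)) \<and>
    (\<forall>k. U k * U (k + 1) * adj (U k) = cis (2 * pi / 9) *\<^sub>C U (k + 1)) \<and>
    (\<forall>i j. \<bar>i - j\<bar> \<ge> 2 \<longrightarrow> U i * U j = U j * U i) \<and>
    (\<forall>a m ks. a \<le> 2 \<and> sorted_wrt (<) ks \<and> (\<forall>k\<in>set ks. m k \<le> 8) \<and>
      (a \<noteq> 0 \<or> (\<exists>k\<in>set ks. m k \<noteq> 0)) \<longrightarrow>
      \<tau> (g ^ a * prod_list (map (\<lambda>k. U k ^ m k) ks)) = 0)"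

definition R0_beta ::
  "'k::complex_hilbert_space bop \<Rightarrow> (int \<Rightarrow> 'k bop) \<Rightarrow> 'k bop \<Rightarrow> 'k bop" where
  "R0_beta g U = restrict (Ad (U (-1))) (R0_alg g U)"

definition E_proj ::
  "('h::complex_hilbert_space \<Rightarrow> 'k::complex_hilbert_space \<Rightarrow> 'l::complex_hilbert_space) \<Rightarrow>
    (nat \<Rightarrow> 'h bop) \<Rightarrow> (nat \<Rightarrow> 'k bop) \<Rightarrow> nat \<Rightarrow> 'l bop" where
  "E_proj t e gp l =
    (\<Sum>(i, j) \<in> {(i, j). i \<in> {1..3} \<and> j \<in> {1..3} \<and> (i + j) mod 3 = l mod 3}. op_tensor t (e i) (gp j))"

definition W_unitary ::
  "('h::complex_hilbert_space \<Rightarrow> 'k::complex_hilbert_space \<Rightarrow> 'l::complex_hilbert_space) \<Rightarrow>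
    (nat \<Rightarrow> 'h bop) \<Rightarrow> (nat \<Rightarrow> 'k bop) \<Rightarrow> 'l bop" where
  "W_unitary t e gp =
    cnj (cis (2 * pi / 9)) *\<^sub>C E_proj t e gp 1 + (cnj (cis (2 * pi / 9)))\<^sup>2 *\<^sub>C E_proj t e gp 2
      + E_proj t e gp 3"

end

theory Submission
  imports Defs
begin

text \<open>
  Write \<open>A\<close> for the interpolated free group factor, \<open>N = A \<otimes> R0\<close>, \<open>M = N \<rtimes> \<int>\<^sub>3\<close> and \<open>\<delta> = exp (2 \<pi> \<i> / 9)\<close>.
  The unitaries \<open>w\<^sub>n = 1 \<otimes> U\<^sub>1\<^sup>* U\<^sub>2 U\<^sub>3\<^sup>* \<dots>\<close> (with \<open>n + 2\<close> factors) commute with \<open>g\<close>, hence with \<open>W\<close>, and are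
  fixed by \<open>\<beta>\<close>; so they commute with \<open>v\<close>. Conjugation by \<open>w\<^sub>n\<close> eventually agrees with
  \<open>Id \<otimes> Ad (U\<^sub>0\<^sup>*) \<beta>\<close> on every generator (\<open>altprod_U\<close>), hence converges to it pointwise in the trace norm.
  This puts \<open>\<beta>\<^sub>\<mu>\<close> in the closure of the inner automorphisms, and \<open>\<beta>\<^sub>\<mu>(w\<^sub>n) = U\<^sub>0\<^sup>* w\<^sub>n U\<^sub>0 = \<delta> w\<^sub>n\<close> exactly. For a
  representative that fixes central sequences asymptotically the scalar does not depend on choices
  (\<open>jones_kappa_eqI\<close>), so the invariant is \<open>\<delta>\<close> once \<open>\<beta>\<^sub>\<mu>\<close> is known to be such a representative.

  That is the main work. Write a central sequence as \<open>a\<^sub>n + b\<^sub>n v + c\<^sub>n v\<^sup>2\<close>. Commutation with \<open>x \<otimes> 1\<close> says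
  that \<open>a\<^sub>n\<close> asymptotically commutes with \<open>A\<close>, and that \<open>b\<^sub>n W\<close> asymptotically intertwines \<open>X\<^sub>i\<close> with \<open>X\<^sub>i\<^sub>+\<^sub>1\<close>
  for \<open>i = 1, 2\<close>. By freeness, vectors whose reduced words do not begin with a letter from \<open>X\<^sub>i\<close> are moved
  by the Chebyshev polynomials of \<open>X\<^sub>i\<close> to orthogonal vectors, so an almost intertwining vector has
  almost no component among them (\<open>coarse_estimate\<close>). Using this for both \<open>X\<^sub>1\<close> and \<open>X\<^sub>2\<close> leaves only
  \<open>1 \<otimes> R0\<close> for \<open>a\<^sub>n\<close> and nothing for \<open>b\<^sub>n\<close> (\<open>asymptotic_equations\<close>); taking adjoints, nothing for \<open>c\<^sub>n\<close>
  either. On the remaining part, commutation with \<open>v\<close>, \<open>W\<close> and \<open>1 \<otimes> U\<^sub>0\<close> gives invariance under \<open>\<beta>\<close> and then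
  under \<open>\<beta>\<^sub>\<mu>\<close> (\<open>central_\<psi>\<close>).

  All maps between the algebras are compared through normality: by the density theorem, proved on
  square-summable sequences of vectors, a normal functional is determined by its values on the
  \<open>*\<close>-algebra of any generating set (\<open>normal_functional_eqI\<close>), and the generators of \<open>N\<close> are those of the
  two factors. This yields \<open>\<gamma>\<^sup>3 = id\<close>, \<open>\<psi> \<gamma> = \<gamma> \<psi>\<close> and the invariance of the trace from finitely many
  commutation relations.
\<close>

section \<open>Hilbert space basics\<close>

subsection \<open>The complex inner product\<close>

lemma scaleC_one [simp]: "1 *\<^sub>C (x::'a::complex_hilbert_space) = x"
  using scaleR_scaleC[of 1 x] by simp

lemma scaleC_zero_left [simp]: "0 *\<^sub>C (x::'a::complex_hilbert_space) = 0"
  using scaleR_scaleC[of 0 x] by simp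

lemma scaleC_minus_one [simp]: "(-1) *\<^sub>C (x::'a::complex_hilbert_space) = - x"
  using scaleR_scaleC[of "-1" x] by simp

lemma scaleC_diff_right: "c *\<^sub>C (x - y :: 'a::complex_hilbert_space) = c *\<^sub>C x - c *\<^sub>C y"
  using scaleC_add_right[of c x "- y"] by (simp add: scaleC_minus)

lemma cinner_add_right: "cinner x (y + z :: 'a::complex_hilbert_space) = cinner x y + cinner x z"
  by (metis cinner_add_left cinner_commute complex_cnj_add)

lemma cinner_scaleC_right: "cinner x (c *\<^sub>C y :: 'a::complex_hilbert_space) = cnj c * cinner x y"
  by (metis cinner_commute cinner_scaleC_left complex_cnj_mult)

lemma cinner_zero_left [simp]: "cinner 0 (x :: 'a::complex_hilbert_space) = 0"
  using cinner_scaleC_left[of 0 x x] by simp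

lemma cinner_zero_right [simp]: "cinner (x :: 'a::complex_hilbert_space) 0 = 0"
  using cinner_scaleC_right[of x 0 x] by simp

lemma cinner_minus_left: "cinner (- x :: 'a::complex_hilbert_space) y = - cinner x y"
  using cinner_scaleC_left[of "-1" x y] by simp

lemma cinner_minus_right: "cinner (x :: 'a::complex_hilbert_space) (- y) = - cinner x y"
  using cinner_scaleC_right[of x "-1" y] by simp

lemma cinner_diff_left: "cinner (x - y :: 'a::complex_hilbert_space) z = cinner x z - cinner y z"
  using cinner_add_left[of x "- y" z] by (simp add: cinner_minus_left)

lemma cinner_diff_right: "cinner (x :: 'a::complex_hilbert_space) (y - z) = cinner x y - cinner x z"
  using cinner_add_right[of x y "- z"] by (simp add: cinner_minus_right)

lemma cinner_scaleR_left: "cinner (r *\<^sub>R x :: 'a::complex_hilbert_space) y = of_real r * cinner x y"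
  by (simp add: scaleR_scaleC cinner_scaleC_left)

lemma cinner_self: "cinner x (x :: 'a::complex_hilbert_space) = of_real ((norm x)\<^sup>2)"
proof -
  have "Im (cinner x x) = 0"
    using cinner_commute[of x x] by (metis cnj.simps(2) neg_equal_zero)
  moreover have "Re (cinner x x) = (norm x)\<^sup>2"
    by (simp add: inner_cinner[symmetric] power2_norm_eq_inner)
  ultimately show ?thesis by (simp add: complex_eq_iff)
qed

lemma cinner_cauchy_schwarz: "cmod (cinner x (y :: 'a::complex_hilbert_space)) \<le> norm x * norm y"
proof (cases "cinner x y = 0")
  case False
  define c where "c = cnj (cinner x y) / cmod (cinner x y)"
  have c: "cmod c = 1" using False by (simp add: c_def norm_divide)
  have "cmod (cinner x y) = Re (cinner (c *\<^sub>C x) y)"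
  proof -
    have "c * cinner x y = complex_of_real ((cmod (cinner x y))\<^sup>2) / cmod (cinner x y)"
      unfolding complex_norm_square c_def by (simp add: mult.commute)
    then show ?thesis using False by (simp add: cinner_scaleC_left power2_eq_square)
  qed
  also have "\<dots> \<le> norm (c *\<^sub>C x) * norm y"
    by (metis inner_cinner norm_cauchy_schwarz)
  finally show ?thesis by (simp add: norm_scaleC c)
qed simp

lemma cinner_ext:
  assumes "\<And>y. cinner x y = cinner (x' :: 'a::complex_hilbert_space) y"
  shows "x = x'"
proof -
  have "cinner (x - x') (x - x') = 0" using assms by (simp add: cinner_diff_left)
  then show ?thesis by (simp add: cinner_self)
qed

lemma cinner_ext_right:
  assumes "\<And>x. cinner x y = cinner x (y' :: 'a::complex_hilbert_space)"
  shows "y = y'"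
  by (rule cinner_ext) (metis assms cinner_commute)

lemma bounded_linear_cinner_left: "bounded_linear (\<lambda>x. cinner x (y :: 'a::complex_hilbert_space))"
  by (rule bounded_linear_intro[where K = "norm y"])
    (simp_all add: cinner_add_left cinner_scaleR_left cinner_cauchy_schwarz scaleR_conv_of_real)

lemma tendsto_cinner_left:
  "(f \<longlongrightarrow> l) F \<Longrightarrow> ((\<lambda>n. cinner (f n) (y :: 'a::complex_hilbert_space)) \<longlongrightarrow> cinner l y) F"
  by (rule bounded_linear.tendsto[OF bounded_linear_cinner_left])


subsection \<open>Orthogonal projections and the Riesz representation theorem\<close>

definition csubspace :: "'a::complex_hilbert_space set \<Rightarrow> bool" where
  "csubspace V \<longleftrightarrow> 0 \<in> V \<and> (\<forall>x\<in>V. \<forall>y\<in>V. x + y \<in> V) \<and> (\<forall>c. \<forall>x\<in>V. c *\<^sub>C x \<in> V)"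

lemma csubspace_closure:
  assumes V: "csubspace V"
  shows "csubspace (closure V)"
  unfolding csubspace_def
proof (intro conjI ballI allI)
  show "0 \<in> closure V" using V closure_subset unfolding csubspace_def by blast
next
  fix x y assume "x \<in> closure V" "y \<in> closure V"
  then obtain f g where "\<And>n. f n \<in> V" "f \<longlonglongrightarrow> x" "\<And>n. g n \<in> V" "g \<longlonglongrightarrow> y"
    unfolding closure_sequential by blast
  then have "\<And>n. f n + g n \<in> V" "(\<lambda>n. f n + g n) \<longlonglongrightarrow> x + y"
    using V by (auto simp: csubspace_def intro: tendsto_add)
  then show "x + y \<in> closure V"
    unfolding closure_sequential by (intro exI[of _ "\<lambda>n. f n + g n"]) simp
next
  fix c x assume "x \<in> closure V"
  then obtain f where f: "\<And>n. f n \<in> V" "f \<longlonglongrightarrow> x"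
    unfolding closure_sequential by blast
  then have "\<And>n. c *\<^sub>C f n \<in> V" "(\<lambda>n. c *\<^sub>C f n) \<longlonglongrightarrow> c *\<^sub>C x"
    using V bounded_linear.tendsto[OF bounded_linear_scaleC f(2)] by (auto simp: csubspace_def)
  then show "c *\<^sub>C x \<in> closure V"
    unfolding closure_sequential by (intro exI[of _ "\<lambda>n. c *\<^sub>C f n"]) simp
qed

lemma csubspace_minus: "csubspace V \<Longrightarrow> x \<in> V \<Longrightarrow> - x \<in> V"
  unfolding csubspace_def by (metis scaleC_minus_one)

lemma csubspace_diff: "csubspace V \<Longrightarrow> x \<in> V \<Longrightarrow> y \<in> V \<Longrightarrow> x - y \<in> V"
  using csubspace_minus[of V y] unfolding csubspace_def by (metis diff_conv_add_uminus)

lemma parallelogram: "(norm (x - y))\<^sup>2 + (norm (x + y))\<^sup>2 = 2 * (norm x)\<^sup>2 + 2 * (norm (y::'a::real_inner))\<^sup>2"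
  by (simp add: power2_norm_eq_inner inner_add_left inner_add_right inner_diff_left inner_diff_right inner_commute)

text \<open>A minimizing sequence for the distance is Cauchy by the parallelogram law; its limit is the
  foot of the perpendicular.\<close>

lemma orthogonal_projection_exists:
  fixes V :: "'a::complex_hilbert_space set"
  assumes V: "csubspace V" and cl: "closed V"
  shows "\<exists>p\<in>V. \<forall>v\<in>V. cinner (x - p) v = 0"
proof -
  have ne: "V \<noteq> {}" using V unfolding csubspace_def by blast
  have Vadd: "a \<in> V \<Longrightarrow> b \<in> V \<Longrightarrow> a + b \<in> V" for a b using V unfolding csubspace_def by blast
  have Vsc: "a \<in> V \<Longrightarrow> c *\<^sub>C a \<in> V" for a c using V unfolding csubspace_def by blast
  define d where "d = infdist x V"
  have d0: "0 \<le> d" by (simp add: d_def infdist_nonneg)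
  have dle: "d \<le> norm (x - v)" if "v \<in> V" for v
    using infdist_le[OF that, of x] by (simp add: d_def dist_norm)
  have "\<exists>v\<in>V. norm (x - v) < d + 1 / real (Suc n)" for n
  proof (rule ccontr)
    assume "\<not> ?thesis"
    then have "d + 1 / real (Suc n) \<le> dist x v" if "v \<in> V" for v
      using that by (force simp: dist_norm)
    then have "d + 1 / real (Suc n) \<le> infdist x V"
      using ne by (auto simp: infdist_def intro!: cINF_greatest)
    then show False by (simp add: d_def)
  qed
  then obtain v where vV: "\<And>n. v n \<in> V" and vd: "\<And>n. norm (x - v n) < d + 1 / real (Suc n)"
    by metis
  have key: "(norm (v m - v n))\<^sup>2 \<le> 4 * (2 * d + 1) / real (Suc N)" if mn: "m \<ge> N" "n \<ge> N" for m n N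
  proof -
    have bnd: "(norm (x - v k))\<^sup>2 \<le> d\<^sup>2 + (2 * d + 1) / real (Suc N)" if "k \<ge> N" for k
    proof -
      have i: "1 / real (Suc k) \<le> 1 / real (Suc N)" using that by (simp add: frac_le)
      have "(norm (x - v k))\<^sup>2 \<le> (d + 1 / real (Suc N))\<^sup>2"
        using vd[of k] i by (intro power_mono) auto
      also have "\<dots> = d\<^sup>2 + (2 * d + 1 / real (Suc N)) * (1 / real (Suc N))"
        by (simp add: power2_eq_square algebra_simps)
      also have "\<dots> \<le> d\<^sup>2 + (2 * d + 1) * (1 / real (Suc N))"
        by (intro add_left_mono mult_right_mono) auto
      finally show ?thesis by simp
    qed
    define h where "h = (1/2) *\<^sub>R (v m + v n)"
    have "h \<in> V" unfolding h_def scaleR_scaleC by (intro Vsc Vadd vV)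
    then have "d\<^sup>2 \<le> (norm (x - h))\<^sup>2" using dle d0 by (intro power_mono) auto
    moreover have "(x - v m) + (x - v n) = 2 *\<^sub>R (x - h)"
      by (simp add: h_def algebra_simps scaleR_2)
    then have "(norm ((x - v m) + (x - v n)))\<^sup>2 = 4 * (norm (x - h))\<^sup>2"
      by (simp add: power_mult_distrib)
    moreover have "(norm (v m - v n))\<^sup>2 + (norm ((x - v m) + (x - v n)))\<^sup>2
        = 2 * (norm (x - v m))\<^sup>2 + 2 * (norm (x - v n))\<^sup>2"
      using parallelogram[of "x - v m" "x - v n"] by (simp add: norm_minus_commute)
    moreover have "4 * (2 * d + 1) / real (Suc N) = 4 * ((2 * d + 1) / real (Suc N))" by simp
    ultimately show ?thesis using bnd[OF mn(1)] bnd[OF mn(2)] by linarith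
  qed
  have "Cauchy v"
  proof (rule CauchyI)
    fix e :: real assume e: "0 < e"
    obtain N where N: "4 * (2 * d + 1) / e\<^sup>2 < real (Suc N)"
    proof -
      obtain N where "4 * (2 * d + 1) / e\<^sup>2 < real N" using reals_Archimedean2 by blast
      then show ?thesis using that[of N] by simp
    qed
    have "norm (v m - v n) < e" if "m \<ge> N" "n \<ge> N" for m n
    proof -
      have "4 * (2 * d + 1) / real (Suc N) < e\<^sup>2"
        using N e by (simp add: pos_divide_less_eq mult.commute)
      then have "(norm (v m - v n))\<^sup>2 < e\<^sup>2" using key[OF that] by linarith
      then show ?thesis using e by (simp add: power_less_imp_less_base)
    qed
    then show "\<exists>M. \<forall>m\<ge>M. \<forall>n\<ge>M. norm (v m - v n) < e" by blast
  qed
  then obtain p where p: "v \<longlonglongrightarrow> p" using Cauchy_convergent convergent_def by blast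
  have pV: "p \<in> V" using closed_sequentially[OF cl] vV p by blast
  have "(\<lambda>n. norm (x - v n)) \<longlonglongrightarrow> norm (x - p)" by (intro tendsto_intros p)
  moreover have "(\<lambda>n. d + 1 / real (Suc n)) \<longlonglongrightarrow> d + 0"
    by (intro tendsto_intros LIMSEQ_Suc[OF lim_1_over_n])
  ultimately have "norm (x - p) \<le> d + 0"
    by (rule LIMSEQ_le) (use vd in \<open>auto intro: less_imp_le\<close>)
  then have pd: "norm (x - p) \<le> d" by simp
  have "cinner (x - p) w = 0" if w: "w \<in> V" for w
  proof (rule ccontr)
    assume nz: "cinner (x - p) w \<noteq> 0"
    then have w0: "norm w > 0" by auto
    define c where "c = cinner (x - p) w / of_real ((norm w)\<^sup>2)"
    have "p + c *\<^sub>C w \<in> V" by (intro Vadd Vsc pV w)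
    then have "norm (x - p) \<le> norm (x - (p + c *\<^sub>C w))" using pd dle by fastforce
    then have le: "(norm (x - p))\<^sup>2 \<le> (norm ((x - p) - c *\<^sub>C w))\<^sup>2"
      by (simp add: diff_diff_eq)
    define a where "a = x - p"
    have "complex_of_real ((norm (a - c *\<^sub>C w))\<^sup>2)
        = cinner a a - cnj c * cinner a w - c * cinner w a + c * cnj c * cinner w w"
      unfolding cinner_self[symmetric]
      by (simp add: cinner_diff_left cinner_diff_right cinner_scaleC_left cinner_scaleC_right algebra_simps)
    also have "c * cinner w a = c * cnj (cinner a w)" by (metis cinner_commute)
    also have "c * cnj c * cinner w w = c * cnj (cinner a w)"
    proof -
      have "cnj c * cinner w w = cnj (cinner a w)"
        using w0 by (simp add: cinner_self c_def a_def)
      then show ?thesis by (simp add: mult.assoc)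
    qed
    also have "cnj c * cinner a w = of_real ((cmod (cinner a w))\<^sup>2 / (norm w)\<^sup>2)"
      by (simp add: c_def a_def complex_norm_square[symmetric] mult.commute)
    finally have "complex_of_real ((norm (a - c *\<^sub>C w))\<^sup>2)
        = of_real ((norm a)\<^sup>2 - (cmod (cinner a w))\<^sup>2 / (norm w)\<^sup>2)"
      by (simp add: cinner_self)
    then have "(norm (a - c *\<^sub>C w))\<^sup>2 = (norm a)\<^sup>2 - (cmod (cinner a w))\<^sup>2 / (norm w)\<^sup>2"
      using of_real_eq_iff by blast
    moreover have "(cmod (cinner a w))\<^sup>2 / (norm w)\<^sup>2 > 0" using nz w0 by (simp add: a_def)
    ultimately show False using le by (simp add: a_def)
  qed
  then show ?thesis using pV by blast
qed

text \<open>The representing vector is a multiple of the component orthogonal to the kernel.\<close>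

lemma riesz:
  fixes f :: "'a::complex_hilbert_space \<Rightarrow> complex"
  assumes f: "bounded_linear f" and fc: "\<And>c x. f (c *\<^sub>C x) = c * f x"
  shows "\<exists>y. \<forall>x. f x = cinner x y"
proof (cases "\<forall>x. f x = 0")
  case True
  then show ?thesis by (intro exI[of _ 0]) simp
next
  case False
  then obtain x where x: "f x \<noteq> 0" by blast
  interpret f: bounded_linear f by fact
  define V where "V = {x. f x = 0}"
  have "csubspace V" by (simp add: csubspace_def V_def f.zero f.add fc)
  moreover have "closed V"
    unfolding V_def by (intro closed_Collect_eq f.continuous_on continuous_on_id continuous_on_const)
  ultimately obtain p where p: "p \<in> V" and orth: "\<And>v. v \<in> V \<Longrightarrow> cinner (x - p) v = 0"
    using orthogonal_projection_exists[of V x] by blast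
  define z where "z = x - p"
  have fz: "f z \<noteq> 0" using x p by (simp add: z_def V_def f.diff)
  then have z0: "z \<noteq> 0" using f.zero by auto
  define y where "y = (cnj (f z) / of_real ((norm z)\<^sup>2)) *\<^sub>C z"
  have "f w = cinner w y" for w
  proof -
    have "f (w - (f w / f z) *\<^sub>C z) = 0" using fz by (simp add: f.diff fc)
    then have "cinner z (w - (f w / f z) *\<^sub>C z) = 0" using orth by (simp add: z_def V_def)
    then have "cinner (w - (f w / f z) *\<^sub>C z) z = 0" by (metis cinner_commute complex_cnj_zero)
    then have "cinner w z = f w / f z * of_real ((norm z)\<^sup>2)"
      by (simp add: cinner_diff_left cinner_scaleC_left cinner_self)
    then show ?thesis using fz z0 by (simp add: y_def cinner_scaleC_right)
  qed
  then show ?thesis by blast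
qed


subsection \<open>Bounded operators and adjoints\<close>

lemma bop_eqI: "(\<And>\<xi>. x \<cdot> \<xi> = y \<cdot> \<xi>) \<Longrightarrow> x = y"
  by (metis bop_apply_inject ext)

lemma bop_bounded_linear: "bounded_linear (bop_apply x)"
  and bop_scaleC: "x \<cdot> (c *\<^sub>C \<xi>) = c *\<^sub>C (x \<cdot> \<xi>)"
  using bop_apply[of x] by auto

lemma bop_add: "x \<cdot> (\<xi> + \<eta>) = x \<cdot> \<xi> + x \<cdot> \<eta>"
  and bop_diff: "x \<cdot> (\<xi> - \<eta>) = x \<cdot> \<xi> - x \<cdot> \<eta>"
  and bop_zero [simp]: "x \<cdot> 0 = 0"
  and bop_minus: "x \<cdot> (- \<xi>) = - (x \<cdot> \<xi>)"
  using bop_bounded_linear[of x] by (simp_all add: linear_simps)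

lemma bop_sum: "x \<cdot> (\<Sum>i\<in>I. f i) = (\<Sum>i\<in>I. x \<cdot> f i)"
  by (induction I rule: infinite_finite_induct) (simp_all add: bop_add)

lemmas bop_apply_simps [simp] = zero_bop.rep_eq one_bop.rep_eq plus_bop.rep_eq uminus_bop.rep_eq
  minus_bop.rep_eq times_bop.rep_eq scaleC_bop.rep_eq

lemma bop_apply_Bop:
  assumes "bounded_linear f" "\<And>c x. f (c *\<^sub>C x) = c *\<^sub>C f x"
  shows "Bop f \<cdot> \<xi> = f \<xi>"
  using assms by (simp add: Bop_inverse)

lemma opnorm_nonneg: "0 \<le> opnorm x"
  unfolding opnorm_def by (rule onorm_pos_le[OF bop_bounded_linear])

lemma norm_bop_le: "norm (x \<cdot> \<xi>) \<le> opnorm x * norm \<xi>"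
  unfolding opnorm_def by (rule onorm[OF bop_bounded_linear])

lemma opnorm_leI: "0 \<le> b \<Longrightarrow> (\<And>\<xi>. norm (x \<cdot> \<xi>) \<le> b * norm \<xi>) \<Longrightarrow> opnorm x \<le> b"
  unfolding opnorm_def by (rule onorm_bound)

lemma opnorm_mult: "opnorm (x * y) \<le> opnorm x * opnorm y"
proof (rule opnorm_leI)
  show "0 \<le> opnorm x * opnorm y" by (simp add: opnorm_nonneg)
next
  fix \<xi>
  have "norm (x \<cdot> (y \<cdot> \<xi>)) \<le> opnorm x * norm (y \<cdot> \<xi>)" by (rule norm_bop_le)
  also have "\<dots> \<le> opnorm x * (opnorm y * norm \<xi>)"
    by (intro mult_left_mono norm_bop_le opnorm_nonneg)
  finally show "norm ((x * y) \<cdot> \<xi>) \<le> opnorm x * opnorm y * norm \<xi>" by (simp add: mult.assoc)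
qed

lemma bop_scale_simps [simp]:
  fixes x y :: "'h::complex_hilbert_space bop"
  shows "c *\<^sub>C x * y = c *\<^sub>C (x * y)" and "x * c *\<^sub>C y = c *\<^sub>C (x * y)"
    and "c *\<^sub>C d *\<^sub>C x = (c * d) *\<^sub>C x" and "1 *\<^sub>C x = x" and "0 *\<^sub>C x = 0"
    and "c *\<^sub>C (0::'h bop) = 0"
  by (rule bop_eqI; simp add: bop_scaleC scaleC_scaleC scaleC_zero)+

lemma bop_scale_add:
  fixes x y :: "'h::complex_hilbert_space bop"
  shows "c *\<^sub>C (x + y) = c *\<^sub>C x + c *\<^sub>C y" and "(c + d) *\<^sub>C x = c *\<^sub>C x + d *\<^sub>C x"
    and "c *\<^sub>C (x - y) = c *\<^sub>C x - c *\<^sub>C y" and "(- c) *\<^sub>C x = - (c *\<^sub>C x)"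
    and "c *\<^sub>C (- x) = - (c *\<^sub>C x)"
proof -
  show m: "(- c) *\<^sub>C x = - (c *\<^sub>C x)"
    by (rule bop_eqI, simp) (metis mult_minus1 scaleC_minus_one scaleC_scaleC)
qed (rule bop_eqI; simp add: scaleC_add_right scaleC_add_left scaleC_diff_right scaleC_minus)+

lemma bop_scale_sum: "c *\<^sub>C (\<Sum>i\<in>I. f i :: 'h::complex_hilbert_space bop) = (\<Sum>i\<in>I. c *\<^sub>C f i)"
  by (induction I rule: infinite_finite_induct) (simp_all add: bop_scale_add)

lemma bop_minus_one: "(-1) *\<^sub>C (x::'h::complex_hilbert_space bop) = - x"
  using bop_scale_add(4)[of 1 x] by simp

lemma adj_exists: "\<exists>y. \<forall>\<xi> \<eta>. cinner (x \<cdot> \<xi>) \<eta> = cinner \<xi> (y \<cdot> \<eta>)"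
proof -
  have "\<exists>z. \<forall>\<xi>. cinner (x \<cdot> \<xi>) \<eta> = cinner \<xi> z" for \<eta>
    by (rule riesz) (simp_all add: bounded_linear_compose[OF bounded_linear_cinner_left bop_bounded_linear]
        bop_scaleC cinner_scaleC_left)
  then obtain f where f: "\<And>\<xi> \<eta>. cinner (x \<cdot> \<xi>) \<eta> = cinner \<xi> (f \<eta>)" by metis
  have add: "f (a + b) = f a + f b" for a b
    by (rule cinner_ext_right) (simp add: f[symmetric] cinner_add_right)
  have sc: "f (c *\<^sub>C a) = c *\<^sub>C f a" for a c
    by (rule cinner_ext_right) (simp add: f[symmetric] cinner_scaleC_right)
  have bd: "norm (f a) \<le> norm a * opnorm x" for a
  proof (cases "norm (f a) = 0")
    case False
    have "(norm (f a))\<^sup>2 = cmod (cinner (x \<cdot> f a) a)" by (simp add: f cinner_self norm_power)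
    also have "\<dots> \<le> norm (x \<cdot> f a) * norm a" by (rule cinner_cauchy_schwarz)
    also have "\<dots> \<le> (opnorm x * norm (f a)) * norm a" by (intro mult_right_mono norm_bop_le) simp
    finally have "norm (f a) * norm (f a) \<le> norm (f a) * (norm a * opnorm x)"
      by (simp add: power2_eq_square algebra_simps)
    then show ?thesis using False by (simp add: mult_le_cancel_left)
  qed (simp add: opnorm_nonneg)
  have "bounded_linear f"
    by (rule bounded_linear_intro[where K = "opnorm x"]) (simp_all add: add sc bd scaleR_scaleC)
  then show ?thesis using f sc by (intro exI[of _ "Bop f"]) (simp add: bop_apply_Bop)
qed

lemma adj_unique:
  assumes "\<And>\<xi> \<eta>. cinner (x \<cdot> \<xi>) \<eta> = cinner \<xi> (y \<cdot> \<eta>)"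
  shows "adj x = y"
  unfolding adj_def
proof (rule the_equality)
  show "\<forall>\<xi> \<eta>. cinner (x \<cdot> \<xi>) \<eta> = cinner \<xi> (y \<cdot> \<eta>)" using assms by blast
next
  fix z assume "\<forall>\<xi> \<eta>. cinner (x \<cdot> \<xi>) \<eta> = cinner \<xi> (z \<cdot> \<eta>)"
  then show "z = y" by (intro bop_eqI cinner_ext_right) (metis assms)
qed

lemma cinner_adj: "cinner (x \<cdot> \<xi>) \<eta> = cinner \<xi> (adj x \<cdot> \<eta>)"
  using adj_exists[of x] adj_unique[of x] by metis

lemma cinner_adj': "cinner (adj x \<cdot> \<xi>) \<eta> = cinner \<xi> (x \<cdot> \<eta>)"
  by (metis cinner_adj cinner_commute)

lemma adj_adj [simp]: "adj (adj x) = x"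
  by (rule adj_unique) (rule cinner_adj')

lemma adj_mult [simp]: "adj (x * y) = adj y * adj x"
  by (rule adj_unique) (simp add: cinner_adj)

lemma adj_add [simp]: "adj (x + y) = adj x + adj y"
  by (rule adj_unique) (simp add: cinner_adj cinner_add_left cinner_add_right)

lemma adj_diff [simp]: "adj (x - y) = adj x - adj y"
  by (rule adj_unique) (simp add: cinner_adj cinner_diff_left cinner_diff_right)

lemma adj_minus [simp]: "adj (- x) = - adj x"
  by (rule adj_unique) (simp add: cinner_adj cinner_minus_left cinner_minus_right)

lemma adj_scaleC [simp]: "adj (c *\<^sub>C x) = cnj c *\<^sub>C adj x"
  by (rule adj_unique) (simp add: cinner_adj cinner_scaleC_left cinner_scaleC_right)

lemma adj_one [simp]: "adj 1 = 1" and adj_zero [simp]: "adj 0 = 0"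
  by (rule adj_unique; simp)+

lemma adj_sum [simp]: "adj (\<Sum>i\<in>I. f i) = (\<Sum>i\<in>I. adj (f i))"
  by (induction I rule: infinite_finite_induct) simp_all

lemma adj_power [simp]: "adj (x ^ n) = adj x ^ n"
  by (induction n) (simp_all add: power_commutes)

lemma orthogonal_projection_bop:
  assumes V: "csubspace V" and cl: "closed V"
  obtains P where "\<And>\<xi>. P \<cdot> \<xi> \<in> V" "\<And>\<xi>. \<xi> \<in> V \<Longrightarrow> P \<cdot> \<xi> = \<xi>" "\<And>\<xi> v. v \<in> V \<Longrightarrow> cinner (\<xi> - P \<cdot> \<xi>) v = 0"
proof -
  obtain p where pV: "\<And>\<xi>. p \<xi> \<in> V" and po: "\<And>\<xi> v. v \<in> V \<Longrightarrow> cinner (\<xi> - p \<xi>) v = 0"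
    using orthogonal_projection_exists[OF V cl] by metis
  have uni: "p \<xi> = a" if a: "a \<in> V" "\<And>v. v \<in> V \<Longrightarrow> cinner (\<xi> - a) v = 0" for \<xi> a
  proof -
    have "p \<xi> - a \<in> V" using a pV V by (simp add: csubspace_diff)
    then have "cinner (\<xi> - a) (p \<xi> - a) - cinner (\<xi> - p \<xi>) (p \<xi> - a) = 0"
      using a(2) po by (metis diff_self)
    then have "cinner (p \<xi> - a) (p \<xi> - a) = 0"
      unfolding cinner_diff_left[symmetric] by simp
    then show ?thesis by (simp add: cinner_self)
  qed
  have add: "p (a + b) = p a + p b" for a b
  proof (rule uni)
    show "p a + p b \<in> V" using V pV unfolding csubspace_def by blast
    show "cinner (a + b - (p a + p b)) v = 0" if "v \<in> V" for v
      using po[OF that, of a] po[OF that, of b] by (simp add: cinner_add_left cinner_diff_left algebra_simps)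
  qed
  have sc: "p (c *\<^sub>C a) = c *\<^sub>C p a" for a c
  proof (rule uni)
    show "c *\<^sub>C p a \<in> V" using V pV unfolding csubspace_def by blast
    show "cinner (c *\<^sub>C a - c *\<^sub>C p a) v = 0" if "v \<in> V" for v
      using po[OF that, of a] by (simp add: cinner_diff_left cinner_scaleC_left)
  qed
  have bd: "norm (p a) \<le> norm a * 1" for a
  proof (cases "norm (p a) = 0")
    case False
    have "cinner (p a) (p a) = cinner a (p a)" using po[OF pV, of a a] by (simp add: cinner_diff_left)
    then have "(norm (p a))\<^sup>2 = cmod (cinner a (p a))" by (metis cinner_self norm_of_real abs_power2)
    also have "\<dots> \<le> norm a * norm (p a)" by (rule cinner_cauchy_schwarz)
    finally show ?thesis using False by (simp add: power2_eq_square mult_le_cancel_right)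
  qed simp
  have bl: "bounded_linear p"
    by (rule bounded_linear_intro[where K = 1]) (use bd in \<open>simp_all add: add sc scaleR_scaleC\<close>)
  have ap: "Bop p \<cdot> \<xi> = p \<xi>" for \<xi> by (simp add: bop_apply_Bop bl sc)
  have "p \<xi> = \<xi>" if "\<xi> \<in> V" for \<xi> using that by (intro uni) simp_all
  then show ?thesis using that[of "Bop p"] pV po by (simp add: ap)
qed


subsection \<open>Bicommutants\<close>

lemma commutant_adj:
  assumes "\<And>x. x \<in> S \<Longrightarrow> adj x \<in> S" "y \<in> commutant S"
  shows "adj y \<in> commutant S"
  unfolding commutant_def
proof (safe)
  fix x assume "x \<in> S"
  then have "adj x * y = y * adj x" using assms unfolding commutant_def by blast
  then have "adj (adj x * y) = adj (y * adj x)" by simp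
  then show "x * adj y = adj y * x" by simp
qed

lemma commutant_antimono: "S \<subseteq> T \<Longrightarrow> commutant T \<subseteq> commutant S"
  unfolding commutant_def by blast

lemma subset_bicommutant: "S \<subseteq> commutant (commutant S)"
  unfolding commutant_def by auto

lemma vN_gen_superset: "S \<subseteq> vN_gen S"
  unfolding vN_gen_def using subset_bicommutant by blast

definition vN_algebra :: "'h::complex_hilbert_space bop set \<Rightarrow> bool" where
  "vN_algebra M \<longleftrightarrow> (\<forall>x\<in>M. adj x \<in> M) \<and> commutant (commutant M) = M"

lemma commutant_commutant_commutant: "commutant (commutant (commutant S)) = commutant S"
  using subset_bicommutant[of "commutant S"] commutant_antimono[OF subset_bicommutant[of S]] by blast

lemma vN_algebra_vN_gen: "vN_algebra (vN_gen S)"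
proof -
  have 1: "adj x \<in> commutant (S \<union> adj ` S)" if "x \<in> commutant (S \<union> adj ` S)" for x
    using that by (rule commutant_adj[rotated]) auto
  have "adj x \<in> vN_gen S" if "x \<in> vN_gen S" for x
    using that unfolding vN_gen_def by (rule commutant_adj[rotated]) (rule 1)
  then show ?thesis
    unfolding vN_algebra_def vN_gen_def by (simp add: commutant_commutant_commutant)
qed

lemma
  assumes "vN_algebra M"
  shows vN_adj: "x \<in> M \<Longrightarrow> adj x \<in> M"
    and vN_one: "1 \<in> M" and vN_zero: "0 \<in> M"
    and vN_add: "x \<in> M \<Longrightarrow> y \<in> M \<Longrightarrow> x + y \<in> M"
    and vN_diff: "x \<in> M \<Longrightarrow> y \<in> M \<Longrightarrow> x - y \<in> M"
    and vN_minus: "x \<in> M \<Longrightarrow> - x \<in> M"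
    and vN_mult: "x \<in> M \<Longrightarrow> y \<in> M \<Longrightarrow> x * y \<in> M"
    and vN_scale: "x \<in> M \<Longrightarrow> c *\<^sub>C x \<in> M"
proof -
  have M: "M = commutant (commutant M)" using assms by (simp add: vN_algebra_def)
  have ops: "x * y \<in> commutant S" "x + y \<in> commutant S" "x - y \<in> commutant S" "- x \<in> commutant S" "c *\<^sub>C x \<in> commutant S"
    if "x \<in> commutant S" "y \<in> commutant S" for x y :: "'a bop" and S c
  proof -
    have c: "z * x = x * z" "z * y = y * z" if "z \<in> S" for z
      using that \<open>x \<in> commutant S\<close> \<open>y \<in> commutant S\<close> by (auto simp: commutant_def)
    have "z * (x * y) = x * y * z" if "z \<in> S" for z
      using c[OF that] by (metis mult.assoc)
    then show "x * y \<in> commutant S" by (simp add: commutant_def)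
    show "x + y \<in> commutant S" "x - y \<in> commutant S" "- x \<in> commutant S" "c *\<^sub>C x \<in> commutant S"
      using c by (auto simp: commutant_def algebra_simps)
  qed
  have "1 \<in> commutant S" "0 \<in> commutant S" for S :: "'a bop set" by (auto simp: commutant_def)
  then show "1 \<in> M" "0 \<in> M" using M by blast+
  show "x \<in> M \<Longrightarrow> adj x \<in> M" using assms by (simp add: vN_algebra_def)
  show "x \<in> M \<Longrightarrow> y \<in> M \<Longrightarrow> x + y \<in> M" "x \<in> M \<Longrightarrow> y \<in> M \<Longrightarrow> x - y \<in> M"
    "x \<in> M \<Longrightarrow> y \<in> M \<Longrightarrow> x * y \<in> M" "x \<in> M \<Longrightarrow> - x \<in> M" "x \<in> M \<Longrightarrow> c *\<^sub>C x \<in> M"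
    using ops[of _ "commutant M"] M by simp_all
qed

lemma vN_sum: "vN_algebra M \<Longrightarrow> (\<And>i. i \<in> I \<Longrightarrow> f i \<in> M) \<Longrightarrow> (\<Sum>i\<in>I. f i) \<in> M"
  by (induction I rule: infinite_finite_induct) (auto intro: vN_add vN_zero)

lemma vN_power: "vN_algebra M \<Longrightarrow> x \<in> M \<Longrightarrow> x ^ n \<in> M"
  by (induction n) (auto intro: vN_one vN_mult)

lemma vN_gen_mono_vN:
  assumes "vN_algebra M" "S \<subseteq> M"
  shows "vN_gen S \<subseteq> M"
proof -
  have "S \<union> adj ` S \<subseteq> M" using assms by (auto intro: vN_adj)
  then have "vN_gen S \<subseteq> commutant (commutant M)"
    unfolding vN_gen_def by (intro commutant_antimono)
  then show ?thesis using assms by (simp add: vN_algebra_def)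
qed

lemma star_alg_subset_vN:
  assumes M: "vN_algebra M" and S: "S \<subseteq> M"
  shows "star_alg S \<subseteq> M"
proof
  fix x assume "x \<in> star_alg S"
  then show "x \<in> M"
    by induction (use S in \<open>auto intro: vN_adj[OF M] vN_one[OF M] vN_add[OF M] vN_mult[OF M] vN_scale[OF M]\<close>)
qed

lemma star_alg_zero: "0 \<in> star_alg S"
  using star_alg.scale[OF star_alg.one, of 0] by simp

lemma star_alg_minus: "x \<in> star_alg S \<Longrightarrow> - x \<in> star_alg S"
  using star_alg.scale[of x S "-1"] by (simp add: bop_minus_one)

lemma star_alg_diff: "x \<in> star_alg S \<Longrightarrow> y \<in> star_alg S \<Longrightarrow> x - y \<in> star_alg S"
  using star_alg.add[of x S "- y"] star_alg_minus[of y S] by simp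


section \<open>The amplification and the density theorem\<close>

subsection \<open>Square-summable sequences of vectors\<close>

lemma summable_sq_add:
  fixes f g :: "nat \<Rightarrow> 'a::real_inner"
  assumes "summable (\<lambda>n. (norm (f n))\<^sup>2)" "summable (\<lambda>n. (norm (g n))\<^sup>2)"
  shows "summable (\<lambda>n. (norm (f n + g n))\<^sup>2)"
proof (rule summable_comparison_test')
  show "summable (\<lambda>n. 2 * (norm (f n))\<^sup>2 + 2 * (norm (g n))\<^sup>2)"
    using assms by (intro summable_add summable_mult)
  show "norm ((norm (f n + g n))\<^sup>2) \<le> 2 * (norm (f n))\<^sup>2 + 2 * (norm (g n))\<^sup>2" if "n \<ge> 0" for n
    using parallelogram[of "f n" "g n"] zero_le_power2[of "norm (f n - g n)"]
    unfolding real_norm_def abs_power2 by linarith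
qed

lemma summable_sq_bop:
  assumes "summable (\<lambda>n. (norm (f n))\<^sup>2)"
  shows "summable (\<lambda>n. (norm (x \<cdot> f n))\<^sup>2)"
proof (rule summable_comparison_test')
  show "summable (\<lambda>n. (opnorm x)\<^sup>2 * (norm (f n))\<^sup>2)" using assms by (intro summable_mult)
  show "norm ((norm (x \<cdot> f n))\<^sup>2) \<le> (opnorm x)\<^sup>2 * (norm (f n))\<^sup>2" if "n \<ge> 0" for n
    using power_mono[OF norm_bop_le[of x "f n"], of 2] by (simp add: power_mult_distrib)
qed

lemma summable_sq_cinner:
  fixes f g :: "nat \<Rightarrow> 'a::complex_hilbert_space"
  assumes "summable (\<lambda>n. (norm (f n))\<^sup>2)" "summable (\<lambda>n. (norm (g n))\<^sup>2)"
  shows "summable (\<lambda>n. cinner (f n) (g n))"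
proof (rule summable_comparison_test')
  show "summable (\<lambda>n. (norm (f n))\<^sup>2 + (norm (g n))\<^sup>2)" using assms by (intro summable_add)
  show "norm (cinner (f n) (g n)) \<le> (norm (f n))\<^sup>2 + (norm (g n))\<^sup>2" if "n \<ge> 0" for n
  proof -
    have "2 * (norm (f n) * norm (g n)) \<le> (norm (f n))\<^sup>2 + (norm (g n))\<^sup>2"
      using zero_le_power2[of "norm (f n) - norm (g n)"] by (simp add: power2_diff)
    moreover have "0 \<le> norm (f n) * norm (g n)" by simp
    ultimately show ?thesis using cinner_cauchy_schwarz[of "f n" "g n"] by linarith
  qed
qed

typedef (overloaded) 'h ell2 =
  "{f :: nat \<Rightarrow> 'h::complex_hilbert_space. summable (\<lambda>n. (norm (f n))\<^sup>2)}"
  morphisms ell2_nth Ell2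
  by (rule exI[of _ "\<lambda>_. 0"]) simp

setup_lifting type_definition_ell2

lemma ell2_summable: "summable (\<lambda>n. (norm (ell2_nth f n))\<^sup>2)"
  using ell2_nth[of f] by simp

lemma ell2_eqI: "(\<And>n. ell2_nth f n = ell2_nth g n) \<Longrightarrow> f = g"
  by (metis ell2_nth_inject ext)

lemma ell2_inner_summable: "summable (\<lambda>n. inner (ell2_nth f n) (ell2_nth g n))"
  using summable_Re[OF summable_sq_cinner[OF ell2_summable ell2_summable], of f g]
  by (simp add: inner_cinner)

instantiation ell2 :: (complex_hilbert_space) real_inner
begin

lift_definition zero_ell2 :: "'a ell2" is "\<lambda>_. 0" by simp

lift_definition plus_ell2 :: "'a ell2 \<Rightarrow> 'a ell2 \<Rightarrow> 'a ell2" is "\<lambda>f g n. f n + g n"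
  by (rule summable_sq_add)

lift_definition uminus_ell2 :: "'a ell2 \<Rightarrow> 'a ell2" is "\<lambda>f n. - f n" by simp

lift_definition minus_ell2 :: "'a ell2 \<Rightarrow> 'a ell2 \<Rightarrow> 'a ell2" is "\<lambda>f g n. f n - g n"
  using summable_sq_add[of _ "\<lambda>n. - g n" for g] by fastforce

lift_definition scaleR_ell2 :: "real \<Rightarrow> 'a ell2 \<Rightarrow> 'a ell2" is "\<lambda>r f n. r *\<^sub>R f n"
  by (simp add: power_mult_distrib summable_mult)

definition inner_ell2 :: "'a ell2 \<Rightarrow> 'a ell2 \<Rightarrow> real" where
  "inner_ell2 f g = (\<Sum>n. inner (ell2_nth f n) (ell2_nth g n))"

definition norm_ell2 :: "'a ell2 \<Rightarrow> real" where
  "norm_ell2 f = sqrt (inner f f)"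

definition dist_ell2 :: "'a ell2 \<Rightarrow> 'a ell2 \<Rightarrow> real" where
  "dist_ell2 f g = norm (f - g)"

definition sgn_ell2 :: "'a ell2 \<Rightarrow> 'a ell2" where
  "sgn_ell2 f = inverse (norm f) *\<^sub>R f"

definition uniformity_ell2 :: "('a ell2 \<times> 'a ell2) filter" where
  "uniformity_ell2 = (INF e\<in>{0<..}. principal {(x, y). dist x y < e})"

definition open_ell2 :: "'a ell2 set \<Rightarrow> bool" where
  "open_ell2 U \<longleftrightarrow> (\<forall>x\<in>U. \<forall>\<^sub>F (x', y) in uniformity. x' = x \<longrightarrow> y \<in> U)"

lemmas ell2_nth_simps [simp] = zero_ell2.rep_eq plus_ell2.rep_eq uminus_ell2.rep_eq
  minus_ell2.rep_eq scaleR_ell2.rep_eq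

instance
proof
  fix f g h :: "'a ell2" and r s :: real
  show "f + g + h = f + (g + h)" "f + g = g + f" "0 + f = f" "- f + f = 0" "f - g = f + - g"
    by (rule ell2_eqI; simp)+
  show "r *\<^sub>R (f + g) = r *\<^sub>R f + r *\<^sub>R g" "(r + s) *\<^sub>R f = r *\<^sub>R f + s *\<^sub>R f"
    "r *\<^sub>R s *\<^sub>R f = (r * s) *\<^sub>R f" "1 *\<^sub>R f = f"
    by (rule ell2_eqI; simp add: scaleR_add_right scaleR_add_left)+
  show "dist f g = norm (f - g)" "sgn f = inverse (norm f) *\<^sub>R f"
    by (simp_all add: dist_ell2_def sgn_ell2_def)
  show "(uniformity :: ('a ell2 \<times> 'a ell2) filter) = (INF e\<in>{0<..}. principal {(x, y). dist x y < e})"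
    by (simp add: uniformity_ell2_def)
  show "open U \<longleftrightarrow> (\<forall>x\<in>U. \<forall>\<^sub>F (x', y) in uniformity. x' = x \<longrightarrow> y \<in> U)" for U :: "'a ell2 set"
    by (simp add: open_ell2_def)
  show "inner f g = inner g f" by (simp add: inner_ell2_def inner_commute)
  show "inner (f + g) h = inner f h + inner g h"
    by (simp add: inner_ell2_def inner_add_left suminf_add[OF ell2_inner_summable ell2_inner_summable])
  show "inner (r *\<^sub>R f) g = r * inner f g"
    by (simp add: inner_ell2_def suminf_mult[OF ell2_inner_summable])
  show "norm f = sqrt (inner f f)" by (simp add: norm_ell2_def)
  show "0 \<le> inner f f"
    by (simp add: inner_ell2_def suminf_nonneg[OF ell2_inner_summable])
  show "inner f f = 0 \<longleftrightarrow> f = 0"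
  proof
    assume "inner f f = 0"
    then have "\<forall>n. inner (ell2_nth f n) (ell2_nth f n) = 0"
      using suminf_eq_zero_iff[OF ell2_inner_summable[of f f]] by (simp add: inner_ell2_def)
    then show "f = 0" by (intro ell2_eqI) simp
  qed (simp add: inner_ell2_def)
qed

end

lemma ell2_norm_sq: "(norm f)\<^sup>2 = (\<Sum>n. (norm (ell2_nth f n))\<^sup>2)"
  by (simp add: power2_norm_eq_inner inner_ell2_def)

lemma ell2_partial_le: "(\<Sum>n<N. (norm (ell2_nth f n))\<^sup>2) \<le> (norm f)\<^sup>2"
  unfolding ell2_norm_sq by (rule sum_le_suminf[OF ell2_summable]) auto

lemma ell2_nth_le: "norm (ell2_nth f n) \<le> norm f"
proof -
  have "(norm (ell2_nth f n))\<^sup>2 \<le> (\<Sum>k<Suc n. (norm (ell2_nth f k))\<^sup>2)"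
    by (simp add: sum_nonneg)
  also have "\<dots> \<le> (norm f)\<^sup>2" by (rule ell2_partial_le)
  finally show ?thesis by (rule power2_le_imp_le) simp
qed

instance ell2 :: (complex_hilbert_space) banach
proof
  fix X :: "nat \<Rightarrow> 'a ell2"
  assume "Cauchy X"
  have C: "\<exists>M. \<forall>m\<ge>M. \<forall>k\<ge>M. norm (X m - X k) < e" if "e > 0" for e
    using \<open>Cauchy X\<close> that unfolding Cauchy_def dist_norm by blast
  have "Cauchy (\<lambda>m. ell2_nth (X m) n)" for n
  proof (rule CauchyI)
    fix e :: real assume "e > 0"
    then obtain M where "\<forall>m\<ge>M. \<forall>k\<ge>M. norm (X m - X k) < e" using C by blast
    then show "\<exists>M. \<forall>m\<ge>M. \<forall>k\<ge>M. norm (ell2_nth (X m) n - ell2_nth (X k) n) < e"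
      using ell2_nth_le[of "X m - X k" n for m k] by (metis le_less_trans ell2_nth_simps(4))
  qed
  then have "\<exists>l. (\<lambda>m. ell2_nth (X m) n) \<longlonglongrightarrow> l" for n
    using Cauchy_convergent convergent_def by blast
  then obtain f where f: "\<And>n. (\<lambda>m. ell2_nth (X m) n) \<longlonglongrightarrow> f n" by metis
  have tail: "summable (\<lambda>n. (norm (ell2_nth (X m) n - f n))\<^sup>2)
      \<and> (\<Sum>n. (norm (ell2_nth (X m) n - f n))\<^sup>2) \<le> e\<^sup>2"
    if "\<forall>m\<ge>M. \<forall>k\<ge>M. norm (X m - X k) < e" "m \<ge> M" for e M m
  proof -
    have le: "(\<Sum>n<N. (norm (ell2_nth (X m) n - f n))\<^sup>2) \<le> e\<^sup>2" for N
    proof (rule LIMSEQ_le_const2)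
      show "(\<lambda>k. \<Sum>n<N. (norm (ell2_nth (X m) n - ell2_nth (X k) n))\<^sup>2)
          \<longlonglongrightarrow> (\<Sum>n<N. (norm (ell2_nth (X m) n - f n))\<^sup>2)"
        by (intro tendsto_intros f)
      have "(\<Sum>n<N. (norm (ell2_nth (X m) n - ell2_nth (X k) n))\<^sup>2) \<le> e\<^sup>2" if "k \<ge> M" for k
      proof -
        have "(\<Sum>n<N. (norm (ell2_nth (X m) n - ell2_nth (X k) n))\<^sup>2) \<le> (norm (X m - X k))\<^sup>2"
          using ell2_partial_le[of "X m - X k" N] by simp
        also have "\<dots> \<le> e\<^sup>2"
          using \<open>\<forall>m\<ge>M. \<forall>k\<ge>M. norm (X m - X k) < e\<close> \<open>m \<ge> M\<close> that by (intro power_mono norm_ge_zero) (simp add: less_imp_le)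
        finally show ?thesis .
      qed
      then show "\<exists>K. \<forall>k\<ge>K. (\<Sum>n<N. (norm (ell2_nth (X m) n - ell2_nth (X k) n))\<^sup>2) \<le> e\<^sup>2" by blast
    qed
    have "summable (\<lambda>n. (norm (ell2_nth (X m) n - f n))\<^sup>2)"
    proof (rule summableI_nonneg_bounded)
      show "sum (\<lambda>n. (norm (ell2_nth (X m) n - f n))\<^sup>2) {..<N} \<le> e\<^sup>2" for N by (rule le)
    qed simp
    then show ?thesis using suminf_le_const[of "\<lambda>n. (norm (ell2_nth (X m) n - f n))\<^sup>2" "e\<^sup>2"] le by blast
  qed
  obtain M1 where "\<forall>m\<ge>M1. \<forall>k\<ge>M1. norm (X m - X k) < 1" using C[of 1] by auto
  then have "summable (\<lambda>n. (norm (ell2_nth (X M1) n - f n))\<^sup>2)" using tail[of M1 1 M1] by simp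
  then have "summable (\<lambda>n. (norm (ell2_nth (X M1) n + - (ell2_nth (X M1) n - f n)))\<^sup>2)"
    by (intro summable_sq_add ell2_summable) (simp add: norm_minus_commute)
  then have sf: "summable (\<lambda>n. (norm (f n))\<^sup>2)" by simp
  define F where "F = Ell2 f"
  have F: "ell2_nth F n = f n" for n using sf by (simp add: F_def Ell2_inverse)
  have "X \<longlonglongrightarrow> F"
  proof (rule metric_LIMSEQ_I)
    fix e :: real assume e: "0 < e"
    then obtain M where M: "\<forall>m\<ge>M. \<forall>k\<ge>M. norm (X m - X k) < e / 2" using C[of "e/2"] by auto
    have "dist (X m) F < e" if "m \<ge> M" for m
    proof -
      have "(norm (X m - F))\<^sup>2 \<le> (e / 2)\<^sup>2" using tail[OF M that] by (simp add: ell2_norm_sq F)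
      then have "norm (X m - F) \<le> e / 2" by (rule power2_le_imp_le) (use e in simp)
      then show ?thesis using e by (simp add: dist_norm)
    qed
    then show "\<exists>no. \<forall>n\<ge>no. dist (X n) F < e" by blast
  qed
  then show "convergent X" unfolding convergent_def by blast
qed

instantiation ell2 :: (complex_hilbert_space) complex_hilbert_space
begin

lift_definition scaleC_ell2 :: "complex \<Rightarrow> 'a ell2 \<Rightarrow> 'a ell2" is "\<lambda>c f n. c *\<^sub>C f n"
  by (simp add: norm_scaleC power_mult_distrib summable_mult)

definition cinner_ell2 :: "'a ell2 \<Rightarrow> 'a ell2 \<Rightarrow> complex" where
  "cinner_ell2 f g = (\<Sum>n. cinner (ell2_nth f n) (ell2_nth g n))"

lemmas ell2_nth_scaleC [simp] = scaleC_ell2.rep_eq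

lemma ell2_cinner_summable: "summable (\<lambda>n. cinner (ell2_nth f n) (ell2_nth g n))"
  by (intro summable_sq_cinner ell2_summable)

instance
proof
  fix f g h :: "'a ell2" and c d :: complex and r :: real
  show "c *\<^sub>C (f + g) = c *\<^sub>C f + c *\<^sub>C g" "(c + d) *\<^sub>C f = c *\<^sub>C f + d *\<^sub>C f"
    "c *\<^sub>C d *\<^sub>C f = (c * d) *\<^sub>C f"
    by (rule ell2_eqI; simp add: scaleC_add_right scaleC_add_left scaleC_scaleC)+
  show "r *\<^sub>R f = complex_of_real r *\<^sub>C f"
    by (rule ell2_eqI; simp add: scaleR_scaleC)
  show "cinner (f + g) h = cinner f h + cinner g h"
    unfolding cinner_ell2_def
    by (simp add: cinner_add_left suminf_add[OF ell2_cinner_summable ell2_cinner_summable])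
  show "cinner (c *\<^sub>C f) g = c * cinner f g"
    unfolding cinner_ell2_def
    by (simp add: cinner_scaleC_left suminf_mult[OF ell2_cinner_summable])
  have "cinner (ell2_nth f n) (ell2_nth g n) = cnj (cinner (ell2_nth g n) (ell2_nth f n))" for n
    by (rule cinner_commute)
  then show "cinner f g = cnj (cinner g f)"
    unfolding cinner_ell2_def
    using bounded_linear.suminf[OF bounded_linear_cnj ell2_cinner_summable[of g f]] by simp
  show "inner f g = Re (cinner f g)"
    unfolding cinner_ell2_def inner_ell2_def inner_cinner
    by (rule bounded_linear.suminf[OF bounded_linear_Re ell2_cinner_summable, symmetric])
qed

end

lemma ell2_nth_sum: "ell2_nth (\<Sum>i\<in>I. f i) n = (\<Sum>i\<in>I. ell2_nth (f i) n)"
  by (induction I rule: infinite_finite_induct) simp_all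

lemma ell2_nth_Ell2: "summable (\<lambda>n. (norm (f n))\<^sup>2) \<Longrightarrow> ell2_nth (Ell2 f) n = f n"
  by (simp add: Ell2_inverse)


subsection \<open>Operators acting diagonally on sequences\<close>

definition amp :: "'h::complex_hilbert_space bop \<Rightarrow> 'h ell2 bop" where
  "amp x = Bop (\<lambda>f. Ell2 (\<lambda>n. x \<cdot> ell2_nth f n))"

lemma ell2_nth_amp [simp]: "ell2_nth (amp x \<cdot> f) n = x \<cdot> ell2_nth f n"
proof -
  define A where "A = (\<lambda>f. Ell2 (\<lambda>n. x \<cdot> ell2_nth f n))"
  have A: "ell2_nth (A f) n = x \<cdot> ell2_nth f n" for f n
    by (simp add: A_def ell2_nth_Ell2 summable_sq_bop ell2_summable)
  have bd: "norm (A f) \<le> norm f * opnorm x" for f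
  proof -
    have "(norm (A f))\<^sup>2 \<le> (\<Sum>n. (opnorm x)\<^sup>2 * (norm (ell2_nth f n))\<^sup>2)"
      unfolding ell2_norm_sq A
    proof (rule suminf_le)
      show "(norm (x \<cdot> ell2_nth f n))\<^sup>2 \<le> (opnorm x)\<^sup>2 * (norm (ell2_nth f n))\<^sup>2" for n
        using power_mono[OF norm_bop_le[of x "ell2_nth f n"], of 2] by (simp add: power_mult_distrib)
    qed (auto intro!: summable_mult summable_sq_bop ell2_summable)
    also have "\<dots> = (norm f * opnorm x)\<^sup>2"
      by (simp add: suminf_mult ell2_summable ell2_norm_sq power_mult_distrib)
    finally show ?thesis by (rule power2_le_imp_le) (simp add: opnorm_nonneg)
  qed
  have "bounded_linear A"
    by (rule bounded_linear_intro[where K = "opnorm x"])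
      (simp_all add: bd, (rule ell2_eqI, simp add: A bop_add scaleR_scaleC bop_scaleC)+)
  moreover have "A (c *\<^sub>C f) = c *\<^sub>C A f" for c f
    by (rule ell2_eqI) (simp add: A bop_scaleC)
  ultimately show ?thesis unfolding amp_def A_def[symmetric] by (simp add: bop_apply_Bop A)
qed

lemma amp_diff: "amp (x - y) \<cdot> f = amp x \<cdot> f - amp y \<cdot> f"
  by (rule ell2_eqI) simp

lemma amp_mult: "amp (x * y) \<cdot> f = amp x \<cdot> (amp y \<cdot> f)"
  by (rule ell2_eqI) simp

lemma amp_adj: "cinner (amp x \<cdot> f) g = cinner f (amp (adj x) \<cdot> g)"
  by (simp add: cinner_ell2_def cinner_adj)

lemma norm_amp_le: "norm (amp x \<cdot> f) \<le> opnorm x * norm f"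
proof -
  have "(norm (amp x \<cdot> f))\<^sup>2 \<le> (\<Sum>n. (opnorm x)\<^sup>2 * (norm (ell2_nth f n))\<^sup>2)"
    unfolding ell2_norm_sq ell2_nth_amp
  proof (rule suminf_le)
    show "(norm (x \<cdot> ell2_nth f n))\<^sup>2 \<le> (opnorm x)\<^sup>2 * (norm (ell2_nth f n))\<^sup>2" for n
      using power_mono[OF norm_bop_le[of x "ell2_nth f n"], of 2] by (simp add: power_mult_distrib)
  qed (auto intro!: summable_mult summable_sq_bop ell2_summable)
  also have "\<dots> = (opnorm x * norm f)\<^sup>2"
    by (simp add: suminf_mult ell2_summable ell2_norm_sq power_mult_distrib)
  finally show ?thesis by (rule power2_le_imp_le) (simp add: opnorm_nonneg)
qed

definition ell2_single :: "nat \<Rightarrow> 'h::complex_hilbert_space \<Rightarrow> 'h ell2" where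
  "ell2_single n \<zeta> = Ell2 (\<lambda>k. if k = n then \<zeta> else 0)"

lemma ell2_nth_single [simp]: "ell2_nth (ell2_single n \<zeta>) k = (if k = n then \<zeta> else 0)"
proof -
  have "summable (\<lambda>k. (norm (if k = n then \<zeta> else 0))\<^sup>2)"
    by (rule summable_finite[of "{n}"]) auto
  then show ?thesis by (simp add: ell2_single_def ell2_nth_Ell2)
qed

lemma norm_ell2_single: "norm (ell2_single n \<zeta>) = norm \<zeta>"
proof -
  have "(norm (ell2_single n \<zeta>))\<^sup>2 = (norm \<zeta>)\<^sup>2"
    unfolding ell2_norm_sq by (subst suminf_finite[of "{n}"]) auto
  then show ?thesis by (simp add: power2_eq_iff_nonneg)
qed

lemma ell2_singles_sums: "(\<lambda>N. \<Sum>n<N. ell2_single n (ell2_nth f n)) \<longlonglongrightarrow> f"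
proof (rule Lim_null[THEN iffD2], rule tendsto_norm_zero_cancel)
  have nth: "ell2_nth (\<Sum>n<N. ell2_single n (ell2_nth f n)) k = (if k < N then ell2_nth f k else 0)" for N k
    by (simp add: ell2_nth_sum)
  have eq: "(norm ((\<Sum>n<N. ell2_single n (ell2_nth f n)) - f))\<^sup>2
      = (norm f)\<^sup>2 - (\<Sum>n<N. (norm (ell2_nth f n))\<^sup>2)" for N
  proof -
    have "(norm ((\<Sum>n<N. ell2_single n (ell2_nth f n)) - f))\<^sup>2
        = (\<Sum>k. (norm (ell2_nth f k))\<^sup>2 - (if k < N then (norm (ell2_nth f k))\<^sup>2 else 0))"
      unfolding ell2_norm_sq by (intro suminf_cong) (simp add: nth)
    also have "\<dots> = (norm f)\<^sup>2 - (\<Sum>k. if k < N then (norm (ell2_nth f k))\<^sup>2 else 0)"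
      unfolding ell2_norm_sq
      by (rule suminf_diff[symmetric]) (auto intro: ell2_summable summable_finite[of "{..<N}"])
    also have "(\<Sum>k. if k < N then (norm (ell2_nth f k))\<^sup>2 else 0) = (\<Sum>n<N. (norm (ell2_nth f n))\<^sup>2)"
      by (subst suminf_finite[of "{..<N}"]) auto
    finally show ?thesis .
  qed
  have "(\<lambda>N. (norm f)\<^sup>2 - (\<Sum>n<N. (norm (ell2_nth f n))\<^sup>2)) \<longlonglongrightarrow> (norm f)\<^sup>2 - (norm f)\<^sup>2"
    unfolding ell2_norm_sq by (intro tendsto_intros summable_LIMSEQ ell2_summable)
  then have "(\<lambda>N. sqrt ((norm ((\<Sum>n<N. ell2_single n (ell2_nth f n)) - f))\<^sup>2)) \<longlonglongrightarrow> sqrt 0"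
    unfolding eq by (intro tendsto_real_sqrt) simp
  then show "(\<lambda>N. norm ((\<Sum>n<N. ell2_single n (ell2_nth f n)) - f)) \<longlonglongrightarrow> 0" by simp
qed


subsection \<open>The density theorem\<close>

text \<open>The projection onto the closure of \<open>amp (star_alg S) f\<close> commutes with \<open>amp\<close> of the algebra, so
  its matrix entries lie in the commutant of \<open>S\<close>; hence it also commutes with \<open>amp x\<close> for \<open>x\<close> in the
  bicommutant, and \<open>amp x f\<close> stays in the closure.\<close>

lemma vN_density:
  assumes x: "x \<in> vN_gen S"
  shows "amp x \<cdot> f \<in> closure {amp y \<cdot> f | y. y \<in> star_alg S}"
proof -
  define V where "V = {amp y \<cdot> f | y. y \<in> star_alg S}"
  have V: "csubspace V"
    unfolding csubspace_def
  proof (intro conjI ballI allI)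
    have "0 = amp 0 \<cdot> f" by (rule ell2_eqI) simp
    then show "0 \<in> V" using star_alg_zero by (auto simp: V_def)
    fix a assume "a \<in> V"
    then obtain y where y: "y \<in> star_alg S" "a = amp y \<cdot> f" by (auto simp: V_def)
    have "c *\<^sub>C a = amp (c *\<^sub>C y) \<cdot> f" for c unfolding y(2) by (rule ell2_eqI) simp
    then show "c *\<^sub>C a \<in> V" for c using star_alg.scale[OF y(1), of c] unfolding V_def by blast
    fix b assume "b \<in> V"
    then obtain z where z: "z \<in> star_alg S" "b = amp z \<cdot> f" by (auto simp: V_def)
    have "a + b = amp (y + z) \<cdot> f" unfolding y(2) z(2) by (rule ell2_eqI) simp
    then show "a + b \<in> V" using star_alg.add[OF y(1) z(1)] unfolding V_def by blast
  qed
  define K where "K = closure V"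
  have K: "csubspace K" "closed K" using csubspace_closure[OF V] by (simp_all add: K_def)
  obtain P where PK: "\<And>g. P \<cdot> g \<in> K" and Pid: "\<And>g. g \<in> K \<Longrightarrow> P \<cdot> g = g"
    and Po: "\<And>g v. v \<in> K \<Longrightarrow> cinner (g - P \<cdot> g) v = 0"
    using orthogonal_projection_bop[OF K] by metis
  have inv: "amp z \<cdot> v \<in> K" if z: "z \<in> star_alg S" and "v \<in> K" for z v
  proof -
    obtain h where h: "\<And>n. h n \<in> V" "h \<longlonglongrightarrow> v" using \<open>v \<in> K\<close> unfolding K_def closure_sequential by blast
    have "amp z \<cdot> h n \<in> V" for n
    proof -
      obtain y where "y \<in> star_alg S" "h n = amp y \<cdot> f" using h(1)[of n] by (auto simp: V_def)
      then show ?thesis using star_alg.mult[OF z] unfolding V_def by (metis (mono_tags, lifting) amp_mult mem_Collect_eq)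
    qed
    moreover have "(\<lambda>n. amp z \<cdot> h n) \<longlonglongrightarrow> amp z \<cdot> v"
      by (rule bounded_linear.tendsto[OF bop_bounded_linear h(2)])
    ultimately show ?thesis unfolding K_def closure_sequential by (intro exI[of _ "\<lambda>n. amp z \<cdot> h n"]) simp
  qed
  have comm: "P \<cdot> (amp z \<cdot> g) = amp z \<cdot> (P \<cdot> g)" if z: "z \<in> star_alg S" for z g
  proof -
    define r where "r = P \<cdot> (amp z \<cdot> g) - amp z \<cdot> (P \<cdot> g)"
    have rK: "r \<in> K" unfolding r_def by (intro csubspace_diff K PK inv z)
    have "cinner (amp z \<cdot> (g - P \<cdot> g)) r = 0"
      unfolding amp_adj by (intro Po inv star_alg.adj z rK)
    moreover have "cinner (amp z \<cdot> g - P \<cdot> (amp z \<cdot> g)) r = 0" by (rule Po[OF rK])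
    ultimately have "cinner (amp z \<cdot> (g - P \<cdot> g)) r - cinner (amp z \<cdot> g - P \<cdot> (amp z \<cdot> g)) r = 0" by simp
    then have "cinner r r = 0"
      unfolding cinner_diff_left[symmetric] by (simp add: r_def bop_diff)
    then show ?thesis by (simp add: cinner_self r_def)
  qed
  define Q where "Q = (\<lambda>m n. Bop (\<lambda>\<zeta>. ell2_nth (P \<cdot> ell2_single n \<zeta>) m))"
  have single_add: "ell2_single n (a + b) = ell2_single n a + ell2_single n b" for n and a b :: 'a
    by (rule ell2_eqI) simp
  have single_sc: "ell2_single n (c *\<^sub>C a) = c *\<^sub>C ell2_single n a" for n c and a :: 'a
    by (rule ell2_eqI) (simp add: scaleC_zero)
  have Q: "Q m n \<cdot> \<zeta> = ell2_nth (P \<cdot> ell2_single n \<zeta>) m" for m n \<zeta>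
    unfolding Q_def
  proof (rule bop_apply_Bop)
    show "bounded_linear (\<lambda>\<zeta>. ell2_nth (P \<cdot> ell2_single n \<zeta>) m)"
    proof (rule bounded_linear_intro[where K = "opnorm P"])
      show "norm (ell2_nth (P \<cdot> ell2_single n a) m) \<le> norm a * opnorm P" for a
        using order_trans[OF ell2_nth_le norm_bop_le, of P "ell2_single n a" m]
        by (simp add: norm_ell2_single mult.commute)
    qed (simp_all add: single_add single_sc bop_add bop_scaleC scaleR_scaleC)
  qed (simp add: single_sc bop_scaleC)
  have amp_single: "amp z \<cdot> ell2_single n \<zeta> = ell2_single n (z \<cdot> \<zeta>)" for z n \<zeta>
    by (rule ell2_eqI) simp
  have "Q m n \<in> commutant (S \<union> adj ` S)" for m n
    unfolding commutant_def
  proof (safe)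
    have c: "z * Q m n = Q m n * z" if "z \<in> star_alg S" for z
      by (rule bop_eqI) (simp add: Q amp_single[symmetric] comm[OF that])
    show "z * Q m n = Q m n * z" if "z \<in> S" for z by (intro c star_alg.gen that)
    show "adj z * Q m n = Q m n * adj z" if "z \<in> S" for z by (intro c star_alg.gen star_alg.adj that)
  qed
  then have xQ: "x * Q m n = Q m n * x" for m n
    using x unfolding vN_gen_def commutant_def[of "commutant (S \<union> adj ` S)"] by auto
  have row: "(\<lambda>N. \<Sum>n<N. Q m n \<cdot> ell2_nth g n) \<longlonglongrightarrow> ell2_nth (P \<cdot> g) m" for g m
  proof (rule Lim_transform_eventually)
    have bl: "bounded_linear (\<lambda>h. ell2_nth h m)"
      by (rule bounded_linear_intro[where K = 1]) (simp_all add: ell2_nth_le)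
    show "(\<lambda>N. ell2_nth (P \<cdot> (\<Sum>n<N. ell2_single n (ell2_nth g n))) m) \<longlonglongrightarrow> ell2_nth (P \<cdot> g) m"
      by (intro bounded_linear.tendsto[OF bl] bounded_linear.tendsto[OF bop_bounded_linear] ell2_singles_sums)
    show "\<forall>\<^sub>F N in sequentially. ell2_nth (P \<cdot> (\<Sum>n<N. ell2_single n (ell2_nth g n))) m
        = (\<Sum>n<N. Q m n \<cdot> ell2_nth g n)"
      by (simp add: Q bop_sum ell2_nth_sum)
  qed
  have "f \<in> V" unfolding V_def using star_alg.one by (auto intro!: exI[of _ 1] ell2_eqI)
  then have Pf: "P \<cdot> f = f" using closure_subset[of V] Pid unfolding K_def by blast
  have "P \<cdot> (amp x \<cdot> f) = amp x \<cdot> f"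
  proof (rule ell2_eqI)
    fix m
    have "(\<lambda>N. x \<cdot> (\<Sum>n<N. Q m n \<cdot> ell2_nth f n)) \<longlonglongrightarrow> x \<cdot> ell2_nth f m"
      using bounded_linear.tendsto[OF bop_bounded_linear row, of x m f] by (simp add: Pf)
    moreover have "x \<cdot> (\<Sum>n<N. Q m n \<cdot> ell2_nth f n) = (\<Sum>n<N. Q m n \<cdot> ell2_nth (amp x \<cdot> f) n)" for N
    proof -
      have "x \<cdot> (Q m n \<cdot> \<zeta>) = Q m n \<cdot> (x \<cdot> \<zeta>)" for n \<zeta>
        using arg_cong[OF xQ[of m n], of "\<lambda>z. z \<cdot> \<zeta>"] by simp
      then show ?thesis by (simp add: bop_sum)
    qed
    ultimately show "ell2_nth (P \<cdot> (amp x \<cdot> f)) m = ell2_nth (amp x \<cdot> f) m"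
      using LIMSEQ_unique[OF row[of m "amp x \<cdot> f"]] by simp
  qed
  then show ?thesis using PK[of "amp x \<cdot> f"] by (simp add: K_def V_def)
qed

text \<open>Two sequences are approximated at once by interleaving them into one.\<close>

definition ileave :: "(nat \<Rightarrow> 'a) \<Rightarrow> (nat \<Rightarrow> 'a) \<Rightarrow> nat \<Rightarrow> 'a" where
  "ileave f g n = (if even n then f (n div 2) else g ((n - 1) div 2))"

lemma ileave_map: "h (ileave f g n) = ileave (\<lambda>n. h (f n)) (\<lambda>n. h (g n)) n"
  by (simp add: ileave_def)

lemma ileave_map2: "h (ileave f g n) (ileave f' g' n) = ileave (\<lambda>n. h (f n) (f' n)) (\<lambda>n. h (g n) (g' n)) n"
  by (simp add: ileave_def)

lemma ileave_sums:
  fixes f g :: "nat \<Rightarrow> 'a::real_normed_vector"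
  assumes "summable f" "summable g"
  shows "(\<lambda>n. ileave f g n) sums (suminf f + suminf g)"
proof -
  define F where "F = (\<lambda>n. if even n then f (n div 2) else 0)"
  define G where "G = (\<lambda>n. if even n then 0 else g ((n - 1) div 2))"
  have "(\<lambda>n. F (2 * n)) sums suminf f \<longleftrightarrow> F sums suminf f"
  proof (rule sums_mono_reindex)
    show "strict_mono ((*) (2::nat))" by (rule strict_monoI) simp
    show "F n = 0" if "n \<notin> range ((*) 2)" for n
      using that by (auto simp: F_def elim!: evenE)
  qed
  then have F: "F sums suminf f" using summable_sums[OF assms(1)] by (simp add: F_def)
  have "(\<lambda>n. G (2 * n + 1)) sums suminf g \<longleftrightarrow> G sums suminf g"
  proof (rule sums_mono_reindex)
    show "strict_mono (\<lambda>n::nat. 2 * n + 1)" by (rule strict_monoI) simp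
    show "G n = 0" if "n \<notin> range (\<lambda>n. 2 * n + 1)" for n
      using that by (auto simp: G_def elim!: oddE)
  qed
  then have G: "G sums suminf g" using summable_sums[OF assms(2)] by (simp add: G_def)
  have "(\<lambda>n. ileave f g n) = (\<lambda>n. F n + G n)" by (auto simp: ileave_def F_def G_def)
  then show ?thesis using sums_add[OF F G] by simp
qed

lemma vN_density2:
  assumes x: "x \<in> vN_gen S" and e: "0 < e"
  obtains y where "y \<in> star_alg S" "norm (amp (x - y) \<cdot> f) < e" "norm (amp (x - y) \<cdot> g) < e"
proof -
  define h where "h = ileave (ell2_nth f) (ell2_nth g)"
  have "summable (\<lambda>n. (norm (h n))\<^sup>2)"
    using sums_summable[OF ileave_sums[OF ell2_summable[of f] ell2_summable[of g]]]
    by (simp add: h_def ileave_map[of "\<lambda>a. (norm a)\<^sup>2"])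
  then have H: "ell2_nth (Ell2 h) n = h n" for n by (rule ell2_nth_Ell2)
  have split: "(norm (amp z \<cdot> Ell2 h))\<^sup>2 = (norm (amp z \<cdot> f))\<^sup>2 + (norm (amp z \<cdot> g))\<^sup>2" for z
  proof -
    have "(\<lambda>n. ileave (\<lambda>n. (norm (ell2_nth (amp z \<cdot> f) n))\<^sup>2) (\<lambda>n. (norm (ell2_nth (amp z \<cdot> g) n))\<^sup>2) n)
        sums ((norm (amp z \<cdot> f))\<^sup>2 + (norm (amp z \<cdot> g))\<^sup>2)"
      unfolding ell2_norm_sq by (rule ileave_sums) (rule ell2_summable)+
    then have "(\<lambda>n. (norm (ell2_nth (amp z \<cdot> Ell2 h) n))\<^sup>2) sums ((norm (amp z \<cdot> f))\<^sup>2 + (norm (amp z \<cdot> g))\<^sup>2)"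
      by (simp only: ell2_nth_amp H) (simp only: h_def ileave_map[of "\<lambda>a. (norm (z \<cdot> a))\<^sup>2"])
    then show ?thesis unfolding ell2_norm_sq[of "amp z \<cdot> Ell2 h"] by (rule sums_unique[symmetric])
  qed
  obtain y where y: "y \<in> star_alg S" "norm (amp y \<cdot> Ell2 h - amp x \<cdot> Ell2 h) < e"
    using vN_density[OF x, of "Ell2 h"] e unfolding closure_approachable dist_norm by blast
  then have n: "norm (amp (x - y) \<cdot> Ell2 h) < e" by (simp add: amp_diff norm_minus_commute)
  have le: "(norm (amp (x - y) \<cdot> f))\<^sup>2 \<le> (norm (amp (x - y) \<cdot> Ell2 h))\<^sup>2"
    "(norm (amp (x - y) \<cdot> g))\<^sup>2 \<le> (norm (amp (x - y) \<cdot> Ell2 h))\<^sup>2"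
    by (simp_all add: split)
  show ?thesis
    using that[OF y(1)] power2_le_imp_le[OF le(1)] power2_le_imp_le[OF le(2)] n by fastforce
qed


subsection \<open>Normal functionals\<close>

lemma normal_functional_amp:
  assumes "normal_functional M \<omega>"
  obtains f g where "\<And>x. x \<in> M \<Longrightarrow> \<omega> x = cinner (amp x \<cdot> f) g"
proof -
  obtain \<xi> \<eta> :: "nat \<Rightarrow> 'a" where "summable (\<lambda>n. (norm (\<xi> n))\<^sup>2)" "summable (\<lambda>n. (norm (\<eta> n))\<^sup>2)"
    "\<forall>x\<in>M. \<omega> x = (\<Sum>n. cinner (x \<cdot> \<xi> n) (\<eta> n))"
    using assms unfolding normal_functional_def by blast
  then show ?thesis using that[of "Ell2 \<xi>" "Ell2 \<eta>"] by (simp add: cinner_ell2_def ell2_nth_Ell2)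
qed

lemma normal_functionalI_amp:
  assumes "\<And>x. x \<in> M \<Longrightarrow> \<omega> x = cinner (amp x \<cdot> f) g"
  shows "normal_functional M \<omega>"
  unfolding normal_functional_def
  by (intro exI[of _ "ell2_nth f"] exI[of _ "ell2_nth g"])
    (use assms in \<open>simp add: ell2_summable cinner_ell2_def\<close>)

lemma normal_functional_vector: "normal_functional M (\<lambda>x. cinner (x \<cdot> \<xi>) \<eta>)"
proof (rule normal_functionalI_amp)
  show "cinner (x \<cdot> \<xi>) \<eta> = cinner (amp x \<cdot> ell2_single 0 \<xi>) (ell2_single 0 \<eta>)" for x
    unfolding cinner_ell2_def by (subst suminf_finite[of "{0}"]) auto
qed

lemma normal_functional_cong:
  "normal_functional M \<omega> \<Longrightarrow> (\<And>x. x \<in> M \<Longrightarrow> \<omega>' x = \<omega> x) \<Longrightarrow> normal_functional M \<omega>'"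
  unfolding normal_functional_def by simp

lemma normal_functional_add:
  assumes "normal_functional M \<omega>" "normal_functional M \<omega>'"
  shows "normal_functional M (\<lambda>x. \<omega> x + \<omega>' x)"
proof -
  obtain f g where 1: "\<And>x. x \<in> M \<Longrightarrow> \<omega> x = cinner (amp x \<cdot> f) g"
    using assms(1) by (rule normal_functional_amp) blast
  obtain f' g' where 2: "\<And>x. x \<in> M \<Longrightarrow> \<omega>' x = cinner (amp x \<cdot> f') g'"
    using assms(2) by (rule normal_functional_amp) blast
  define \<xi> where "\<xi> = ileave (ell2_nth f) (ell2_nth f')"
  define \<eta> where "\<eta> = ileave (ell2_nth g) (ell2_nth g')"
  show ?thesis
    unfolding normal_functional_def
  proof (intro exI conjI ballI)
    show "summable (\<lambda>n. (norm (\<xi> n))\<^sup>2)" "summable (\<lambda>n. (norm (\<eta> n))\<^sup>2)"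
      unfolding \<xi>_def \<eta>_def ileave_map[of "\<lambda>a. (norm a)\<^sup>2"]
      by (rule sums_summable[OF ileave_sums]; rule ell2_summable)+
    fix x assume x: "x \<in> M"
    have "(\<lambda>n. cinner (x \<cdot> \<xi> n) (\<eta> n)) sums
        ((\<Sum>n. cinner (ell2_nth (amp x \<cdot> f) n) (ell2_nth g n)) + (\<Sum>n. cinner (ell2_nth (amp x \<cdot> f') n) (ell2_nth g' n)))"
      unfolding \<xi>_def \<eta>_def ileave_map2[of "\<lambda>a b. cinner (x \<cdot> a) b"]
      using ileave_sums[OF ell2_cinner_summable[of "amp x \<cdot> f" g] ell2_cinner_summable[of "amp x \<cdot> f'" g']] by simp
    then show "\<omega> x + \<omega>' x = (\<Sum>n. cinner (x \<cdot> \<xi> n) (\<eta> n))"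
      unfolding 1[OF x] 2[OF x] cinner_ell2_def by (rule sums_unique)
  qed
qed

lemma normal_functional_mult_left:
  assumes "normal_functional M \<omega>"
  shows "normal_functional M (\<lambda>x. c * \<omega> x)"
proof -
  obtain f g where 1: "\<And>x. x \<in> M \<Longrightarrow> \<omega> x = cinner (amp x \<cdot> f) g"
    using assms by (rule normal_functional_amp) blast
  then show ?thesis
    by (intro normal_functionalI_amp[of _ _ "c *\<^sub>C f" g]) (simp add: bop_scaleC cinner_scaleC_left)
qed

text \<open>The form in which normality is used: normal functionals are determined by the generated
  \<open>*\<close>-algebra.\<close>

lemma normal_functional_eqI:
  assumes \<omega>: "normal_functional (vN_gen S) \<omega>" and \<omega>': "normal_functional (vN_gen S) \<omega>'"
    and eq: "\<And>y. y \<in> star_alg S \<Longrightarrow> \<omega> y = \<omega>' y" and x: "x \<in> vN_gen S"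
  shows "\<omega> x = \<omega>' x"
proof -
  have "normal_functional (vN_gen S) (\<lambda>x. \<omega> x + (- 1) * \<omega>' x)"
    by (intro normal_functional_add normal_functional_mult_left \<omega> \<omega>')
  then obtain f g where fg: "\<And>x. x \<in> vN_gen S \<Longrightarrow> \<omega> x + (- 1) * \<omega>' x = cinner (amp x \<cdot> f) g"
    by (rule normal_functional_amp) blast
  have sub: "star_alg S \<subseteq> vN_gen S"
    by (intro star_alg_subset_vN vN_algebra_vN_gen vN_gen_superset)
  have "\<forall>v\<in>closure {amp y \<cdot> f | y. y \<in> star_alg S}. cinner v g = 0"
  proof (rule continuous_constant_on_closure[of _ "\<lambda>v. cinner v g", THEN ballI])
    show "continuous_on (closure {amp y \<cdot> f | y. y \<in> star_alg S}) (\<lambda>v. cinner v g)"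
      by (rule linear_continuous_on[OF bounded_linear_cinner_left])
    show "cinner v g = 0" if "v \<in> {amp y \<cdot> f | y. y \<in> star_alg S}" for v
      using that fg[symmetric] sub eq by auto
  qed
  then have "cinner (amp x \<cdot> f) g = 0" using vN_density[OF x] by blast
  then show ?thesis using fg[OF x] by simp
qed


section \<open>The trace norm\<close>

lemma opnorm_adj_le: "opnorm (adj x) \<le> opnorm x"
proof (rule opnorm_leI[OF opnorm_nonneg])
  fix \<xi>
  show "norm (adj x \<cdot> \<xi>) \<le> opnorm x * norm \<xi>"
  proof (cases "norm (adj x \<cdot> \<xi>) = 0")
    case False
    have "(norm (adj x \<cdot> \<xi>))\<^sup>2 = cmod (cinner (x \<cdot> (adj x \<cdot> \<xi>)) \<xi>)"
      by (simp add: cinner_adj cinner_self norm_power)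
    also have "\<dots> \<le> norm (x \<cdot> (adj x \<cdot> \<xi>)) * norm \<xi>" by (rule cinner_cauchy_schwarz)
    also have "\<dots> \<le> (opnorm x * norm (adj x \<cdot> \<xi>)) * norm \<xi>" by (intro mult_right_mono norm_bop_le) simp
    finally have "norm (adj x \<cdot> \<xi>) * norm (adj x \<cdot> \<xi>) \<le> norm (adj x \<cdot> \<xi>) * (opnorm x * norm \<xi>)"
      by (simp add: power2_eq_square algebra_simps)
    then show ?thesis using False by (simp add: mult_le_cancel_left)
  qed (simp add: opnorm_nonneg)
qed

lemma opnorm_adj: "opnorm (adj x) = opnorm x"
  using opnorm_adj_le[of x] opnorm_adj_le[of "adj x"] by simp

lemma opnorm_one_le: "opnorm 1 \<le> 1"
  by (rule opnorm_leI) simp_all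

lemma opnorm_power_le: "opnorm (x ^ n) \<le> opnorm x ^ n"
proof (induction n)
  case 0
  show ?case using opnorm_one_le by simp
next
  case (Suc n)
  have "opnorm (x ^ Suc n) \<le> opnorm x * opnorm (x ^ n)" by (simp add: opnorm_mult)
  also have "\<dots> \<le> opnorm x * opnorm x ^ n" by (intro mult_left_mono Suc opnorm_nonneg)
  finally show ?case by simp
qed

text \<open>Iterated Cauchy--Schwarz estimates \<open>p(n)\<^sup>2 \<le> a p(n + 1)\<close> turn a crude exponential bound into the
  sharp one.\<close>

lemma power_trick:
  fixes p :: "nat \<Rightarrow> real"
  assumes p0: "\<And>n. 0 \<le> p n" and step: "\<And>n. (p n)\<^sup>2 \<le> a * p (Suc n)"
    and bd: "\<And>n. p n \<le> C * K ^ (2 ^ n)" and a: "0 \<le> a" and K: "0 \<le> K"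
  shows "p 0 \<le> a * K"
proof (cases "a = 0 \<or> K = 0")
  case True
  then show ?thesis
  proof
    assume "a = 0" then show ?thesis using step[of 0] by simp
  next
    assume "K = 0" then show ?thesis using bd[of 0] by simp
  qed
next
  case False
  then have pos: "a > 0" "K > 0" using a K by simp_all
  define q where "q = p 0 / (a * K)"
  have q0: "0 \<le> q" using p0[of 0] pos by (simp add: q_def)
  have qn: "q ^ (2 ^ n) \<le> p n / (a * K ^ (2 ^ n))" for n
  proof (induction n)
    case (Suc n)
    have "q ^ (2 ^ Suc n) = (q ^ (2 ^ n))\<^sup>2" by (simp add: power_even_eq)
    also have "\<dots> \<le> (p n / (a * K ^ (2 ^ n)))\<^sup>2" by (intro power_mono Suc) (simp add: q0)
    also have "\<dots> = (p n)\<^sup>2 / (a\<^sup>2 * K ^ (2 ^ Suc n))"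
      by (simp add: power_divide power_mult_distrib power_even_eq)
    also have "\<dots> \<le> (a * p (Suc n)) / (a\<^sup>2 * K ^ (2 ^ Suc n))"
      by (intro divide_right_mono step) simp
    also have "\<dots> = p (Suc n) / (a * K ^ (2 ^ Suc n))" using pos by (simp add: power2_eq_square)
    finally show ?case .
  qed (simp add: q_def)
  have "p n / (a * K ^ (2 ^ n)) \<le> C / a" for n
    using bd[of n] pos by (simp add: field_simps)
  then have qb: "q ^ (2 ^ n) \<le> C / a" for n using qn order_trans by blast
  have "q \<le> 1"
  proof (rule ccontr)
    assume "\<not> q \<le> 1"
    then obtain m where m: "C / a < q ^ m" using real_arch_pow[of q "C / a"] by auto
    have "q ^ m \<le> q ^ (2 ^ m)"
      using \<open>\<not> q \<le> 1\<close> less_exp[of m] by (intro power_increasing) (auto intro: less_imp_le)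
    then show False using m qb[of m] by linarith
  qed
  then show ?thesis using pos by (simp add: q_def)
qed

locale tracial =
  fixes M :: "'h::complex_hilbert_space bop set" and \<tau> :: "'h bop \<Rightarrow> complex"
  assumes M: "vN_algebra M" and tr: "faithful_normal_trace M \<tau>"
begin

lemmas M_closed [simp, intro] = vN_adj[OF M] vN_one[OF M] vN_zero[OF M] vN_add[OF M] vN_diff[OF M]
  vN_minus[OF M] vN_mult[OF M] vN_scale[OF M] vN_sum[OF M] vN_power[OF M]

abbreviation n2 where "n2 \<equiv> norm2 \<tau>"

lemma tr_add: "x \<in> M \<Longrightarrow> y \<in> M \<Longrightarrow> \<tau> (x + y) = \<tau> x + \<tau> y"
  and tr_scale: "x \<in> M \<Longrightarrow> \<tau> (c *\<^sub>C x) = c * \<tau> x"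
  and tr_comm: "x \<in> M \<Longrightarrow> y \<in> M \<Longrightarrow> \<tau> (x * y) = \<tau> (y * x)"
  and tr_one [simp]: "\<tau> 1 = 1"
  and tr_faithful: "x \<in> M \<Longrightarrow> \<tau> (adj x * x) = 0 \<Longrightarrow> x = 0"
  and tr_normal: "normal_functional M \<tau>"
  using tr by (simp_all add: faithful_normal_trace_def)

lemma tr_real: "x \<in> M \<Longrightarrow> \<tau> (adj x * x) \<in> \<real>"
  and tr_pos: "x \<in> M \<Longrightarrow> 0 \<le> Re (\<tau> (adj x * x))"
proof -
  have "\<forall>x\<in>M. \<tau> (adj x * x) \<in> \<real> \<and> 0 \<le> Re (\<tau> (adj x * x))"
    using tr unfolding faithful_normal_trace_def by (elim conjE)
  then show "x \<in> M \<Longrightarrow> \<tau> (adj x * x) \<in> \<real>" "x \<in> M \<Longrightarrow> 0 \<le> Re (\<tau> (adj x * x))"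
    by blast+
qed

lemma tr_zero [simp]: "\<tau> 0 = 0" using tr_scale[of 0 0] by simp

lemma tr_minus: "x \<in> M \<Longrightarrow> \<tau> (- x) = - \<tau> x"
  using tr_scale[of x "-1"] by (simp add: bop_minus_one)

lemma tr_diff: "x \<in> M \<Longrightarrow> y \<in> M \<Longrightarrow> \<tau> (x - y) = \<tau> x - \<tau> y"
  using tr_add[of x "- y"] by (simp add: tr_minus)

lemma tr_sum: "(\<And>i. i \<in> I \<Longrightarrow> f i \<in> M) \<Longrightarrow> \<tau> (\<Sum>i\<in>I. f i) = (\<Sum>i\<in>I. \<tau> (f i))"
  by (induction I rule: infinite_finite_induct) (simp_all add: tr_add)

text \<open>Polarization of the reality of \<open>\<tau>(x\<^sup>* x)\<close>.\<close>

lemma tr_hermitian: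
  assumes x: "x \<in> M" and y: "y \<in> M"
  shows "\<tau> (adj x * y) = cnj (\<tau> (adj y * x))"
proof -
  define s where "s = \<tau> (adj x * y)"
  define r where "r = \<tau> (adj y * x)"
  have "\<tau> (adj (x + y) * (x + y)) = \<tau> (adj x * x) + s + r + \<tau> (adj y * y)"
    using x y by (simp add: distrib_left distrib_right tr_add s_def r_def algebra_simps)
  then have "s + r \<in> \<real>"
    using tr_real[of x] tr_real[of y] tr_real[of "x + y"] x y
    by (simp add: complex_is_Real_iff)
  moreover have "\<tau> (adj (x + \<i> *\<^sub>C y) * (x + \<i> *\<^sub>C y)) = \<tau> (adj x * x) + \<i> * s - \<i> * r + \<tau> (adj y * y)"
    using x y by (simp add: distrib_left distrib_right tr_add tr_diff tr_scale bop_scale_add s_def r_def algebra_simps)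
  then have "\<i> * s - \<i> * r \<in> \<real>"
    using tr_real[of x] tr_real[of y] tr_real[of "x + \<i> *\<^sub>C y"] x y
    by (simp add: complex_is_Real_iff)
  ultimately show ?thesis
    unfolding s_def[symmetric] r_def[symmetric] by (simp add: complex_is_Real_iff complex_eq_iff)
qed

lemma tr_adj: "x \<in> M \<Longrightarrow> \<tau> (adj x) = cnj (\<tau> x)"
  using tr_hermitian[of x 1] by simp

lemma tr_n2: "x \<in> M \<Longrightarrow> \<tau> (adj x * x) = of_real ((n2 x)\<^sup>2)"
  using tr_real[of x] tr_pos[of x] by (simp add: norm2_def complex_is_Real_iff complex_eq_iff)

lemma n2_nonneg [simp]: "x \<in> M \<Longrightarrow> 0 \<le> n2 x"
  using tr_pos[of x] by (simp add: norm2_def)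

lemma n2_zero [simp]: "n2 0 = 0" by (simp add: norm2_def)

lemma n2_one [simp]: "n2 1 = 1" by (simp add: norm2_def)

lemma n2_eq_zero: "x \<in> M \<Longrightarrow> n2 x = 0 \<Longrightarrow> x = 0"
  using tr_n2[of x] by (intro tr_faithful) simp_all

lemma n2_scale: "x \<in> M \<Longrightarrow> n2 (c *\<^sub>C x) = cmod c * n2 x"
proof -
  assume x: "x \<in> M"
  have "complex_of_real ((n2 (c *\<^sub>C x))\<^sup>2) = (c * cnj c) * of_real ((n2 x)\<^sup>2)"
    using x unfolding tr_n2[OF x, symmetric] tr_n2[OF vN_scale[OF M x], symmetric] by (simp add: tr_scale)
  also have "\<dots> = of_real ((cmod c * n2 x)\<^sup>2)" by (simp add: complex_norm_square[symmetric] power_mult_distrib)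
  finally have "(n2 (c *\<^sub>C x))\<^sup>2 = (cmod c * n2 x)\<^sup>2" using of_real_eq_iff by blast
  then show ?thesis using x by (simp add: power2_eq_iff_nonneg)
qed

lemma n2_minus: "x \<in> M \<Longrightarrow> n2 (- x) = n2 x"
  by (simp add: norm2_def)

lemma n2_diff_commute: "x \<in> M \<Longrightarrow> y \<in> M \<Longrightarrow> n2 (x - y) = n2 (y - x)"
  using n2_minus[of "x - y"] by simp

lemma n2_adj [simp]: "x \<in> M \<Longrightarrow> n2 (adj x) = n2 x"
  by (simp add: norm2_def tr_comm[of x "adj x"])

lemma n2_cauchy_schwarz:
  assumes x: "x \<in> M" and y: "y \<in> M"
  shows "cmod (\<tau> (adj y * x)) \<le> n2 x * n2 y"
proof (cases "n2 y = 0")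
  case True
  then have "y = 0" using n2_eq_zero y by blast
  then show ?thesis by simp
next
  case False
  define z where "z = \<tau> (adj y * x)"
  define c where "c = z / of_real ((n2 y)\<^sup>2)"
  have cz: "cnj c * z = of_real ((cmod z)\<^sup>2 / (n2 y)\<^sup>2)"
    by (simp add: c_def complex_norm_square[symmetric] mult.commute)
  have cc: "c * cnj c * of_real ((n2 y)\<^sup>2) = cnj c * z"
  proof -
    have "c * of_real ((n2 y)\<^sup>2) = z" using False by (simp add: c_def)
    then show ?thesis by (metis mult.assoc mult.commute)
  qed
  have h: "\<tau> (adj x * y) = cnj z" using tr_hermitian[OF x y] by (simp add: z_def)
  have ccz: "c * cnj z = cnj c * z"
    using cz by (metis complex_cnj_cnj complex_cnj_complex_of_real complex_cnj_mult mult.commute)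
  have "complex_of_real ((n2 (x - c *\<^sub>C y))\<^sup>2)
      = of_real ((n2 x)\<^sup>2) - c * cnj z - cnj c * z + c * cnj c * of_real ((n2 y)\<^sup>2)"
    unfolding tr_n2[OF x, symmetric] tr_n2[OF y, symmetric]
      tr_n2[OF vN_diff[OF M x vN_scale[OF M y]], symmetric]
    using x y by (simp add: left_diff_distrib right_diff_distrib tr_diff tr_add tr_scale bop_scale_add h z_def algebra_simps)
  also have "\<dots> = of_real ((n2 x)\<^sup>2 - (cmod z)\<^sup>2 / (n2 y)\<^sup>2)"
    unfolding cc ccz cz by simp
  finally have "(n2 (x - c *\<^sub>C y))\<^sup>2 = (n2 x)\<^sup>2 - (cmod z)\<^sup>2 / (n2 y)\<^sup>2"
    using of_real_eq_iff by blast
  then have "(cmod z)\<^sup>2 / (n2 y)\<^sup>2 \<le> (n2 x)\<^sup>2" using zero_le_power2[of "n2 (x - c *\<^sub>C y)"] by linarith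
  then have "(cmod z)\<^sup>2 \<le> (n2 x * n2 y)\<^sup>2"
    using False by (simp add: pos_divide_le_eq power_mult_distrib)
  then show ?thesis unfolding z_def by (rule power2_le_imp_le) (use x y in simp)
qed

lemma n2_sq_add:
  assumes x: "x \<in> M" and y: "y \<in> M"
  shows "(n2 (x + y))\<^sup>2 = (n2 x)\<^sup>2 + (n2 y)\<^sup>2 + 2 * Re (\<tau> (adj y * x))"
proof -
  have "complex_of_real ((n2 (x + y))\<^sup>2)
      = of_real ((n2 x)\<^sup>2) + of_real ((n2 y)\<^sup>2) + (\<tau> (adj y * x) + cnj (\<tau> (adj y * x)))"
    unfolding tr_n2[OF x, symmetric] tr_n2[OF y, symmetric] tr_n2[OF vN_add[OF M x y], symmetric]
    using x y by (simp add: distrib_left distrib_right tr_add tr_hermitian[OF x y, symmetric])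
  also have "\<tau> (adj y * x) + cnj (\<tau> (adj y * x)) = of_real (2 * Re (\<tau> (adj y * x)))"
    by (rule complex_add_cnj)
  finally show ?thesis by (metis of_real_add of_real_eq_iff)
qed

lemma n2_triangle:
  assumes x: "x \<in> M" and y: "y \<in> M"
  shows "n2 (x + y) \<le> n2 x + n2 y"
proof (rule power2_le_imp_le)
  have "Re (\<tau> (adj y * x)) \<le> n2 x * n2 y"
    using n2_cauchy_schwarz[OF x y] complex_Re_le_cmod order_trans by blast
  then show "(n2 (x + y))\<^sup>2 \<le> (n2 x + n2 y)\<^sup>2"
    using n2_sq_add[OF x y] by (simp add: power2_sum)
qed (use x y in simp)

lemma n2_triangle_diff: "x \<in> M \<Longrightarrow> y \<in> M \<Longrightarrow> n2 (x - y) \<le> n2 x + n2 y"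
  using n2_triangle[of x "- y"] by (simp add: n2_minus)

lemma n2_triangle3: "x \<in> M \<Longrightarrow> y \<in> M \<Longrightarrow> z \<in> M \<Longrightarrow> n2 (x - z) \<le> n2 (x - y) + n2 (y - z)"
  using n2_triangle[of "x - y" "y - z"] by simp

lemma n2_reverse: "x \<in> M \<Longrightarrow> y \<in> M \<Longrightarrow> n2 x \<le> n2 (x - y) + n2 y"
  using n2_triangle[of "x - y" y] by simp

lemma n2_unitary_left:
  assumes "w \<in> M" "adj w * w = 1" "x \<in> M"
  shows "n2 (w * x) = n2 x"
proof -
  have "adj x * adj w * (w * x) = adj x * ((adj w * w) * x)" by (simp only: mult.assoc)
  then show ?thesis using assms by (simp add: norm2_def)
qed

lemma n2_unitary_right:
  assumes "w \<in> M" "w * adj w = 1" "x \<in> M"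
  shows "n2 (x * w) = n2 x"
proof -
  have "n2 (adj (x * w)) = n2 (adj x)"
    using assms by (simp add: n2_unitary_left del: n2_adj)
  then show ?thesis using assms n2_adj[of "x * w"] by (simp del: adj_mult)
qed

text \<open>The positive functional \<open>z \<mapsto> \<tau>(x\<^sup>* z x)\<close> is crudely bounded because \<open>\<tau>\<close> is normal; the power trick
  makes the bound sharp without taking square roots of positive operators.\<close>

lemma n2_mult_left:
  assumes d: "d \<in> M" and x: "x \<in> M"
  shows "n2 (d * x) \<le> opnorm d * n2 x"
proof -
  define h where "h = adj d * d"
  have hM: "h ^ k \<in> M" for k using d by (auto simp: h_def)
  have hs: "adj (h ^ k) = h ^ k" for k by (simp add: h_def)
  define p where "p = (\<lambda>n. Re (\<tau> (adj x * (h ^ (2 ^ n) * x))))"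
  have sq: "h ^ (2 ^ Suc n) = adj (h ^ (2 ^ n)) * h ^ (2 ^ n)" for n
    unfolding hs by (simp add: power_add[symmetric] mult_2)
  have pS: "p (Suc n) = (n2 (h ^ (2 ^ n) * x))\<^sup>2" for n
  proof -
    have "adj x * (h ^ (2 ^ Suc n) * x) = adj (h ^ (2 ^ n) * x) * (h ^ (2 ^ n) * x)"
      unfolding sq by (simp add: mult.assoc)
    then show ?thesis using x hM by (simp add: p_def tr_n2 del: adj_mult power_Suc)
  qed
  have "adj x * (h * x) = adj (d * x) * (d * x)" by (simp add: h_def mult.assoc)
  then have p00: "p 0 = (n2 (d * x))\<^sup>2" using d x by (simp add: p_def tr_n2 del: adj_mult)
  obtain f g where fg: "\<And>z. z \<in> M \<Longrightarrow> \<tau> z = cinner (amp z \<cdot> f) g"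
    using tr_normal by (rule normal_functional_amp) blast
  define C where "C = norm (amp x \<cdot> f) * norm (amp x \<cdot> g)"
  have main: "p 0 \<le> (n2 x)\<^sup>2 * opnorm h"
  proof (rule power_trick)
    show "0 \<le> p n" for n using p00 pS by (cases n) simp_all
    show "(p n)\<^sup>2 \<le> (n2 x)\<^sup>2 * p (Suc n)" for n
    proof -
      have "\<bar>p n\<bar> \<le> cmod (\<tau> (adj x * (h ^ (2 ^ n) * x)))"
        unfolding p_def by (rule abs_Re_le_cmod)
      also have "\<dots> \<le> n2 (h ^ (2 ^ n) * x) * n2 x" using x hM by (intro n2_cauchy_schwarz) auto
      finally have "\<bar>p n\<bar>\<^sup>2 \<le> (n2 (h ^ (2 ^ n) * x) * n2 x)\<^sup>2" by (rule power_mono) simp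
      then show ?thesis by (simp add: pS power_mult_distrib mult.commute)
    qed
    show "p n \<le> C * opnorm h ^ (2 ^ n)" for n
    proof -
      have "p n \<le> cmod (\<tau> (adj x * (h ^ (2 ^ n) * x)))"
        unfolding p_def by (rule complex_Re_le_cmod)
      also have "\<tau> (adj x * (h ^ (2 ^ n) * x)) = cinner (amp (h ^ (2 ^ n)) \<cdot> (amp x \<cdot> f)) (amp x \<cdot> g)"
        using x hM by (simp add: fg amp_mult amp_adj[of "adj x"])
      also have "cmod \<dots> \<le> norm (amp (h ^ (2 ^ n)) \<cdot> (amp x \<cdot> f)) * norm (amp x \<cdot> g)"
        by (rule cinner_cauchy_schwarz)
      also have "\<dots> \<le> (opnorm (h ^ (2 ^ n)) * norm (amp x \<cdot> f)) * norm (amp x \<cdot> g)"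
        by (intro mult_right_mono norm_amp_le) simp
      also have "\<dots> \<le> (opnorm h ^ (2 ^ n) * norm (amp x \<cdot> f)) * norm (amp x \<cdot> g)"
        by (intro mult_right_mono opnorm_power_le) simp_all
      finally show ?thesis by (simp add: C_def mult_ac)
    qed
  qed (simp_all add: opnorm_nonneg)
  have oh: "opnorm h \<le> (opnorm d)\<^sup>2"
    unfolding h_def using opnorm_mult[of "adj d" d] by (simp add: opnorm_adj power2_eq_square)
  from oh have "(n2 x)\<^sup>2 * opnorm h \<le> (n2 x)\<^sup>2 * (opnorm d)\<^sup>2" by (rule mult_left_mono) simp
  with main have "(n2 (d * x))\<^sup>2 \<le> (n2 x)\<^sup>2 * (opnorm d)\<^sup>2"
    unfolding p00 by (rule order_trans)
  then have "(n2 (d * x))\<^sup>2 \<le> (opnorm d * n2 x)\<^sup>2"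
    by (simp only: power_mult_distrib mult.commute)
  then show ?thesis by (rule power2_le_imp_le) (use x in \<open>simp add: opnorm_nonneg\<close>)
qed

lemma n2_mult_right:
  assumes d: "d \<in> M" and x: "x \<in> M"
  shows "n2 (x * d) \<le> n2 x * opnorm d"
proof -
  have "n2 (x * d) = n2 (adj d * adj x)" using n2_adj[of "x * d"] x d by simp
  also have "\<dots> \<le> opnorm (adj d) * n2 (adj x)" using x d by (intro n2_mult_left) auto
  finally show ?thesis using x by (simp add: opnorm_adj mult.commute)
qed

lemma n2_le_opnorm: "x \<in> M \<Longrightarrow> n2 x \<le> opnorm x"
  using n2_mult_left[of x 1] by simp

lemma n2_dense:
  assumes S: "M = vN_gen S" and x: "x \<in> M" and e: "0 < e"
  obtains y where "y \<in> star_alg S" "y \<in> M" "n2 (x - y) < e"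
proof -
  obtain f g where fg: "\<And>z. z \<in> M \<Longrightarrow> \<tau> z = cinner (amp z \<cdot> f) g"
    using tr_normal by (rule normal_functional_amp) blast
  obtain y where y: "y \<in> star_alg S" "norm (amp (x - y) \<cdot> f) < e" "norm (amp (x - y) \<cdot> g) < e"
    using vN_density2[of x S e f g] x e S by blast
  have yM: "y \<in> M" using y(1) star_alg_subset_vN[OF M, of S] vN_gen_superset S by blast
  have "(n2 (x - y))\<^sup>2 = cmod (\<tau> (adj (x - y) * (x - y)))"
    using x yM by (simp add: tr_n2 norm_power del: adj_diff)
  also have "\<dots> = cmod (cinner (amp (x - y) \<cdot> f) (amp (x - y) \<cdot> g))"
    using x yM by (simp add: fg amp_mult amp_adj[of "adj (x - y)"] del: adj_diff)
  also have "\<dots> \<le> norm (amp (x - y) \<cdot> f) * norm (amp (x - y) \<cdot> g)" by (rule cinner_cauchy_schwarz)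
  also have "\<dots> < e * e" using y e by (intro mult_strict_mono') auto
  finally have "n2 (x - y) < e"
    using e by (intro power_less_imp_less_base[of _ 2 e]) (simp_all add: power2_eq_square)
  then show ?thesis using that y(1) yM by blast
qed

end


section \<open>Tensor products of operators\<close>

lemma commute_mult:
  fixes x :: "'a::semigroup_mult"
  assumes "x * y = y * x" "x' * y = y * x'"
  shows "x * x' * y = y * (x * x')"
proof -
  have "x * x' * y = x * y * x'" by (simp only: mult.assoc assms(2))
  also have "\<dots> = y * (x * x')" by (simp only: assms(1) mult.assoc)
  finally show ?thesis .
qed

locale htensor =
  fixes t :: "'h::complex_hilbert_space \<Rightarrow> 'k::complex_hilbert_space \<Rightarrow> 'l::complex_hilbert_space"
  assumes t: "hilbert_tensor t"
begin

lemma t_add_left: "t (a + a') b = t a b + t a' b"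
  and t_add_right: "t a (b + b') = t a b + t a b'"
  and t_scale_left: "t (c *\<^sub>C a) b = c *\<^sub>C t a b"
  and t_scale_right: "t a (c *\<^sub>C b) = c *\<^sub>C t a b"
  and t_cinner: "cinner (t a b) (t a' b') = cinner a a' * cinner b b'"
  and t_dense: "closure (span {t a b | a b. True}) = UNIV"
  using t unfolding hilbert_tensor_def by simp_all

lemma t_norm: "norm (t a b) = norm a * norm b"
proof -
  have "complex_of_real ((norm (t a b))\<^sup>2) = of_real ((norm a * norm b)\<^sup>2)"
    unfolding cinner_self[symmetric] t_cinner by (simp add: cinner_self power_mult_distrib)
  then have "(norm (t a b))\<^sup>2 = (norm a * norm b)\<^sup>2" using of_real_eq_iff by blast
  then show ?thesis by (simp add: power2_eq_iff_nonneg)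
qed

definition fsum :: "('h \<times> 'k) list \<Rightarrow> 'h bop \<Rightarrow> 'l" where
  "fsum L x = (\<Sum>(a, b)\<leftarrow>L. t (x \<cdot> a) b)"

lemma fsum_simps [simp]:
  "fsum [] x = 0" "fsum (p # L) x = t (x \<cdot> fst p) (snd p) + fsum L x"
  by (simp_all add: fsum_def case_prod_unfold)

lemma fsum_append: "fsum (L @ L') x = fsum L x + fsum L' x"
  by (induction L) (simp_all add: add.assoc)

lemma fsum_scale: "fsum (map (\<lambda>(a, b). (c *\<^sub>C a, b)) L) x = c *\<^sub>C fsum L x"
  by (induction L) (auto simp: scaleC_zero scaleC_add_right bop_scaleC t_scale_left)

lemma fsum_minus: "fsum (map (\<lambda>(a, b). ((-1) *\<^sub>C a, b)) L) x = - fsum L x"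
  using fsum_scale[of "-1" L x] by simp

lemma fsum_cinner_single: "cinner (fsum L (z * y)) (t a b) = cinner (fsum L y) (t (adj z \<cdot> a) b)"
  by (induction L) (simp_all add: cinner_add_left t_cinner cinner_adj)

lemma fsum_cinner: "cinner (fsum L (z * y)) (fsum L' w) = cinner (fsum L y) (fsum L' (adj z * w))"
  by (induction L') (simp_all add: cinner_add_right fsum_cinner_single)

lemma fsum_crude: "norm (fsum L y) \<le> opnorm y * (\<Sum>(a, b)\<leftarrow>L. norm a * norm b)"
proof (induction L)
  case (Cons p L)
  have "norm (fsum (p # L) y) \<le> norm (t (y \<cdot> fst p) (snd p)) + norm (fsum L y)"
    by (simp add: norm_triangle_ineq)
  also have "\<dots> \<le> opnorm y * norm (fst p) * norm (snd p) + opnorm y * (\<Sum>(a, b)\<leftarrow>L. norm a * norm b)"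
    unfolding t_norm by (intro add_mono mult_right_mono norm_bop_le Cons) simp
  finally show ?case by (simp add: case_prod_unfold algebra_simps)
qed simp

text \<open>The form \<open>z \<mapsto> \<langle>(z \<otimes> 1) \<zeta>, \<zeta>\<rangle>\<close> on a finite sum \<open>\<zeta>\<close> of elementary tensors is positive, so
  the power trick bounds it by the operator norm.\<close>

lemma fsum_bound: "norm (fsum L x) \<le> opnorm x * norm (fsum L 1)"
proof -
  define h where "h = adj x * x"
  have hs: "adj h = h" by (simp add: h_def)
  define p where "p = (\<lambda>n. Re (cinner (fsum L (h ^ (2 ^ n))) (fsum L 1)))"
  have pS: "p (Suc n) = (norm (fsum L (h ^ (2 ^ n))))\<^sup>2" for n
  proof -
    have "h ^ (2 ^ Suc n) = h ^ (2 ^ n) * h ^ (2 ^ n)" by (simp add: power_add[symmetric] mult_2)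
    then have "cinner (fsum L (h ^ (2 ^ Suc n))) (fsum L 1) = cinner (fsum L (h ^ (2 ^ n))) (fsum L (h ^ (2 ^ n)))"
      by (simp add: fsum_cinner hs)
    then show ?thesis by (simp add: p_def cinner_self del: power_Suc)
  qed
  have p00: "p 0 = (norm (fsum L x))\<^sup>2"
    by (simp add: p_def h_def fsum_cinner cinner_self)
  define C where "C = (\<Sum>(a, b)\<leftarrow>L. norm a * norm b) * norm (fsum L 1)"
  have main: "p 0 \<le> (norm (fsum L 1))\<^sup>2 * opnorm h"
  proof (rule power_trick)
    show "0 \<le> p n" for n using p00 pS by (cases n) simp_all
    show "(p n)\<^sup>2 \<le> (norm (fsum L 1))\<^sup>2 * p (Suc n)" for n
    proof -
      have "\<bar>p n\<bar> \<le> norm (fsum L (h ^ (2 ^ n))) * norm (fsum L 1)"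
        unfolding p_def using abs_Re_le_cmod cinner_cauchy_schwarz order_trans by blast
      then have "\<bar>p n\<bar>\<^sup>2 \<le> (norm (fsum L (h ^ (2 ^ n))) * norm (fsum L 1))\<^sup>2" by (rule power_mono) simp
      then show ?thesis by (simp add: pS power_mult_distrib mult.commute)
    qed
    show "p n \<le> C * opnorm h ^ (2 ^ n)" for n
    proof -
      have "p n \<le> norm (fsum L (h ^ (2 ^ n))) * norm (fsum L 1)"
        unfolding p_def using complex_Re_le_cmod cinner_cauchy_schwarz order_trans by blast
      also have "\<dots> \<le> (opnorm (h ^ (2 ^ n)) * (\<Sum>(a, b)\<leftarrow>L. norm a * norm b)) * norm (fsum L 1)"
        by (intro mult_right_mono fsum_crude) simp
      also have "\<dots> \<le> (opnorm h ^ (2 ^ n) * (\<Sum>(a, b)\<leftarrow>L. norm a * norm b)) * norm (fsum L 1)"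
        by (intro mult_right_mono opnorm_power_le) (auto intro!: sum_list_nonneg)
      finally show ?thesis by (simp add: C_def mult_ac)
    qed
  qed (simp_all add: opnorm_nonneg)
  have "opnorm h \<le> (opnorm x)\<^sup>2"
    unfolding h_def using opnorm_mult[of "adj x" x] by (simp add: opnorm_adj power2_eq_square)
  then have "(norm (fsum L 1))\<^sup>2 * opnorm h \<le> (norm (fsum L 1))\<^sup>2 * (opnorm x)\<^sup>2"
    by (rule mult_left_mono) simp
  with main have "(norm (fsum L x))\<^sup>2 \<le> (norm (fsum L 1))\<^sup>2 * (opnorm x)\<^sup>2"
    unfolding p00 by (rule order_trans)
  then have "(norm (fsum L x))\<^sup>2 \<le> (opnorm x * norm (fsum L 1))\<^sup>2"
    by (simp only: power_mult_distrib mult.commute)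
  then show ?thesis by (rule power2_le_imp_le) (simp add: opnorm_nonneg)
qed

lemma fsum_diff_bound: "norm (fsum L x - fsum L' x) \<le> opnorm x * norm (fsum L 1 - fsum L' 1)"
  using fsum_bound[of "L @ map (\<lambda>(a, b). ((-1) *\<^sub>C a, b)) L'" x]
  by (simp add: fsum_append fsum_minus del: scaleC_minus_one)

lemma fsum_dense: "\<exists>Ls. (\<lambda>n. fsum (Ls n) 1) \<longlonglongrightarrow> \<zeta>"
proof -
  have rep: "\<exists>L. v = fsum L 1" if "v \<in> span {t a b | a b. True}" for v
    using that
  proof (induction rule: span_induct_alt)
    case base
    show ?case by (rule exI[of _ "[]"]) simp
  next
    case (step c x y)
    then obtain a b L where "x = t a b" "y = fsum L 1" by blast
    then have "c *\<^sub>R x + y = fsum ((complex_of_real c *\<^sub>C a, b) # L) 1"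
      by (simp add: scaleR_scaleC t_scale_left)
    then show ?case by blast
  qed
  have "\<zeta> \<in> closure (span {t a b | a b. True})" unfolding t_dense by simp
  then obtain v where v: "\<And>n. v n \<in> span {t a b | a b. True}" "v \<longlonglongrightarrow> \<zeta>"
    unfolding closure_sequential by blast
  obtain Ls where "\<And>n. v n = fsum (Ls n) 1" using rep[OF v(1)] by metis
  then have "v = (\<lambda>n. fsum (Ls n) 1)" by (rule ext)
  then show ?thesis using v(2) by blast
qed

text \<open>By the previous bound, \<open>x \<otimes> 1\<close> extends from the dense span of elementary tensors.\<close>

lemma ext_tensor_left: "\<exists>z. \<forall>a b. z \<cdot> t a b = t (x \<cdot> a) b"
proof -
  have "\<exists>\<eta>. \<forall>Ls. (\<lambda>n. fsum (Ls n) 1) \<longlonglongrightarrow> \<zeta> \<longrightarrow> (\<lambda>n. fsum (Ls n) x) \<longlonglongrightarrow> \<eta>" for \<zeta>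
  proof -
    obtain Ls where Ls: "(\<lambda>n. fsum (Ls n) 1) \<longlonglongrightarrow> \<zeta>" using fsum_dense by blast
    have "Cauchy (\<lambda>n. fsum (Ls n) x)"
    proof (rule CauchyI)
      fix e :: real assume e: "0 < e"
      define d where "d = e / (opnorm x + 1)"
      have k: "opnorm x + 1 > 0" using opnorm_nonneg[of x] by linarith
      then have "d > 0" using e by (simp add: d_def)
      then obtain M where M: "\<forall>m\<ge>M. \<forall>n\<ge>M. norm (fsum (Ls m) 1 - fsum (Ls n) 1) < d"
        using CauchyD[OF LIMSEQ_imp_Cauchy[OF Ls]] by blast
      have "norm (fsum (Ls m) x - fsum (Ls n) x) < e" if "m \<ge> M" "n \<ge> M" for m n
      proof -
        have "norm (fsum (Ls m) x - fsum (Ls n) x) \<le> opnorm x * norm (fsum (Ls m) 1 - fsum (Ls n) 1)"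
          by (rule fsum_diff_bound)
        also have "\<dots> \<le> opnorm x * d"
          using M that by (intro mult_left_mono opnorm_nonneg) (simp add: less_imp_le)
        also have "\<dots> < (opnorm x + 1) * d" using \<open>d > 0\<close> by simp
        also have "\<dots> = e" using k by (simp add: d_def)
        finally show ?thesis .
      qed
      then show "\<exists>M. \<forall>m\<ge>M. \<forall>n\<ge>M. norm (fsum (Ls m) x - fsum (Ls n) x) < e" by blast
    qed
    then obtain \<eta> where \<eta>: "(\<lambda>n. fsum (Ls n) x) \<longlonglongrightarrow> \<eta>" using Cauchy_convergent convergent_def by blast
    have "(\<lambda>n. fsum (Ls' n) x) \<longlonglongrightarrow> \<eta>" if Ls': "(\<lambda>n. fsum (Ls' n) 1) \<longlonglongrightarrow> \<zeta>" for Ls'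
    proof -
      have "(\<lambda>n. fsum (Ls' n) 1 - fsum (Ls n) 1) \<longlonglongrightarrow> \<zeta> - \<zeta>" by (intro tendsto_diff Ls Ls')
      then have "(\<lambda>n. opnorm x * norm (fsum (Ls' n) 1 - fsum (Ls n) 1)) \<longlonglongrightarrow> opnorm x * norm (\<zeta> - \<zeta>)"
        by (intro tendsto_mult tendsto_const tendsto_norm)
      then have "(\<lambda>n. opnorm x * norm (fsum (Ls' n) 1 - fsum (Ls n) 1)) \<longlonglongrightarrow> 0" by simp
      then have "(\<lambda>n. fsum (Ls' n) x - fsum (Ls n) x) \<longlonglongrightarrow> 0"
        by (rule Lim_null_comparison[rotated]) (simp add: fsum_diff_bound)
      from tendsto_add[OF this \<eta>] show ?thesis by simp
    qed
    then show ?thesis by blast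
  qed
  then obtain g where g: "\<And>\<zeta> Ls. (\<lambda>n. fsum (Ls n) 1) \<longlonglongrightarrow> \<zeta> \<Longrightarrow> (\<lambda>n. fsum (Ls n) x) \<longlonglongrightarrow> g \<zeta>" by metis
  have add: "g (\<zeta> + \<zeta>') = g \<zeta> + g \<zeta>'" for \<zeta> \<zeta>'
  proof -
    obtain L L' where L: "(\<lambda>n. fsum (L n) 1) \<longlonglongrightarrow> \<zeta>" "(\<lambda>n. fsum (L' n) 1) \<longlonglongrightarrow> \<zeta>'" using fsum_dense by metis
    have "(\<lambda>n. fsum (L n @ L' n) 1) \<longlonglongrightarrow> \<zeta> + \<zeta>'" unfolding fsum_append by (intro tendsto_add L)
    from g[OF this] have "(\<lambda>n. fsum (L n) x + fsum (L' n) x) \<longlonglongrightarrow> g (\<zeta> + \<zeta>')" by (simp add: fsum_append)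
    then show ?thesis using tendsto_add[OF g[OF L(1)] g[OF L(2)]] LIMSEQ_unique by blast
  qed
  have sc: "g (c *\<^sub>C \<zeta>) = c *\<^sub>C g \<zeta>" for c \<zeta>
  proof -
    obtain L where L: "(\<lambda>n. fsum (L n) 1) \<longlonglongrightarrow> \<zeta>" using fsum_dense by metis
    have "(\<lambda>n. fsum (map (\<lambda>(a, b). (c *\<^sub>C a, b)) (L n)) 1) \<longlonglongrightarrow> c *\<^sub>C \<zeta>"
      unfolding fsum_scale by (rule bounded_linear.tendsto[OF bounded_linear_scaleC L])
    from g[OF this] have "(\<lambda>n. c *\<^sub>C fsum (L n) x) \<longlonglongrightarrow> g (c *\<^sub>C \<zeta>)" by (simp add: fsum_scale)
    then show ?thesis using bounded_linear.tendsto[OF bounded_linear_scaleC g[OF L]] LIMSEQ_unique by blast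
  qed
  have bd: "norm (g \<zeta>) \<le> norm \<zeta> * opnorm x" for \<zeta>
  proof -
    obtain L where L: "(\<lambda>n. fsum (L n) 1) \<longlonglongrightarrow> \<zeta>" using fsum_dense by metis
    show ?thesis
    proof (rule LIMSEQ_le)
      show "(\<lambda>n. norm (fsum (L n) x)) \<longlonglongrightarrow> norm (g \<zeta>)" by (intro tendsto_norm g L)
      show "(\<lambda>n. norm (fsum (L n) 1) * opnorm x) \<longlonglongrightarrow> norm \<zeta> * opnorm x"
        by (intro tendsto_mult tendsto_norm L tendsto_const)
      show "\<exists>N. \<forall>n\<ge>N. norm (fsum (L n) x) \<le> norm (fsum (L n) 1) * opnorm x"
        using fsum_bound by (simp add: mult.commute)
    qed
  qed
  have "bounded_linear g"
    by (rule bounded_linear_intro[where K = "opnorm x"]) (simp_all add: add sc bd scaleR_scaleC)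
  then have G: "Bop g \<cdot> \<zeta> = g \<zeta>" for \<zeta> by (simp add: bop_apply_Bop sc)
  have "g (t a b) = t (x \<cdot> a) b" for a b
  proof -
    have "(\<lambda>n::nat. fsum [(a, b)] 1) \<longlonglongrightarrow> t a b" by simp
    from g[OF this] show ?thesis by (simp add: LIMSEQ_const_iff)
  qed
  then show ?thesis using G by (intro exI[of _ "Bop g"]) simp
qed

lemma tensor_vec_ext:
  assumes "\<And>a b. cinner (t a b) \<zeta> = cinner (t a b) \<zeta>'"
  shows "\<zeta> = \<zeta>'"
proof (rule cinner_ext_right)
  fix x
  obtain Ls where Ls: "(\<lambda>n. fsum (Ls n) 1) \<longlonglongrightarrow> x" using fsum_dense by blast
  have "cinner (fsum L 1) \<zeta> = cinner (fsum L 1) \<zeta>'" for L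
    by (induction L) (simp_all add: cinner_add_left assms)
  then have "(\<lambda>n. cinner (fsum (Ls n) 1) \<zeta>) = (\<lambda>n. cinner (fsum (Ls n) 1) \<zeta>')" by simp
  then show "cinner x \<zeta> = cinner x \<zeta>'"
    using tendsto_cinner_left[OF Ls, of \<zeta>] tendsto_cinner_left[OF Ls, of \<zeta>'] LIMSEQ_unique by metis
qed

lemma tensor_bop_ext:
  assumes "\<And>a b. z \<cdot> t a b = z' \<cdot> t a b"
  shows "z = z'"
proof -
  have "adj z \<cdot> \<zeta> = adj z' \<cdot> \<zeta>" for \<zeta>
    by (rule tensor_vec_ext) (simp add: cinner_adj[symmetric] assms)
  then have "adj z = adj z'" by (rule bop_eqI)
  then show ?thesis by (metis adj_adj)
qed

end

lemma (in htensor) htensor_flip: "htensor (\<lambda>b a. t a b)"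
proof
  have "{t a b | b a. True} = {t a b | a b. True}" by blast
  then have "closure (span {t a b | b a. True}) = UNIV" using t_dense by simp
  then show "hilbert_tensor (\<lambda>b a. t a b)"
    unfolding hilbert_tensor_def
    by (simp add: t_add_left t_add_right t_scale_left t_scale_right t_cinner mult.commute)
qed

context htensor
begin

abbreviation ot where "ot \<equiv> op_tensor t"

lemma ot_apply: "ot x y \<cdot> t a b = t (x \<cdot> a) (y \<cdot> b)"
proof -
  obtain z where z: "\<And>a b. z \<cdot> t a b = t (x \<cdot> a) b" using ext_tensor_left by blast
  obtain z' where z': "\<And>a b. z' \<cdot> t a b = t a (y \<cdot> b)"
    using htensor.ext_tensor_left[OF htensor_flip, of y] by blast
  have zz: "\<forall>a b. (z * z') \<cdot> t a b = t (x \<cdot> a) (y \<cdot> b)" by (simp add: z z')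
  have "ot x y = z * z'"
    unfolding op_tensor_def
  proof (rule the_equality, rule zz)
    fix w assume "\<forall>a b. w \<cdot> t a b = t (x \<cdot> a) (y \<cdot> b)"
    then show "w = z * z'" using zz by (intro tensor_bop_ext) simp
  qed
  then show ?thesis using zz by simp
qed

lemma ot_mult: "ot x y * ot x' y' = ot (x * x') (y * y')"
  and ot_one: "ot 1 1 = 1"
  and ot_add_left: "ot (x + x') y = ot x y + ot x' y"
  and ot_add_right: "ot x (y + y') = ot x y + ot x y'"
  and ot_scale_left: "ot (c *\<^sub>C x) y = c *\<^sub>C ot x y"
  and ot_scale_right: "ot x (c *\<^sub>C y) = c *\<^sub>C ot x y"
  by (rule tensor_bop_ext; simp add: ot_apply t_add_left t_add_right t_scale_left t_scale_right)+

lemma ot_zero [simp]: "ot 0 y = 0" "ot x 0 = 0"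
  using ot_scale_left[of 0 0 y] ot_scale_right[of x 0 0] by simp_all

lemma ot_minus_left: "ot (- x) y = - ot x y"
  using ot_scale_left[of "-1" x y] by (simp add: bop_minus_one)

lemma ot_diff_left: "ot (x - x') y = ot x y - ot x' y"
  using ot_add_left[of x "- x'" y] by (simp add: ot_minus_left)

lemma ot_sum_left: "ot (\<Sum>i\<in>I. f i) y = (\<Sum>i\<in>I. ot (f i) y)"
  by (induction I rule: infinite_finite_induct) (simp_all add: ot_add_left)

lemma ot_sum_right: "ot x (\<Sum>i\<in>I. f i) = (\<Sum>i\<in>I. ot x (f i))"
  by (induction I rule: infinite_finite_induct) (simp_all add: ot_add_right)

lemma ot_adj [simp]: "adj (ot x y) = ot (adj x) (adj y)"
proof (rule tensor_bop_ext)
  fix a b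
  show "adj (ot x y) \<cdot> t a b = ot (adj x) (adj y) \<cdot> t a b"
    by (rule tensor_vec_ext, subst cinner_adj[symmetric]) (simp add: ot_apply t_cinner cinner_adj)
qed

text \<open>Slicing with the Riesz theorem turns a vector functional on \<open>x \<otimes> 1\<close> into one on \<open>x\<close>, so the
  commutant of the tensored generators commutes with the whole first leg.\<close>

lemma ot_left_in_vN_gen:
  assumes x: "x \<in> vN_gen S"
  shows "ot x 1 \<in> vN_gen ((\<lambda>x. ot x 1) ` S)"
proof -
  define T where "T = (\<lambda>x. ot x 1) ` S"
  have "ot x 1 * y = y * ot x 1" if y: "y \<in> commutant (T \<union> adj ` T)" for y
  proof -
    have slice: "\<exists>\<eta>. \<forall>a. cinner (t a b) \<zeta> = cinner a \<eta>" for b \<zeta>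
    proof (rule riesz)
      show "bounded_linear (\<lambda>a. cinner (t a b) \<zeta>)"
      proof (rule bounded_linear_intro[where K = "norm b * norm \<zeta>"])
        show "norm (cinner (t a b) \<zeta>) \<le> norm a * (norm b * norm \<zeta>)" for a
          using cinner_cauchy_schwarz[of "t a b" \<zeta>] by (simp add: t_norm mult.assoc)
      qed (simp_all add: t_add_left cinner_add_left scaleR_scaleC t_scale_left cinner_scaleC_left scaleR_conv_of_real)
    qed (simp add: t_scale_left cinner_scaleC_left)
    have ya: "adj y \<in> commutant (T \<union> adj ` T)"
      using y by (rule commutant_adj[rotated]) auto
    have gens: "ot s 1 * z = z * ot s 1" if "s \<in> S" "z \<in> commutant (T \<union> adj ` T)" for s z
      using that by (auto simp: commutant_def T_def)
    have "ot s 1 * y = y * ot s 1 \<and> ot s 1 * adj y = adj y * ot s 1" if "s \<in> star_alg S" for s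
      using that
    proof induction
      case (gen s) then show ?case using gens y ya by simp
    next
      case (mult s s')
      have "ot (s * s') 1 = ot s 1 * ot s' 1" by (simp add: ot_mult)
      then show ?case using mult by (simp only: commute_mult)
    next
      case (adj s)
      then have "adj (y * ot s 1) = adj (ot s 1 * y)" "adj (adj y * ot s 1) = adj (ot s 1 * adj y)" by simp_all
      then show ?case by simp
    qed (simp_all add: ot_one ot_add_left ot_scale_left distrib_left distrib_right)
    then have comm_gen: "ot s 1 * y = y * ot s 1" if "s \<in> star_alg S" for s using that by blast
    have eq: "cinner ((ot x 1 * y) \<cdot> t a b) (t a' b') = cinner ((y * ot x 1) \<cdot> t a b) (t a' b')" for a b a' b'
    proof -
      obtain \<eta> where \<eta>: "\<And>c. cinner (t c b) (adj y \<cdot> t a' b') = cinner c \<eta>" using slice by blast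
      obtain \<eta>' where \<eta>': "\<And>c. cinner (t c b') (y \<cdot> t a b) = cinner c \<eta>'" using slice by blast
      have R: "cinner ((y * ot z 1) \<cdot> t a b) (t a' b') = cinner (z \<cdot> a) \<eta>" for z
        by (simp add: cinner_adj[of y] ot_apply \<eta>)
      have Lh: "cinner ((ot z 1 * y) \<cdot> t a b) (t a' b') = cinner (z \<cdot> \<eta>') a'" for z
      proof -
        have "cinner ((ot z 1 * y) \<cdot> t a b) (t a' b') = cnj (cinner (t (adj z \<cdot> a') b') (y \<cdot> t a b))"
          by (simp add: cinner_adj[of "ot z 1"] ot_apply) (rule cinner_commute)
        also have "\<dots> = cinner \<eta>' (adj z \<cdot> a')" unfolding \<eta>' by (rule cinner_commute[symmetric])
        finally show ?thesis by (simp add: cinner_adj)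
      qed
      have "cinner (x \<cdot> \<eta>') a' = cinner (x \<cdot> a) \<eta>"
      proof (rule normal_functional_eqI[OF _ _ _ x])
        show "cinner (z \<cdot> \<eta>') a' = cinner (z \<cdot> a) \<eta>" if "z \<in> star_alg S" for z
          using comm_gen[OF that] R[of z] Lh[of z] by simp
      qed (rule normal_functional_vector)+
      then show ?thesis by (simp only: R Lh)
    qed
    show ?thesis
    proof (rule tensor_bop_ext, rule tensor_vec_ext)
      fix a b a' b'
      show "cinner (t a' b') ((ot x 1 * y) \<cdot> t a b) = cinner (t a' b') ((y * ot x 1) \<cdot> t a b)"
        using eq[of a b a' b'] by (metis cinner_commute)
    qed
  qed
  then show ?thesis by (auto simp: vN_gen_def T_def[symmetric] commutant_def[of "commutant _"])
qed

end

lemma op_tensor_flip: "op_tensor (\<lambda>b a. t a b) y x = op_tensor t x y"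
  unfolding op_tensor_def by (rule arg_cong[where f = The]) auto

context htensor
begin

lemma ot_right_in_vN_gen: "y \<in> vN_gen S \<Longrightarrow> ot 1 y \<in> vN_gen (ot 1 ` S)"
  using htensor.ot_left_in_vN_gen[OF htensor_flip, of y S] by (simp only: op_tensor_flip[of t])

lemma vN_tensor_ot: "x \<in> A \<Longrightarrow> y \<in> B \<Longrightarrow> ot x y \<in> vN_tensor t A B"
  unfolding vN_tensor_def by (rule subsetD[OF vN_gen_superset]) auto

text \<open>Hence generators of the factors give generators of the tensor product.\<close>

lemma vN_tensor_generators:
  assumes A: "A = vN_gen SA" and B: "B = vN_gen SB"
  shows "vN_tensor t A B = vN_gen ((\<lambda>x. ot x 1) ` SA \<union> ot 1 ` SB)"
proof
  let ?G = "(\<lambda>x. ot x 1) ` SA \<union> ot 1 ` SB"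
  have v: "vN_algebra (vN_gen ?G)" by (rule vN_algebra_vN_gen)
  have sub: "vN_gen T \<subseteq> vN_gen ?G" if "T \<subseteq> ?G" for T
    using that vN_gen_superset[of ?G] by (intro vN_gen_mono_vN v) blast
  have "ot x y \<in> vN_gen ?G" if "x \<in> A" "y \<in> B" for x y
  proof -
    have "ot x 1 \<in> vN_gen ?G"
      by (rule subsetD[OF sub ot_left_in_vN_gen]) (use that A in auto)
    moreover have "ot 1 y \<in> vN_gen ?G"
      by (rule subsetD[OF sub ot_right_in_vN_gen]) (use that B in auto)
    ultimately
    have "ot x 1 * ot 1 y \<in> vN_gen ?G" by (rule vN_mult[OF v])
    then show ?thesis by (simp add: ot_mult)
  qed
  then show "vN_tensor t A B \<subseteq> vN_gen ?G"
    unfolding vN_tensor_def by (intro vN_gen_mono_vN v) auto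
  have "1 \<in> A" "1 \<in> B" "SA \<subseteq> A" "SB \<subseteq> B"
    unfolding A B by (simp_all add: vN_one vN_algebra_vN_gen vN_gen_superset)
  then have "?G \<subseteq> vN_tensor t A B" by (auto intro: vN_tensor_ot)
  then show "vN_gen ?G \<subseteq> vN_tensor t A B"
    unfolding vN_tensor_def by (intro vN_gen_mono_vN vN_algebra_vN_gen)
qed

end


section \<open>Chebyshev polynomials of a semicircular element\<close>

text \<open>The polynomials \<open>U\<^sub>n(s/2)\<close> of the second kind, for \<open>s\<close> in an arbitrary ring.\<close>

fun cheb :: "nat \<Rightarrow> 'a::{ring,monoid_mult} \<Rightarrow> 'a" where
  "cheb 0 s = 1"
| "cheb (Suc 0) s = s"
| "cheb (Suc (Suc n)) s = s * cheb (Suc n) s - cheb n s"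

lemma cheb_commute: "s * cheb n s = cheb n s * s"
proof (induction n s rule: cheb.induct)
  case (3 n s)
  have "s * cheb (Suc n) s * s = s * (s * cheb (Suc n) s)" by (simp only: mult.assoc 3(1)[symmetric])
  then show ?case using 3(2) by (simp add: left_diff_distrib right_diff_distrib)
qed simp_all

lemma cheb_commute_cheb: "cheb m s * cheb n s = cheb n s * cheb m s"
proof (induction n s rule: cheb.induct)
  case (3 n s)
  have "cheb m s * (s * cheb (Suc n) s) = s * cheb (Suc n) s * cheb m s"
  proof -
    have "cheb m s * (s * cheb (Suc n) s) = s * (cheb m s * cheb (Suc n) s)"
      by (simp only: mult.assoc[symmetric] cheb_commute[of s m])
    then show ?thesis by (simp only: 3(1) mult.assoc)
  qed
  then show ?case using 3(2) by (simp add: left_diff_distrib right_diff_distrib)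
qed (simp_all add: cheb_commute)

text \<open>The quadratic form that the three-term recursion preserves.\<close>

lemma cheb_quadratic:
  "cheb (Suc n) s * cheb (Suc n) s + cheb n s * cheb n s - s * cheb n s * cheb (Suc n) s = 1"
proof (induction n)
  case (Suc n)
  define a b where "a = cheb n s" and "b = cheb (Suc n) s"
  define c where "c = cheb (Suc (Suc n)) s"
  have c: "c = s * b - a" by (simp add: c_def b_def a_def)
  have ab: "a * b = b * a" unfolding a_def b_def by (rule cheb_commute_cheb)
  have sb: "s * b = b * s" "s * a = a * s" by (simp_all only: a_def b_def cheb_commute)
  have "c * c - s * b * c = (c - s * b) * c" by (simp only: left_diff_distrib)
  also have "\<dots> = a * a - a * (s * b)" by (simp add: c right_diff_distrib)
  also have "a * (s * b) = s * a * b" by (simp only: mult.assoc[symmetric] sb(2))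
  finally have "c * c + b * b - s * b * c = b * b + a * a - s * a * b" by (simp add: algebra_simps)
  then show ?case
    using Suc unfolding a_def[symmetric] b_def[symmetric] c_def[symmetric] by simp
qed (simp add: algebra_simps)

lemma cheb_sin: "cheb n (2 * cos \<theta>) * sin \<theta> = sin (real (Suc n) * \<theta>)" for \<theta> :: real
proof (induction n rule: induct_nat_012)
  case 1
  show ?case by (simp add: sin_double)
next
  case (ge2 n)
  have "cheb (Suc (Suc n)) (2 * cos \<theta>) * sin \<theta>
      = 2 * cos \<theta> * (cheb (Suc n) (2 * cos \<theta>) * sin \<theta>) - cheb n (2 * cos \<theta>) * sin \<theta>"
    by (simp add: algebra_simps)
  also have "\<dots> = 2 * cos \<theta> * sin (real (Suc (Suc n)) * \<theta>) - sin (real (Suc n) * \<theta>)"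
    by (simp only: ge2)
  also have "\<dots> = sin (real (Suc (Suc (Suc n))) * \<theta>)"
  proof -
    have "real (Suc (Suc (Suc n))) * \<theta> = real (Suc (Suc n)) * \<theta> + \<theta>"
      "real (Suc n) * \<theta> = real (Suc (Suc n)) * \<theta> - \<theta>" by (simp_all add: algebra_simps)
    then show ?thesis by (simp only: sin_add sin_diff) simp
  qed
  finally show ?case .
qed simp

lemma continuous_on_cheb: "continuous_on A (\<lambda>t::real. cheb n (c * t))"
  by (induction n rule: induct_nat_012) (auto intro!: continuous_intros)

definition sc_density :: "real \<Rightarrow> real \<Rightarrow> real" where
  "sc_density r t = 2 / (pi * r\<^sup>2) * sqrt (r\<^sup>2 - t\<^sup>2)"

lemma continuous_on_sc_density: "continuous_on A (sc_density r)"
  unfolding sc_density_def by (intro continuous_intros)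

text \<open>With \<open>t = r cos \<theta>\<close> the integrand becomes \<open>(2/\<pi>) sin ((n + 1) \<theta>) sin ((m + 1) \<theta>)\<close>.\<close>

lemma cheb_orthonormal_integral:
  assumes r: "0 < r"
  shows "integral {-r..r} (\<lambda>t. cheb n (2 / r * t) * cheb m (2 / r * t) * sc_density r t)
    = (if n = m then 1 else 0)"
proof -
  define k :: real where "k = real n - real m"
  define l :: real where "l = real n + real m + 2"
  define H where "H = (\<lambda>\<theta>. - (1 / pi) * ((if n = m then \<theta> else sin (k * \<theta>) / k) - sin (l * \<theta>) / l))"
  have l: "l > 0" by (simp add: l_def)
  have k: "n \<noteq> m \<Longrightarrow> k \<noteq> 0" by (simp add: k_def)
  have H': "(H has_real_derivative - (2 / pi) * (sin (real (Suc n) * \<theta>) * sin (real (Suc m) * \<theta>))) (at \<theta>)" for \<theta>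
  proof -
    have "(H has_real_derivative - (1 / pi) * (cos (k * \<theta>) - cos (l * \<theta>))) (at \<theta>)"
      unfolding H_def using l k
      by (cases "n = m") (auto intro!: derivative_eq_intros simp: k_def)
    moreover have e: "2 * (sin (real (Suc n) * \<theta>) * sin (real (Suc m) * \<theta>)) = cos (k * \<theta>) - cos (l * \<theta>)"
    proof -
      have "k * \<theta> = real (Suc n) * \<theta> - real (Suc m) * \<theta>" "l * \<theta> = real (Suc n) * \<theta> + real (Suc m) * \<theta>"
        by (simp_all add: k_def l_def algebra_simps)
      then show ?thesis by (simp only: cos_add cos_diff)
    qed
    ultimately have "(H has_real_derivative - (1 / pi) * (2 * (sin (real (Suc n) * \<theta>) * sin (real (Suc m) * \<theta>)))) (at \<theta>)"
      by (simp only: e)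
    then show ?thesis by (simp del: of_nat_Suc)
  qed
  define F where "F = (\<lambda>t. H (arccos (t / r)))"
  have "((\<lambda>t. cheb n (2 / r * t) * cheb m (2 / r * t) * sc_density r t) has_integral (F r - F (- r))) {-r..r}"
  proof (rule fundamental_theorem_of_calculus_interior)
    have cH: "continuous_on UNIV H"
      using H' by (meson DERIV_isCont continuous_at_imp_continuous_on)
    show "continuous_on {-r..r} F"
      unfolding F_def
      by (rule continuous_on_compose2[OF cH]) (use r in \<open>auto intro!: continuous_intros simp: field_simps\<close>)
    fix t assume "t \<in> {-r<..<r}"
    then have t: "-1 < t / r" "t / r < 1" using r by (simp_all add: field_simps)
    define \<theta> where "\<theta> = arccos (t / r)"
    have ct: "cos \<theta> = t / r" using t by (simp add: \<theta>_def)
    have st: "sin \<theta> = sqrt (1 - (t / r)\<^sup>2)" using t by (simp add: \<theta>_def sin_arccos)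
    have t2: "(t / r)\<^sup>2 < 1" using t by (simp add: abs_square_less_1 abs_less_iff)
    then have sp: "sin \<theta> > 0" by (simp add: st)
    have "((\<lambda>t. arccos (t / r)) has_real_derivative inverse (- sqrt (1 - (t / r)\<^sup>2)) * (1 / r)) (at t)"
      using r by (intro DERIV_chain2[where f = arccos and g = "\<lambda>t. t / r"] DERIV_arccos t)
        (auto intro!: derivative_eq_intros)
    then have "(F has_real_derivative - (2 / pi) * (sin (real (Suc n) * \<theta>) * sin (real (Suc m) * \<theta>))
        * (inverse (- sqrt (1 - (t / r)\<^sup>2)) * (1 / r))) (at t)"
      unfolding F_def \<theta>_def by (rule DERIV_chain2[OF H'])
    moreover have "- (2 / pi) * (sin (real (Suc n) * \<theta>) * sin (real (Suc m) * \<theta>))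
        * (inverse (- sqrt (1 - (t / r)\<^sup>2)) * (1 / r))
      = cheb n (2 / r * t) * cheb m (2 / r * t) * sc_density r t"
    proof -
      have tt: "2 / r * t = 2 * cos \<theta>" by (simp add: ct)
      have "r\<^sup>2 - t\<^sup>2 = r\<^sup>2 * (1 - (t / r)\<^sup>2)" using r by (simp add: field_simps power_divide)
      then have "sqrt (r\<^sup>2 - t\<^sup>2) = r * sin \<theta>" using r by (simp add: st real_sqrt_mult)
      then have d: "sc_density r t = 2 / (pi * r) * sin \<theta>"
        using r by (simp add: sc_density_def power2_eq_square)
      show ?thesis
        unfolding tt d st[symmetric] cheb_sin[symmetric] using sp r by (simp add: field_simps)
    qed
    ultimately show "(F has_vector_derivative cheb n (2 / r * t) * cheb m (2 / r * t) * sc_density r t) (at t)"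
      by (simp add: has_real_derivative_iff_has_vector_derivative)
  qed (use r in simp)
  moreover have "F r - F (- r) = (if n = m then 1 else 0)"
  proof -
    have "sin (k * pi) = 0"
    proof -
      have "k = of_int (int n - int m)" by (simp add: k_def)
      then show ?thesis using sin_integer_2pi sin_zero_iff_int2 by blast
    qed
    moreover have "sin (l * pi) = 0"
    proof -
      have "l = of_int (int n + int m + 2)" by (simp add: l_def)
      then show ?thesis using sin_zero_iff_int2 by blast
    qed
    ultimately show ?thesis using r by (simp add: F_def H_def)
  qed
  ultimately show ?thesis by (simp add: integral_unique)
qed

lemma cheb_in_star_alg: "s \<in> star_alg S \<Longrightarrow> cheb n s \<in> star_alg S"
  by (induction n s rule: cheb.induct) (auto intro: star_alg.intros star_alg_diff)

lemma adj_cheb: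
  fixes s :: "'h::complex_hilbert_space bop"
  assumes "adj s = s"
  shows "adj (cheb n s) = cheb n s"
  by (induction n rule: induct_nat_012) (simp_all add: assms cheb_commute[symmetric] del: cheb.simps(3), simp add: assms cheb_commute)

context tracial
begin

lemma cheb_in: "s \<in> M \<Longrightarrow> cheb n s \<in> M"
  by (induction n rule: induct_nat_012) auto

text \<open>Moments determine the trace of every polynomial in the semicircular element; the induction
  carries an additional power along to absorb the factors of the recursion.\<close>

lemma semicircular_cheb_moment:
  assumes x: "x \<in> M" and r: "0 < r"
    and mom: "\<And>n. \<tau> (x ^ n) = complex_of_real (integral {-r..r} (\<lambda>t. t ^ n * sc_density r t))"
  shows "\<tau> (x ^ k * cheb n (complex_of_real (2 / r) *\<^sub>C x) * cheb m (complex_of_real (2 / r) *\<^sub>C x))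
    = complex_of_real (integral {-r..r} (\<lambda>t. t ^ k * cheb n (2 / r * t) * cheb m (2 / r * t) * sc_density r t))"
proof -
  define s where "s = complex_of_real (2 / r) *\<^sub>C x"
  have sM: "s \<in> M" using x by (simp add: s_def)
  note int = integrable_continuous_interval continuous_intros continuous_on_cheb continuous_on_sc_density
  have one: "\<tau> (x ^ k * cheb n s) = complex_of_real (integral {-r..r} (\<lambda>t. t ^ k * cheb n (2 / r * t) * sc_density r t))" for k n
  proof (induction n arbitrary: k rule: induct_nat_012)
    case 0
    show ?case by (simp add: mom)
  next
    case 1
    have "\<tau> (x ^ k * s) = complex_of_real (2 / r) * \<tau> (x ^ Suc k)"
      using x by (simp add: s_def tr_scale power_commutes)
    also have "\<dots> = complex_of_real (integral {-r..r} (\<lambda>t. 2 / r * (t ^ Suc k * sc_density r t)))"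
      by (simp only: mom integral_mult_right of_real_mult)
    finally show ?case by (simp add: mult_ac)
  next
    case (ge2 n)
    have "x ^ k * cheb (Suc (Suc n)) s = complex_of_real (2 / r) *\<^sub>C (x ^ Suc k * cheb (Suc n) s) - x ^ k * cheb n s"
      by (simp add: right_diff_distrib) (simp add: s_def power_commutes[symmetric] mult.assoc[symmetric] del: cheb.simps)
    then have "\<tau> (x ^ k * cheb (Suc (Suc n)) s)
        = complex_of_real (2 / r) * \<tau> (x ^ Suc k * cheb (Suc n) s) - \<tau> (x ^ k * cheb n s)"
      using x cheb_in[OF sM] by (simp add: tr_diff tr_scale del: cheb.simps power_Suc)
    also have "\<dots> = complex_of_real (2 / r * integral {-r..r} (\<lambda>t. t ^ Suc k * cheb (Suc n) (2 / r * t) * sc_density r t)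
        - integral {-r..r} (\<lambda>t. t ^ k * cheb n (2 / r * t) * sc_density r t))"
      unfolding ge2 by simp
    also have "2 / r * integral {-r..r} (\<lambda>t. t ^ Suc k * cheb (Suc n) (2 / r * t) * sc_density r t)
        - integral {-r..r} (\<lambda>t. t ^ k * cheb n (2 / r * t) * sc_density r t)
      = integral {-r..r} (\<lambda>t. 2 / r * (t ^ Suc k * cheb (Suc n) (2 / r * t) * sc_density r t)
          - t ^ k * cheb n (2 / r * t) * sc_density r t)"
      unfolding integral_mult_right[symmetric] by (intro integral_diff[symmetric] int)
    also have "\<dots> = integral {-r..r} (\<lambda>t. t ^ k * cheb (Suc (Suc n)) (2 / r * t) * sc_density r t)"
      by (rule integral_cong) (simp add: algebra_simps)
    finally show ?case .
  qed
  show ?thesis unfolding s_def[symmetric]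
  proof (induction m arbitrary: k rule: induct_nat_012)
    case 0
    show ?case by (simp add: one)
  next
    case 1
    have "x ^ k * cheb n s * s = complex_of_real (2 / r) *\<^sub>C (x ^ Suc k * cheb n s)"
      by (simp only: mult.assoc cheb_commute[symmetric]) (simp add: s_def power_commutes[symmetric] mult.assoc)
    then have "\<tau> (x ^ k * cheb n s * s) = complex_of_real (2 / r) * \<tau> (x ^ Suc k * cheb n s)"
      using x cheb_in[OF sM] by (simp add: tr_scale del: power_Suc)
    also have "\<dots> = complex_of_real (integral {-r..r} (\<lambda>t. 2 / r * (t ^ Suc k * cheb n (2 / r * t) * sc_density r t)))"
      by (simp only: one integral_mult_right of_real_mult)
    finally show ?case by (simp add: mult_ac)
  next
    case (ge2 m)
    have "x ^ k * cheb n s * cheb (Suc (Suc m)) s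
        = complex_of_real (2 / r) *\<^sub>C (x ^ Suc k * cheb n s * cheb (Suc m) s) - x ^ k * cheb n s * cheb m s"
    proof -
      have "x ^ k * cheb n s * (s * cheb (Suc m) s) = x ^ k * (s * cheb n s) * cheb (Suc m) s"
        by (simp only: mult.assoc cheb_commute)
      also have "\<dots> = complex_of_real (2 / r) *\<^sub>C (x ^ Suc k * cheb n s * cheb (Suc m) s)"
        by (simp add: s_def power_commutes[symmetric] mult.assoc del: cheb.simps)
      finally show ?thesis by (simp add: right_diff_distrib)
    qed
    then have "\<tau> (x ^ k * cheb n s * cheb (Suc (Suc m)) s)
        = complex_of_real (2 / r) * \<tau> (x ^ Suc k * cheb n s * cheb (Suc m) s) - \<tau> (x ^ k * cheb n s * cheb m s)"
      using x cheb_in[OF sM] by (simp add: tr_diff tr_scale del: cheb.simps power_Suc)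
    also have "\<dots> = complex_of_real (2 / r * integral {-r..r} (\<lambda>t. t ^ Suc k * cheb n (2 / r * t) * cheb (Suc m) (2 / r * t) * sc_density r t)
        - integral {-r..r} (\<lambda>t. t ^ k * cheb n (2 / r * t) * cheb m (2 / r * t) * sc_density r t))"
      unfolding ge2 by simp
    also have "2 / r * integral {-r..r} (\<lambda>t. t ^ Suc k * cheb n (2 / r * t) * cheb (Suc m) (2 / r * t) * sc_density r t)
        - integral {-r..r} (\<lambda>t. t ^ k * cheb n (2 / r * t) * cheb m (2 / r * t) * sc_density r t)
      = integral {-r..r} (\<lambda>t. 2 / r * (t ^ Suc k * cheb n (2 / r * t) * cheb (Suc m) (2 / r * t) * sc_density r t)
          - t ^ k * cheb n (2 / r * t) * cheb m (2 / r * t) * sc_density r t)"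
      unfolding integral_mult_right[symmetric] by (intro integral_diff[symmetric] int)
    also have "\<dots> = integral {-r..r} (\<lambda>t. t ^ k * cheb n (2 / r * t) * cheb (Suc (Suc m)) (2 / r * t) * sc_density r t)"
      by (rule integral_cong) (simp add: algebra_simps)
    finally show ?case .
  qed
qed

lemma semicircular_cheb:
  assumes x: "x \<in> M" and sc: "semicircular \<tau> x"
  obtains r where "0 < r" "\<And>n m. \<tau> (cheb n (complex_of_real (2 / r) *\<^sub>C x) * cheb m (complex_of_real (2 / r) *\<^sub>C x))
    = (if n = m then 1 else 0)"
proof -
  obtain r where r: "0 < r" and
    mom: "\<And>n. \<tau> (x ^ n) = complex_of_real (integral {-r..r} (\<lambda>t. t ^ n * sc_density r t))"
    using sc unfolding semicircular_def sc_density_def by blast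
  show ?thesis
    using that[OF r] semicircular_cheb_moment[OF x r mom, of 0] cheb_orthonormal_integral[OF r] by simp
qed

text \<open>Right multiplication by consecutive Chebyshev polynomials cannot make a vector small twice.\<close>

lemma cheb_lower_bound:
  assumes s: "s \<in> M" "adj s = s" and g: "g \<in> M"
  shows "real p * (n2 g)\<^sup>2 \<le> (1 + opnorm s / 2) * (\<Sum>k<2 * p. (n2 (g * cheb k s))\<^sup>2)"
proof -
  have pair: "(n2 g)\<^sup>2 \<le> (1 + opnorm s / 2) * ((n2 (g * cheb k s))\<^sup>2 + (n2 (g * cheb (Suc k) s))\<^sup>2)" for k
  proof -
    define a where "a = g * cheb k s"
    define b where "b = g * cheb (Suc k) s"
    have cM: "cheb k s \<in> M" for k by (rule cheb_in[OF s(1)])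
    have aM: "a \<in> M" and bM: "b \<in> M" using g cM by (auto simp: a_def b_def simp del: cheb.simps)
    have "g * adj g = g * (cheb (Suc k) s * cheb (Suc k) s + cheb k s * cheb k s - s * cheb k s * cheb (Suc k) s) * adj g"
      by (simp only: cheb_quadratic mult_1_right)
    also have "\<dots> = b * adj b + a * adj a - (a * s) * adj b"
      unfolding cheb_commute[of s k]
      by (simp add: a_def b_def adj_cheb[OF s(2)] algebra_simps del: cheb.simps)
    finally have "\<tau> (g * adj g) = \<tau> (b * adj b) + \<tau> (a * adj a) - \<tau> ((a * s) * adj b)"
      using aM bM s by (simp add: tr_add tr_diff)
    then have "\<tau> (adj g * g) = \<tau> (adj b * b) + \<tau> (adj a * a) - \<tau> (adj b * (a * s))"
      using aM bM s g by (simp add: tr_comm[of g] tr_comm[of b "adj b"] tr_comm[of a "adj a"] tr_comm[of "a * s"])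
    then have "complex_of_real ((n2 g)\<^sup>2) = of_real ((n2 b)\<^sup>2 + (n2 a)\<^sup>2) - \<tau> (adj b * (a * s))"
      using aM bM g by (simp add: tr_n2)
    then have "(n2 g)\<^sup>2 = (n2 b)\<^sup>2 + (n2 a)\<^sup>2 - Re (\<tau> (adj b * (a * s)))"
      by (metis Re_complex_of_real minus_complex.simps(1))
    also have "- Re (\<tau> (adj b * (a * s))) \<le> n2 (a * s) * n2 b"
      using n2_cauchy_schwarz[of "a * s" b] aM bM s abs_Re_le_cmod[of "\<tau> (adj b * (a * s))"] by simp
    then have "(n2 b)\<^sup>2 + (n2 a)\<^sup>2 - Re (\<tau> (adj b * (a * s))) \<le> (n2 b)\<^sup>2 + (n2 a)\<^sup>2 + n2 (a * s) * n2 b" by simp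
    also have "n2 (a * s) * n2 b \<le> (n2 a * opnorm s) * n2 b"
      using aM bM s by (intro mult_right_mono n2_mult_right) simp_all
    also have "\<dots> = opnorm s * (n2 a * n2 b)" by simp
    also have "\<dots> \<le> opnorm s * (((n2 a)\<^sup>2 + (n2 b)\<^sup>2) / 2)"
      using zero_le_power2[of "n2 a - n2 b"] by (intro mult_left_mono opnorm_nonneg) (simp add: power2_diff)
    finally show ?thesis unfolding a_def[symmetric] b_def[symmetric] by (simp add: algebra_simps add_divide_distrib)
  qed
  show ?thesis
  proof (induction p)
    case (Suc p)
    have "real (Suc p) * (n2 g)\<^sup>2 = real p * (n2 g)\<^sup>2 + (n2 g)\<^sup>2" by (simp add: algebra_simps)
    also have "\<dots> \<le> (1 + opnorm s / 2) * (\<Sum>k<2 * p. (n2 (g * cheb k s))\<^sup>2)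
        + (1 + opnorm s / 2) * ((n2 (g * cheb (2 * p) s))\<^sup>2 + (n2 (g * cheb (Suc (2 * p)) s))\<^sup>2)"
      by (intro add_mono Suc pair)
    also have "\<dots> = (1 + opnorm s / 2) * (\<Sum>k<2 * Suc p. (n2 (g * cheb k s))\<^sup>2)"
      by (simp add: algebra_simps del: cheb.simps)
    finally show ?case .
  qed simp
qed

end


section \<open>Reduced words in a free family\<close>

inductive_set cspan :: "'h::complex_hilbert_space bop set \<Rightarrow> 'h bop set" for S where
  zero: "0 \<in> cspan S"
| step: "x \<in> S \<Longrightarrow> y \<in> cspan S \<Longrightarrow> c *\<^sub>C x + y \<in> cspan S"

lemma cspan_base: "x \<in> S \<Longrightarrow> x \<in> cspan S"
  using cspan.step[OF _ cspan.zero, of x S 1] by simp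

lemma cspan_add: "x \<in> cspan S \<Longrightarrow> y \<in> cspan S \<Longrightarrow> x + y \<in> cspan S"
  by (induction rule: cspan.induct) (auto intro: cspan.step simp: add.assoc)

lemma cspan_scale: "x \<in> cspan S \<Longrightarrow> c *\<^sub>C x \<in> cspan S"
proof (induction rule: cspan.induct)
  case (step x y d)
  then show ?case using cspan.step[of x S "c *\<^sub>C y" "c * d"] by (simp add: bop_scale_add)
qed (simp add: cspan.zero)

lemma cspan_linear_image:
  assumes f0: "f 0 = 0" and f: "\<And>c x y. f (c *\<^sub>C x + y) = c *\<^sub>C f x + f y"
    and S: "\<And>x. x \<in> S \<Longrightarrow> f x \<in> cspan T" and x: "x \<in> cspan S"
  shows "f x \<in> cspan T"
  using x by induction (auto simp: f0 f intro: cspan.zero cspan_add cspan_scale S)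

lemma cspan_idem: "S \<subseteq> cspan T \<Longrightarrow> x \<in> cspan S \<Longrightarrow> x \<in> cspan T"
  by (rule cspan_linear_image[where f = "\<lambda>x. x"]) auto

lemma cspan_mult_right:
  "(\<And>x. x \<in> S \<Longrightarrow> x * b \<in> cspan T) \<Longrightarrow> x \<in> cspan S \<Longrightarrow> x * b \<in> cspan T"
  by (rule cspan_linear_image[where f = "\<lambda>x. x * b"]) (simp_all add: distrib_right)

lemma cspan_mult_left:
  "(\<And>x. x \<in> S \<Longrightarrow> b * x \<in> cspan T) \<Longrightarrow> x \<in> cspan S \<Longrightarrow> b * x \<in> cspan T"
  by (rule cspan_linear_image[where f = "\<lambda>x. b * x"]) (simp_all add: distrib_left)

lemma cspan_subset_vN: "vN_algebra M \<Longrightarrow> S \<subseteq> M \<Longrightarrow> cspan S \<subseteq> M"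
proof
  fix x assume M: "vN_algebra M" "S \<subseteq> M" and "x \<in> cspan S"
  from this(3) show "x \<in> M" by induction (use M in \<open>auto intro: vN_zero vN_add vN_scale\<close>)
qed

lemma cspan_split:
  "x \<in> cspan (S \<union> T) \<Longrightarrow> \<exists>f g. f \<in> cspan S \<and> g \<in> cspan T \<and> x = f + g"
proof (induction rule: cspan.induct)
  case zero
  show ?case by (intro exI[of _ 0]) (simp add: cspan.zero)
next
  case (step x y c)
  then obtain f g where fg: "f \<in> cspan S" "g \<in> cspan T" "y = f + g" by blast
  show ?case
  proof (cases "x \<in> S")
    case True
    then have "c *\<^sub>C x + f \<in> cspan S" using fg by (intro cspan.step)
    then show ?thesis using fg by (intro exI[of _ "c *\<^sub>C x + f"] exI[of _ g]) (simp add: add.assoc)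
  next
    case False
    then have "c *\<^sub>C x + g \<in> cspan T" using fg step by (intro cspan.step) auto
    then show ?thesis using fg by (intro exI[of _ f] exI[of _ "c *\<^sub>C x + g"]) (simp add: algebra_simps)
  qed
qed

lemma (in tracial) cspan_orth:
  assumes S: "S \<subseteq> M" and T: "T \<subseteq> M"
    and orth: "\<And>x y. x \<in> S \<Longrightarrow> y \<in> T \<Longrightarrow> \<tau> (adj x * y) = 0"
    and x: "x \<in> cspan S" and y: "y \<in> cspan T"
  shows "\<tau> (adj x * y) = 0"
proof -
  have 1: "\<tau> (adj s * y) = 0" if s: "s \<in> S" for s
    using y
  proof induction
    case (step z w c)
    have "z \<in> M" "w \<in> M" "s \<in> M" using step s S T cspan_subset_vN[OF M T] by auto
    then show ?case using step orth[OF s] by (simp add: distrib_left tr_add tr_scale)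
  qed simp
  have yM: "y \<in> M" using y cspan_subset_vN[OF M T] by blast
  show ?thesis
    using x
  proof induction
    case (step z w c)
    have "z \<in> M" "w \<in> M" using step S cspan_subset_vN[OF M S] by auto
    then show ?case using step 1 yM by (simp add: distrib_right tr_add tr_scale)
  qed simp
qed

fun ohd :: "'i list \<Rightarrow> 'i option" where
  "ohd [] = None"
| "ohd (i # is) = Some i"

locale free_algs = tracial M \<tau> for M :: "'h::complex_hilbert_space bop set" and \<tau> +
  fixes I :: "'i set" and G :: "'i \<Rightarrow> 'h bop set"
  assumes free: "free_family \<tau> I (\<lambda>i. star_alg (G i))" and G_sub: "\<And>i. i \<in> I \<Longrightarrow> G i \<subseteq> M"
begin

abbreviation B where "B i \<equiv> star_alg (G i)"

lemma B_sub: "i \<in> I \<Longrightarrow> x \<in> B i \<Longrightarrow> x \<in> M"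
  using star_alg_subset_vN[OF M G_sub] by blast

text \<open>A reduced word: centred letters from the algebras with indices \<open>is\<close>, neighbouring indices
  being different. The empty word is allowed and has \<open>ohd is = None\<close>.\<close>

definition rword :: "'i list \<Rightarrow> 'h bop list \<Rightarrow> bool" where
  "rword is xs \<longleftrightarrow> distinct_adj is \<and> list_all2 (\<lambda>i x. i \<in> I \<and> x \<in> B i \<and> \<tau> x = 0) is xs"

definition words :: "'i option set \<Rightarrow> 'h bop set" where
  "words T = {prod_list xs | is xs. rword is xs \<and> ohd is \<in> T}"

lemma wordsI: "rword is xs \<Longrightarrow> ohd is \<in> T \<Longrightarrow> prod_list xs \<in> words T"
  unfolding words_def by blast

lemma words_Un: "words (T \<union> T') = words T \<union> words T'"
  unfolding words_def by blast

lemma one_word: "None \<in> T \<Longrightarrow> 1 \<in> words T"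
  using wordsI[of "[]" "[]" T] by (simp add: rword_def)

lemma words_None: "words {None} = {1}"
proof -
  have "ohd is = None \<longleftrightarrow> is = []" for "is" :: "'i list" by (cases "is") simp_all
  then show ?thesis using one_word[of "{None}"] by (auto simp: words_def rword_def)
qed

lemma words_empty: "words {} = {}"
  by (simp add: words_def)

lemma rword_in_M: "rword is xs \<Longrightarrow> prod_list xs \<in> M"
proof -
  assume "rword is xs"
  then have "list_all2 (\<lambda>i x. i \<in> I \<and> x \<in> B i \<and> \<tau> x = 0) is xs" by (simp add: rword_def)
  then show ?thesis by induction (auto intro: B_sub)
qed

lemma words_sub: "words T \<subseteq> M"
  using rword_in_M by (auto simp: words_def)

lemma rword_trace:
  assumes "rword is xs" "is \<noteq> []"
  shows "\<tau> (prod_list xs) = 0"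
proof -
  have l: "list_all2 (\<lambda>i x. i \<in> I \<and> x \<in> B i \<and> \<tau> x = 0) is xs" and d: "distinct_adj is"
    using assms by (simp_all add: rword_def)
  have len: "length xs = length is" using list_all2_lengthD[OF l] by simp
  have nth: "is ! j \<in> I \<and> xs ! j \<in> B (is ! j) \<and> \<tau> (xs ! j) = 0" if "j < length is" for j
    using list_all2_nthD[OF l that] .
  have "set is \<subseteq> I" using nth by (auto simp: in_set_conv_nth)
  then show ?thesis using free assms(2) len nth d unfolding free_family_def by blast
qed

lemma adj_prod_list: "adj (prod_list xs) = prod_list (rev (map adj xs))"
  by (induction xs) simp_all

lemma rword_rev:
  assumes "rword is xs"
  shows "rword (rev is) (rev (map adj xs))"
proof -
  have "list_all2 (\<lambda>i x. i \<in> I \<and> x \<in> B i \<and> \<tau> x = 0) is (map adj xs)"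
    unfolding list_all2_map2
    by (rule list_all2_mono[OF assms[unfolded rword_def, THEN conjunct2]])
      (auto intro: star_alg.adj simp: tr_adj B_sub)
  then show ?thesis using assms by (simp add: rword_def)
qed

lemma rword_append:
  assumes "rword is xs" "rword js ys" "is = [] \<or> js = [] \<or> last is \<noteq> hd js"
  shows "rword (is @ js) (xs @ ys)"
  using assms by (auto simp: rword_def distinct_adj_append_iff intro: list_all2_appendI)

text \<open>Words with different first indices do not cancel in \<open>x\<^sup>* y\<close>.\<close>

lemma words_orth:
  assumes x: "x \<in> words T" and y: "y \<in> words T'" and T: "T \<inter> T' = {}"
  shows "\<tau> (adj x * y) = 0"
proof -
  obtain "is" xs where x: "rword is xs" "ohd is \<in> T" "x = prod_list xs" using x by (auto simp: words_def)
  obtain js ys where y: "rword js ys" "ohd js \<in> T'" "y = prod_list ys" using y by (auto simp: words_def)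
  have ne: "ohd is \<noteq> ohd js" using x y T by auto
  have "rword (rev is @ js) (rev (map adj xs) @ ys)"
  proof (rule rword_append[OF rword_rev[OF x(1)] y(1)])
    show "rev is = [] \<or> js = [] \<or> last (rev is) \<noteq> hd js"
      using ne by (cases "is"; cases js) auto
  qed
  moreover have "rev is @ js \<noteq> []" using ne by auto
  ultimately have "\<tau> (prod_list (rev (map adj xs) @ ys)) = 0" by (rule rword_trace)
  then show ?thesis by (simp add: x(3) y(3) adj_prod_list)
qed

lemma B_split:
  assumes "i \<in> I" "b \<in> B i"
  obtains b' where "b' \<in> B i" "\<tau> b' = 0" "b = b' + \<tau> b *\<^sub>C 1"
proof
  have "b \<in> M" using assms B_sub by blast
  then show "\<tau> (b - \<tau> b *\<^sub>C 1) = 0" by (simp add: tr_diff tr_scale)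
  show "b - \<tau> b *\<^sub>C 1 \<in> B i" using assms by (intro star_alg_diff star_alg.scale star_alg.one)
qed simp

text \<open>Multiplying a word on the right by a letter of index \<open>j\<close> changes its first index only when
  this creates or destroys the one-letter word with index \<open>j\<close>.\<close>

lemma words_mult_right:
  assumes j: "j \<in> I" and b: "b \<in> B j" and T: "None \<in> T \<longleftrightarrow> Some j \<in> T" and w: "w \<in> words T"
  shows "w * b \<in> cspan (words T)"
proof -
  obtain "is" xs where w: "rword is xs" "ohd is \<in> T" "w = prod_list xs" using w by (auto simp: words_def)
  show ?thesis
  proof (cases "is \<noteq> [] \<and> last is = j")
    case False
    obtain b' where b': "b' \<in> B j" "\<tau> b' = 0" "b = b' + \<tau> b *\<^sub>C 1" using B_split[OF j b] by blast
    have "rword (is @ [j]) (xs @ [b'])"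
      by (rule rword_append[OF w(1)]) (use False b' j in \<open>auto simp: rword_def\<close>)
    moreover have "ohd (is @ [j]) \<in> T" using w(2) T by (cases "is") auto
    ultimately have 1: "w * b' \<in> words T" using wordsI by (fastforce simp: w(3))
    have "w * b = w * b' + \<tau> b *\<^sub>C w" by (subst b'(3)) (simp add: distrib_left)
    moreover have "w \<in> words T" using wordsI[OF w(1,2)] w(3) by simp
    ultimately show ?thesis using 1 by (simp add: cspan_add cspan_scale cspan_base)
  next
    case True
    then obtain "is'" where is': "is = is' @ [j]" by (metis append_butlast_last_id)
    have l: "list_all2 (\<lambda>i x. i \<in> I \<and> x \<in> B i \<and> \<tau> x = 0) (is' @ [j]) xs"
      using w(1) is' by (simp add: rword_def)
    then obtain xs' c where xs: "xs = xs' @ [c]" "list_all2 (\<lambda>i x. i \<in> I \<and> x \<in> B i \<and> \<tau> x = 0) is' xs'" "c \<in> B j"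
      unfolding list_all2_append1 by (auto simp: list_all2_Cons1)
    have d: "distinct_adj is'" using w(1) is' by (simp add: rword_def distinct_adj_append_iff)
    have cb: "c * b \<in> B j" using xs(3) b by (rule star_alg.mult)
    obtain b' where b': "b' \<in> B j" "\<tau> b' = 0" "c * b = b' + \<tau> (c * b) *\<^sub>C 1" using B_split[OF j cb] by blast
    have r': "rword is' xs'" using d xs(2) by (simp add: rword_def)
    have "rword is (xs' @ [b'])"
      using w(1) is' b' xs(2) j by (auto simp: rword_def intro!: list_all2_appendI)
    then have 1: "prod_list xs' * b' \<in> words T" using wordsI[OF _ w(2)] by fastforce
    have "ohd is' \<in> T" using w(2) T is' by (cases "is'") auto
    then have 2: "prod_list xs' \<in> words T" using wordsI[OF r'] by blast
    have "w * b = prod_list xs' * (c * b)" by (simp add: w(3) xs(1) mult.assoc)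
    also have "\<dots> = prod_list xs' * b' + \<tau> (c * b) *\<^sub>C prod_list xs'" by (subst b'(3)) (simp add: distrib_left)
    finally show ?thesis using 1 2 by (simp add: cspan_add cspan_scale cspan_base)
  qed
qed

lemma words_mult_left:
  assumes i: "i \<in> I" and c: "c \<in> B i" "\<tau> c = 0" and w: "w \<in> words T" and T: "Some i \<notin> T"
  shows "c * w \<in> words {Some i}"
proof -
  obtain "is" xs where w: "rword is xs" "ohd is \<in> T" "w = prod_list xs" using w by (auto simp: words_def)
  have "rword ([i] @ is) ([c] @ xs)"
    by (rule rword_append) (use w c i T in \<open>auto simp: rword_def neq_Nil_conv\<close>)
  then show ?thesis using wordsI[of "i # is" "c # xs" "{Some i}"] w(3) by simp
qed

text \<open>The span of the reduced words is closed under right multiplication by letters, hence a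
  \<open>*\<close>-algebra.\<close>

lemma star_alg_words:
  assumes x: "x \<in> star_alg (\<Union>i\<in>I. G i)"
  shows "x \<in> cspan (words UNIV)"
proof -
  have letter: "y * b \<in> cspan (words UNIV)" if "y \<in> cspan (words UNIV)" "j \<in> I" "b \<in> B j" for y j b
    by (rule cspan_mult_right[OF _ that(1)], rule words_mult_right[OF that(2,3)]) simp_all
  have word: "y * prod_list xs \<in> cspan (words UNIV)"
    if "y \<in> cspan (words UNIV)" "list_all2 (\<lambda>i x. i \<in> I \<and> x \<in> B i \<and> \<tau> x = 0) is xs" for y "is" xs
    using that(2,1)
  proof (induction arbitrary: y rule: list_all2_induct)
    case (Cons i "is" x xs)
    then show ?case using letter[of y i x] by (simp add: mult.assoc[symmetric])
  qed simp
  have mult: "y * z \<in> cspan (words UNIV)" if "y \<in> cspan (words UNIV)" "z \<in> cspan (words UNIV)" for y z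
  proof (rule cspan_mult_left[OF _ that(2)])
    fix w assume "w \<in> words UNIV"
    then obtain "is" xs where "rword is xs" "w = prod_list xs" by (auto simp: words_def)
    then show "y * w \<in> cspan (words UNIV)" unfolding rword_def using word[OF that(1)] by blast
  qed
  have adj: "adj y \<in> cspan (words UNIV)" if "y \<in> cspan (words UNIV)" for y
    using that
  proof induction
    case (step x y c)
    have "adj x \<in> words UNIV"
    proof -
      obtain "is" xs where "rword is xs" "x = prod_list xs" using step(1) by (auto simp: words_def)
      then show ?thesis using wordsI[OF rword_rev, of "is" xs UNIV] by (simp add: adj_prod_list)
    qed
    then show ?case using step by (auto intro: cspan.step)
  qed (simp add: cspan.zero)
  show ?thesis
    using x
  proof induction
    case (gen x)
    then obtain i where "i \<in> I" "x \<in> B i" by (auto intro: star_alg.gen)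
    then show ?case using letter[of 1 i x] by (simp add: cspan_base one_word)
  qed (auto intro: mult adj cspan_add cspan_scale cspan_base one_word)
qed

end


section \<open>Asymptotic bimodule equations\<close>

lemma star_alg_mono: "S \<subseteq> T \<Longrightarrow> star_alg S \<subseteq> star_alg T"
proof
  fix x assume "S \<subseteq> T" and "x \<in> star_alg S"
  from this(2) show "x \<in> star_alg T"
    by induction (use \<open>S \<subseteq> T\<close> in \<open>auto intro: star_alg.intros\<close>)
qed

text \<open>Elementary tensors are closed under products and adjoints, so no more than sums are needed.\<close>

lemma (in htensor) star_alg_tensors:
  assumes A: "\<And>x y. x \<in> A \<Longrightarrow> y \<in> A \<Longrightarrow> x * y \<in> A" "\<And>x. x \<in> A \<Longrightarrow> adj x \<in> A" "1 \<in> A"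
    and B: "\<And>x y. x \<in> B \<Longrightarrow> y \<in> B \<Longrightarrow> x * y \<in> B" "\<And>x. x \<in> B \<Longrightarrow> adj x \<in> B" "1 \<in> B"
    and z: "z \<in> star_alg {ot x y | x y. x \<in> A \<and> y \<in> B}"
  shows "z \<in> cspan {ot x y | x y. x \<in> A \<and> y \<in> B}"
proof -
  define S where "S = {ot x y | x y. x \<in> A \<and> y \<in> B}"
  have S1: "1 \<in> S" unfolding S_def ot_one[symmetric] using A(3) B(3) by blast
  have Smult: "y * z \<in> cspan S" if "y \<in> cspan S" "z \<in> cspan S" for y z
  proof (rule cspan_mult_left[OF _ that(2)])
    fix z assume z: "z \<in> S"
    show "y * z \<in> cspan S"
    proof (rule cspan_mult_right[OF _ that(1)])
      fix y assume y: "y \<in> S"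
      obtain a b a' b' where "y = ot a b" "z = ot a' b'" "a \<in> A" "b \<in> B" "a' \<in> A" "b' \<in> B"
        using y z by (auto simp: S_def)
      then have "y * z = ot (a * a') (b * b')" "a * a' \<in> A" "b * b' \<in> B"
        by (simp_all add: ot_mult A(1) B(1))
      then show "y * z \<in> cspan S" by (auto simp: S_def intro!: cspan_base)
    qed
  qed
  have Sadj: "adj y \<in> cspan S" if "y \<in> cspan S" for y
    using that
  proof induction
    case (step y z c)
    then obtain a b where "y = ot a b" "a \<in> A" "b \<in> B" by (auto simp: S_def)
    then have "adj y = ot (adj a) (adj b)" "adj a \<in> A" "adj b \<in> B"
      by (simp_all add: A(2) B(2))
    then have "adj y \<in> S" by (auto simp: S_def)
    then show ?case using step by (auto intro: cspan.step)
  qed (simp add: cspan.zero)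
  have "z \<in> star_alg S" using z by (simp add: S_def)
  then have "z \<in> cspan S"
    by induction (auto intro: Smult Sadj cspan_add cspan_scale cspan_base S1)
  then show ?thesis by (simp add: S_def)
qed

locale tensor_free = htensor t + FA: free_algs A \<tau>A I G + NT: tracial N \<tau>N
  for t :: "'h::complex_hilbert_space \<Rightarrow> 'k::complex_hilbert_space \<Rightarrow> 'l::complex_hilbert_space"
    and A :: "'h bop set" and \<tau>A :: "'h bop \<Rightarrow> complex" and I :: "'i set" and G :: "'i \<Rightarrow> 'h bop set"
    and N :: "'l bop set" and \<tau>N :: "'l bop \<Rightarrow> complex" +
  fixes R :: "'k bop set" and \<tau>R :: "'k bop \<Rightarrow> complex"
  assumes A_gen: "A = vN_gen (\<Union>i\<in>I. G i)" and R: "vN_algebra R" and N_gen: "N = vN_tensor t A R"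
    and tr_ot: "\<And>x y. x \<in> A \<Longrightarrow> y \<in> R \<Longrightarrow> \<tau>N (ot x y) = \<tau>A x * \<tau>R y"
begin

abbreviation n2 where "n2 \<equiv> norm2 \<tau>N"

lemma ot_in_N: "x \<in> A \<Longrightarrow> y \<in> R \<Longrightarrow> ot x y \<in> N"
  unfolding N_gen by (rule vN_tensor_ot)

definition twords :: "'i option set \<Rightarrow> 'l bop set" where
  "twords T = {ot w y | w y. w \<in> FA.words T \<and> y \<in> R}"

abbreviation Sp where "Sp T \<equiv> cspan (twords T)"

lemma twords_sub: "twords T \<subseteq> N"
  using FA.words_sub[of T] ot_in_N by (auto simp: twords_def)

lemma Sp_sub: "x \<in> Sp T \<Longrightarrow> x \<in> N"
  using cspan_subset_vN[OF NT.M twords_sub] by blast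

lemma twords_Un: "twords (T \<union> T') = twords T \<union> twords T'"
  unfolding twords_def FA.words_Un by blast

lemma Sp_None: "c \<in> Sp {None} \<Longrightarrow> \<exists>y\<in>R. c = ot 1 y"
proof (induction rule: cspan.induct)
  case zero
  show ?case by (rule bexI[of _ 0]) (simp_all add: vN_zero[OF R])
next
  case (step x z c)
  then obtain y y' where "y \<in> R" "y' \<in> R" "x = ot 1 y" "z = ot 1 y'"
    by (auto simp: twords_def FA.words_None)
  then show ?case
    by (intro bexI[of _ "c *\<^sub>C y + y'"])
      (simp_all add: ot_add_right ot_scale_right vN_add[OF R] vN_scale[OF R])
qed

lemma Sp_empty: "c \<in> Sp {} \<Longrightarrow> c = 0"
  by (erule cspan.cases) (simp_all add: twords_def FA.words_empty)

lemma Sp_orth: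
  assumes "T \<inter> T' = {}" "x \<in> Sp T" "y \<in> Sp T'"
  shows "\<tau>N (adj x * y) = 0"
proof (rule NT.cspan_orth[OF twords_sub twords_sub _ assms(2,3)])
  fix x y assume "x \<in> twords T" "y \<in> twords T'"
  then obtain w v w' v' where x: "x = ot w v" "w \<in> FA.words T" "v \<in> R"
    and y: "y = ot w' v'" "w' \<in> FA.words T'" "v' \<in> R" by (auto simp: twords_def)
  have "w \<in> A" "w' \<in> A" using x y FA.words_sub by blast+
  then have "\<tau>N (adj x * y) = \<tau>A (adj w * w') * \<tau>R (adj v * v')"
    using x y by (simp add: ot_mult tr_ot vN_adj[OF R] vN_mult[OF R])
  then show "\<tau>N (adj x * y) = 0" using FA.words_orth[OF x(2) y(2) assms(1)] by simp
qed

lemma Sp_ot: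
  assumes w: "w \<in> cspan (FA.words T)" and y: "y \<in> R"
  shows "ot w y \<in> Sp T"
  by (rule cspan_linear_image[where f = "\<lambda>w. ot w y", OF _ _ _ w])
    (use y in \<open>auto simp: ot_add_left ot_scale_left twords_def intro: cspan_base\<close>)

lemma Sp_mult_right:
  assumes j: "j \<in> I" and b: "b \<in> FA.B j" and T: "None \<in> T \<longleftrightarrow> Some j \<in> T" and x: "x \<in> Sp T"
  shows "x * ot b 1 \<in> Sp T"
proof (rule cspan_mult_right[OF _ x])
  fix x assume "x \<in> twords T"
  then obtain w y where x: "x = ot w y" "w \<in> FA.words T" "y \<in> R" by (auto simp: twords_def)
  have "ot (w * b) y \<in> Sp T" by (rule Sp_ot[OF FA.words_mult_right[OF j b T x(2)] x(3)])
  then show "x * ot b 1 \<in> Sp T" by (simp add: x ot_mult)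
qed

lemma Sp_mult_left:
  assumes i: "i \<in> I" and c: "c \<in> FA.B i" "\<tau>A c = 0" and T: "Some i \<notin> T" and x: "x \<in> Sp T"
  shows "ot c 1 * x \<in> Sp {Some i}"
proof (rule cspan_mult_left[OF _ x])
  fix x assume "x \<in> twords T"
  then obtain w y where x: "x = ot w y" "w \<in> FA.words T" "y \<in> R" by (auto simp: twords_def)
  have "ot (c * w) y \<in> Sp {Some i}"
    by (rule Sp_ot[OF cspan_base[OF FA.words_mult_left[OF i c x(2) T]] x(3)])
  then show "ot c 1 * x \<in> Sp {Some i}" by (simp add: x ot_mult)
qed

lemma Sp_dense:
  assumes a: "a \<in> N" and e: "0 < e"
  obtains x where "x \<in> Sp UNIV" "n2 (a - x) < e"
proof -
  define E where "E = (\<lambda>x. ot x 1) ` (\<Union>i\<in>I. G i) \<union> ot 1 ` R"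
  define S where "S = {ot w y | w y. w \<in> star_alg (\<Union>i\<in>I. G i) \<and> y \<in> R}"
  have "R = vN_gen R"
    using vN_gen_superset[of R] vN_gen_mono_vN[OF R, of R] by blast
  then have NE: "N = vN_gen E"
    unfolding N_gen E_def by (rule vN_tensor_generators[OF A_gen])
  obtain x where x: "x \<in> star_alg E" "n2 (a - x) < e"
    using NT.n2_dense[OF NE a e] by blast
  have "E \<subseteq> S"
    using vN_one[OF R] by (auto simp: E_def S_def intro: star_alg.gen star_alg.one)
  then have "x \<in> star_alg S" using x(1) star_alg_mono by blast
  then have "x \<in> cspan S"
    unfolding S_def
    by (rule star_alg_tensors[rotated -1])
      (auto intro: star_alg.intros simp: vN_mult[OF R] vN_adj[OF R] vN_one[OF R])
  moreover have "S \<subseteq> Sp UNIV" unfolding S_def by (auto intro!: Sp_ot FA.star_alg_words)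
  ultimately have "x \<in> Sp UNIV" by (rule cspan_idem[rotated])
  then show ?thesis using that x(2) by blast
qed

lemma ot_cheb: "cheb n (ot s 1) = ot (cheb n s) 1"
  by (induction n rule: induct_nat_012) (simp_all add: ot_one ot_mult ot_diff_left)

text \<open>The coarseness estimate. The vectors \<open>U\<^sub>k(s) g U\<^sub>k(s')\<close> are orthogonal because \<open>g\<close> does not start with
  a letter of index \<open>i\<close>, and the equation \<open>U\<^sub>k(s) x \<approx> x U\<^sub>k(s')\<close> makes the inner product of each of
  them with \<open>x\<close> equal to the square of its norm. Bessel's inequality then bounds their number.\<close>

lemma coarse_estimate:
  assumes i: "i \<in> I" and s: "s \<in> FA.B i" "adj s = s"
    and on: "\<And>n m. \<tau>A (cheb n s * cheb m s) = (if n = m then 1 else 0)"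
    and j: "j \<in> I" and s': "s' \<in> FA.B j" "adj s' = s'"
    and T: "Some i \<notin> T" "None \<in> T \<longleftrightarrow> Some j \<in> T"
    and f: "f \<in> Sp (- T)" and g: "g \<in> Sp T"
    and p: "0 < p" and \<eta>: "0 \<le> \<eta>" "\<eta> \<le> 1 / 2"
    and near: "\<And>k. k < 2 * p \<Longrightarrow> n2 (ot (cheb k s) 1 * (f + g) - (f + g) * ot (cheb k s') 1) \<le> \<eta>"
  shows "(n2 g)\<^sup>2 \<le> (2 + opnorm (ot s' 1)) * ((n2 (f + g))\<^sup>2 / real p + 2 * \<eta>)"
proof -
  define D where "D k = ot (cheb k s) 1" for k
  define D' where "D' k = ot (cheb k s') 1" for k
  define h where "h k = g * D' k" for k
  define x where "x = f + g"
  have one: "1 \<in> R" by (rule vN_one[OF R])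
  have cB: "cheb k s \<in> FA.B i" "cheb k s' \<in> FA.B j" for k by (simp_all add: cheb_in_star_alg s s')
  have sA: "cheb k s \<in> A" "cheb k s' \<in> A" "s' \<in> A" for k
    using FA.B_sub i j cB s' by blast+
  have DN: "D k \<in> N" "D' k \<in> N" for k using sA one by (simp_all add: D_def D'_def ot_in_N)
  have Dadj: "adj (D k) = D k" for k by (simp add: D_def adj_cheb s)
  have hS: "h k \<in> Sp T" for k unfolding h_def D'_def by (rule Sp_mult_right[OF j cB(2) T(2) g])
  have fS: "f * D' k \<in> Sp (- T)" for k
    unfolding D'_def by (rule Sp_mult_right[OF j cB(2) _ f]) (use T(2) in simp)
  have fN: "f \<in> N" and gN: "g \<in> N" and hN: "h k \<in> N" for k
    using Sp_sub f g hS by blast+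
  then have xN: "x \<in> N" by (simp add: x_def)
  have iso: "\<tau>N (adj (h k) * (D k * D l) * h l) = (if k = l then of_real ((n2 (h k))\<^sup>2) else 0)" for k l
  proof -
    define \<delta> :: complex where "\<delta> = (if k = l then 1 else 0)"
    define c where "c = cheb k s * cheb l s - \<delta> *\<^sub>C 1"
    have cc: "c \<in> FA.B i" "\<tau>A c = 0"
      unfolding c_def using cB on[of k l] sA
      by (auto simp: FA.tr_diff FA.tr_scale \<delta>_def intro!: star_alg_diff star_alg.mult star_alg.scale star_alg.one)
    have "D k * D l = ot c 1 + \<delta> *\<^sub>C 1"
      by (simp add: D_def ot_mult c_def ot_diff_left ot_scale_left ot_one)
    then have "adj (h k) * (D k * D l) * h l = adj (h k) * (ot c 1 * h l) + \<delta> *\<^sub>C (adj (h k) * h l)"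
      by (simp add: distrib_left distrib_right mult.assoc)
    moreover have cS: "ot c 1 * h l \<in> Sp {Some i}" by (rule Sp_mult_left[OF i cc T(1) hS])
    then have "\<tau>N (adj (h k) * (ot c 1 * h l)) = 0" using T(1) by (intro Sp_orth[OF _ hS]) auto
    ultimately have "\<tau>N (adj (h k) * (D k * D l) * h l) = \<delta> * \<tau>N (adj (h k) * h l)"
      using hN Sp_sub[OF cS] by (simp add: NT.tr_add NT.tr_scale)
    then show ?thesis using hN by (simp add: \<delta>_def NT.tr_n2)
  qed
  define Y where "Y = (\<Sum>k<2 * p. D k * h k)"
  define S where "S = (\<Sum>k<2 * p. (n2 (h k))\<^sup>2)"
  have YN: "Y \<in> N" unfolding Y_def using DN hN by (intro NT.M_closed) auto
  have "adj Y * Y = (\<Sum>k<2 * p. \<Sum>l<2 * p. adj (h k) * (D k * D l) * h l)"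
    by (simp add: Y_def Dadj sum_product mult.assoc)
  then have "\<tau>N (adj Y * Y) = (\<Sum>k<2 * p. \<Sum>l<2 * p. \<tau>N (adj (h k) * (D k * D l) * h l))"
    using hN DN by (simp add: NT.tr_sum)
  also have "\<dots> = of_real S" by (simp add: iso S_def)
  finally have nY: "(n2 Y)\<^sup>2 = S" using YN by (simp add: NT.tr_n2 flip: of_real_power)
  define err where "err k = D k * x - x * D' k" for k
  have errN: "err k \<in> N" for k unfolding err_def using DN xN by simp
  have summand: "\<tau>N (adj (h k) * (D k * x)) = of_real ((n2 (h k))\<^sup>2) + \<tau>N (adj (h k) * err k)" for k
  proof -
    have "D k * x = f * D' k + (h k + err k)" by (simp add: err_def x_def h_def distrib_right)
    then have "adj (h k) * (D k * x) = adj (h k) * (f * D' k) + (adj (h k) * h k + adj (h k) * err k)"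
      by (simp add: distrib_left)
    moreover have "\<tau>N (adj (h k) * (f * D' k)) = 0" by (rule Sp_orth[OF _ hS fS]) simp
    ultimately show ?thesis using hN errN fN DN by (simp add: NT.tr_add NT.tr_n2)
  qed
  have "adj Y * x = (\<Sum>k<2 * p. adj (h k) * (D k * x))"
    by (simp add: Y_def Dadj sum_distrib_right mult.assoc)
  then have "\<tau>N (adj Y * x) = (\<Sum>k<2 * p. of_real ((n2 (h k))\<^sup>2) + \<tau>N (adj (h k) * err k))"
    using hN DN xN by (simp add: NT.tr_sum summand)
  then have "\<tau>N (adj Y * x) = of_real S + (\<Sum>k<2 * p. \<tau>N (adj (h k) * err k))"
    by (simp add: sum.distrib S_def)
  then have "of_real S = \<tau>N (adj Y * x) - (\<Sum>k<2 * p. \<tau>N (adj (h k) * err k))" by simp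
  then have "cmod (of_real S) \<le> cmod (\<tau>N (adj Y * x)) + cmod (\<Sum>k<2 * p. \<tau>N (adj (h k) * err k))"
    by (metis norm_triangle_ineq4)
  moreover have "S \<ge> 0" by (simp add: S_def sum_nonneg)
  moreover have "cmod (\<tau>N (adj Y * x)) \<le> ((n2 x)\<^sup>2 + S) / 2"
  proof -
    have "cmod (\<tau>N (adj Y * x)) \<le> n2 x * n2 Y" by (rule NT.n2_cauchy_schwarz[OF xN YN])
    also have "\<dots> \<le> ((n2 x)\<^sup>2 + (n2 Y)\<^sup>2) / 2"
      using zero_le_power2[of "n2 x - n2 Y"] by (simp add: power2_diff)
    finally show ?thesis by (simp add: nY)
  qed
  moreover have "cmod (\<Sum>k<2 * p. \<tau>N (adj (h k) * err k)) \<le> \<eta> * ((2 * real p + S) / 2)"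
  proof -
    have "cmod (\<tau>N (adj (h k) * err k)) \<le> \<eta> * ((1 + (n2 (h k))\<^sup>2) / 2)" if "k < 2 * p" for k
    proof -
      have "cmod (\<tau>N (adj (h k) * err k)) \<le> n2 (err k) * n2 (h k)" by (rule NT.n2_cauchy_schwarz[OF errN hN])
      also have "\<dots> \<le> \<eta> * n2 (h k)"
        using near[OF that] hN by (intro mult_right_mono) (simp_all add: err_def D_def D'_def x_def)
      also have "\<dots> \<le> \<eta> * ((1 + (n2 (h k))\<^sup>2) / 2)"
        using zero_le_power2[of "n2 (h k) - 1"] by (intro mult_left_mono \<eta>) (simp add: power2_diff)
      finally show ?thesis .
    qed
    then have "cmod (\<Sum>k<2 * p. \<tau>N (adj (h k) * err k)) \<le> (\<Sum>k<2 * p. \<eta> * ((1 + (n2 (h k))\<^sup>2) / 2))"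
      by (intro sum_norm_le) simp
    also have "\<dots> = \<eta> * ((2 * real p + S) / 2)"
      unfolding sum_distrib_left[symmetric] sum_divide_distrib[symmetric] by (simp add: sum.distrib S_def)
    finally show ?thesis .
  qed
  ultimately have "S \<le> ((n2 x)\<^sup>2 + S) / 2 + \<eta> * ((2 * real p + S) / 2)"
    unfolding norm_of_real by linarith
  moreover have "\<eta> * S \<le> 1 / 2 * S" using \<eta> \<open>S \<ge> 0\<close> by (intro mult_right_mono)
  ultimately have "S \<le> 2 * (n2 x)\<^sup>2 + 4 * \<eta> * real p" by (simp add: algebra_simps add_divide_distrib)
  have "real p * (n2 g)\<^sup>2 \<le> (1 + opnorm (ot s' 1) / 2) * S"
  proof -
    have "ot s' 1 \<in> N" "adj (ot s' 1) = ot s' 1" using sA one s' by (simp_all add: ot_in_N)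
    from NT.cheb_lower_bound[OF this gN, of p] show ?thesis
      unfolding S_def h_def D'_def ot_cheb .
  qed
  also have "\<dots> \<le> (1 + opnorm (ot s' 1) / 2) * (2 * (n2 x)\<^sup>2 + 4 * \<eta> * real p)"
    using \<open>S \<le> 2 * (n2 x)\<^sup>2 + 4 * \<eta> * real p\<close> by (intro mult_left_mono) (simp_all add: opnorm_nonneg)
  also have "\<dots> = real p * ((2 + opnorm (ot s' 1)) * ((n2 x)\<^sup>2 / real p + 2 * \<eta>))"
    using p by (simp add: field_simps)
  finally show ?thesis using p by (simp add: x_def)
qed

text \<open>Two letters of different index leave only the words in \<open>Z\<close>: the empty word when the equations
  are untwisted, nothing when they are twisted.\<close>

lemma coarse_two_letters:
  assumes Z: "Z \<subseteq> {None}" and i12: "i1 \<noteq> i2" and x: "x \<in> Sp UNIV"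
  obtains c f1 g1 f2 g2 where "c \<in> Sp Z" "f1 \<in> Sp (- (- (Z \<union> {Some i1})))" "g1 \<in> Sp (- (Z \<union> {Some i1}))" "x = f1 + g1"
    "f2 \<in> Sp (- (- (Z \<union> {Some i2})))" "g2 \<in> Sp (- (Z \<union> {Some i2}))" "x = f2 + g2" "n2 (x - c) \<le> n2 g1 + n2 g2"
proof -
  have split: "\<exists>f g. f \<in> Sp T \<and> g \<in> Sp (- T) \<and> x = f + g" for T
    using cspan_split[of x "twords T" "twords (- T)"] x by (simp add: twords_Un[symmetric] Compl_partition)
  have split2: "\<exists>c f'. c \<in> Sp Z \<and> f' \<in> Sp {Some i} \<and> f = c + f'" if "f \<in> Sp (Z \<union> {Some i})" for i f
    using cspan_split[of f "twords Z" "twords {Some i}"] that by (simp add: twords_Un[symmetric])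
  obtain f1 g1 where 1: "f1 \<in> Sp (Z \<union> {Some i1})" "g1 \<in> Sp (- (Z \<union> {Some i1}))" "x = f1 + g1"
    using split[of "Z \<union> {Some i1}"] by blast
  obtain f2 g2 where 2: "f2 \<in> Sp (Z \<union> {Some i2})" "g2 \<in> Sp (- (Z \<union> {Some i2}))" "x = f2 + g2"
    using split[of "Z \<union> {Some i2}"] by blast
  obtain c1 h1 where c1: "c1 \<in> Sp Z" "h1 \<in> Sp {Some i1}" "f1 = c1 + h1" using split2[OF 1(1)] by blast
  obtain c2 h2 where c2: "c2 \<in> Sp Z" "h2 \<in> Sp {Some i2}" "f2 = c2 + h2" using split2[OF 2(1)] by blast
  have N: "c1 \<in> N" "c2 \<in> N" "h1 \<in> N" "h2 \<in> N" "g1 \<in> N" "g2 \<in> N"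
    using c1 c2 1 2 Sp_sub by blast+
  have o: "\<tau>N (adj h1 * c1) = 0" "\<tau>N (adj h1 * c2) = 0" "\<tau>N (adj h1 * h2) = 0" "\<tau>N (adj h1 * g1) = 0"
    using Z i12 by (auto intro!: Sp_orth[OF _ c1(2) c1(1)] Sp_orth[OF _ c1(2) c2(1)]
        Sp_orth[OF _ c1(2) c2(2)] Sp_orth[OF _ c1(2) 1(2)])
  have "h1 = (c2 + h2 + g2) - (c1 + g1)" using 1(3) 2(3) c1(3) c2(3) by (simp add: algebra_simps)
  then have "adj h1 * h1 = (adj h1 * c2 + adj h1 * h2 + adj h1 * g2) - (adj h1 * c1 + adj h1 * g1)"
    by (metis distrib_left right_diff_distrib)
  then have "\<tau>N (adj h1 * h1) = \<tau>N (adj h1 * g2)" using N o by (simp add: NT.tr_add NT.tr_diff)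
  then have "(n2 h1)\<^sup>2 = cmod (\<tau>N (adj h1 * g2))" using N by (metis NT.tr_n2 norm_of_real abs_power2)
  also have "\<dots> \<le> n2 g2 * n2 h1" by (rule NT.n2_cauchy_schwarz) (rule N)+
  finally have le: "n2 h1 * n2 h1 \<le> n2 g2 * n2 h1" by (simp add: power2_eq_square)
  have "n2 h1 \<le> n2 g2"
  proof (cases "n2 h1 = 0")
    case False
    then have "n2 h1 > 0" using N by (simp add: order_less_le)
    then show ?thesis using le by simp
  qed (use N in simp)
  moreover have "x - c1 = h1 + g1" using 1(3) c1(3) by simp
  then have "n2 (x - c1) \<le> n2 h1 + n2 g1" using NT.n2_triangle N by simp
  ultimately have "n2 (x - c1) \<le> n2 g1 + n2 g2" by simp
  then show ?thesis using that[OF c1(1) _ 1(2,3) _ 2(2,3)] 1(1) 2(1) by simp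
qed

end


context tensor_free
begin

text \<open>The data entering the coarseness estimate: a letter \<open>s\<close> with orthonormal Chebyshev polynomials and
  the letter \<open>s'\<close> with which it is to be intertwined.\<close>

definition letter_pair :: "'i \<Rightarrow> 'h bop \<Rightarrow> 'i \<Rightarrow> 'h bop \<Rightarrow> bool" where
  "letter_pair i s j s' \<longleftrightarrow> i \<in> I \<and> s \<in> FA.B i \<and> adj s = s \<and> j \<in> I \<and> s' \<in> FA.B j \<and> adj s' = s' \<and>
    (\<forall>n m. \<tau>A (cheb n s * cheb m s) = (if n = m then 1 else 0))"

lemma letter_pair_in_N: "letter_pair i s j s' \<Longrightarrow> ot (cheb k s) 1 \<in> N \<and> ot (cheb k s') 1 \<in> N"
  unfolding letter_pair_def
  using FA.B_sub cheb_in_star_alg vN_one[OF R] by (blast intro: ot_in_N)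

lemma coarse_estimate_pair:
  assumes "letter_pair i s j s'" "Z \<subseteq> {None}" "None \<in> Z \<longleftrightarrow> j = i"
    and "f \<in> Sp (- (- (Z \<union> {Some i})))" "g \<in> Sp (- (Z \<union> {Some i}))"
    and "0 < p" "0 \<le> \<eta>" "\<eta> \<le> 1 / 2"
    and "\<And>k. k < 2 * p \<Longrightarrow> n2 (ot (cheb k s) 1 * (f + g) - (f + g) * ot (cheb k s') 1) \<le> \<eta>"
  shows "(n2 g)\<^sup>2 \<le> (2 + opnorm (ot s' 1)) * ((n2 (f + g))\<^sup>2 / real p + 2 * \<eta>)"
  using assms unfolding letter_pair_def
  by (intro coarse_estimate[of i s j s' "- (Z \<union> {Some i})"]) auto

text \<open>The choice \<open>Z = {None}\<close> is for commutation (\<open>j = i\<close>), the choice \<open>Z = {}\<close> for twisted equations. The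
  number \<open>2 p\<close> of polynomials is fixed first, so that only finitely many equations are used when the
  sequence is replaced by finite sums of words.\<close>

lemma asymptotic_equations:
  assumes Z: "Z \<subseteq> {None}" and i12: "i1 \<noteq> i2"
    and p1: "letter_pair i1 s1 j1 t1" "None \<in> Z \<longleftrightarrow> j1 = i1"
    and p2: "letter_pair i2 s2 j2 t2" "None \<in> Z \<longleftrightarrow> j2 = i2"
    and a: "\<And>n. a n \<in> N" "\<And>n. n2 (a n) \<le> C"
    and lim1: "\<And>k. (\<lambda>n. n2 (ot (cheb k s1) 1 * a n - a n * ot (cheb k t1) 1)) \<longlonglongrightarrow> 0"
    and lim2: "\<And>k. (\<lambda>n. n2 (ot (cheb k s2) 1 * a n - a n * ot (cheb k t2) 1)) \<longlonglongrightarrow> 0"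
    and e: "0 < e"
  shows "\<forall>\<^sub>F n in sequentially. \<exists>c\<in>Sp Z. n2 (a n - c) < e"
proof -
  define D1 D1' D2 D2' where "D1 k = ot (cheb k s1) 1" and "D1' k = ot (cheb k t1) 1"
    and "D2 k = ot (cheb k s2) 1" and "D2' k = ot (cheb k t2) 1" for k
  have DN: "D1 k \<in> N" "D1' k \<in> N" "D2 k \<in> N" "D2' k \<in> N" for k
    using letter_pair_in_N[OF p1(1)] letter_pair_in_N[OF p2(1)]
    by (simp_all add: D1_def D1'_def D2_def D2'_def)
  define K where "K = 2 + max (opnorm (ot t1 1)) (opnorm (ot t2 1))"
  have K: "K > 0" "2 + opnorm (ot t1 1) \<le> K" "2 + opnorm (ot t2 1) \<le> K"
    using opnorm_nonneg[of "ot t1 1"] by (simp_all add: K_def)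
  define q where "q = (e / 4)\<^sup>2"
  have q: "q > 0" using e by (simp add: q_def)
  have C0: "0 \<le> C" using a(2)[of 0] a(1)[of 0] NT.n2_nonneg by (metis order_trans)
  obtain p where p: "2 * K * (C + 1)\<^sup>2 / q < real p" using reals_Archimedean2 by blast
  have "0 \<le> 2 * K * (C + 1)\<^sup>2 / q" using K(1) q by simp
  with p have p0: "0 < p" by (metis le_less_trans of_nat_0_less_iff)
  have pq: "K * ((C + 1)\<^sup>2 / real p) \<le> q / 2"
    using p p0 q by (simp add: pos_divide_less_eq pos_divide_le_eq mult_ac)
  define \<eta> where "\<eta> = min (1 / 2) (q / (4 * K))"
  have \<eta>: "0 < \<eta>" "\<eta> \<le> 1 / 2" using q K(1) by (simp_all add: \<eta>_def)
  have "\<eta> \<le> q / (4 * K)" by (simp add: \<eta>_def)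
  then have \<eta>q: "K * (2 * \<eta>) \<le> q / 2" using K(1) by (simp add: pos_le_divide_eq mult_ac)
  define Q where "Q = (\<Sum>k<2 * p. opnorm (D1 k) + opnorm (D1' k) + opnorm (D2 k) + opnorm (D2' k)) + 1"
  have Q1: "1 \<le> Q" by (simp add: Q_def sum_nonneg opnorm_nonneg)
  have Qk: "opnorm (D1 k) + opnorm (D1' k) \<le> Q" "opnorm (D2 k) + opnorm (D2' k) \<le> Q" if "k < 2 * p" for k
  proof -
    have "opnorm (D1 k) + opnorm (D1' k) + opnorm (D2 k) + opnorm (D2' k) \<le> Q - 1"
      unfolding Q_def using that
      by (simp add: member_le_sum[of k "{..<2 * p}" "\<lambda>k. opnorm (D1 k) + opnorm (D1' k) + opnorm (D2 k) + opnorm (D2' k)"] opnorm_nonneg)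
    then show "opnorm (D1 k) + opnorm (D1' k) \<le> Q" "opnorm (D2 k) + opnorm (D2' k) \<le> Q"
      using opnorm_nonneg[of "D1 k"] opnorm_nonneg[of "D1' k"] opnorm_nonneg[of "D2 k"] opnorm_nonneg[of "D2' k"]
      by linarith+
  qed
  define d where "d = min (min 1 (e / 2)) (\<eta> / (2 * Q))"
  have d: "d > 0" "d \<le> 1" "d \<le> e / 2" "Q * d \<le> \<eta> / 2"
  proof -
    show "d > 0" "d \<le> 1" "d \<le> e / 2" using e \<eta> Q1 by (simp_all add: d_def)
    have "d \<le> \<eta> / (2 * Q)" by (simp add: d_def)
    then show "Q * d \<le> \<eta> / 2" using Q1 by (simp add: pos_le_divide_eq mult_ac)
  qed
  have "\<forall>\<^sub>F n in sequentially. \<forall>k\<in>{..<2 * p}. n2 (D1 k * a n - a n * D1' k) < \<eta> / 2"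
    using lim1 \<eta>(1) by (intro eventually_ball_finite ballI order_tendstoD(2)) (auto simp: D1_def D1'_def)
  moreover have "\<forall>\<^sub>F n in sequentially. \<forall>k\<in>{..<2 * p}. n2 (D2 k * a n - a n * D2' k) < \<eta> / 2"
    using lim2 \<eta>(1) by (intro eventually_ball_finite ballI order_tendstoD(2)) (auto simp: D2_def D2'_def)
  ultimately show ?thesis
  proof eventually_elim
    case (elim n)
    obtain x where x: "x \<in> Sp UNIV" "n2 (a n - x) < d" using Sp_dense[OF a(1) d(1)] by blast
    have xN: "x \<in> N" using x Sp_sub by blast
    have axN: "a n - x \<in> N" using a(1) xN by simp
    have nx: "n2 x \<le> C + 1"
      using NT.n2_reverse[OF xN a(1)[of n]] NT.n2_diff_commute[OF xN a(1)[of n]] x(2) d(2) a(2)[of n] by linarith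
    have near: "n2 (E * x - x * E') \<le> \<eta>"
      if "E \<in> N" "E' \<in> N" "n2 (E * a n - a n * E') < \<eta> / 2" "opnorm E + opnorm E' \<le> Q" for E E'
    proof -
      have "E * x - x * E' = (E * a n - a n * E') - (E * (a n - x) - (a n - x) * E')"
        by (simp add: algebra_simps)
      then have "n2 (E * x - x * E') \<le> n2 (E * a n - a n * E') + n2 (E * (a n - x) - (a n - x) * E')"
        using NT.n2_triangle_diff[of "E * a n - a n * E'" "E * (a n - x) - (a n - x) * E'"] that(1,2) a(1) xN by simp
      also have "n2 (E * (a n - x) - (a n - x) * E') \<le> n2 (E * (a n - x)) + n2 ((a n - x) * E')"
        using that(1,2) axN by (intro NT.n2_triangle_diff) auto
      also have "\<dots> \<le> opnorm E * n2 (a n - x) + n2 (a n - x) * opnorm E'"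
        by (intro add_mono NT.n2_mult_left NT.n2_mult_right that axN)
      also have "\<dots> = (opnorm E + opnorm E') * n2 (a n - x)" by (simp add: algebra_simps)
      also have "\<dots> \<le> Q * d"
        using that(4) x(2) axN Q1 opnorm_nonneg[of E] opnorm_nonneg[of E'] by (intro mult_mono) auto
      finally show ?thesis using that(3) d(4) by linarith
    qed
    obtain c f1 g1 f2 g2 where c: "c \<in> Sp Z"
      and 1: "f1 \<in> Sp (- (- (Z \<union> {Some i1})))" "g1 \<in> Sp (- (Z \<union> {Some i1}))" "x = f1 + g1"
      and 2: "f2 \<in> Sp (- (- (Z \<union> {Some i2})))" "g2 \<in> Sp (- (Z \<union> {Some i2}))" "x = f2 + g2"
      and xc: "n2 (x - c) \<le> n2 g1 + n2 g2"
      by (rule coarse_two_letters[OF Z i12 x(1)])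
    have fin: "n2 g \<le> e / 4" if "g \<in> N" "(n2 g)\<^sup>2 \<le> L * ((n2 x)\<^sup>2 / real p + 2 * \<eta>)" "L \<le> K" for g L
    proof -
      have "(n2 g)\<^sup>2 \<le> K * ((n2 x)\<^sup>2 / real p + 2 * \<eta>)"
        using that(2) mult_right_mono[OF that(3), of "(n2 x)\<^sup>2 / real p + 2 * \<eta>"] \<eta>(1) by simp
      also have "\<dots> \<le> K * ((C + 1)\<^sup>2 / real p + 2 * \<eta>)"
        using nx K(1) xN by (intro mult_left_mono add_right_mono divide_right_mono power_mono) auto
      also have "\<dots> \<le> (e / 4)\<^sup>2" using pq \<eta>q unfolding distrib_left q_def by linarith
      finally show ?thesis by (rule power2_le_imp_le) (use e in simp)
    qed
    have g1: "n2 g1 \<le> e / 4"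
    proof (rule fin[OF _ _ K(2)])
      show "(n2 g1)\<^sup>2 \<le> (2 + opnorm (ot t1 1)) * ((n2 x)\<^sup>2 / real p + 2 * \<eta>)"
        unfolding 1(3)
      proof (rule coarse_estimate_pair[OF p1(1) Z p1(2) 1(1,2) p0 _ \<eta>(2)])
        show "n2 (ot (cheb k s1) 1 * (f1 + g1) - (f1 + g1) * ot (cheb k t1) 1) \<le> \<eta>" if "k < 2 * p" for k
          using near[OF DN(1,2)] elim(1) Qk(1) that unfolding 1(3)[symmetric] by (simp add: D1_def D1'_def)
      qed (use \<eta> in simp)
    qed (rule Sp_sub[OF 1(2)])
    have g2: "n2 g2 \<le> e / 4"
    proof (rule fin[OF _ _ K(3)])
      show "(n2 g2)\<^sup>2 \<le> (2 + opnorm (ot t2 1)) * ((n2 x)\<^sup>2 / real p + 2 * \<eta>)"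
        unfolding 2(3)
      proof (rule coarse_estimate_pair[OF p2(1) Z p2(2) 2(1,2) p0 _ \<eta>(2)])
        show "n2 (ot (cheb k s2) 1 * (f2 + g2) - (f2 + g2) * ot (cheb k t2) 1) \<le> \<eta>" if "k < 2 * p" for k
          using near[OF DN(3,4)] elim(2) Qk(2) that unfolding 2(3)[symmetric] by (simp add: D2_def D2'_def)
      qed (use \<eta> in simp)
    qed (rule Sp_sub[OF 2(2)])
    have "n2 (a n - c) \<le> n2 (a n - x) + n2 (x - c)" by (intro NT.n2_triangle3 a xN Sp_sub[OF c])
    also have "\<dots> < d + (e / 4 + e / 4)" using x(2) xc g1 g2 by linarith
    also have "\<dots> \<le> e" using d(3) by simp
    finally show ?case using c by blast
  qed
qed

end


section \<open>Normal homomorphisms\<close>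

definition nhom :: "'h::complex_hilbert_space bop set \<Rightarrow> ('h bop \<Rightarrow> 'h bop) \<Rightarrow> bool" where
  "nhom N \<Phi> \<longleftrightarrow> (\<forall>x\<in>N. \<Phi> x \<in> N) \<and>
    (\<forall>x\<in>N. \<forall>y\<in>N. \<Phi> (x + y) = \<Phi> x + \<Phi> y) \<and>
    (\<forall>c. \<forall>x\<in>N. \<Phi> (c *\<^sub>C x) = c *\<^sub>C \<Phi> x) \<and>
    (\<forall>x\<in>N. \<forall>y\<in>N. \<Phi> (x * y) = \<Phi> x * \<Phi> y) \<and>
    (\<forall>x\<in>N. \<Phi> (adj x) = adj (\<Phi> x)) \<and> \<Phi> 1 = 1 \<and> normal_map N \<Phi>"

lemma
  assumes "nhom N \<Phi>"
  shows nhom_in: "x \<in> N \<Longrightarrow> \<Phi> x \<in> N"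
    and nhom_add: "x \<in> N \<Longrightarrow> y \<in> N \<Longrightarrow> \<Phi> (x + y) = \<Phi> x + \<Phi> y"
    and nhom_scale: "x \<in> N \<Longrightarrow> \<Phi> (c *\<^sub>C x) = c *\<^sub>C \<Phi> x"
    and nhom_mult: "x \<in> N \<Longrightarrow> y \<in> N \<Longrightarrow> \<Phi> (x * y) = \<Phi> x * \<Phi> y"
    and nhom_adj: "x \<in> N \<Longrightarrow> \<Phi> (adj x) = adj (\<Phi> x)"
    and nhom_one: "\<Phi> 1 = 1"
    and nhom_normal: "normal_functional N \<omega> \<Longrightarrow> normal_functional N (\<lambda>x. \<omega> (\<Phi> x))"
  using assms unfolding nhom_def normal_map_def o_def by simp_all

lemma nhom_minus: "nhom N \<Phi> \<Longrightarrow> x \<in> N \<Longrightarrow> \<Phi> (- x) = - \<Phi> x"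
  using nhom_scale[of N \<Phi> x "-1"] by (simp add: bop_minus_one)

lemma nhom_diff: "nhom N \<Phi> \<Longrightarrow> vN_algebra N \<Longrightarrow> x \<in> N \<Longrightarrow> y \<in> N \<Longrightarrow> \<Phi> (x - y) = \<Phi> x - \<Phi> y"
  using nhom_add[of N \<Phi> x "- y"] by (simp add: nhom_minus vN_minus)

lemma nhom_zero: "nhom N \<Phi> \<Longrightarrow> vN_algebra N \<Longrightarrow> \<Phi> 0 = 0"
  using nhom_scale[of N \<Phi> 0 0] by (simp add: vN_zero)

lemma nhom_compose:
  assumes "nhom N \<Phi>" "nhom N \<Psi>"
  shows "nhom N (\<lambda>x. \<Phi> (\<Psi> x))"
  unfolding nhom_def normal_map_def o_def
  using nhom_normal[OF assms(2) nhom_normal[OF assms(1)]]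
  by (simp add: nhom_in[OF assms(1)] nhom_in[OF assms(2)] nhom_add[OF assms(1)] nhom_add[OF assms(2)]
      nhom_scale[OF assms(1)] nhom_scale[OF assms(2)] nhom_mult[OF assms(1)] nhom_mult[OF assms(2)]
      nhom_adj[OF assms(1)] nhom_adj[OF assms(2)] nhom_one[OF assms(1)] nhom_one[OF assms(2)])

lemma nhom_id: "nhom N (\<lambda>x. x)"
  by (simp add: nhom_def normal_map_def o_def)

lemma nhom_cong:
  assumes \<Phi>: "nhom N \<Phi>" and N: "vN_algebra N" and eq: "\<And>x. x \<in> N \<Longrightarrow> \<Psi> x = \<Phi> x"
  shows "nhom N \<Psi>"
proof -
  have "normal_functional N (\<lambda>x. \<omega> (\<Psi> x))" if "normal_functional N \<omega>" for \<omega>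
    by (rule normal_functional_cong[OF nhom_normal[OF \<Phi> that]]) (simp add: eq)
  then show ?thesis
    using \<Phi> unfolding nhom_def normal_map_def o_def
    by (simp add: eq vN_add[OF N] vN_scale[OF N] vN_mult[OF N] vN_adj[OF N] vN_one[OF N])
qed

lemma Aut_bij: "\<Phi> \<in> Aut N \<Longrightarrow> bij_betw \<Phi> N N"
  by (simp add: Aut_def Bij_def)

lemma Aut_one:
  assumes N: "vN_algebra N" and \<Phi>: "\<Phi> \<in> Aut N"
  shows "\<Phi> 1 = 1"
proof -
  have b: "\<Phi> ` N = N" using Aut_bij[OF \<Phi>] by (simp add: bij_betw_def)
  then obtain x where x: "x \<in> N" "\<Phi> x = 1" using vN_one[OF N] by (metis imageE)
  have "\<Phi> (x * 1) = \<Phi> x * \<Phi> 1" using \<Phi> x(1) vN_one[OF N] unfolding Aut_def by blast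
  then show ?thesis by (simp add: x)
qed

lemma nhom_Aut:
  assumes N: "vN_algebra N" and \<Phi>: "\<Phi> \<in> Aut N" "normal_map N \<Phi>"
  shows "nhom N \<Phi>"
proof -
  have "\<forall>x\<in>N. \<Phi> x \<in> N" using Aut_bij[OF \<Phi>(1)] by (auto simp: bij_betw_def)
  then show ?thesis using \<Phi> Aut_one[OF N \<Phi>(1)] unfolding nhom_def Aut_def by simp
qed

lemma nhom_Ad:
  assumes N: "vN_algebra N" and w: "w \<in> unitaries N"
  shows "nhom N (Ad w)"
proof -
  have w: "w \<in> N" "adj w * w = 1" "w * adj w = 1" using w by (simp_all add: unitaries_def)
  have m: "w * (x * y) * adj w = w * x * adj w * (w * y * adj w)" for x y
  proof -
    have "w * x * adj w * (w * y * adj w) = w * x * (adj w * w) * y * adj w" by (simp only: mult.assoc)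
    then show ?thesis by (simp add: w mult.assoc)
  qed
  have nf: "normal_functional N (\<lambda>x. \<omega> (w * x * adj w))" if "normal_functional N \<omega>" for \<omega>
  proof -
    obtain f g where fg: "\<And>x. x \<in> N \<Longrightarrow> \<omega> x = cinner (amp x \<cdot> f) g"
      using \<open>normal_functional N \<omega>\<close> by (rule normal_functional_amp) blast
    show ?thesis
      by (rule normal_functionalI_amp[of _ _ "amp (adj w) \<cdot> f" "amp (adj w) \<cdot> g"])
        (use w in \<open>simp add: fg vN_mult[OF N] vN_adj[OF N] amp_mult amp_adj[of w]\<close>)
  qed
  then show ?thesis
    unfolding nhom_def normal_map_def o_def Ad_def
    using w m by (simp add: vN_mult[OF N] vN_adj[OF N] distrib_left distrib_right mult.assoc)
qed

text \<open>Normal homomorphisms are determined by their values on generators.\<close>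

lemma nhom_eqI:
  assumes N: "N = vN_gen S" and \<Phi>: "nhom N \<Phi>" and \<Psi>: "nhom N \<Psi>"
    and eq: "\<And>s. s \<in> S \<Longrightarrow> \<Phi> s = \<Psi> s" and x: "x \<in> N"
  shows "\<Phi> x = \<Psi> x"
proof -
  have vN: "vN_algebra N" unfolding N by (rule vN_algebra_vN_gen)
  have sub: "star_alg S \<subseteq> N"
    unfolding N by (intro star_alg_subset_vN vN_algebra_vN_gen vN_gen_superset)
  have alg: "\<Phi> y = \<Psi> y" if "y \<in> star_alg S" for y
    using that
  proof induction
    case (add x y)
    then have "x \<in> N" "y \<in> N" using sub by blast+
    then show ?case using add by (simp add: nhom_add[OF \<Phi>] nhom_add[OF \<Psi>])
  next
    case (mult x y)
    then have "x \<in> N" "y \<in> N" using sub by blast+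
    then show ?case using mult by (simp add: nhom_mult[OF \<Phi>] nhom_mult[OF \<Psi>])
  next
    case (scale x c)
    then have "x \<in> N" using sub by blast
    then show ?case using scale by (simp add: nhom_scale[OF \<Phi>] nhom_scale[OF \<Psi>])
  next
    case (adj x)
    then have "x \<in> N" using sub by blast
    then show ?case using adj by (simp add: nhom_adj[OF \<Phi>] nhom_adj[OF \<Psi>])
  qed (simp_all add: eq nhom_one[OF \<Phi>] nhom_one[OF \<Psi>])
  have "cinner (\<Phi> x \<cdot> \<xi>) \<eta> = cinner (\<Psi> x \<cdot> \<xi>) \<eta>" for \<xi> \<eta>
    by (rule normal_functional_eqI[where S = S])
      (use x alg nhom_normal[OF \<Phi> normal_functional_vector] nhom_normal[OF \<Psi> normal_functional_vector]
        in \<open>simp_all add: N\<close>)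
  then show ?thesis by (intro bop_eqI cinner_ext)
qed


section \<open>The crossed product\<close>

lemma prod_cinner [simp]: "cinner (a, b) (c, d) = cinner a c + cinner b d"
  by (simp add: cinner_prod_def)

lemma prod_scaleC [simp]: "c *\<^sub>C (a, b) = (c *\<^sub>C a, c *\<^sub>C b)"
  by (simp add: scaleC_prod_def)

lemmas diag3_apply [simp] = diag3.rep_eq and crossed_v_apply [simp] = crossed_v.rep_eq

lemma bop3_eqI: "(\<And>a b c. x \<cdot> (a, b, c) = y \<cdot> (a, b, c)) \<Longrightarrow> x = y"
  by (rule bop_eqI) (metis prod_cases3)

lemma diag3_mult: "diag3 x y z * diag3 x' y' z' = diag3 (x * x') (y * y') (z * z')"
  and diag3_add: "diag3 x y z + diag3 x' y' z' = diag3 (x + x') (y + y') (z + z')"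
  and diag3_scale: "c *\<^sub>C diag3 x y z = diag3 (c *\<^sub>C x) (c *\<^sub>C y) (c *\<^sub>C z)"
  and diag3_one: "diag3 1 1 1 = 1"
  and crossed_v_diag3: "crossed_v * diag3 x y z = diag3 z x y * crossed_v"
  and crossed_v_cube: "crossed_v * (crossed_v * crossed_v) = 1"
  by (rule bop3_eqI; simp)+

lemma diag3_adj: "adj (diag3 x y z) = diag3 (adj x) (adj y) (adj z)"
proof (rule adj_unique)
  fix \<xi> \<eta> :: "'a \<times> 'a \<times> 'a"
  show "cinner (diag3 x y z \<cdot> \<xi>) \<eta> = cinner \<xi> (diag3 (adj x) (adj y) (adj z) \<cdot> \<eta>)"
    by (cases \<xi>; cases \<eta>) (simp add: cinner_adj)
qed

lemma crossed_v_adj: "adj crossed_v = crossed_v * crossed_v"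
proof (rule adj_unique)
  fix \<xi> \<eta> :: "'a \<times> 'a \<times> 'a"
  show "cinner (crossed_v \<cdot> \<xi>) \<eta> = cinner \<xi> ((crossed_v * crossed_v) \<cdot> \<eta>)"
    by (cases \<xi>; cases \<eta>) simp
qed

text \<open>The \<open>j\<close>-th entry of the first row of a three by three operator matrix.\<close>

lift_definition entry :: "nat \<Rightarrow> ('l::complex_hilbert_space \<times> 'l \<times> 'l) bop \<Rightarrow> 'l bop" is
  "\<lambda>j f \<zeta>. fst (f (if j = 0 then (\<zeta>, 0, 0) else if j = 1 then (0, \<zeta>, 0) else (0, 0, \<zeta>)))"
proof -
  fix j :: nat and f :: "'l \<times> 'l \<times> 'l \<Rightarrow> 'l \<times> 'l \<times> 'l"
  let ?e = "\<lambda>\<zeta>::'l. if j = 0 then (\<zeta>, 0, 0) else if j = 1 then (0, \<zeta>, 0) else (0, 0, \<zeta>)"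
  assume f: "bounded_linear f \<and> (\<forall>c x. f (c *\<^sub>C x) = c *\<^sub>C f x)"
  have e: "bounded_linear ?e"
    by (cases "j = 0"; cases "j = 1")
      (auto intro!: bounded_linear_Pair bounded_linear_ident bounded_linear_zero)
  have "bounded_linear (\<lambda>\<zeta>. fst (f (?e \<zeta>)))"
    by (rule bounded_linear_compose[OF bounded_linear_fst bounded_linear_compose[OF conjunct1[OF f] e]])
  moreover have "?e (c *\<^sub>C \<zeta>) = c *\<^sub>C ?e \<zeta>" for c \<zeta> by (simp add: scaleC_zero)
  then have "fst (f (?e (c *\<^sub>C \<zeta>))) = c *\<^sub>C fst (f (?e \<zeta>))" for c \<zeta>
    using f by (simp only: scaleC_prod_def fst_conv)
  ultimately show "bounded_linear (\<lambda>\<zeta>. fst (f (?e \<zeta>))) \<and> (\<forall>c \<zeta>. fst (f (?e (c *\<^sub>C \<zeta>))) = c *\<^sub>C fst (f (?e \<zeta>)))"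
    by blast
qed

definition emb :: "nat \<Rightarrow> 'l::complex_hilbert_space \<Rightarrow> 'l \<times> 'l \<times> 'l" where
  "emb j \<zeta> = (if j = 0 then (\<zeta>, 0, 0) else if j = 1 then (0, \<zeta>, 0) else (0, 0, \<zeta>))"

lemma entry_apply: "entry j x \<cdot> \<zeta> = fst (x \<cdot> emb j \<zeta>)"
  by (simp add: entry.rep_eq emb_def)

lemma cinner_entry: "cinner (entry j x \<cdot> \<zeta>) \<eta> = cinner (x \<cdot> emb j \<zeta>) (emb 0 \<eta>)"
  by (cases "x \<cdot> emb j \<zeta>") (simp add: entry_apply emb_def[of 0])

lemma norm_emb: "norm (emb j \<zeta>) = norm \<zeta>"
  by (simp add: emb_def norm_Pair)

lemma entry_normal:
  assumes \<omega>: "normal_functional N \<omega>" and sub: "\<And>x. x \<in> M \<Longrightarrow> entry j x \<in> N"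
  shows "normal_functional M (\<lambda>x. \<omega> (entry j x))"
proof -
  obtain \<xi> \<eta> :: "nat \<Rightarrow> 'a" where s: "summable (\<lambda>n. (norm (\<xi> n))\<^sup>2)" "summable (\<lambda>n. (norm (\<eta> n))\<^sup>2)"
    and e: "\<forall>x\<in>N. \<omega> x = (\<Sum>n. cinner (x \<cdot> \<xi> n) (\<eta> n))"
    using \<omega> unfolding normal_functional_def by blast
  show ?thesis
    unfolding normal_functional_def
    by (intro exI[of _ "\<lambda>n. emb j (\<xi> n)"] exI[of _ "\<lambda>n. emb 0 (\<eta> n)"])
      (use s e sub in \<open>simp add: norm_emb cinner_entry\<close>)
qed

locale crossed =
  fixes N :: "'l::complex_hilbert_space bop set" and \<gamma> :: "'l bop \<Rightarrow> 'l bop"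
  assumes N: "vN_algebra N" and \<gamma>: "nhom N \<gamma>" and \<gamma>3: "\<And>x. x \<in> N \<Longrightarrow> \<gamma> (\<gamma> (\<gamma> x)) = x"
begin

abbreviation \<pi> where "\<pi> \<equiv> crossed_pi \<gamma>"
abbreviation v :: "('l \<times> 'l \<times> 'l) bop" where "v \<equiv> crossed_v"
abbreviation M where "M \<equiv> crossed_product N \<gamma>"

lemmas N_closed [simp, intro] = vN_adj[OF N] vN_one[OF N] vN_zero[OF N] vN_add[OF N] vN_diff[OF N]
  vN_minus[OF N] vN_mult[OF N] vN_scale[OF N] nhom_in[OF \<gamma>]

lemma M: "vN_algebra M"
  unfolding crossed_product_def by (rule vN_algebra_vN_gen)

lemma \<pi>_in [simp, intro]: "x \<in> N \<Longrightarrow> \<pi> x \<in> M" and v_in [simp, intro]: "v \<in> M"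
  unfolding crossed_product_def by (rule subsetD[OF vN_gen_superset]; simp)+

lemmas M_closed [simp, intro] = vN_adj[OF M] vN_one[OF M] vN_zero[OF M] vN_add[OF M] vN_diff[OF M]
  vN_minus[OF M] vN_mult[OF M] vN_scale[OF M]

lemma \<pi>_add: "x \<in> N \<Longrightarrow> y \<in> N \<Longrightarrow> \<pi> (x + y) = \<pi> x + \<pi> y"
  and \<pi>_scale: "x \<in> N \<Longrightarrow> \<pi> (c *\<^sub>C x) = c *\<^sub>C \<pi> x"
  and \<pi>_mult: "x \<in> N \<Longrightarrow> y \<in> N \<Longrightarrow> \<pi> (x * y) = \<pi> x * \<pi> y"
  and \<pi>_adj: "x \<in> N \<Longrightarrow> \<pi> (adj x) = adj (\<pi> x)"
  and \<pi>_one: "\<pi> 1 = 1"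
  by (simp_all add: crossed_pi_def nhom_add[OF \<gamma>] nhom_scale[OF \<gamma>] nhom_mult[OF \<gamma>] nhom_adj[OF \<gamma>]
      nhom_one[OF \<gamma>] diag3_add diag3_scale diag3_mult diag3_adj diag3_one)

lemma \<pi>_zero [simp]: "\<pi> 0 = 0" using \<pi>_scale[of 0 0] by simp

lemma \<pi>_diff: "x \<in> N \<Longrightarrow> y \<in> N \<Longrightarrow> \<pi> (x - y) = \<pi> x - \<pi> y"
  using \<pi>_add[of x "- y"] \<pi>_scale[of y "-1"] by (simp add: bop_minus_one)

lemma v_\<pi>: "x \<in> N \<Longrightarrow> v * \<pi> x = \<pi> (\<gamma> x) * v"
  by (simp add: crossed_pi_def crossed_v_diag3 \<gamma>3)

lemma v_\<pi>_assoc: "x \<in> N \<Longrightarrow> v * (\<pi> x * z) = \<pi> (\<gamma> x) * (v * z)"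
  using v_\<pi>[of x] by (simp only: mult.assoc[symmetric])

lemma v3: "v * (v * v) = 1" by (rule crossed_v_cube)

lemma v3_assoc: "v * (v * (v * z)) = z"
  using arg_cong[OF v3, of "\<lambda>x. x * z"] by (simp add: mult.assoc)

lemma adj_v: "adj v = v * v" by (rule crossed_v_adj)

definition rep :: "'l bop \<Rightarrow> 'l bop \<Rightarrow> 'l bop \<Rightarrow> ('l \<times> 'l \<times> 'l) bop" where
  "rep a b c = \<pi> a + \<pi> b * v + \<pi> c * (v * v)"

lemma rep_in [simp, intro]: "a \<in> N \<Longrightarrow> b \<in> N \<Longrightarrow> c \<in> N \<Longrightarrow> rep a b c \<in> M"
  by (simp add: rep_def)

lemma rep_add: "a \<in> N \<Longrightarrow> b \<in> N \<Longrightarrow> c \<in> N \<Longrightarrow> a' \<in> N \<Longrightarrow> b' \<in> N \<Longrightarrow> c' \<in> N \<Longrightarrow>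
    rep a b c + rep a' b' c' = rep (a + a') (b + b') (c + c')"
  by (simp add: rep_def \<pi>_add distrib_right)

lemma rep_scale: "a \<in> N \<Longrightarrow> b \<in> N \<Longrightarrow> c \<in> N \<Longrightarrow> d *\<^sub>C rep a b c = rep (d *\<^sub>C a) (d *\<^sub>C b) (d *\<^sub>C c)"
  by (simp add: rep_def \<pi>_scale bop_scale_add)

lemma rep_diff: "a \<in> N \<Longrightarrow> b \<in> N \<Longrightarrow> c \<in> N \<Longrightarrow> a' \<in> N \<Longrightarrow> b' \<in> N \<Longrightarrow> c' \<in> N \<Longrightarrow>
    rep a b c - rep a' b' c' = rep (a - a') (b - b') (c - c')"
  by (simp add: rep_def \<pi>_diff left_diff_distrib)

lemma rep_mult:
  assumes "a \<in> N" "b \<in> N" "c \<in> N" "a' \<in> N" "b' \<in> N" "c' \<in> N"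
  shows "rep a b c * rep a' b' c' = rep (a * a' + b * \<gamma> c' + c * \<gamma> (\<gamma> b'))
    (a * b' + b * \<gamma> a' + c * \<gamma> (\<gamma> c')) (a * c' + b * \<gamma> b' + c * \<gamma> (\<gamma> a'))"
  using assms
  by (simp add: rep_def \<pi>_add \<pi>_mult distrib_left distrib_right mult.assoc v_\<pi> v_\<pi>_assoc v3 v3_assoc add_ac)

lemma rep_adj:
  assumes "a \<in> N" "b \<in> N" "c \<in> N"
  shows "adj (rep a b c) = rep (adj a) (\<gamma> (adj c)) (\<gamma> (\<gamma> (adj b)))"
  using assms
  by (simp add: rep_def \<pi>_adj[symmetric] adj_v mult.assoc v_\<pi> v_\<pi>_assoc v3 v3_assoc add_ac)

lemma rep_one: "rep 1 0 0 = 1" and rep_v: "rep 0 1 0 = v" and rep_\<pi>: "rep a 0 0 = \<pi> a"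
  by (simp_all add: rep_def \<pi>_one)

lemma rep_entries:
  shows "entry 0 (rep a b c) = a" "entry 2 (rep a b c) = b" "entry 1 (rep a b c) = c"
  by (rule bop_eqI; simp add: entry_apply emb_def rep_def crossed_pi_def)+

lemma entry_in_N:
  assumes x: "x \<in> M"
  shows "entry j x \<in> N"
proof -
  have "entry j x * y = y * entry j x" if y: "y \<in> commutant N" for y
  proof -
    have ny: "n * y = y * n" if "n \<in> N" for n using y that by (simp add: commutant_def)
    have ny': "n * adj y = adj y * n" if "n \<in> N" for n
    proof -
      have "adj (adj n * y) = adj (y * adj n)" using ny[of "adj n"] that by simp
      then show ?thesis by simp
    qed
    have "s * diag3 y y y = diag3 y y y * s" if "s \<in> \<pi> ` N \<union> {v} \<union> adj ` (\<pi> ` N \<union> {v})" for s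
      using that
    proof (safe)
      show "\<pi> n * diag3 y y y = diag3 y y y * \<pi> n" if "n \<in> N" for n
        using that by (simp add: crossed_pi_def diag3_mult ny)
      then show "adj (\<pi> n) * diag3 y y y = diag3 y y y * adj (\<pi> n)" if "n \<in> N" for n
        using that by (simp add: \<pi>_adj[symmetric])
      show "v * diag3 y y y = diag3 y y y * v" by (rule crossed_v_diag3)
      show "adj v * diag3 y y y = diag3 y y y * adj v"
        unfolding adj_v by (intro commute_mult crossed_v_diag3)
    qed
    then have "diag3 y y y \<in> commutant (\<pi> ` N \<union> {v} \<union> adj ` (\<pi> ` N \<union> {v}))"
      unfolding commutant_def by blast
    then have "x * diag3 y y y = diag3 y y y * x"
      using x unfolding crossed_product_def vN_gen_def commutant_def[of "commutant _"] by auto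
    then have "(x * diag3 y y y) \<cdot> \<xi> = (diag3 y y y * x) \<cdot> \<xi>" for \<xi> by (rule arg_cong)
    then have e: "x \<cdot> (diag3 y y y \<cdot> \<xi>) = diag3 y y y \<cdot> (x \<cdot> \<xi>)" for \<xi>
      by (simp only: times_bop.rep_eq)
    have emb: "diag3 y y y \<cdot> emb j \<zeta> = emb j (y \<cdot> \<zeta>)" for \<zeta> by (simp add: emb_def)
    have f: "fst (diag3 y y y \<cdot> \<xi>) = y \<cdot> fst \<xi>" for \<xi> by (cases \<xi>) simp
    show ?thesis
    proof (rule bop_eqI)
      fix \<zeta>
      have "(entry j x * y) \<cdot> \<zeta> = fst (x \<cdot> emb j (y \<cdot> \<zeta>))" by (simp add: entry_apply)
      also have "\<dots> = y \<cdot> fst (x \<cdot> emb j \<zeta>)" by (simp only: emb[symmetric] e f)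
      finally show "(entry j x * y) \<cdot> \<zeta> = (y * entry j x) \<cdot> \<zeta>" by (simp add: entry_apply)
    qed
  qed
  then have "entry j x \<in> commutant (commutant N)" unfolding commutant_def[of "commutant N"] by auto
  then show ?thesis using N by (simp add: vN_algebra_def)
qed

text \<open>Every element is a finite sum \<open>a + bv + cv\<^sup>2\<close>: such sums form a \<open>*\<close>-algebra, and the relations
  between the matrix entries pass to the bicommutant because \<open>\<gamma>\<close> is normal.\<close>

lemma M_rep:
  assumes x: "x \<in> M"
  shows "x = rep (entry 0 x) (entry 2 x) (entry 1 x)"
proof -
  define S where "S = \<pi> ` N \<union> {v}"
  have MS: "M = vN_gen S" by (simp add: S_def crossed_product_def)
  have alg: "\<exists>a\<in>N. \<exists>b\<in>N. \<exists>c\<in>N. y = rep a b c" if "y \<in> star_alg S" for y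
    using that
  proof induction
    case (gen y)
    then show ?case
      unfolding S_def using rep_\<pi> rep_v N_closed(2,3) by (metis Un_iff imageE singletonD)
  next
    case one
    show ?case using rep_one N_closed(2,3) by metis
  next
    case (add y z)
    then obtain a b c a' b' c' where "a \<in> N" "b \<in> N" "c \<in> N" "y = rep a b c" "a' \<in> N" "b' \<in> N" "c' \<in> N" "z = rep a' b' c'"
      by blast
    then show ?case
      by (intro bexI[of _ "a + a'"] bexI[of _ "b + b'"] bexI[of _ "c + c'"]) (simp_all add: rep_add)
  next
    case (mult y z)
    then obtain a b c a' b' c' where "a \<in> N" "b \<in> N" "c \<in> N" "y = rep a b c" "a' \<in> N" "b' \<in> N" "c' \<in> N" "z = rep a' b' c'"
      by blast
    then show ?case
      by (intro bexI[of _ "a * a' + b * \<gamma> c' + c * \<gamma> (\<gamma> b')"]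
          bexI[of _ "a * b' + b * \<gamma> a' + c * \<gamma> (\<gamma> c')"] bexI[of _ "a * c' + b * \<gamma> b' + c * \<gamma> (\<gamma> a')"])
        (simp_all add: rep_mult)
  next
    case (scale y d)
    then obtain a b c where "a \<in> N" "b \<in> N" "c \<in> N" "y = rep a b c" by blast
    then show ?case
      by (intro bexI[of _ "d *\<^sub>C a"] bexI[of _ "d *\<^sub>C b"] bexI[of _ "d *\<^sub>C c"]) (simp_all add: rep_scale)
  next
    case (adj y)
    then obtain a b c where "a \<in> N" "b \<in> N" "c \<in> N" "y = rep a b c" by blast
    then show ?case
      by (intro bexI[of _ "adj a"] bexI[of _ "\<gamma> (adj c)"] bexI[of _ "\<gamma> (\<gamma> (adj b))"]) (simp_all add: rep_adj)
  qed
  have nv: "normal_functional M (\<lambda>y. cinner (\<Phi> (entry j y) \<cdot> \<xi>) \<eta>)" if "nhom N \<Phi>" for \<Phi> j \<xi> \<eta>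
    by (rule entry_normal[OF nhom_normal[OF that normal_functional_vector] entry_in_N])
  note g2 = nhom_compose[OF \<gamma> \<gamma>]
  have "cinner (x \<cdot> (\<xi>0, \<xi>1, \<xi>2)) (\<eta>0, \<eta>1, \<eta>2)
      = cinner (rep (entry 0 x) (entry 2 x) (entry 1 x) \<cdot> (\<xi>0, \<xi>1, \<xi>2)) (\<eta>0, \<eta>1, \<eta>2)" for \<xi>0 \<xi>1 \<xi>2 \<eta>0 \<eta>1 \<eta>2
  proof (rule normal_functional_eqI[of S "\<lambda>x. cinner (x \<cdot> (\<xi>0, \<xi>1, \<xi>2)) (\<eta>0, \<eta>1, \<eta>2)"])
    show "normal_functional (vN_gen S) (\<lambda>x. cinner (x \<cdot> (\<xi>0, \<xi>1, \<xi>2)) (\<eta>0, \<eta>1, \<eta>2))"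
      by (rule normal_functional_vector)
    show "normal_functional (vN_gen S)
        (\<lambda>x. cinner (rep (entry 0 x) (entry 2 x) (entry 1 x) \<cdot> (\<xi>0, \<xi>1, \<xi>2)) (\<eta>0, \<eta>1, \<eta>2))"
      unfolding MS[symmetric]
      by (simp add: rep_def crossed_pi_def cinner_add_left)
        (intro normal_functional_add nv nhom_id \<gamma> g2)
    show "x \<in> vN_gen S" using x MS by simp
    fix y assume "y \<in> star_alg S"
    then obtain a b c where "y = rep a b c" using alg by blast
    then show "cinner (y \<cdot> (\<xi>0, \<xi>1, \<xi>2)) (\<eta>0, \<eta>1, \<eta>2)
        = cinner (rep (entry 0 y) (entry 2 y) (entry 1 y) \<cdot> (\<xi>0, \<xi>1, \<xi>2)) (\<eta>0, \<eta>1, \<eta>2)"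
      by (simp only: rep_entries)
  qed
  then show ?thesis by (intro bop3_eqI cinner_ext) (metis prod_cases3)
qed

lemma M_cases:
  assumes "x \<in> M"
  obtains a b c where "a \<in> N" "b \<in> N" "c \<in> N" "x = rep a b c"
  using M_rep[OF assms] entry_in_N[OF assms] by metis

lemma rep_eq_iff: "rep a b c = rep a' b' c' \<longleftrightarrow> a = a' \<and> b = b' \<and> c = c'"
  by (metis rep_entries)

text \<open>A normal functional on the crossed product restricts to normal functionals on the
  coefficients.\<close>

lemma coefficient_normal:
  assumes \<omega>: "normal_functional M \<omega>" and z: "z \<in> M"
  shows "normal_functional N (\<lambda>a. \<omega> (\<pi> a * z))"
proof -
  obtain f g where fg: "\<And>x. x \<in> M \<Longrightarrow> \<omega> x = cinner (amp x \<cdot> f) g"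
    using \<omega> by (rule normal_functional_amp) blast
  define h where "h = amp z \<cdot> f"
  have sq: "summable (\<lambda>n. (norm (k (ell2_nth F n)))\<^sup>2)"
    if "\<And>p. norm (k p) \<le> norm p" for k :: "'l \<times> 'l \<times> 'l \<Rightarrow> 'l" and F
    by (rule summable_comparison_test'[OF ell2_summable[of F]]) (use that in \<open>simp add: power_mono\<close>)
  have n1: "norm (fst q) \<le> norm q" "norm (snd q) \<le> norm q" for q :: "'c::real_normed_vector \<times> 'd::real_normed_vector"
    by (cases q, simp add: norm_fst_le norm_snd_le)+
  have nk: "norm (fst p) \<le> norm p" "norm (fst (snd p)) \<le> norm p" "norm (snd (snd p)) \<le> norm p"
    for p :: "'l \<times> 'l \<times> 'l"
    by (rule n1, rule order_trans[OF n1(1) n1(2)], rule order_trans[OF n1(2) n1(2)])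
  define \<Omega> where "\<Omega> k = (\<lambda>a. \<Sum>n. cinner (a \<cdot> k (ell2_nth h n)) (k (ell2_nth g n)))"
    for k :: "'l \<times> 'l \<times> 'l \<Rightarrow> 'l"
  have \<Omega>: "normal_functional N (\<Omega> k)" if "\<And>p. norm (k p) \<le> norm p" for k
    unfolding normal_functional_def \<Omega>_def
    by (intro exI[of _ "\<lambda>n. k (ell2_nth h n)"] exI[of _ "\<lambda>n. k (ell2_nth g n)"]) (simp add: sq[OF that])
  have sm: "summable (\<lambda>n. cinner (a \<cdot> k (ell2_nth h n)) (k (ell2_nth g n)))" if "\<And>p. norm (k p) \<le> norm p"
    for k :: "'l \<times> 'l \<times> 'l \<Rightarrow> 'l" and a
    by (rule summable_sq_cinner[OF summable_sq_bop[OF sq[OF that]] sq[OF that]])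
  have "\<omega> (\<pi> a * z) = \<Omega> fst a + (\<Omega> (\<lambda>p. fst (snd p)) (\<gamma> (\<gamma> a)) + \<Omega> (\<lambda>p. snd (snd p)) (\<gamma> a))" if a: "a \<in> N" for a
  proof -
    have "\<omega> (\<pi> a * z) = (\<Sum>n. cinner (\<pi> a \<cdot> ell2_nth h n) (ell2_nth g n))"
      using a z by (simp add: fg amp_mult cinner_ell2_def h_def)
    also have "\<dots> = (\<Sum>n. cinner (a \<cdot> fst (ell2_nth h n)) (fst (ell2_nth g n))
        + (cinner (\<gamma> (\<gamma> a) \<cdot> fst (snd (ell2_nth h n))) (fst (snd (ell2_nth g n)))
        + cinner (\<gamma> a \<cdot> snd (snd (ell2_nth h n))) (snd (snd (ell2_nth g n)))))"
      by (simp add: crossed_pi_def cinner_prod_def case_prod_unfold)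
    also have "\<dots> = \<Omega> fst a + (\<Omega> (\<lambda>p. fst (snd p)) (\<gamma> (\<gamma> a)) + \<Omega> (\<lambda>p. snd (snd p)) (\<gamma> a))"
      unfolding \<Omega>_def suminf_add[OF sm[OF nk(2)] sm[OF nk(3)]]
        suminf_add[OF sm[OF nk(1)] summable_add[OF sm[OF nk(2)] sm[OF nk(3)]]] by (rule refl)
    finally show ?thesis .
  qed
  moreover have "normal_functional N (\<lambda>a. \<Omega> fst a + (\<Omega> (\<lambda>p. fst (snd p)) (\<gamma> (\<gamma> a)) + \<Omega> (\<lambda>p. snd (snd p)) (\<gamma> a)))"
    by (intro normal_functional_add \<Omega> nk nhom_normal[OF \<gamma>] nhom_normal[OF nhom_compose[OF \<gamma> \<gamma>]])
  ultimately show ?thesis by (rule normal_functional_cong[rotated])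
qed

end


section \<open>Computing the Jones invariant\<close>

context tracial
begin

lemma unitaries_mult: "w \<in> unitaries M \<Longrightarrow> z \<in> unitaries M \<Longrightarrow> w * z \<in> unitaries M"
proof -
  assume w: "w \<in> unitaries M" and z: "z \<in> unitaries M"
  have "adj z * adj w * (w * z) = adj z * (adj w * w) * z" "w * z * (adj z * adj w) = w * (z * adj z) * adj w"
    by (simp_all only: mult.assoc)
  then show ?thesis using w z by (simp add: unitaries_def)
qed

lemma unitaries_adj: "w \<in> unitaries M \<Longrightarrow> adj w \<in> unitaries M"
  by (simp add: unitaries_def)

lemma unitariesD:
  assumes "w \<in> unitaries M"
  shows "w \<in> M" "adj w * w = 1" "w * adj w = 1" "adj w * (w * x) = x" "w * (adj w * x) = x"
  using assms by (simp_all add: unitaries_def mult.assoc[symmetric])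

lemma n2_unitary_mult:
  assumes "w \<in> unitaries M" "x \<in> M"
  shows "n2 (w * x) = n2 x" "n2 (x * w) = n2 x" "n2 (adj w * x) = n2 x" "n2 (x * adj w) = n2 x"
  using assms unitariesD[OF assms(1)] by (simp_all add: n2_unitary_left n2_unitary_right)

lemma Ad_in: "w \<in> M \<Longrightarrow> x \<in> M \<Longrightarrow> Ad w x \<in> M"
  by (simp add: Ad_def)

lemma Ad_Ad: "Ad z (Ad w x) = Ad (z * w) x"
  by (simp add: Ad_def mult.assoc)

lemma n2_Ad: "w \<in> unitaries M \<Longrightarrow> x \<in> M \<Longrightarrow> n2 (Ad w x) = n2 x"
  using unitariesD(1)[of w] by (simp add: Ad_def n2_unitary_mult)

lemma Ad_diff: "Ad w (x - y) = Ad w x - Ad w y"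
  by (simp add: Ad_def left_diff_distrib right_diff_distrib)

lemma Inn_sub_Bij:
  assumes w: "w \<in> unitaries M"
  shows "restrict (Ad w) M \<in> Bij M"
proof -
  have "bij_betw (restrict (Ad w) M) M M"
    by (rule bij_betw_byWitness[where f' = "Ad (adj w)"])
      (use unitariesD[OF w] in \<open>auto simp: Ad_Ad Ad_in, auto simp: Ad_def\<close>)
  then show ?thesis by (simp add: Bij_def)
qed

lemma one_unitary: "1 \<in> unitaries M"
  by (simp add: unitaries_def)

lemma Aut_D:
  assumes "\<phi> \<in> Aut M"
  shows "x \<in> M \<Longrightarrow> \<phi> x \<in> M" "x \<in> M \<Longrightarrow> y \<in> M \<Longrightarrow> \<phi> (x * y) = \<phi> x * \<phi> y" "x \<in> M \<Longrightarrow> \<phi> (adj x) = adj (\<phi> x)"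
    "\<phi> 1 = 1" "\<phi> \<in> Bij M"
  using assms Aut_bij[OF assms] Aut_one[OF M assms] by (auto simp: Aut_def bij_betw_def)

lemma Aut_unitary: "\<phi> \<in> Aut M \<Longrightarrow> w \<in> unitaries M \<Longrightarrow> \<phi> w \<in> unitaries M"
proof -
  assume \<phi>: "\<phi> \<in> Aut M" and w: "w \<in> unitaries M"
  have "adj (\<phi> w) * \<phi> w = \<phi> (adj w * w)" "\<phi> w * adj (\<phi> w) = \<phi> (w * adj w)"
    using Aut_D[OF \<phi>] unitariesD(1)[OF w] by simp_all
  then show ?thesis using Aut_D[OF \<phi>] unitariesD[OF w] by (simp add: unitaries_def)
qed

lemma quotient_xi_eq:
  assumes \<phi>: "\<phi> \<in> Aut M" and \<phi>': "\<phi>' \<in> Aut M" and eq: "quotient_xi M \<phi>' = quotient_xi M \<phi>"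
  obtains u where "u \<in> unitaries M" "\<And>x. x \<in> M \<Longrightarrow> \<phi>' x = Ad u (\<phi> x)"
proof -
  have mem: "\<psi> \<in> quotient_xi M \<phi>'' \<longleftrightarrow> (\<exists>u\<in>unitaries M. \<psi> = compose M (restrict (Ad u) M) \<phi>'')"
    if "\<phi>'' \<in> Bij M" for \<psi> \<phi>''
    using that Inn_sub_Bij
    by (auto simp: quotient_xi_def r_coset_def AutGroup_def BijGroup_def Inn_def)
  have "compose M (restrict (Ad 1) M) \<phi>' = \<phi>'"
  proof
    fix x
    show "compose M (restrict (Ad 1) M) \<phi>' x = \<phi>' x"
      using Aut_D[OF \<phi>'] by (cases "x \<in> M") (auto simp: compose_def Ad_def Bij_def extensional_def)
  qed
  then have "\<phi>' \<in> quotient_xi M \<phi>'" unfolding mem[OF Aut_D(5)[OF \<phi>']] using one_unitary by metis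
  then obtain u where u: "u \<in> unitaries M" "\<phi>' = compose M (restrict (Ad u) M) \<phi>"
    unfolding eq mem[OF Aut_D(5)[OF \<phi>]] by blast
  then have "\<phi>' x = Ad u (\<phi> x)" if "x \<in> M" for x
    using that Aut_D(1)[OF \<phi>] by (simp add: compose_def)
  then show ?thesis using that u(1) by blast
qed

lemma Inn_closureI:
  assumes \<phi>: "\<phi> \<in> Aut M" and w: "\<And>n. w n \<in> unitaries M"
    and lim: "\<And>x. x \<in> M \<Longrightarrow> (\<lambda>n. n2 (Ad (w n) x - \<phi> x)) \<longlonglongrightarrow> 0"
  shows "\<phi> \<in> Inn_closure M \<tau>"
proof -
  have "\<exists>\<psi>\<in>Inn M. \<forall>x\<in>F. n2 (\<phi> x - \<psi> x) < \<epsilon>" if F: "finite F" "F \<subseteq> M" "0 < \<epsilon>" for F \<epsilon>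
  proof -
    have "\<forall>\<^sub>F n in sequentially. \<forall>x\<in>F. n2 (Ad (w n) x - \<phi> x) < \<epsilon>"
      using F lim by (intro eventually_ball_finite ballI order_tendstoD(2)) auto
    then obtain n where n: "\<forall>x\<in>F. n2 (Ad (w n) x - \<phi> x) < \<epsilon>"
      using eventually_happens trivial_limit_sequentially by blast
    have "n2 (\<phi> x - restrict (Ad (w n)) M x) < \<epsilon>" if "x \<in> F" for x
    proof -
      have xM: "x \<in> M" using that F by blast
      then have "\<phi> x \<in> M" "Ad (w n) x \<in> M" using Aut_D(1)[OF \<phi>] Ad_in unitariesD(1)[OF w] by blast+
      then show ?thesis using n that xM n2_diff_commute[of "\<phi> x" "Ad (w n) x"] by simp
    qed
    moreover have "restrict (Ad (w n)) M \<in> Inn M" using w by (auto simp: Inn_def)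
    ultimately show ?thesis by blast
  qed
  then show ?thesis using \<phi> by (simp add: Inn_closure_def)
qed

lemma quotient_xi_in_ChiGroup:
  "\<phi> \<in> Ct M \<tau> \<inter> Inn_closure M \<tau> \<Longrightarrow> quotient_xi M \<phi> \<in> carrier (ChiGroup M \<tau>)"
  by (auto simp: ChiGroup_def FactGroup_def RCOSETS_def quotient_xi_def r_coset_def)

lemma opnorm_unitary: "adj w * w = 1 \<Longrightarrow> opnorm w \<le> 1"
proof (rule opnorm_leI)
  fix \<xi> assume "adj w * w = 1"
  then have "adj w \<cdot> (w \<cdot> \<xi>) = \<xi>" by (metis times_bop.rep_eq one_bop.rep_eq)
  then have "cinner (w \<cdot> \<xi>) (w \<cdot> \<xi>) = cinner \<xi> \<xi>" by (simp add: cinner_adj)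
  then have "(norm (w \<cdot> \<xi>))\<^sup>2 = (norm \<xi>)\<^sup>2" unfolding cinner_self of_real_eq_iff .
  then show "norm (w \<cdot> \<xi>) \<le> 1 * norm \<xi>" by (simp add: power2_eq_iff_nonneg)
qed simp

text \<open>Two implementing sequences for the same class differ, up to a fixed unitary, by a central
  sequence of unitaries; the representative fixes central sequences asymptotically, so both
  sequences give the same scalar.\<close>

lemma jones_kappa_eqI:
  assumes \<phi>: "\<phi> \<in> Ct M \<tau> \<inter> Inn_closure M \<tau>" and z: "cmod z = 1"
    and w: "\<And>n. w n \<in> unitaries M"
    and lim: "\<And>x. x \<in> M \<Longrightarrow> (\<lambda>n. n2 (Ad (w n) x - \<phi> x)) \<longlonglongrightarrow> 0"
    and \<phi>w: "\<And>n. \<phi> (w n) = z *\<^sub>C w n"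
  shows "jones_kappa M \<tau> (quotient_xi M \<phi>) = z"
  unfolding jones_kappa_def
proof (rule the_equality)
  have "(\<lambda>n. n2 (\<phi> (w n) - z *\<^sub>C w n)) \<longlonglongrightarrow> 0" by (simp add: \<phi>w)
  then show "cmod z = 1 \<and> (\<exists>\<phi>' w'. \<phi>' \<in> Ct M \<tau> \<inter> Inn_closure M \<tau> \<and> quotient_xi M \<phi>' = quotient_xi M \<phi> \<and>
      (\<forall>n. w' n \<in> unitaries M) \<and> (\<forall>x\<in>M. (\<lambda>n. n2 (Ad (w' n) x - \<phi>' x)) \<longlonglongrightarrow> 0) \<and>
      (\<lambda>n. n2 (\<phi>' (w' n) - z *\<^sub>C w' n)) \<longlonglongrightarrow> 0)"
    using z \<phi> w lim by blast
next
  fix z'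
  assume "cmod z' = 1 \<and> (\<exists>\<phi>' w'. \<phi>' \<in> Ct M \<tau> \<inter> Inn_closure M \<tau> \<and> quotient_xi M \<phi>' = quotient_xi M \<phi> \<and>
      (\<forall>n. w' n \<in> unitaries M) \<and> (\<forall>x\<in>M. (\<lambda>n. n2 (Ad (w' n) x - \<phi>' x)) \<longlonglongrightarrow> 0) \<and>
      (\<lambda>n. n2 (\<phi>' (w' n) - z' *\<^sub>C w' n)) \<longlonglongrightarrow> 0)"
  then obtain \<phi>' w' where z': "cmod z' = 1" and \<phi>': "\<phi>' \<in> Ct M \<tau> \<inter> Inn_closure M \<tau>"
    and q: "quotient_xi M \<phi>' = quotient_xi M \<phi>" and w': "\<And>n. w' n \<in> unitaries M"
    and lim': "\<And>x. x \<in> M \<Longrightarrow> (\<lambda>n. n2 (Ad (w' n) x - \<phi>' x)) \<longlonglongrightarrow> 0"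
    and lim_z': "(\<lambda>n. n2 (\<phi>' (w' n) - z' *\<^sub>C w' n)) \<longlonglongrightarrow> 0" by blast
  have A: "\<phi> \<in> Aut M" "\<phi>' \<in> Aut M" using \<phi> \<phi>' by (auto simp: Ct_def)
  obtain u where u: "u \<in> unitaries M" and \<phi>'u: "\<And>x. x \<in> M \<Longrightarrow> \<phi>' x = Ad u (\<phi> x)"
    using quotient_xi_eq[OF A q] by blast
  note uD = unitariesD[OF u]
  define y where "y n = adj u * w' n" for n
  have y: "y n \<in> unitaries M" for n unfolding y_def by (intro unitaries_mult unitaries_adj u w')
  have Ad_y: "Ad (y n) x - \<phi> x = Ad (adj u) (Ad (w' n) x - \<phi>' x)" if "x \<in> M" for n x
  proof -
    have "Ad (adj u) (\<phi>' x) = \<phi> x" using that uD by (simp add: \<phi>'u Ad_Ad) (simp add: Ad_def)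
    then show ?thesis by (simp add: Ad_diff Ad_Ad y_def)
  qed
  have lim_y: "(\<lambda>n. n2 (Ad (y n) x - \<phi> x)) \<longlonglongrightarrow> 0" if x: "x \<in> M" for x
  proof -
    have "n2 (Ad (y n) x - \<phi> x) = n2 (Ad (w' n) x - \<phi>' x)" for n
      unfolding Ad_y[OF x]
      by (intro n2_Ad unitaries_adj u vN_diff[OF M] Ad_in x unitariesD(1)[OF w'] Aut_D(1)[OF A(2)])
    then show ?thesis using lim'[OF x] by simp
  qed
  have y_z': "(\<lambda>n. n2 (\<phi> (y n) - z' *\<^sub>C y n)) \<longlonglongrightarrow> 0"
  proof (rule tendsto_sandwich[OF _ _ tendsto_const])
    have "(\<lambda>n. n2 (\<phi>' (w' n) - z' *\<^sub>C w' n) + n2 (Ad (y n) u - \<phi> u)) \<longlonglongrightarrow> 0 + 0"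
      by (intro tendsto_add lim_z' lim_y uD(1))
    then show "(\<lambda>n. n2 (\<phi>' (w' n) - z' *\<^sub>C w' n) + n2 (Ad (y n) u - \<phi> u)) \<longlonglongrightarrow> 0" by simp
    have "n2 (\<phi> (y n) - z' *\<^sub>C y n) \<le> n2 (\<phi>' (w' n) - z' *\<^sub>C w' n) + n2 (Ad (y n) u - \<phi> u)" for n
    proof -
      note wD = unitariesD[OF w'[of n]]
      note \<phi>u = Aut_unitary[OF A(1) u]
      define a where "a = adj (\<phi> u) * (adj u * ((\<phi>' (w' n) - z' *\<^sub>C w' n) * u))"
      define b where "b = adj (\<phi> u - Ad (y n) u) * (z' *\<^sub>C (adj u * (w' n * u)))"
      have m: "\<phi> u \<in> M" "\<phi>' (w' n) \<in> M" "Ad (y n) u \<in> M" "y n \<in> M" "\<phi> (y n) \<in> M"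
        using Aut_D(1)[OF A(1)] Aut_D(1)[OF A(2)] wD(1) uD(1) unitariesD(1)[OF y[of n]] Ad_in by blast+
      have "\<phi> (y n) = adj (\<phi> u) * \<phi> (w' n)"
        unfolding y_def using Aut_D[OF A(1)] uD(1) wD(1) by simp
      also have "\<phi> (w' n) = adj u * (\<phi>' (w' n) * u)"
        using wD(1) uD by (simp add: \<phi>'u Ad_def mult.assoc)
      finally have 1: "\<phi> (y n) = adj (\<phi> u) * (adj u * (\<phi>' (w' n) * u))" .
      have "adj (Ad (y n) u) * (adj u * (w' n * u)) = y n"
        using uD wD by (simp add: y_def Ad_def mult.assoc)
      then have "\<phi> (y n) - z' *\<^sub>C y n = a + b"
        unfolding a_def b_def by (simp add: 1 left_diff_distrib right_diff_distrib bop_scale_add)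
      then have "n2 (\<phi> (y n) - z' *\<^sub>C y n) \<le> n2 a + n2 b"
        using m uD wD n2_triangle[of a b] by (simp add: a_def b_def)
      moreover have "n2 a = n2 (\<phi>' (w' n) - z' *\<^sub>C w' n)"
        unfolding a_def using m uD wD by (simp add: n2_unitary_mult[OF \<phi>u] n2_unitary_mult[OF u])
      moreover have "n2 b = n2 (adj (\<phi> u - Ad (y n) u))"
      proof -
        have e: "adj u * (w' n * u) \<in> unitaries M" by (intro unitaries_mult unitaries_adj u w')
        have "b = z' *\<^sub>C (adj (\<phi> u - Ad (y n) u) * (adj u * (w' n * u)))" by (simp add: b_def)
        then have "n2 b = n2 (adj (\<phi> u - Ad (y n) u) * (adj u * (w' n * u)))"
          using m uD wD z' by (simp add: n2_scale)
        also have "\<dots> = n2 (adj (\<phi> u - Ad (y n) u))"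
          by (rule n2_unitary_mult(2)[OF e]) (use m in simp)
        finally show ?thesis .
      qed
      moreover have "n2 (adj (\<phi> u - Ad (y n) u)) = n2 (Ad (y n) u - \<phi> u)"
        using m n2_diff_commute[of "\<phi> u" "Ad (y n) u"] by (simp del: adj_diff)
      ultimately show ?thesis by simp
    qed
    then show "\<forall>\<^sub>F n in sequentially. n2 (\<phi> (y n) - z' *\<^sub>C y n) \<le> n2 (\<phi>' (w' n) - z' *\<^sub>C w' n) + n2 (Ad (y n) u - \<phi> u)"
      by simp
    show "\<forall>\<^sub>F n in sequentially. 0 \<le> n2 (\<phi> (y n) - z' *\<^sub>C y n)"
      using unitariesD(1)[OF y] Aut_D(1)[OF A(1)] by simp
  qed
  define x where "x n = adj (w n) * y n" for n
  have xu: "x n \<in> unitaries M" for n unfolding x_def by (intro unitaries_mult unitaries_adj w y)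
  have xM: "x n \<in> M" for n by (rule unitariesD(1)[OF xu])
  have "central_sequence M \<tau> x"
    unfolding central_sequence_def
  proof (intro conjI allI ballI)
    show "x n \<in> M" for n by (rule xM)
    show "\<exists>C. \<forall>n. opnorm (x n) \<le> C" using opnorm_unitary unitariesD(2)[OF xu] by blast
    fix m assume m: "m \<in> M"
    have le: "n2 (x n * m - m * x n) \<le> n2 (Ad (y n) m - \<phi> m) + n2 (Ad (w n) m - \<phi> m)" for n
    proof -
      note wD = unitariesD[OF w[of n]] and yD = unitariesD[OF y[of n]]
      have k: "Ad (y n) m \<in> M" "Ad (w n) m \<in> M" "\<phi> m \<in> M"
        using m wD yD Ad_in Aut_D(1)[OF A(1)] by blast+
      have "x n * m - m * x n = adj (w n) * ((Ad (y n) m - Ad (w n) m) * y n)"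
        using wD yD by (simp add: x_def Ad_def left_diff_distrib right_diff_distrib mult.assoc)
      then have "n2 (x n * m - m * x n) = n2 (Ad (y n) m - Ad (w n) m)"
        using k yD by (simp add: n2_unitary_mult[OF w] n2_unitary_mult[OF y])
      also have "\<dots> \<le> n2 (Ad (y n) m - \<phi> m) + n2 (\<phi> m - Ad (w n) m)" by (rule n2_triangle3) (rule k)+
      finally show ?thesis using k n2_diff_commute by simp
    qed
    have "(\<lambda>n. n2 (Ad (y n) m - \<phi> m) + n2 (Ad (w n) m - \<phi> m)) \<longlonglongrightarrow> 0 + 0"
      by (intro tendsto_add lim lim_y m)
    then have "(\<lambda>n. n2 (Ad (y n) m - \<phi> m) + n2 (Ad (w n) m - \<phi> m)) \<longlonglongrightarrow> 0" by simp
    then show "(\<lambda>n. n2 (x n * m - m * x n)) \<longlonglongrightarrow> 0"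
      by (rule tendsto_sandwich[OF _ _ tendsto_const, rotated 2]) (use le xM m in simp_all)
  qed
  then have "(\<lambda>n. n2 (\<phi> (x n) - x n)) \<longlonglongrightarrow> 0" using \<phi> by (simp add: Ct_def)
  then have "(\<lambda>n. n2 (\<phi> (x n) - x n) + n2 (\<phi> (y n) - z' *\<^sub>C y n)) \<longlonglongrightarrow> 0 + 0"
    by (intro tendsto_add y_z')
  moreover have "cmod (cnj z * z' - 1) \<le> n2 (\<phi> (x n) - x n) + n2 (\<phi> (y n) - z' *\<^sub>C y n)" for n
  proof -
    note wD = unitariesD[OF w[of n]] and yD = unitariesD[OF y[of n]]
    have \<phi>y: "\<phi> (y n) \<in> M" using yD Aut_D(1)[OF A(1)] by blast
    have \<phi>x: "\<phi> (x n) = cnj z *\<^sub>C (adj (w n) * \<phi> (y n))"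
      unfolding x_def using wD yD Aut_D[OF A(1)] by (simp add: \<phi>w)
    have "(cnj z * z' - 1) *\<^sub>C x n = (\<phi> (x n) - x n) - cnj z *\<^sub>C (adj (w n) * (\<phi> (y n) - z' *\<^sub>C y n))"
      unfolding \<phi>x
      by (simp add: x_def right_diff_distrib bop_scale_add diff_conv_add_uminus[of "cnj z * z'"] del: add_uminus_conv_diff)
    then have "n2 ((cnj z * z' - 1) *\<^sub>C x n)
        \<le> n2 (\<phi> (x n) - x n) + n2 (cnj z *\<^sub>C (adj (w n) * (\<phi> (y n) - z' *\<^sub>C y n)))"
      using wD(1) yD(1) \<phi>y xM Aut_D(1)[OF A(1) xM] by (simp add: n2_triangle_diff)
    moreover have "n2 ((cnj z * z' - 1) *\<^sub>C x n) = cmod (cnj z * z' - 1)"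
      using xM n2_unitary_mult(1)[OF xu, of 1 n] by (simp add: n2_scale)
    moreover have "n2 (cnj z *\<^sub>C (adj (w n) * (\<phi> (y n) - z' *\<^sub>C y n))) = n2 (\<phi> (y n) - z' *\<^sub>C y n)"
      using wD(1) yD(1) \<phi>y z by (simp add: n2_scale n2_unitary_mult[OF w])
    ultimately show ?thesis by simp
  qed
  ultimately have "cmod (cnj z * z' - 1) \<le> 0 + 0" by (intro LIMSEQ_le_const[of _ "0 + 0"]) auto
  then have "cnj z * z' = 1" by simp
  then have "z * cnj z * z' = z" by (metis mult.assoc mult.right_neutral)
  then show "z' = z" using z by (simp add: complex_norm_square[symmetric])
qed

end


section \<open>Automorphisms of the crossed product\<close>

lemma tendsto_zero_le:
  fixes f g :: "nat \<Rightarrow> real"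
  assumes "g \<longlonglongrightarrow> 0" "\<And>n. 0 \<le> f n" "\<And>n. f n \<le> g n"
  shows "f \<longlonglongrightarrow> 0"
  by (rule tendsto_sandwich[OF _ _ tendsto_const assms(1)]) (use assms in simp_all)

lemma nhom_cheb: "nhom N \<Phi> \<Longrightarrow> vN_algebra N \<Longrightarrow> s \<in> N \<Longrightarrow> \<Phi> (cheb k s) = cheb k (\<Phi> s) \<and> cheb k s \<in> N"
  by (induction k rule: induct_nat_012)
    (auto simp: nhom_one nhom_mult nhom_diff vN_one vN_mult vN_diff)

text \<open>Convergence of \<open>Ad (w n)\<close> need only be checked on generators, since all maps are isometric for
  the trace norm.\<close>

lemma (in tracial) Ad_limit_from_generators:
  assumes S: "M = vN_gen S" and w: "\<And>n. w n \<in> unitaries M" and \<psi>: "nhom M \<psi>"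
    and iso: "\<And>x. x \<in> M \<Longrightarrow> n2 (\<psi> x) = n2 x"
    and gen: "\<And>s. s \<in> S \<Longrightarrow> \<forall>\<^sub>F n in sequentially. Ad (w n) s = \<psi> s"
    and x: "x \<in> M"
  shows "(\<lambda>n. n2 (Ad (w n) x - \<psi> x)) \<longlonglongrightarrow> 0"
proof (rule tendstoI)
  fix e :: real assume e: "0 < e"
  have sub: "star_alg S \<subseteq> M" unfolding S by (intro star_alg_subset_vN vN_algebra_vN_gen vN_gen_superset)
  have alg: "\<forall>\<^sub>F n in sequentially. Ad (w n) y = \<psi> y" if "y \<in> star_alg S" for y
    using that
  proof induction
    case one
    show ?case using unitariesD[OF w] by (simp add: Ad_def nhom_one[OF \<psi>])
  next
    case (add x y)
    then have m: "x \<in> M" "y \<in> M" using sub by blast+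
    show ?case using add.IH
      by eventually_elim (use m in \<open>simp add: nhom_add[OF \<psi>] nhom_add[OF nhom_Ad[OF M w]]\<close>)
  next
    case (mult x y)
    then have m: "x \<in> M" "y \<in> M" using sub by blast+
    show ?case using mult.IH
      by eventually_elim (use m in \<open>simp add: nhom_mult[OF \<psi>] nhom_mult[OF nhom_Ad[OF M w]]\<close>)
  next
    case (scale x c)
    then have m: "x \<in> M" using sub by blast
    show ?case using scale.IH
      by eventually_elim (use m in \<open>simp add: nhom_scale[OF \<psi>] nhom_scale[OF nhom_Ad[OF M w]]\<close>)
  next
    case (adj x)
    then have m: "x \<in> M" using sub by blast
    show ?case using adj.IH
      by eventually_elim (use m in \<open>simp add: nhom_adj[OF \<psi>] nhom_adj[OF nhom_Ad[OF M w]]\<close>)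
  qed (rule gen)
  obtain y where y: "y \<in> star_alg S" "y \<in> M" "n2 (x - y) < e / 2" using n2_dense[OF S x, of "e / 2"] e by auto
  show "\<forall>\<^sub>F n in sequentially. dist (n2 (Ad (w n) x - \<psi> x)) 0 < e"
    using alg[OF y(1)]
  proof eventually_elim
    case (elim n)
    have m: "Ad (w n) x \<in> M" "Ad (w n) y \<in> M" "\<psi> x \<in> M" "\<psi> y \<in> M"
      using x y(2) by (simp_all add: Ad_in unitariesD(1)[OF w] nhom_in[OF \<psi>])
    have "Ad (w n) x - \<psi> x = Ad (w n) (x - y) - \<psi> (x - y)"
      using x y(2) elim by (simp add: Ad_diff nhom_diff[OF \<psi> M])
    then have "n2 (Ad (w n) x - \<psi> x) \<le> n2 (Ad (w n) (x - y)) + n2 (\<psi> (x - y))"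
      using x y(2) by (simp add: n2_triangle_diff Ad_in unitariesD(1)[OF w] nhom_in[OF \<psi>])
    also have "\<dots> = n2 (x - y) + n2 (x - y)" using x y(2) by (simp add: n2_Ad[OF w] iso)
    finally show ?case using y(3) m by (simp add: dist_real_def)
  qed
qed

locale crossed_trace = crossed N \<gamma> for N :: "'l::complex_hilbert_space bop set" and \<gamma> +
  fixes \<tau> :: "('l \<times> 'l \<times> 'l) bop \<Rightarrow> complex"
  assumes tr: "faithful_normal_trace M \<tau>"
    and vanish: "\<And>a. a \<in> N \<Longrightarrow> \<tau> (\<pi> a * v) = 0" "\<And>a. a \<in> N \<Longrightarrow> \<tau> (\<pi> a * (v * v)) = 0"
begin

sublocale MT: tracial M \<tau>
  by standard (rule M, rule tr)

abbreviation \<tau>N :: "'l bop \<Rightarrow> complex" where "\<tau>N \<equiv> (\<lambda>a. \<tau> (\<pi> a))"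
abbreviation n2 where "n2 \<equiv> norm2 \<tau>"
abbreviation nN where "nN \<equiv> norm2 \<tau>N"

lemma nN_eq: "a \<in> N \<Longrightarrow> nN a = n2 (\<pi> a)"
  by (simp add: norm2_def \<pi>_mult \<pi>_adj)

lemma trace_N: "faithful_normal_trace N \<tau>N"
  unfolding faithful_normal_trace_def
proof (intro conjI ballI allI impI)
  fix x y c assume x: "x \<in> N"
  show "\<tau>N (c *\<^sub>C x) = c * \<tau>N x" using x by (simp add: \<pi>_scale MT.tr_scale)
  have p: "\<tau>N (adj x * x) = \<tau> (adj (\<pi> x) * \<pi> x)" using x by (simp add: \<pi>_mult \<pi>_adj)
  show "\<tau>N (adj x * x) \<in> \<real>" "0 \<le> Re (\<tau>N (adj x * x))"
    unfolding p using x by (simp_all add: MT.tr_real MT.tr_pos)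
  show "x = 0" if "\<tau>N (adj x * x) = 0"
  proof -
    have "\<pi> x = 0" using that x unfolding p by (intro MT.tr_faithful) auto
    then have "rep x 0 0 = rep 0 0 0" by (simp add: rep_\<pi>)
    then show ?thesis by (simp add: rep_eq_iff)
  qed
  assume y: "y \<in> N"
  show "\<tau>N (x + y) = \<tau>N x + \<tau>N y" using x y by (simp add: \<pi>_add MT.tr_add)
  show "\<tau>N (x * y) = \<tau>N (y * x)" using x y by (simp add: \<pi>_mult MT.tr_comm[of "\<pi> x"])
next
  show "\<tau>N 1 = 1" by (simp add: \<pi>_one)
  show "normal_functional N \<tau>N" using coefficient_normal[OF MT.tr_normal vN_one[OF M]] by simp
qed

sublocale NT: tracial N \<tau>N
  by standard (rule N, rule trace_N)

lemma trace_\<gamma>: "a \<in> N \<Longrightarrow> \<tau>N (\<gamma> a) = \<tau>N a"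
proof -
  assume a: "a \<in> N"
  have "\<pi> (\<gamma> a) = v * (\<pi> a * (v * v))" using a by (simp add: v_\<pi>_assoc v3)
  also have "\<tau> \<dots> = \<tau> (\<pi> a * (v * v) * v)" using a by (intro MT.tr_comm) auto
  also have "\<pi> a * (v * v) * v = \<pi> a" by (simp add: mult.assoc v3)
  finally show ?thesis .
qed

lemma nN_\<gamma>: "a \<in> N \<Longrightarrow> nN (\<gamma> a) = nN a"
  using trace_\<gamma>[of "adj a * a"] by (simp add: norm2_def nhom_mult[OF \<gamma>] nhom_adj[OF \<gamma>])

lemma trace_rep: "a \<in> N \<Longrightarrow> b \<in> N \<Longrightarrow> c \<in> N \<Longrightarrow> \<tau> (rep a b c) = \<tau>N a"
  by (simp add: rep_def MT.tr_add vanish)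

lemma coefficient_le_0:
  assumes "a \<in> N" "b \<in> N" "c \<in> N"
  shows "nN a \<le> n2 (rep a b c)"
proof -
  have "(nN a)\<^sup>2 = cmod (\<tau>N (adj a * a))" using assms by (simp add: NT.tr_n2 norm_power)
  also have "\<tau>N (adj a * a) = \<tau> (adj (\<pi> a) * rep a b c)"
    using assms rep_mult[of "adj a" 0 0 a b c] by (simp add: rep_\<pi> trace_rep flip: \<pi>_adj)
  also have "cmod \<dots> \<le> n2 (rep a b c) * nN a"
    using assms MT.n2_cauchy_schwarz[of "rep a b c" "\<pi> a"] by (simp add: nN_eq)
  finally have le: "nN a * nN a \<le> n2 (rep a b c) * nN a" by (simp add: power2_eq_square)
  show ?thesis
  proof (cases "nN a = 0")
    case False
    then have "nN a > 0" using assms by (simp add: order_less_le)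
    then show ?thesis using le by simp
  qed (use assms in simp)
qed

lemma v_unitary: "v \<in> unitaries M"
  by (simp add: unitaries_def adj_v mult.assoc v3)

lemma rep_times_v: "a \<in> N \<Longrightarrow> b \<in> N \<Longrightarrow> c \<in> N \<Longrightarrow> rep a b c * v = rep c a b"
  by (simp add: rep_def distrib_right mult.assoc v3 add_ac)

lemma v_times_rep: "a \<in> N \<Longrightarrow> b \<in> N \<Longrightarrow> c \<in> N \<Longrightarrow> v * rep a b c = rep (\<gamma> c) (\<gamma> a) (\<gamma> b)"
  by (simp add: rep_def distrib_left v_\<pi> v_\<pi>_assoc mult.assoc v3 add_ac)

lemma n2_rotate: "a \<in> N \<Longrightarrow> b \<in> N \<Longrightarrow> c \<in> N \<Longrightarrow> n2 (rep c a b) = n2 (rep a b c)"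
  using MT.n2_unitary_mult(2)[OF v_unitary, of "rep a b c"] by (simp add: rep_times_v)

lemma coefficient_le:
  assumes "a \<in> N" "b \<in> N" "c \<in> N"
  shows "nN a \<le> n2 (rep a b c)" "nN b \<le> n2 (rep a b c)" "nN c \<le> n2 (rep a b c)"
  using coefficient_le_0[of a b c] coefficient_le_0[of b c a] coefficient_le_0[of c a b]
    n2_rotate[of a b c] n2_rotate[of b c a] assms by simp_all

lemma n2_rep_le:
  assumes "a \<in> N" "b \<in> N" "c \<in> N"
  shows "n2 (rep a b c) \<le> nN a + nN b + nN c"
proof -
  have "n2 (rep a b c) \<le> n2 (\<pi> a) + n2 (\<pi> b * v) + n2 (\<pi> c * (v * v))"
    unfolding rep_def using assms
    by (intro order_trans[OF MT.n2_triangle] add_right_mono MT.n2_triangle) auto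
  also have "n2 (\<pi> b * v) = n2 (\<pi> b)" using assms by (intro MT.n2_unitary_mult(2) v_unitary) auto
  also have "n2 (\<pi> c * (v * v)) = n2 (\<pi> c)"
    using assms by (intro MT.n2_unitary_mult(2) MT.unitaries_mult v_unitary) auto
  finally show ?thesis using assms by (simp add: nN_eq)
qed

text \<open>A coefficientwise map that commutes with \<open>\<gamma>\<close> is an automorphism.\<close>

lemma coefficientwise_Aut:
  assumes \<psi>: "nhom N \<psi>" "bij_betw \<psi> N N" and comm: "\<And>a. a \<in> N \<Longrightarrow> \<psi> (\<gamma> a) = \<gamma> (\<psi> a)"
    and ext: "\<beta> \<in> extensional M"
    and \<beta>: "\<And>a b c. a \<in> N \<Longrightarrow> b \<in> N \<Longrightarrow> c \<in> N \<Longrightarrow> \<beta> (rep a b c) = rep (\<psi> a) (\<psi> b) (\<psi> c)"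
  shows "\<beta> \<in> Aut M"
proof -
  note \<psi>N = nhom_in[OF \<psi>(1)]
  have "bij_betw \<beta> M M"
    unfolding bij_betw_def
  proof
    show "inj_on \<beta> M"
    proof (rule inj_onI)
      fix x y assume "x \<in> M" "y \<in> M" and eq: "\<beta> x = \<beta> y"
      obtain a b c a' b' c' where "a \<in> N" "b \<in> N" "c \<in> N" "x = rep a b c" "a' \<in> N" "b' \<in> N" "c' \<in> N" "y = rep a' b' c'"
        using M_cases[OF \<open>x \<in> M\<close>] M_cases[OF \<open>y \<in> M\<close>] by metis
      then show "x = y" using eq \<psi>(2) by (auto simp: \<beta> rep_eq_iff bij_betw_def dest: inj_onD)
    qed
    show "\<beta> ` M = M"
    proof
      show "\<beta> ` M \<subseteq> M"
      proof
        fix y assume "y \<in> \<beta> ` M"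
        then obtain x where x: "x \<in> M" "y = \<beta> x" by blast
        obtain a b c where "a \<in> N" "b \<in> N" "c \<in> N" "x = rep a b c" using M_cases[OF x(1)] by metis
        then show "y \<in> M" by (simp add: x \<beta> \<psi>N)
      qed
      show "M \<subseteq> \<beta> ` M"
      proof
        fix y assume "y \<in> M"
        then obtain a b c where y: "a \<in> N" "b \<in> N" "c \<in> N" "y = rep a b c" by (rule M_cases)
        have surj: "\<exists>d'\<in>N. d = \<psi> d'" if "d \<in> N" for d using that \<psi>(2) by (auto simp: bij_betw_def)
        obtain a' where "a' \<in> N" "a = \<psi> a'" using surj[OF y(1)] by (rule bexE)
        moreover obtain b' where "b' \<in> N" "b = \<psi> b'" using surj[OF y(2)] by (rule bexE)
        moreover obtain c' where "c' \<in> N" "c = \<psi> c'" using surj[OF y(3)] by (rule bexE)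
        ultimately
        have "y = \<beta> (rep a' b' c')" "rep a' b' c' \<in> M" by (simp_all add: y \<beta>)
        then show "y \<in> \<beta> ` M" by blast
      qed
    qed
  qed
  then have bij: "\<beta> \<in> Bij M" using ext by (simp add: Bij_def)
  have add: "\<beta> (x + y) = \<beta> x + \<beta> y" and mult: "\<beta> (x * y) = \<beta> x * \<beta> y" if "x \<in> M" "y \<in> M" for x y
  proof -
    obtain a b c where 1: "a \<in> N" "b \<in> N" "c \<in> N" "x = rep a b c" using M_cases[OF \<open>x \<in> M\<close>] by metis
    obtain a' b' c' where 2: "a' \<in> N" "b' \<in> N" "c' \<in> N" "y = rep a' b' c'" using M_cases[OF \<open>y \<in> M\<close>] by metis
    show "\<beta> (x + y) = \<beta> x + \<beta> y" using 1 2 by (simp add: rep_add \<beta> \<psi>N nhom_add[OF \<psi>(1)])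
    show "\<beta> (x * y) = \<beta> x * \<beta> y"
      using 1 2 by (simp add: rep_mult \<beta> \<psi>N nhom_add[OF \<psi>(1)] nhom_mult[OF \<psi>(1)] comm)
  qed
  have scale: "\<beta> (d *\<^sub>C x) = d *\<^sub>C \<beta> x" and adj: "\<beta> (adj x) = adj (\<beta> x)" if "x \<in> M" for x d
  proof -
    obtain a b c where 1: "a \<in> N" "b \<in> N" "c \<in> N" "x = rep a b c" using M_cases[OF \<open>x \<in> M\<close>] by metis
    show "\<beta> (d *\<^sub>C x) = d *\<^sub>C \<beta> x" using 1 by (simp add: rep_scale \<beta> \<psi>N nhom_scale[OF \<psi>(1)])
    show "\<beta> (adj x) = adj (\<beta> x)" using 1 by (simp add: rep_adj \<beta> \<psi>N nhom_adj[OF \<psi>(1)] comm)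
  qed
  show ?thesis unfolding Aut_def using bij add mult scale adj by simp
qed

text \<open>A unitary of \<open>N\<close> fixed by \<open>\<gamma>\<close> commutes with \<open>v\<close> and acts coefficientwise.\<close>

lemma Ad_\<pi>_rep:
  assumes w: "w \<in> unitaries N" "\<gamma> w = w" and a: "a \<in> N" "b \<in> N" "c \<in> N"
  shows "Ad (\<pi> w) (rep a b c) = rep (Ad w a) (Ad w b) (Ad w c)"
proof -
  note wD = NT.unitariesD[OF w(1)]
  have "\<gamma> (adj w) = adj w" using wD(1) w(2) by (simp add: nhom_adj[OF \<gamma>])
  moreover have "Ad (\<pi> w) (rep a b c) = rep w 0 0 * rep a b c * rep (adj w) 0 0"
    using wD(1) by (simp add: Ad_def rep_\<pi> \<pi>_adj)
  ultimately show ?thesis using wD(1) a by (simp add: rep_mult Ad_def nhom_zero[OF \<gamma> N])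
qed

lemma \<pi>_unitary: "w \<in> unitaries N \<Longrightarrow> \<pi> w \<in> unitaries M"
proof -
  assume "w \<in> unitaries N"
  then have w: "w \<in> N" "adj w * w = 1" "w * adj w = 1" by (simp_all add: unitaries_def)
  have "adj (\<pi> w) * \<pi> w = \<pi> (adj w * w)" "\<pi> w * adj (\<pi> w) = \<pi> (w * adj w)"
    using w(1) by (simp_all add: \<pi>_mult \<pi>_adj)
  then show ?thesis using w by (simp add: unitaries_def \<pi>_one)
qed

lemma coefficientwise_Ad_limit:
  assumes w: "\<And>n. w n \<in> unitaries N" "\<And>n. \<gamma> (w n) = w n" and \<psi>: "nhom N \<psi>"
    and \<beta>: "\<And>a b c. a \<in> N \<Longrightarrow> b \<in> N \<Longrightarrow> c \<in> N \<Longrightarrow> \<beta> (rep a b c) = rep (\<psi> a) (\<psi> b) (\<psi> c)"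
    and lim: "\<And>a. a \<in> N \<Longrightarrow> (\<lambda>n. nN (Ad (w n) a - \<psi> a)) \<longlonglongrightarrow> 0" and x: "x \<in> M"
  shows "(\<lambda>n. n2 (Ad (\<pi> (w n)) x - \<beta> x)) \<longlonglongrightarrow> 0"
proof -
  obtain a b c where 1: "a \<in> N" "b \<in> N" "c \<in> N" "x = rep a b c" using M_cases[OF x] by metis
  have wN: "w n \<in> N" for n using NT.unitariesD(1)[OF w(1)] .
  have "(\<lambda>n. nN (Ad (w n) a - \<psi> a) + nN (Ad (w n) b - \<psi> b) + nN (Ad (w n) c - \<psi> c)) \<longlonglongrightarrow> 0 + 0 + 0"
    by (intro tendsto_add lim 1)
  then have L: "(\<lambda>n. nN (Ad (w n) a - \<psi> a) + nN (Ad (w n) b - \<psi> b) + nN (Ad (w n) c - \<psi> c)) \<longlonglongrightarrow> 0" by simp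
  have eq: "Ad (\<pi> (w n)) x - \<beta> x = rep (Ad (w n) a - \<psi> a) (Ad (w n) b - \<psi> b) (Ad (w n) c - \<psi> c)" for n
    using 1 by (simp add: Ad_\<pi>_rep[OF w] \<beta> rep_diff NT.Ad_in wN nhom_in[OF \<psi>])
  show ?thesis
    unfolding eq
    by (rule tendsto_zero_le[OF L])
      (use 1 in \<open>simp_all add: NT.Ad_in wN nhom_in[OF \<psi>] n2_rep_le\<close>)
qed

lemma central_coefficients:
  assumes x: "central_sequence M \<tau> x"
  obtains a b c C where "\<And>n. a n \<in> N" "\<And>n. b n \<in> N" "\<And>n. c n \<in> N" "\<And>n. x n = rep (a n) (b n) (c n)"
    "\<And>n. nN (a n) \<le> C" "\<And>n. nN (b n) \<le> C" "\<And>n. nN (c n) \<le> C"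
    "\<And>y. y \<in> N \<Longrightarrow> (\<lambda>n. nN (a n * y - y * a n)) \<longlonglongrightarrow> 0"
    "\<And>y. y \<in> N \<Longrightarrow> (\<lambda>n. nN (b n * \<gamma> y - y * b n)) \<longlonglongrightarrow> 0"
    "(\<lambda>n. nN (\<gamma> (a n) - a n)) \<longlonglongrightarrow> 0"
proof -
  have xM: "x n \<in> M" for n using x by (simp add: central_sequence_def)
  obtain C where C: "\<And>n. opnorm (x n) \<le> C" using x unfolding central_sequence_def by blast
  have lim: "(\<lambda>n. n2 (x n * y - y * x n)) \<longlonglongrightarrow> 0" if "y \<in> M" for y
    using x that by (simp add: central_sequence_def)
  define a b c where "a n = entry 0 (x n)" and "b n = entry 2 (x n)" and "c n = entry 1 (x n)" for n
  have N': "a n \<in> N" "b n \<in> N" "c n \<in> N" for n by (simp_all add: a_def b_def c_def entry_in_N xM)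
  have x': "x n = rep (a n) (b n) (c n)" for n unfolding a_def b_def c_def by (rule M_rep[OF xM])
  have nC: "n2 (x n) \<le> C" for n using MT.n2_le_opnorm[OF xM] C order_trans by blast
  have bd: "nN (a n) \<le> C" "nN (b n) \<le> C" "nN (c n) \<le> C" for n
    using coefficient_le[OF N'(1,2,3), of n n n] nC[of n] by (simp_all add: x')
  have comm: "x n * \<pi> y - \<pi> y * x n
      = rep (a n * y - y * a n) (b n * \<gamma> y - y * b n) (c n * \<gamma> (\<gamma> y) - y * c n)" if "y \<in> N" for n y
    unfolding x' rep_\<pi>[symmetric] using that N'
    by (simp add: rep_mult rep_diff nhom_zero[OF \<gamma> N])
  have commv: "v * x n - x n * v = rep (\<gamma> (c n) - c n) (\<gamma> (a n) - a n) (\<gamma> (b n) - b n)" for n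
    unfolding x' using N' by (simp add: rep_times_v v_times_rep rep_diff)
  show ?thesis
  proof (rule that[OF N' x' bd])
    fix y assume y: "y \<in> N"
    have k: "a n * y - y * a n \<in> N" "b n * \<gamma> y - y * b n \<in> N" "c n * \<gamma> (\<gamma> y) - y * c n \<in> N" for n
      using N' y by simp_all
    show "(\<lambda>n. nN (a n * y - y * a n)) \<longlonglongrightarrow> 0" "(\<lambda>n. nN (b n * \<gamma> y - y * b n)) \<longlonglongrightarrow> 0"
      by (rule tendsto_zero_le[OF lim[OF \<pi>_in[OF y]]]; use k coefficient_le[OF k] comm[OF y] in simp)+
  next
    have "(\<lambda>n. n2 (v * x n - x n * v)) \<longlonglongrightarrow> 0"
      using lim[OF v_in] MT.n2_diff_commute xM by simp
    then show "(\<lambda>n. nN (\<gamma> (a n) - a n)) \<longlonglongrightarrow> 0"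
    proof (rule tendsto_zero_le)
      have k: "\<gamma> (c n) - c n \<in> N" "\<gamma> (a n) - a n \<in> N" "\<gamma> (b n) - b n \<in> N" for n using N' by simp_all
      show "0 \<le> nN (\<gamma> (a n) - a n)" for n using k by simp
      show "nN (\<gamma> (a n) - a n) \<le> n2 (v * x n - x n * v)" for n
        unfolding commv by (rule coefficient_le(2)[OF k])
    qed
  qed
qed

lemma central_adj: "central_sequence M \<tau> x \<Longrightarrow> central_sequence M \<tau> (\<lambda>n. adj (x n))"
proof -
  assume x: "central_sequence M \<tau> x"
  then have xM: "x n \<in> M" for n by (simp add: central_sequence_def)
  have eq: "n2 (adj (x n) * y - y * adj (x n)) = n2 (x n * adj y - adj y * x n)" if "y \<in> M" for n y
  proof -
    have "adj (adj (x n) * y - y * adj (x n)) = adj y * x n - x n * adj y" by simp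
    then have "n2 (adj (x n) * y - y * adj (x n)) = n2 (adj y * x n - x n * adj y)"
      using xM that MT.n2_adj[of "adj (x n) * y - y * adj (x n)"] by simp
    also have "\<dots> = n2 (x n * adj y - adj y * x n)" using xM that by (intro MT.n2_diff_commute) auto
    finally show ?thesis .
  qed
  show ?thesis using x xM eq unfolding central_sequence_def by (simp add: opnorm_adj)
qed

end


section \<open>Central sequences of the crossed product\<close>

locale model = crossed_trace N \<gamma> \<tau> +
  TF: tensor_free t A \<tau>A I G N "\<lambda>a. \<tau> (crossed_pi \<gamma> a)" R \<tau>R
  for t :: "'h::complex_hilbert_space \<Rightarrow> 'k::complex_hilbert_space \<Rightarrow> 'l::complex_hilbert_space"
    and A :: "'h bop set" and \<tau>A :: "'h bop \<Rightarrow> complex" and I :: "'i set" and G :: "'i \<Rightarrow> 'h bop set"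
    and N :: "'l bop set" and \<gamma> :: "'l bop \<Rightarrow> 'l bop" and \<tau> :: "('l \<times> 'l \<times> 'l) bop \<Rightarrow> complex"
    and R :: "'k bop set" and \<tau>R :: "'k bop \<Rightarrow> complex" +
  fixes \<alpha>\<beta> \<psi> :: "'l bop \<Rightarrow> 'l bop" and W :: "'l bop" and b :: "'k bop \<Rightarrow> 'k bop" and u0 :: "'k bop"
    and i1 i2 j1 j2 :: 'i and s1 s2 t1 t2 :: "'h bop"
  assumes W: "W \<in> unitaries N" and \<gamma>_eq: "\<And>a. a \<in> N \<Longrightarrow> \<gamma> a = Ad W (\<alpha>\<beta> a)"
    and \<alpha>\<beta>: "nhom N \<alpha>\<beta>" and \<alpha>\<beta>_R: "\<And>y. y \<in> R \<Longrightarrow> \<alpha>\<beta> (op_tensor t 1 y) = op_tensor t 1 (b y)"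
    and \<psi>: "nhom N \<psi>" and \<psi>_iso: "\<And>a. a \<in> N \<Longrightarrow> nN (\<psi> a) = nN a"
    and u0: "u0 \<in> unitaries R"
    and \<psi>_R: "\<And>y. y \<in> R \<Longrightarrow> \<psi> (op_tensor t 1 y) = op_tensor t 1 (adj u0 * b y * u0)"
    and i12: "i1 \<noteq> i2" and j12: "j1 \<noteq> i1" "j2 \<noteq> i2"
    and untwisted: "TF.letter_pair i1 s1 i1 s1" "TF.letter_pair i2 s2 i2 s2"
    and twisted: "TF.letter_pair i1 s1 j1 t1" "TF.letter_pair i2 s2 j2 t2"
    and \<alpha>\<beta>_s: "\<alpha>\<beta> (op_tensor t s1 1) = op_tensor t t1 1" "\<alpha>\<beta> (op_tensor t s2 1) = op_tensor t t2 1"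
begin

abbreviation ot where "ot \<equiv> op_tensor t"

lemma WD: "W \<in> N" "adj W * W = 1" "W * adj W = 1"
  using W by (simp_all add: unitaries_def)

lemma \<alpha>\<beta>_eq: "a \<in> N \<Longrightarrow> \<alpha>\<beta> a = adj W * \<gamma> a * W"
  using WD by (simp add: \<gamma>_eq Ad_def mult.assoc) (simp add: mult.assoc[symmetric])

lemma \<alpha>\<beta>_iso: "a \<in> N \<Longrightarrow> nN (\<alpha>\<beta> a) = nN a"
  using WD(1) by (simp add: \<alpha>\<beta>_eq NT.n2_unitary_mult[OF W] nN_\<gamma>)

text \<open>The coefficient \<open>b\<close> of \<open>v\<close> satisfies \<open>y b \<approx> b \<gamma>(y)\<close>, so \<open>b W\<close> intertwines two free letters.\<close>

lemma central_v_coefficient: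
  assumes bN: "\<And>n. c n \<in> N" and bd: "\<And>n. nN (c n) \<le> C"
    and comm: "\<And>y. y \<in> N \<Longrightarrow> (\<lambda>n. nN (c n * \<gamma> y - y * c n)) \<longlonglongrightarrow> 0"
  shows "(\<lambda>n. nN (c n)) \<longlonglongrightarrow> 0"
proof (rule tendstoI)
  fix e :: real assume e: "0 < e"
  have lim: "(\<lambda>n. nN (ot (cheb k s) 1 * (c n * W) - (c n * W) * ot (cheb k t') 1)) \<longlonglongrightarrow> 0"
    if p: "TF.letter_pair i s j t'" and s: "\<alpha>\<beta> (ot s 1) = ot t' 1" for i j s t' k
  proof -
    have DN: "ot (cheb k s) 1 \<in> N" "ot (cheb k t') 1 \<in> N" for k using TF.letter_pair_in_N[OF p] by simp_all
    have "ot s 1 \<in> N" using DN(1)[of 1] by simp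
    then have "\<alpha>\<beta> (ot (cheb k s) 1) = ot (cheb k t') 1"
      using nhom_cheb[OF \<alpha>\<beta> N, of "ot s 1" k] by (simp add: s TF.ot_cheb)
    then have \<gamma>D: "\<gamma> (ot (cheb k s) 1) = W * ot (cheb k t') 1 * adj W"
      using \<gamma>_eq[OF DN(1)] by (simp add: Ad_def)
    have eq: "ot (cheb k s) 1 * (c n * W) - (c n * W) * ot (cheb k t') 1
        = - ((c n * \<gamma> (ot (cheb k s) 1) - ot (cheb k s) 1 * c n) * W)" for n
      using WD by (simp add: \<gamma>D left_diff_distrib mult.assoc)
    have k: "c n * \<gamma> (ot (cheb k s) 1) - ot (cheb k s) 1 * c n \<in> N" for n using bN DN by simp
    have "nN (ot (cheb k s) 1 * (c n * W) - (c n * W) * ot (cheb k t') 1)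
        = nN (c n * \<gamma> (ot (cheb k s) 1) - ot (cheb k s) 1 * c n)" for n
      unfolding eq using k WD(1) by (simp add: NT.n2_minus NT.n2_unitary_mult[OF W])
    then show ?thesis using comm[OF DN(1)] by simp
  qed
  have "\<forall>\<^sub>F n in sequentially. \<exists>d\<in>TF.Sp {}. nN (c n * W - d) < e"
    by (rule TF.asymptotic_equations[OF _ i12 twisted(1) _ twisted(2) _ _ _ lim[OF twisted(1) \<alpha>\<beta>_s(1)] lim[OF twisted(2) \<alpha>\<beta>_s(2)] e, of _ C])
      (use j12 bN bd WD(1) in \<open>simp_all add: NT.n2_unitary_mult[OF W]\<close>)
  then show "\<forall>\<^sub>F n in sequentially. dist (nN (c n)) 0 < e"
  proof eventually_elim
    case (elim n)
    then obtain d where "d \<in> TF.Sp {}" "nN (c n * W - d) < e" by blast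
    moreover from this have "d = 0" by (intro TF.Sp_empty)
    ultimately have "nN (c n * W) < e" by simp
    then show ?case using bN[of n] by (simp add: NT.n2_unitary_mult[OF W] dist_real_def)
  qed
qed

lemma central_1_coefficient:
  assumes aN: "\<And>n. a n \<in> N" and bd: "\<And>n. nN (a n) \<le> C"
    and comm: "\<And>y. y \<in> N \<Longrightarrow> (\<lambda>n. nN (a n * y - y * a n)) \<longlonglongrightarrow> 0" and e: "0 < e"
  shows "\<forall>\<^sub>F n in sequentially. \<exists>y\<in>R. nN (a n - ot 1 y) < e"
proof -
  have lim: "(\<lambda>n. nN (ot (cheb k s) 1 * a n - a n * ot (cheb k s) 1)) \<longlonglongrightarrow> 0"
    if p: "TF.letter_pair i s j t'" for i j s t' k
  proof -
    have DN: "ot (cheb k s) 1 \<in> N" using TF.letter_pair_in_N[OF p] by simp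
    have "nN (ot (cheb k s) 1 * a n - a n * ot (cheb k s) 1) = nN (a n * ot (cheb k s) 1 - ot (cheb k s) 1 * a n)" for n
      using DN aN by (intro NT.n2_diff_commute) auto
    then show ?thesis using comm[OF DN] by simp
  qed
  have "\<forall>\<^sub>F n in sequentially. \<exists>d\<in>TF.Sp {None}. nN (a n - d) < e"
    by (rule TF.asymptotic_equations[OF _ i12 untwisted(1) _ untwisted(2) _ _ _ lim[OF untwisted(1)] lim[OF untwisted(2)] e, of _ C])
      (use aN bd in simp_all)
  then show ?thesis
    by eventually_elim (use TF.Sp_None in blast)
qed

text \<open>On \<open>1 \<otimes> R\<close> the maps \<open>\<alpha>\<beta>\<close> and \<open>\<psi>\<close> differ by \<open>Ad (1 \<otimes> u0\<^sup>*)\<close>. A central sequence is asymptotically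
  invariant under \<open>\<gamma>\<close>, hence under \<open>\<alpha>\<beta>\<close> because it commutes with \<open>W\<close>, hence under \<open>\<psi>\<close> because it
  commutes with \<open>1 \<otimes> u0\<close>.\<close>

lemma central_\<psi>:
  assumes aN: "\<And>n. a n \<in> N" and bd: "\<And>n. nN (a n) \<le> C"
    and comm: "\<And>y. y \<in> N \<Longrightarrow> (\<lambda>n. nN (a n * y - y * a n)) \<longlonglongrightarrow> 0"
    and inv: "(\<lambda>n. nN (\<gamma> (a n) - a n)) \<longlonglongrightarrow> 0"
  shows "(\<lambda>n. nN (\<psi> (a n) - a n)) \<longlonglongrightarrow> 0"
proof (rule tendstoI)
  fix e :: real assume e: "0 < e"
  define U where "U = ot 1 u0"
  have U: "U \<in> unitaries N"
    using u0 TF.ot_in_N[OF vN_one[OF TF.FA.M], of u0] by (simp add: U_def unitaries_def TF.ot_mult TF.ot_one)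
  have UN: "U \<in> N" using NT.unitariesD(1)[OF U] .
  have "(\<lambda>n. nN (\<gamma> (a n) - a n) + nN (a n * W - W * a n) + nN (a n * U - U * a n)) \<longlonglongrightarrow> 0 + 0 + 0"
    by (intro tendsto_add inv comm WD(1) UN)
  from order_tendstoD(2)[OF this, of "e / 8"]
  have "\<forall>\<^sub>F n in sequentially. nN (\<gamma> (a n) - a n) + nN (a n * W - W * a n) + nN (a n * U - U * a n) < e / 8"
    using e by simp
  moreover have "\<forall>\<^sub>F n in sequentially. \<exists>y\<in>R. nN (a n - ot 1 y) < e / 8"
    by (rule central_1_coefficient[OF aN bd comm]) (use e in simp_all)
  ultimately show "\<forall>\<^sub>F n in sequentially. dist (nN (\<psi> (a n) - a n)) 0 < e"
  proof eventually_elim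
    case (elim n)
    then obtain y where y: "y \<in> R" "nN (a n - ot 1 y) < e / 8" by blast
    define c where "c = ot 1 y"
    have cN: "c \<in> N" unfolding c_def by (rule TF.ot_in_N[OF vN_one[OF TF.FA.M] y(1)])
    note [simp] = aN cN WD(1) UN nhom_in[OF \<alpha>\<beta>] nhom_in[OF \<psi>]
    have ac: "nN (a n - c) < e / 8" "nN (c - a n) < e / 8"
      using y(2) NT.n2_diff_commute[OF aN[of n] cN] by (simp_all add: c_def)
    have "nN (\<alpha>\<beta> (a n) - a n) \<le> nN (\<gamma> (a n) - a n) + nN (a n * W - W * a n)"
    proof -
      have eq: "\<alpha>\<beta> (a n) - a n = adj W * ((\<gamma> (a n) - a n) * W) + adj W * (a n * W - W * a n)"
        using WD(2) by (simp add: \<alpha>\<beta>_eq left_diff_distrib right_diff_distrib mult.assoc)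
          (simp add: mult.assoc[symmetric])
      have "nN (\<alpha>\<beta> (a n) - a n) \<le> nN (adj W * ((\<gamma> (a n) - a n) * W)) + nN (adj W * (a n * W - W * a n))"
        unfolding eq by (rule NT.n2_triangle) simp_all
      then show "nN (\<alpha>\<beta> (a n) - a n) \<le> nN (\<gamma> (a n) - a n) + nN (a n * W - W * a n)"
        by (simp add: NT.n2_unitary_mult[OF W])
    qed
    moreover have "nN (\<alpha>\<beta> c - c) \<le> nN (\<alpha>\<beta> (c - a n)) + nN (\<alpha>\<beta> (a n) - a n) + nN (a n - c)"
    proof -
      have eq: "\<alpha>\<beta> c - c = \<alpha>\<beta> (c - a n) + (\<alpha>\<beta> (a n) - a n) + (a n - c)" by (simp add: nhom_diff[OF \<alpha>\<beta> N])
      have "nN (\<alpha>\<beta> c - c) \<le> nN (\<alpha>\<beta> (c - a n) + (\<alpha>\<beta> (a n) - a n)) + nN (a n - c)"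
        unfolding eq by (rule NT.n2_triangle) simp_all
      also have "\<dots> \<le> nN (\<alpha>\<beta> (c - a n)) + nN (\<alpha>\<beta> (a n) - a n) + nN (a n - c)"
        by (intro add_right_mono NT.n2_triangle) simp_all
      finally show ?thesis .
    qed
    moreover have "nN (\<psi> (a n) - a n) \<le> nN (\<psi> (a n - c)) + nN (\<alpha>\<beta> c - c) + nN (c - a n) + nN (a n * U - U * a n)"
    proof -
      have "\<psi> c = adj U * (\<alpha>\<beta> c * U)"
        using y(1) by (simp add: c_def \<psi>_R \<alpha>\<beta>_R U_def TF.ot_mult mult.assoc)
      then have eq: "\<psi> (a n) - a n = \<psi> (a n - c) + adj U * ((\<alpha>\<beta> c - c) * U) + adj U * ((c - a n) * U)
          + adj U * (a n * U - U * a n)"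
        using NT.unitariesD(2)[OF U]
        by (simp add: nhom_diff[OF \<psi> N] left_diff_distrib right_diff_distrib mult.assoc)
          (simp add: mult.assoc[symmetric])
      have "nN (\<psi> (a n) - a n) \<le> nN (\<psi> (a n - c) + adj U * ((\<alpha>\<beta> c - c) * U) + adj U * ((c - a n) * U))
          + nN (adj U * (a n * U - U * a n))"
        unfolding eq by (rule NT.n2_triangle) simp_all
      also have "\<dots> \<le> nN (\<psi> (a n - c)) + nN (adj U * ((\<alpha>\<beta> c - c) * U)) + nN (adj U * ((c - a n) * U))
          + nN (adj U * (a n * U - U * a n))"
        by (intro add_right_mono order_trans[OF NT.n2_triangle] NT.n2_triangle) simp_all
      finally show ?thesis by (simp add: NT.n2_unitary_mult[OF U])
    qed
    moreover have "0 \<le> nN (a n * U - U * a n)" "0 \<le> nN (a n * W - W * a n)" "0 \<le> nN (\<gamma> (a n) - a n)" by simp_all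
    moreover have "nN (\<alpha>\<beta> (c - a n)) = nN (c - a n)" "nN (\<psi> (a n - c)) = nN (a n - c)"
      by (simp_all add: \<alpha>\<beta>_iso \<psi>_iso)
    ultimately have "nN (\<psi> (a n) - a n) < e"
      using elim(1) ac by linarith
    then show ?case by (simp add: dist_real_def)
  qed
qed

lemma coefficientwise_Ct:
  assumes \<beta>A: "\<beta> \<in> Aut M"
    and \<beta>: "\<And>a b c. a \<in> N \<Longrightarrow> b \<in> N \<Longrightarrow> c \<in> N \<Longrightarrow> \<beta> (rep a b c) = rep (\<psi> a) (\<psi> b) (\<psi> c)"
  shows "\<beta> \<in> Ct M \<tau>"
proof -
  have "(\<lambda>n. n2 (\<beta> (x n) - x n)) \<longlonglongrightarrow> 0" if x: "central_sequence M \<tau> x" for x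
  proof -
    obtain a b c C where N': "\<And>n. a n \<in> N" "\<And>n. b n \<in> N" "\<And>n. c n \<in> N" and x': "\<And>n. x n = rep (a n) (b n) (c n)"
      and bd: "\<And>n. nN (a n) \<le> C" "\<And>n. nN (b n) \<le> C" "\<And>n. nN (c n) \<le> C"
      and comm: "\<And>y. y \<in> N \<Longrightarrow> (\<lambda>n. nN (a n * y - y * a n)) \<longlonglongrightarrow> 0"
        "\<And>y. y \<in> N \<Longrightarrow> (\<lambda>n. nN (b n * \<gamma> y - y * b n)) \<longlonglongrightarrow> 0"
      and inv: "(\<lambda>n. nN (\<gamma> (a n) - a n)) \<longlonglongrightarrow> 0"
      proof -
        show thesis by (rule central_coefficients[OF x]) (rule that)
      qed
    have b0: "(\<lambda>n. nN (b n)) \<longlonglongrightarrow> 0" by (rule central_v_coefficient[OF N'(2) bd(2) comm(2)])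
    have c0: "(\<lambda>n. nN (c n)) \<longlonglongrightarrow> 0"
    proof -
      obtain a' b' c' C' where N1: "\<And>n. a' n \<in> N" and N2: "\<And>n. b' n \<in> N" and N3: "\<And>n. c' n \<in> N"
        and x'': "\<And>n. adj (x n) = rep (a' n) (b' n) (c' n)"
        and "\<And>n. nN (a' n) \<le> C'" and bd': "\<And>n. nN (b' n) \<le> C'" and "\<And>n. nN (c' n) \<le> C'"
        and "\<And>y. y \<in> N \<Longrightarrow> (\<lambda>n. nN (a' n * y - y * a' n)) \<longlonglongrightarrow> 0"
        and comm': "\<And>y. y \<in> N \<Longrightarrow> (\<lambda>n. nN (b' n * \<gamma> y - y * b' n)) \<longlonglongrightarrow> 0"
        and "(\<lambda>n. nN (\<gamma> (a' n) - a' n)) \<longlonglongrightarrow> 0"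
        proof -
          show thesis by (rule central_coefficients[OF central_adj[OF x]]) (rule that)
        qed
      have "(\<lambda>n. nN (b' n)) \<longlonglongrightarrow> 0" by (rule central_v_coefficient[OF N2 bd' comm'])
      moreover have "b' n = \<gamma> (adj (c n))" for n
        using x''[of n] N' by (simp add: x' rep_adj rep_eq_iff)
      then have "nN (b' n) = nN (c n)" for n using N' by (simp add: nN_\<gamma>)
      ultimately show ?thesis by simp
    qed
    have a0: "(\<lambda>n. nN (\<psi> (a n) - a n)) \<longlonglongrightarrow> 0" by (rule central_\<psi>[OF N'(1) bd(1) comm(1) inv])
    have "(\<lambda>n. nN (\<psi> (a n) - a n) + (nN (b n) + nN (b n)) + (nN (c n) + nN (c n))) \<longlonglongrightarrow> 0 + (0 + 0) + (0 + 0)"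
      by (intro tendsto_add a0 b0 c0)
    then have L: "(\<lambda>n. nN (\<psi> (a n) - a n) + (nN (b n) + nN (b n)) + (nN (c n) + nN (c n))) \<longlonglongrightarrow> 0" by simp
    note [simp] = N' nhom_in[OF \<psi>]
    have eq: "\<beta> (x n) - x n = rep (\<psi> (a n) - a n) (\<psi> (b n) - b n) (\<psi> (c n) - c n)" for n
      by (simp add: x' \<beta> rep_diff)
    have d: "nN (\<psi> z - z) \<le> nN z + nN z" if "z \<in> N" for z
      using NT.n2_triangle_diff[of "\<psi> z" z] that by (simp add: \<psi>_iso)
    show ?thesis
      unfolding eq
    proof (rule tendsto_zero_le[OF L])
      fix n
      show "0 \<le> n2 (rep (\<psi> (a n) - a n) (\<psi> (b n) - b n) (\<psi> (c n) - c n))" by simp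
      have "n2 (rep (\<psi> (a n) - a n) (\<psi> (b n) - b n) (\<psi> (c n) - c n))
          \<le> nN (\<psi> (a n) - a n) + nN (\<psi> (b n) - b n) + nN (\<psi> (c n) - c n)"
        by (rule n2_rep_le) simp_all
      also have "\<dots> \<le> nN (\<psi> (a n) - a n) + (nN (b n) + nN (b n)) + (nN (c n) + nN (c n))"
        by (intro add_mono d order_refl N')
      finally show "n2 (rep (\<psi> (a n) - a n) (\<psi> (b n) - b n) (\<psi> (c n) - c n))
          \<le> nN (\<psi> (a n) - a n) + (nN (b n) + nN (b n)) + (nN (c n) + nN (c n))" .
    qed
  qed
  then show ?thesis using \<beta>A by (simp add: Ct_def)
qed

end


section \<open>Functional calculus of finite spectral families\<close>

definition spec_family :: "'i set \<Rightarrow> ('i \<Rightarrow> 'h::complex_hilbert_space bop) \<Rightarrow> bool" where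
  "spec_family J Q \<longleftrightarrow> finite J \<and> (\<forall>i\<in>J. \<forall>j\<in>J. Q i * Q j = (if i = j then Q i else 0)) \<and>
    (\<forall>i\<in>J. adj (Q i) = Q i) \<and> (\<Sum>i\<in>J. Q i) = 1"

lemma spec_mult:
  assumes "spec_family J Q"
  shows "(\<Sum>i\<in>J. f i *\<^sub>C Q i) * (\<Sum>i\<in>J. h i *\<^sub>C Q i) = (\<Sum>i\<in>J. (f i * h i) *\<^sub>C Q i)"
proof -
  have J: "finite J" using assms by (simp add: spec_family_def)
  have "(\<Sum>i\<in>J. f i *\<^sub>C Q i) * (\<Sum>i\<in>J. h i *\<^sub>C Q i) = (\<Sum>i\<in>J. \<Sum>j\<in>J. (f i * h j) *\<^sub>C (Q i * Q j))"
    by (simp add: sum_product mult.commute)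
  also have "\<dots> = (\<Sum>i\<in>J. \<Sum>j\<in>J. if i = j then (f i * h i) *\<^sub>C Q i else 0)"
    by (intro sum.cong refl) (use assms in \<open>auto simp: spec_family_def\<close>)
  also have "\<dots> = (\<Sum>i\<in>J. (f i * h i) *\<^sub>C Q i)" using J by simp
  finally show ?thesis .
qed

lemma spec_adj:
  assumes "spec_family J Q"
  shows "adj (\<Sum>i\<in>J. f i *\<^sub>C Q i) = (\<Sum>i\<in>J. cnj (f i) *\<^sub>C Q i)"
  unfolding adj_sum by (intro sum.cong refl) (use assms in \<open>simp add: spec_family_def\<close>)

lemma spec_unitary:
  assumes Q: "spec_family J Q" and f: "\<And>i. i \<in> J \<Longrightarrow> cmod (f i) = 1" and w: "w = (\<Sum>i\<in>J. f i *\<^sub>C Q i)"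
  shows "adj w * w = 1" "w * adj w = 1"
proof -
  have "cnj (f i) * f i = 1" "f i * cnj (f i) = 1" if "i \<in> J" for i
    using f[OF that] by (simp_all add: complex_norm_square[symmetric] mult.commute[of "cnj (f i)"])
  then show "adj w * w = 1" "w * adj w = 1"
    unfolding w spec_adj[OF Q] spec_mult[OF Q] using Q by (auto simp: spec_family_def)
qed

lemma uniform_unitary_spec:
  assumes "uniform_unitary \<tau> n w p"
  shows "spec_family {1..n} p" "w = (\<Sum>j\<in>{1..n}. cis (2 * pi * real j / real n) *\<^sub>C p j)"
  using assms by (auto simp: uniform_unitary_def spec_family_def)

lemma uniform_unitary_unitary:
  assumes "uniform_unitary \<tau> n w p"
  shows "adj w * w = 1" "w * adj w = 1"
  using spec_unitary[OF uniform_unitary_spec(1)[OF assms] _ uniform_unitary_spec(2)[OF assms]] by simp_all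

lemma (in htensor) spec_family_ot:
  assumes P: "spec_family J P" and Q: "spec_family K Q"
  shows "spec_family (J \<times> K) (\<lambda>(i, j). ot (P i) (Q j))"
proof -
  have "(\<Sum>(i, j)\<in>J \<times> K. ot (P i) (Q j)) = (\<Sum>i\<in>J. \<Sum>j\<in>K. ot (P i) (Q j))"
    by (simp add: sum.cartesian_product)
  also have "\<dots> = ot (\<Sum>i\<in>J. P i) (\<Sum>j\<in>K. Q j)" unfolding ot_sum_left unfolding ot_sum_right ..
  finally have "(\<Sum>(i, j)\<in>J \<times> K. ot (P i) (Q j)) = 1" using P Q by (simp add: spec_family_def ot_one)
  then show ?thesis using P Q by (auto simp: spec_family_def ot_mult)
qed

lemma (in htensor) ot_spec:
  "ot (\<Sum>i\<in>J. f i *\<^sub>C P i) (\<Sum>j\<in>K. h j *\<^sub>C Q j) = (\<Sum>p\<in>J \<times> K. (f (fst p) * h (snd p)) *\<^sub>C (case p of (i, j) \<Rightarrow> ot (P i) (Q j)))"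
proof -
  have "ot (\<Sum>i\<in>J. f i *\<^sub>C P i) (\<Sum>j\<in>K. h j *\<^sub>C Q j) = (\<Sum>i\<in>J. \<Sum>j\<in>K. (f i * h j) *\<^sub>C ot (P i) (Q j))"
    unfolding ot_sum_left unfolding ot_sum_right by (simp add: ot_scale_left ot_scale_right mult.commute)
  then show ?thesis by (simp add: sum.cartesian_product case_prod_unfold)
qed


section \<open>Cube roots of unity\<close>

lemma cis_third:
  defines "\<omega> \<equiv> cis (2 * pi / 3)" and "\<delta> \<equiv> cis (2 * pi / 9)"
  shows "\<omega> ^ 3 = 1" "\<omega>\<^sup>2 + \<omega> + 1 = 0" "\<delta> ^ 3 = \<omega>" "cnj \<omega> * \<omega> = 1" "cnj \<delta> * \<delta> = 1"
proof -
  have "\<omega> ^ 3 = cis (real 3 * (2 * pi / 3))" unfolding \<omega>_def by (rule Complex.DeMoivre)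
  also have "real 3 * (2 * pi / 3) = 2 * pi" by simp
  finally show 3: "\<omega> ^ 3 = 1" by simp
  have "sin (2 * pi / 3) > 0" by (rule sin_gt_zero) (use pi_gt_zero in linarith)+
  then have "\<omega> \<noteq> 1" by (auto simp: \<omega>_def complex_eq_iff)
  moreover have "(\<omega> - 1) * (\<omega>\<^sup>2 + \<omega> + 1) = \<omega> ^ 3 - 1" by (simp add: algebra_simps power2_eq_square power3_eq_cube)
  ultimately show "\<omega>\<^sup>2 + \<omega> + 1 = 0" using 3 by simp
  have "\<delta> ^ 3 = cis (real 3 * (2 * pi / 9))" unfolding \<delta>_def by (rule Complex.DeMoivre)
  also have "real 3 * (2 * pi / 9) = 2 * pi / 3" by simp
  finally show "\<delta> ^ 3 = \<omega>" by (simp add: \<omega>_def)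
  show "cnj \<omega> * \<omega> = 1" "cnj \<delta> * \<delta> = 1" by (simp_all add: \<omega>_def \<delta>_def cis_cnj cis_mult)
qed

text \<open>A function on the cube roots of unity is a quadratic polynomial.\<close>

lemma cube_root_interpolation:
  obtains c0 c1 c2 :: complex where
    "\<And>m::nat. c0 + c1 * cis (2 * pi / 3) ^ m + c2 * (cis (2 * pi / 3) ^ m * cis (2 * pi / 3) ^ m) = d ^ (m mod 3)"
proof -
  define w where "w = cis (2 * pi / 3)"
  have w: "w\<^sup>2 + w + 1 = 0" "w ^ 3 = 1" unfolding w_def by (rule cis_third)+
  have w3: "w * (w * w) = 1" using w(2) by (simp add: power3_eq_cube mult.assoc)
  have w2: "w * w = - 1 - w" using w(1) unfolding power2_eq_square by algebra
  define c0 c1 c2 where "c0 = (1 + d + d\<^sup>2) / 3" and "c1 = (1 + d * (w * w) + d\<^sup>2 * w) / 3"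
    and "c2 = (1 + d * w + d\<^sup>2 * (w * w)) / 3"
  have m: "w ^ m = w ^ (m mod 3)" for m
  proof -
    have "w ^ m = w ^ (3 * (m div 3) + m mod 3)" by simp
    also have "\<dots> = w ^ (m mod 3)" unfolding power_add power_mult w(2) by simp
    finally show ?thesis .
  qed
  have cancel3: "a = b" if "3 * a = 3 * b" for a b :: complex using that by simp
  have "c0 + c1 * w ^ m + c2 * (w ^ m * w ^ m) = d ^ (m mod 3)" for m
  proof -
    have "m mod 3 < 3" by simp
    then consider "m mod 3 = 0" | "m mod 3 = 1" | "m mod 3 = 2" by linarith
    then show ?thesis
    proof cases
      case 1
      have "3 * (c0 + c1 + c2) = 3 * 1"
        unfolding c0_def c1_def c2_def using w(1) by simp algebra
      from cancel3[OF this] show ?thesis unfolding m[of m] 1 by simp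
    next
      case 2
      have "3 * (c0 + c1 * w + c2 * (w * w)) = 3 * d"
        unfolding c0_def c1_def c2_def using w(1) by simp algebra
      from cancel3[OF this] show ?thesis unfolding m[of m] 2 by simp
    next
      case 3
      have "3 * (c0 + c1 * w\<^sup>2 + c2 * (w\<^sup>2 * w\<^sup>2)) = 3 * d\<^sup>2"
        unfolding c0_def c1_def c2_def using w(1) by simp algebra
      from cancel3[OF this] show ?thesis unfolding m[of m] 3 by simp
    qed
  qed
  then show ?thesis using that unfolding w_def by blast
qed


section \<open>Conjugation and normal functionals on generated algebras\<close>

text \<open>Conjugation by \<open>w\<^sup>*\<close> maps the commutant of \<open>S\<close> into itself, also when \<open>w\<close> is outside the algebra.\<close>

lemma Ad_vN_gen:
  assumes w: "adj w * w = 1" "w * adj w = 1" and S: "\<And>s. s \<in> S \<Longrightarrow> Ad w s \<in> vN_gen S"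
    and x: "x \<in> vN_gen S"
  shows "Ad w x \<in> vN_gen S"
proof -
  let ?T = "S \<union> adj ` S"
  have comm: "z * y = y * z" if "z \<in> vN_gen S" "y \<in> commutant ?T" for z y
    using that unfolding vN_gen_def commutant_def[of "commutant ?T"] by auto
  have T: "Ad w s \<in> vN_gen S" if "s \<in> ?T" for s
  proof -
    have "Ad w (adj s) = adj (Ad w s)" for s by (simp add: Ad_def mult.assoc)
    then show ?thesis using that S vN_adj[OF vN_algebra_vN_gen[of S]] by auto
  qed
  have "Ad w x * y = y * Ad w x" if y: "y \<in> commutant ?T" for y
  proof -
    have move: "s * (adj w * y * w) = adj w * y * w * s" if "Ad w s * y = y * Ad w s" for s
    proof -
      have "s * (adj w * y * w) = adj w * w * s * adj w * y * w" by (simp add: w mult.assoc[symmetric])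
      also have "\<dots> = adj w * (Ad w s * y) * w" by (simp only: Ad_def mult.assoc)
      also have "\<dots> = adj w * y * w * s * (adj w * w)" unfolding that by (simp only: Ad_def mult.assoc)
      finally show ?thesis by (simp add: w)
    qed
    have "adj w * y * w \<in> commutant ?T"
      unfolding commutant_def using move comm[OF T y] by blast
    from comm[OF x this] have xy: "x * (adj w * y * w) = adj w * y * w * x" .
    have "Ad w x * y = w * (x * (adj w * y * w)) * adj w"
    proof -
      have "w * (x * (adj w * y * w)) * adj w = w * x * adj w * y * (w * adj w)" by (simp only: mult.assoc)
      then show ?thesis by (simp add: Ad_def w)
    qed
    also have "\<dots> = w * adj w * y * (w * x * adj w)" unfolding xy by (simp only: mult.assoc)
    finally show ?thesis by (simp add: Ad_def w)
  qed
  then show ?thesis unfolding vN_gen_def commutant_def[of "commutant ?T"] by auto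
qed

lemma (in htensor) tensor_normal_eqI:
  assumes A: "vN_algebra A" and B: "vN_algebra B"
    and \<omega>: "normal_functional (vN_tensor t A B) \<omega>" and \<omega>': "normal_functional (vN_tensor t A B) \<omega>'"
    and eq: "\<And>x y. x \<in> A \<Longrightarrow> y \<in> B \<Longrightarrow> \<omega> (ot x y) = \<omega>' (ot x y)" and z: "z \<in> vN_tensor t A B"
  shows "\<omega> z = \<omega>' z"
proof -
  define S where "S = {ot x y | x y. x \<in> A \<and> y \<in> B}"
  have N: "vN_tensor t A B = vN_gen S" by (simp add: vN_tensor_def S_def)
  have Ssub: "cspan S \<subseteq> vN_gen S" by (rule cspan_subset_vN[OF vN_algebra_vN_gen vN_gen_superset])
  obtain f g where fg: "\<And>x. x \<in> vN_gen S \<Longrightarrow> \<omega> x = cinner (amp x \<cdot> f) g"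
    using \<omega> unfolding N by (rule normal_functional_amp) blast
  obtain f' g' where fg': "\<And>x. x \<in> vN_gen S \<Longrightarrow> \<omega>' x = cinner (amp x \<cdot> f') g'"
    using \<omega>' unfolding N by (rule normal_functional_amp) blast
  have lin: "amp (c *\<^sub>C x + y) \<cdot> h = c *\<^sub>C (amp x \<cdot> h) + amp y \<cdot> h" "amp 0 \<cdot> h = 0" for c x y and h :: "'l ell2"
    by (rule ell2_eqI; simp)+
  have "cinner (amp y \<cdot> f) g = cinner (amp y \<cdot> f') g'" if "y \<in> cspan S" for y
    using that
  proof induction
    case (step x y c)
    have x: "x \<in> vN_gen S" using step(1) vN_gen_superset by blast
    have "\<omega> x = \<omega>' x" using step(1) eq by (auto simp: S_def)
    then have "cinner (amp x \<cdot> f) g = cinner (amp x \<cdot> f') g'" by (simp only: fg[OF x] fg'[OF x])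
    then show ?case using step(3) by (simp add: lin cinner_add_left cinner_scaleC_left)
  qed (simp add: lin)
  then have cs: "\<omega> y = \<omega>' y" if "y \<in> cspan S" for y using that fg fg' Ssub by (simp add: subset_iff)
  have alg: "y \<in> cspan S" if "y \<in> star_alg S" for y
    using that unfolding S_def
    by (rule star_alg_tensors[rotated -1])
      (simp_all add: vN_mult[OF A] vN_adj[OF A] vN_one[OF A] vN_mult[OF B] vN_adj[OF B] vN_one[OF B])
  show ?thesis
    by (rule normal_functional_eqI[OF \<omega>[unfolded N] \<omega>'[unfolded N] _ z[unfolded N]]) (rule cs[OF alg])
qed


section \<open>Commutation up to scalars\<close>

text \<open>All relations of the model say that two unitaries commute up to a scalar.\<close>

definition qc :: "'h::complex_hilbert_space bop \<Rightarrow> 'h bop \<Rightarrow> complex \<Rightarrow> bool" where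
  "qc w z c \<longleftrightarrow> w * z = c *\<^sub>C (z * w)"

lemma qc_one: "qc 1 z 1" "qc z 1 1" "qc z z 1"
  by (simp_all add: qc_def)

lemma qc_mult_left: "qc w z c \<Longrightarrow> qc w' z c' \<Longrightarrow> qc (w * w') z (c * c')"
proof -
  assume "qc w z c" "qc w' z c'"
  then have 1: "w * z = c *\<^sub>C (z * w)" and 2: "w' * z = c' *\<^sub>C (z * w')" by (simp_all add: qc_def)
  have "w * w' * z = w * (w' * z)" by (rule mult.assoc)
  also have "\<dots> = c' *\<^sub>C (w * z * w')" by (simp add: 2 mult.assoc)
  also have "\<dots> = (c * c') *\<^sub>C (z * (w * w'))" by (simp add: 1 mult.assoc mult.commute)
  finally show ?thesis by (simp add: qc_def)
qed

lemma qc_flip: "qc w z c \<Longrightarrow> cnj c * c = 1 \<Longrightarrow> qc z w (cnj c)"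
  by (simp add: qc_def)

lemma qc_adj_left:
  assumes q: "qc w z c" and c: "cnj c * c = 1" and w: "adj w * w = 1" "w * adj w = 1"
  shows "qc (adj w) z (cnj c)"
proof -
  have "z * adj w = adj w * (w * z) * adj w" by (simp add: w mult.assoc[symmetric])
  also have "w * z = c *\<^sub>C (z * w)" using q by (simp add: qc_def)
  also have "adj w * (c *\<^sub>C (z * w)) * adj w = c *\<^sub>C (adj w * z)" by (simp add: w mult.assoc)
  finally have "z * adj w = c *\<^sub>C (adj w * z)" .
  then show ?thesis by (simp add: qc_def c)
qed

lemma qc_Ad: "qc w z c \<Longrightarrow> w * adj w = 1 \<Longrightarrow> Ad w z = c *\<^sub>C z"
  by (simp add: qc_def Ad_def mult.assoc)

lemma qc_Ad_adj:
  assumes "qc w z c" "cnj c * c = 1" "adj w * w = 1" "w * adj w = 1"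
  shows "adj w * z * w = cnj c *\<^sub>C z"
  using qc_Ad[OF qc_adj_left[OF assms]] assms(3) by (simp add: Ad_def)

lemma Ad_qc:
  assumes "Ad w z = c *\<^sub>C z" "adj w * w = 1"
  shows "qc w z c"
proof -
  have "w * z = w * z * adj w * w" using assms(2) by (simp add: mult.assoc)
  also have "\<dots> = c *\<^sub>C (z * w)" using assms(1) by (simp add: Ad_def)
  finally show ?thesis by (simp add: qc_def)
qed

section \<open>The alternating product\<close>

text \<open>The product \<open>U\<^sub>1\<^sup>* U\<^sub>2 U\<^sub>3\<^sup>* \<dots>\<close> of the first \<open>m\<close> unitaries. The alternating exponents make the two
  scalars that \<open>U\<^sub>k\<close> picks up from its neighbours cancel for \<open>k \<ge> 2\<close>.\<close>

fun altprod :: "(int \<Rightarrow> 'k::complex_hilbert_space bop) \<Rightarrow> nat \<Rightarrow> 'k bop" where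
  "altprod U 0 = 1"
| "altprod U (Suc m) = altprod U m * (if even m then adj (U (int m + 1)) else U (int m + 1))"

text \<open>The scalar by which conjugation with \<open>altprod U m\<close> multiplies \<open>U\<^sub>k\<close>; it is stationary from \<open>m = k + 1\<close>
  on.\<close>

definition alt_scalar :: "nat \<Rightarrow> nat \<Rightarrow> complex" where
  "alt_scalar m k = (if k = 0 then (if m \<ge> 1 then cis (2 * pi / 9) else 1)
    else if k = 1 then (if m \<ge> 2 then cnj (cis (2 * pi / 9)) else 1)
    else if m = k - 1 \<or> m = k then (if even (k - 1) then cis (2 * pi / 9) else cnj (cis (2 * pi / 9))) else 1)"

locale R_relations =
  fixes g :: "'k::complex_hilbert_space bop" and U :: "int \<Rightarrow> 'k bop"
  assumes gU: "adj g * g = 1" "g * adj g = 1" and UU: "\<And>k. adj (U k) * U k = 1" "\<And>k. U k * adj (U k) = 1"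
    and qg: "\<And>k. qc (U k) g (if k \<in> {0, -1} then cnj (cis (2 * pi / 3)) else 1)"
    and qup: "\<And>k. qc (U k) (U (k + 1)) (cis (2 * pi / 9))"
    and qfar: "\<And>i j. \<bar>i - j\<bar> \<ge> 2 \<Longrightarrow> qc (U i) (U j) 1"
begin

lemma qdown: "qc (U (k + 1)) (U k) (cnj (cis (2 * pi / 9)))"
  by (rule qc_flip[OF qup cis_third(5)])

lemma altprod_unitary: "adj (altprod U m) * altprod U m = 1 \<and> altprod U m * adj (altprod U m) = 1"
proof (induction m)
  case (Suc m)
  define P where "P = (if even m then adj (U (int m + 1)) else U (int m + 1))"
  have P: "adj P * P = 1" "P * adj P = 1" using UU by (simp_all add: P_def)
  have "adj P * adj (altprod U m) * (altprod U m * P) = adj P * (adj (altprod U m) * altprod U m) * P"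
    "altprod U m * P * (adj P * adj (altprod U m)) = altprod U m * (P * adj P) * adj (altprod U m)"
    by (simp_all only: mult.assoc)
  then show ?case using Suc P by (simp add: P_def[symmetric])
qed simp

lemma altprod_g: "qc (altprod U m) g 1"
proof (induction m)
  case (Suc m)
  have "qc (U (int m + 1)) g 1" using qg[of "int m + 1"] by simp
  then have "qc (if even m then adj (U (int m + 1)) else U (int m + 1)) g 1"
    using qc_adj_left[of "U (int m + 1)" g 1] UU by simp
  then show ?case using qc_mult_left[OF Suc] by simp
qed (simp add: qc_one)

lemma altprod_U_minus_one: "qc (U (- 1)) (altprod U m) 1"
proof -
  have "qc (altprod U m) (U (- 1)) 1"
  proof (induction m)
    case (Suc m)
    have "qc (U (int m + 1)) (U (- 1)) 1" by (rule qfar) simp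
    then have "qc (if even m then adj (U (int m + 1)) else U (int m + 1)) (U (- 1)) 1"
      using qc_adj_left[of "U (int m + 1)" "U (- 1)" 1] UU by simp
    then show ?case using qc_mult_left[OF Suc] by simp
  qed (simp add: qc_one)
  then show ?thesis using qc_flip[of "altprod U m" "U (- 1)" 1] by simp
qed

lemma altprod_U: "qc (altprod U m) (U (int k)) (alt_scalar m k)"
proof (induction m)
  case 0
  have "alt_scalar 0 k = 1" by (auto simp: alt_scalar_def)
  then show ?case by (simp add: qc_one)
next
  case (Suc m)
  define \<delta> where "\<delta> = cis (2 * pi / 9)"
  have \<delta>: "cnj \<delta> * \<delta> = 1" "\<delta> * cnj \<delta> = 1" using cis_third(5) by (simp_all add: \<delta>_def mult.commute)
  define c where "c = (if k = m + 2 then \<delta> else if k = m then cnj \<delta> else 1)"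
  have q: "qc (U (int m + 1)) (U (int k)) c"
  proof -
    consider "k = m + 2" | "k = m" | "k = m + 1" | "\<bar>int m + 1 - int k\<bar> \<ge> 2" by linarith
    then show ?thesis
    proof cases
      case 1
      then show ?thesis using qup[of "int m + 1"] by (simp add: c_def \<delta>_def add_ac)
    next
      case 2
      then show ?thesis using qdown[of "int m"] by (simp add: c_def \<delta>_def)
    next
      case 3
      then show ?thesis using qc_one(3)[of "U (int m + 1)"] by (simp add: c_def add_ac)
    next
      case 4
      then show ?thesis using qfar[OF 4] by (auto simp: c_def)
    qed
  qed
  have cc: "cnj c * c = 1" using \<delta> by (simp add: c_def)
  define c' where "c' = (if even m then cnj c else c)"
  have "qc (if even m then adj (U (int m + 1)) else U (int m + 1)) (U (int k)) c'"
    using q qc_adj_left[OF q cc UU] by (simp add: c'_def)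
  then have "qc (altprod U (Suc m)) (U (int k)) (alt_scalar m k * c')"
    using qc_mult_left[OF Suc] by simp
  moreover have "alt_scalar m k * c' = alt_scalar (Suc m) k"
  proof -
    consider "k = 0" | "k = 1" | j where "k = j + 2" by (metis One_nat_def add_2_eq_Suc' not0_implies_Suc)
    then show ?thesis
    proof cases
      case 1
      then show ?thesis using \<delta> by (cases "m = 0") (simp_all add: alt_scalar_def c'_def c_def \<delta>_def[symmetric])
    next
      case 2
      then show ?thesis using \<delta> by (cases "m = 0"; cases "m = 1") (simp_all add: alt_scalar_def c'_def c_def \<delta>_def[symmetric])
    next
      case (3 j)
      then show ?thesis using \<delta>
        by (cases "m = j"; cases "m = Suc j"; cases "m = Suc (Suc j)")
          (auto simp: alt_scalar_def c'_def c_def \<delta>_def[symmetric])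
    qed
  qed
  ultimately show ?case by simp
qed

end

section \<open>The model\<close>

locale setting =
  fixes t :: "'h::complex_hilbert_space \<Rightarrow> 'k::complex_hilbert_space \<Rightarrow> 'l::complex_hilbert_space"
    and X :: "nat \<Rightarrow> 'h bop" and u :: "'h bop" and e :: "nat \<Rightarrow> 'h bop"
    and \<tau>A :: "'h bop \<Rightarrow> complex" and \<alpha> :: "'h bop \<Rightarrow> 'h bop"
    and g :: "'k bop" and gp :: "nat \<Rightarrow> 'k bop"
    and U :: "int \<Rightarrow> 'k bop" and Up :: "int \<Rightarrow> nat \<Rightarrow> 'k bop"
    and \<tau>R :: "'k bop \<Rightarrow> complex"
    and \<alpha>\<beta> \<gamma> \<psi> :: "'l bop \<Rightarrow> 'l bop" and A :: "'h bop set" and R0 :: "'k bop set"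
    and N :: "'l bop set" and W :: "'l bop"
  assumes tensor: "hilbert_tensor t"
    and LF: "LF_model X u e \<tau>A" and alpha: "LF_auto X u \<alpha>"
    and R: "R_model g gp U Up \<tau>R"
    and A_def: "A = LF_alg X u" and R0_def: "R0 = R0_alg g U"
    and N_def: "N = vN_tensor t A R0"
    and alpha_beta: "tensor_aut t A R0 \<alpha> (R0_beta g U) \<alpha>\<beta>"
    and W_def: "W = W_unitary t e gp"
    and gamma_def: "\<gamma> = (\<lambda>x\<in>N. Ad W (\<alpha>\<beta> x))"
    and psi: "tensor_aut t A R0 (\<lambda>x\<in>A. x) (\<lambda>y\<in>R0. Ad (adj (U 0)) (R0_beta g U y)) \<psi>"
begin

sublocale htensor t by standard (rule tensor)

abbreviation \<omega> where "\<omega> \<equiv> cis (2 * pi / 3)"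
abbreviation \<delta> where "\<delta> \<equiv> cis (2 * pi / 9)"
abbreviation b where "b \<equiv> R0_beta g U"

lemma vN_A: "vN_algebra A" and vN_R0: "vN_algebra R0" and vN_N: "vN_algebra N"
  unfolding A_def LF_alg_def R0_def R0_alg_def N_def vN_tensor_def by (rule vN_algebra_vN_gen)+

lemmas N_closed [simp, intro] = vN_adj[OF vN_N] vN_one[OF vN_N] vN_zero[OF vN_N] vN_add[OF vN_N]
  vN_mult[OF vN_N] vN_scale[OF vN_N]

lemma u_unitary: "adj u * u = 1" "u * adj u = 1"
  using LF uniform_unitary_unitary[of \<tau>A 3 u e] by (simp_all add: LF_model_def)

sublocale RR: R_relations g U
proof
  have uu: "uniform_unitary \<tau>R 9 (U k) (Up k)" and ug: "uniform_unitary \<tau>R 3 g gp" for k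
    using R by (simp_all add: R_model_def)
  show gg: "adj g * g = 1" "g * adj g = 1" using uniform_unitary_unitary[OF ug] by simp_all
  show UU: "adj (U k) * U k = 1" "U k * adj (U k) = 1" for k using uniform_unitary_unitary[OF uu] by simp_all
  show "qc (U k) g (if k \<in> {0, -1} then cnj \<omega> else 1)" for k
    by (rule Ad_qc[OF _ UU(1)]) (use R in \<open>simp add: R_model_def Ad_def\<close>)
  show "qc (U k) (U (k + 1)) \<delta>" for k
    by (rule Ad_qc[OF _ UU(1)]) (use R in \<open>simp add: R_model_def Ad_def\<close>)
  show "qc (U i) (U j) 1" if "\<bar>i - j\<bar> \<ge> 2" for i j
    using R that by (simp add: R_model_def qc_def)
qed

lemma gens_A: "X 1 \<in> A" "X 2 \<in> A" "X 3 \<in> A" "u \<in> A"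
  unfolding A_def LF_alg_def by (rule subsetD[OF vN_gen_superset]; simp)+

lemma gens_R0: "g \<in> R0" "0 \<le> k \<Longrightarrow> U k \<in> R0"
  unfolding R0_def R0_alg_def by (rule subsetD[OF vN_gen_superset]; simp)+

lemma one_A: "1 \<in> A" and one_R0: "1 \<in> R0"
  by (rule vN_one[OF vN_A], rule vN_one[OF vN_R0])

lemma ot_N: "x \<in> A \<Longrightarrow> y \<in> R0 \<Longrightarrow> ot x y \<in> N"
  unfolding N_def by (rule vN_tensor_ot)

definition gens :: "'l bop set" where
  "gens = (\<lambda>x. ot x 1) ` {X 1, X 2, X 3, u} \<union> ot 1 ` insert g (U ` {0..})"

lemma N_gens: "N = vN_gen gens"
  unfolding N_def gens_def
  by (rule vN_tensor_generators) (simp_all add: A_def LF_alg_def R0_def R0_alg_def)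

lemma gens_cases:
  assumes "s \<in> gens"
  obtains x where "x \<in> {X 1, X 2, X 3, u}" "s = ot x 1" | "s = ot 1 g" | k where "s = ot 1 (U (int k))"
proof -
  from assms consider x where "x \<in> {X 1, X 2, X 3, u}" "s = ot x 1" | "s = ot 1 g" | k where "0 \<le> k" "s = ot 1 (U k)"
    unfolding gens_def by blast
  then show ?thesis
  proof cases
    case (3 k)
    then have "s = ot 1 (U (int (nat k)))" by simp
    then show ?thesis by (rule that(3))
  qed (use that in blast)+
qed

lemma b_eq: "y \<in> R0 \<Longrightarrow> b y = Ad (U (- 1)) y"
  by (simp add: R0_beta_def R0_def)

lemma b_in: "y \<in> R0 \<Longrightarrow> b y \<in> R0"
proof -
  assume y: "y \<in> R0"
  have "Ad (U (- 1)) s \<in> R0" if sS: "s \<in> insert g (U ` {0..})" for s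
  proof -
    have "\<exists>c. Ad (U (- 1)) s = c *\<^sub>C s"
    proof (cases "s = g")
      case True
      then show ?thesis using qc_Ad[OF RR.qg RR.UU(2)] by blast
    next
      case False
      then obtain k where k: "0 \<le> k" "s = U k" using sS by auto
      then consider "k = 0" | "\<bar>- 1 - k\<bar> \<ge> 2" by linarith
      then show ?thesis
      proof cases
        case 1
        then show ?thesis using qc_Ad[OF RR.qup[of "- 1"] RR.UU(2)] k by auto
      next
        case 2
        then show ?thesis using qc_Ad[OF RR.qfar[OF 2] RR.UU(2)] k by blast
      qed
    qed
    moreover have "s \<in> R0" using sS gens_R0 by auto
    ultimately show ?thesis using vN_scale[OF vN_R0] by auto
  qed
  moreover have R0S: "R0 = vN_gen (insert g (U ` {0..}))" by (simp only: R0_def R0_alg_def)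
  ultimately have S: "Ad (U (- 1)) s \<in> vN_gen (insert g (U ` {0..}))" if "s \<in> insert g (U ` {0..})" for s
    using that by (simp only:)
  have "Ad (U (- 1)) y \<in> vN_gen (insert g (U ` {0..}))"
    by (rule Ad_vN_gen[OF RR.UU(1) RR.UU(2) S y[unfolded R0S]])
  then show ?thesis by (simp only: b_eq[OF y] R0S)
qed

lemma b_one: "b 1 = 1" using RR.UU(2) by (simp add: b_eq one_R0 Ad_def)

lemma b_g: "b g = cnj \<omega> *\<^sub>C g"
  using qc_Ad[OF RR.qg[of "- 1"] RR.UU(2)] by (simp add: b_eq gens_R0)

lemma b_U: "b (U (int k)) = (if k = 0 then \<delta> else 1) *\<^sub>C U (int k)"
proof (cases "k = 0")
  case True
  then show ?thesis using qc_Ad[OF RR.qup[of "- 1"] RR.UU(2)] by (simp add: b_eq gens_R0)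
next
  case False
  then have "\<bar>- 1 - int k\<bar> \<ge> 2" by linarith
  then show ?thesis using qc_Ad[OF RR.qfar RR.UU(2)] False by (simp add: b_eq gens_R0)
qed

lemma alpha_Aut: "\<alpha> \<in> Aut A" and alpha_X: "\<alpha> (X 1) = X 2" "\<alpha> (X 2) = X 3" "\<alpha> (X 3) = u * X 1 * adj u"
  and alpha_u: "\<alpha> u = \<omega> *\<^sub>C u"
  using alpha by (simp_all add: LF_auto_def A_def)

lemma alpha_hom: "x \<in> A \<Longrightarrow> y \<in> A \<Longrightarrow> \<alpha> (x * y) = \<alpha> x * \<alpha> y" "x \<in> A \<Longrightarrow> \<alpha> (adj x) = adj (\<alpha> x)"
  "x \<in> A \<Longrightarrow> \<alpha> (c *\<^sub>C x) = c *\<^sub>C \<alpha> x" "x \<in> A \<Longrightarrow> \<alpha> x \<in> A" "\<alpha> 1 = 1"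
  using alpha_Aut Aut_bij[OF alpha_Aut] Aut_one[OF vN_A alpha_Aut] by (auto simp: Aut_def bij_betw_def)

lemma alpha_conj: "x \<in> A \<Longrightarrow> \<alpha> (u * x * adj u) = u * \<alpha> x * adj u"
proof -
  assume x: "x \<in> A"
  have "\<alpha> (u * x * adj u) = (\<omega> *\<^sub>C u) * \<alpha> x * adj (\<omega> *\<^sub>C u)"
    using x gens_A(4) by (simp add: alpha_hom alpha_u vN_mult[OF vN_A] vN_adj[OF vN_A])
  then show ?thesis using cis_third(4) by simp
qed

lemma \<alpha>\<beta>_hom: "nhom N \<alpha>\<beta>" and \<psi>_hom: "nhom N \<psi>"
  using alpha_beta psi nhom_Aut[OF vN_N] by (simp_all add: tensor_aut_def N_def)

lemma \<alpha>\<beta>_ot: "x \<in> A \<Longrightarrow> y \<in> R0 \<Longrightarrow> \<alpha>\<beta> (ot x y) = ot (\<alpha> x) (b y)"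
  using alpha_beta by (simp add: tensor_aut_def)

lemma \<psi>_ot: "x \<in> A \<Longrightarrow> y \<in> R0 \<Longrightarrow> \<psi> (ot x y) = ot x (adj (U 0) * b y * U 0)"
  using psi by (simp add: tensor_aut_def Ad_def)

lemma \<alpha>\<beta>_left: "x \<in> A \<Longrightarrow> \<alpha>\<beta> (ot x 1) = ot (\<alpha> x) 1"
  and \<alpha>\<beta>_right: "y \<in> R0 \<Longrightarrow> \<alpha>\<beta> (ot 1 y) = ot 1 (b y)"
  and \<psi>_left: "x \<in> A \<Longrightarrow> \<psi> (ot x 1) = ot x 1"
  using RR.UU by (simp_all add: \<alpha>\<beta>_ot \<psi>_ot one_A one_R0 b_one alpha_hom(5))

lemma \<psi>_g: "\<psi> (ot 1 g) = ot 1 g"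
proof -
  have "adj (U 0) * g * U 0 = \<omega> *\<^sub>C g"
    using qc_Ad_adj[OF RR.qg[of 0] _ RR.UU] cis_third(4) by (simp add: mult.commute)
  then show ?thesis
    using cis_third(4) by (simp add: \<psi>_ot one_A gens_R0 b_g ot_scale_right)
qed

lemma \<psi>_U: "\<psi> (ot 1 (U (int k))) = alt_scalar (k + 2) k *\<^sub>C ot 1 (U (int k))"
proof -
  have "adj (U 0) * U (int k) * U 0 = (if k = 1 then cnj \<delta> else 1) *\<^sub>C U (int k)"
  proof -
    consider "k = 0" | "k = 1" | "\<bar>0 - int k\<bar> \<ge> 2" by linarith
    then show ?thesis
    proof cases
      case 1
      then show ?thesis using RR.UU by simp
    next
      case 2
      then show ?thesis using qc_Ad_adj[OF RR.qup[of 0] cis_third(5) RR.UU] by simp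
    next
      case 3
      then show ?thesis using qc_Ad_adj[OF RR.qfar[OF 3] _ RR.UU] by auto
    qed
  qed
  moreover have "alt_scalar (k + 2) k = (if k = 0 then \<delta> else 1) * (if k = 1 then cnj \<delta> else 1)"
    by (auto simp: alt_scalar_def)
  ultimately show ?thesis by (simp only: \<psi>_ot one_A gens_R0 b_U) (simp add: \<psi>_ot one_A gens_R0 b_U ot_scale_right)
qed

definition Z :: "'l bop" where "Z = ot u g"

lemma Z_in: "Z \<in> N" and Z_unitary: "adj Z * Z = 1" "Z * adj Z = 1"
  using u_unitary RR.gU by (simp_all add: Z_def ot_N gens_A gens_R0 ot_mult ot_one)

lemma \<alpha>\<beta>_Z: "\<alpha>\<beta> Z = Z"
  using cis_third(4)
  by (simp add: Z_def \<alpha>\<beta>_ot gens_A gens_R0 b_g alpha_u ot_scale_left ot_scale_right)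

lemma \<psi>_Z: "\<psi> Z = Z"
proof -
  have Z: "Z = ot u 1 * ot 1 g" by (simp add: Z_def ot_mult)
  show ?thesis
    unfolding Z by (simp add: nhom_mult[OF \<psi>_hom] ot_N gens_A gens_R0 one_A one_R0 \<psi>_left \<psi>_g)
qed

definition JJ :: "(nat \<times> nat) set" where "JJ = {1..3} \<times> {1..3}"
definition Q :: "nat \<times> nat \<Rightarrow> 'l bop" where "Q = (\<lambda>(i, j). ot (e i) (gp j))"

lemma Q_spec: "spec_family JJ Q"
  unfolding JJ_def Q_def
  using LF R uniform_unitary_spec(1)[of \<tau>A 3 u e] uniform_unitary_spec(1)[of \<tau>R 3 g gp]
  by (intro spec_family_ot) (simp_all add: LF_model_def R_model_def)

lemma Z_spec: "Z = (\<Sum>p\<in>JJ. \<omega> ^ (fst p + snd p) *\<^sub>C Q p)"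
proof -
  have u: "u = (\<Sum>i\<in>{1..3}. \<omega> ^ i *\<^sub>C e i)" and g: "g = (\<Sum>j\<in>{1..3}. \<omega> ^ j *\<^sub>C gp j)"
    using LF R uniform_unitary_spec(2)[of \<tau>A 3 u e] uniform_unitary_spec(2)[of \<tau>R 3 g gp]
    by (simp_all add: LF_model_def R_model_def Complex.DeMoivre mult_ac)
  show ?thesis
    unfolding Z_def by (subst u, subst g, subst ot_spec) (simp add: JJ_def Q_def power_add)
qed

lemma E_proj_spec: "E_proj t e gp l = (\<Sum>p\<in>JJ. (if (fst p + snd p) mod 3 = l mod 3 then 1 else 0) *\<^sub>C Q p)"
proof -
  have "E_proj t e gp l = (\<Sum>p\<in>{p \<in> JJ. (fst p + snd p) mod 3 = l mod 3}. Q p)"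
    unfolding E_proj_def by (rule sum.cong) (auto simp: JJ_def Q_def)
  also have "\<dots> = (\<Sum>p\<in>JJ. if (fst p + snd p) mod 3 = l mod 3 then Q p else 0)"
    by (rule sum.inter_filter) (simp add: JJ_def)
  also have "\<dots> = (\<Sum>p\<in>JJ. (if (fst p + snd p) mod 3 = l mod 3 then 1 else 0) *\<^sub>C Q p)"
    by (rule sum.cong) simp_all
  finally show ?thesis .
qed

lemma W_spec: "W = (\<Sum>p\<in>JJ. cnj \<delta> ^ ((fst p + snd p) mod 3) *\<^sub>C Q p)"
proof -
  have "cnj \<delta> * (if m mod 3 = 1 mod 3 then 1 else 0) + (cnj \<delta>)\<^sup>2 * (if m mod 3 = 2 mod 3 then 1 else 0)
      + (if m mod 3 = 3 mod 3 then 1 else 0) = cnj \<delta> ^ (m mod 3)" for m :: nat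
  proof -
    have "m mod 3 < 3" by simp
    then consider "m mod 3 = 0" | "m mod 3 = 1" | "m mod 3 = 2" by linarith
    then show ?thesis by cases simp_all
  qed
  then show ?thesis
    unfolding W_def W_unitary_def E_proj_spec bop_scale_sum
    by (simp only: sum.distrib[symmetric] bop_scale_simps(3) bop_scale_add(2)[symmetric])
qed

lemma W_unitary: "adj W * W = 1" "W * adj W = 1"
  by (rule spec_unitary[OF Q_spec _ W_spec]; simp add: norm_power)+

text \<open>\<open>W\<close> is a cube root of \<open>Z\<^sup>*\<close> and a polynomial in \<open>Z\<close>.\<close>

lemma W_cube: "W * W * W = adj Z"
proof -
  have "cnj \<delta> ^ (m mod 3) * cnj \<delta> ^ (m mod 3) * cnj \<delta> ^ (m mod 3) = cnj (\<omega> ^ m)" for m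
  proof -
    have "cnj \<delta> ^ (m mod 3) * cnj \<delta> ^ (m mod 3) * cnj \<delta> ^ (m mod 3) = cnj ((\<delta> ^ 3) ^ (m mod 3))"
      by (simp add: power_mult_distrib[symmetric] power3_eq_cube)
    also have "\<dots> = cnj ((\<omega> ^ 3) ^ (m div 3) * \<omega> ^ (m mod 3))" by (simp only: cis_third) simp
    also have "\<dots> = cnj (\<omega> ^ m)" by (simp only: power_mult[symmetric] power_add[symmetric]) simp
    finally show ?thesis .
  qed
  then show ?thesis
    unfolding Z_spec spec_adj[OF Q_spec] W_spec spec_mult[OF Q_spec] by simp
qed

lemma W_poly: obtains c0 c1 c2 where "W = c0 *\<^sub>C 1 + c1 *\<^sub>C Z + c2 *\<^sub>C (Z * Z)"
proof -
  obtain c0 c1 c2 where c: "\<And>m. c0 + c1 * \<omega> ^ m + c2 * (\<omega> ^ m * \<omega> ^ m) = cnj \<delta> ^ (m mod 3)"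
    using cube_root_interpolation[of "cnj \<delta>"] by metis
  have one: "(1::'l bop) = (\<Sum>p\<in>JJ. 1 *\<^sub>C Q p)" using Q_spec by (simp add: spec_family_def)
  have "c0 *\<^sub>C 1 + c1 *\<^sub>C Z + c2 *\<^sub>C (Z * Z) = W"
    unfolding Z_spec spec_mult[OF Q_spec] W_spec c[symmetric]
    by (subst one) (simp only: bop_scale_sum sum.distrib[symmetric] bop_scale_simps(3) bop_scale_add(2)[symmetric] mult_1_right)
  then show ?thesis using that by metis
qed

lemma W_in: "W \<in> N"
  by (rule W_poly) (simp add: Z_in)

lemma W_fixed:
  assumes "nhom N \<Phi>" "\<Phi> Z = Z"
  shows "\<Phi> W = W"
  by (rule W_poly) (simp add: nhom_add[OF assms(1)] nhom_scale[OF assms(1)] nhom_mult[OF assms(1)]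
      nhom_one[OF assms(1)] assms(2) Z_in)

lemma W_commute:
  assumes "Z * x = x * Z"
  shows "W * x = x * W"
proof -
  have "Z * Z * x = x * (Z * Z)" by (rule commute_mult[OF assms assms])
  then show ?thesis by (rule_tac W_poly) (simp add: distrib_left distrib_right assms)
qed

lemma W_N: "W \<in> unitaries N"
  using W_in W_unitary by (simp add: unitaries_def)

lemma \<gamma>_eq: "x \<in> N \<Longrightarrow> \<gamma> x = Ad W (\<alpha>\<beta> x)"
  by (simp add: gamma_def)

lemma \<gamma>_hom: "nhom N \<gamma>"
  by (rule nhom_cong[OF nhom_compose[OF nhom_Ad[OF vN_N W_N] \<alpha>\<beta>_hom] vN_N]) (rule \<gamma>_eq)

text \<open>Since \<open>\<alpha>\<beta>\<close> is normal, the relations \<open>\<alpha>\<^sup>3 = Ad u\<close> and \<open>\<beta>\<^sup>3 = Ad g\<close> are needed on generators only.\<close>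

lemma \<alpha>\<beta>_cube: "x \<in> N \<Longrightarrow> \<alpha>\<beta> (\<alpha>\<beta> (\<alpha>\<beta> x)) = Ad Z x"
proof (rule nhom_eqI[OF N_gens nhom_compose[OF \<alpha>\<beta>_hom nhom_compose[OF \<alpha>\<beta>_hom \<alpha>\<beta>_hom]] nhom_Ad[OF vN_N]])
  show "Z \<in> unitaries N" using Z_in Z_unitary by (simp add: unitaries_def)
  note [simp] = gens_A gens_R0 vN_mult[OF vN_A] vN_adj[OF vN_A] vN_scale[OF vN_A]
  have left: "Ad Z (ot x 1) = ot (u * x * adj u) 1" for x
    using RR.gU by (simp add: Z_def Ad_def ot_mult)
  have right: "Ad Z (ot 1 y) = ot 1 (g * y * adj g)" for y
    using u_unitary by (simp add: Z_def Ad_def ot_mult)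
  have \<omega>3: "\<omega> * (\<omega> * \<omega>) = 1" "cnj \<omega> * (cnj \<omega> * cnj \<omega>) = 1" "\<delta> * (\<delta> * \<delta>) = \<omega>"
  proof -
    show w: "\<omega> * (\<omega> * \<omega>) = 1" and "\<delta> * (\<delta> * \<delta>) = \<omega>"
      using cis_third(1,3) by (simp_all add: power3_eq_cube mult.assoc)
    have "cnj \<omega> * (cnj \<omega> * cnj \<omega>) = cnj (\<omega> * (\<omega> * \<omega>))" by simp
    then show "cnj \<omega> * (cnj \<omega> * cnj \<omega>) = 1" unfolding w by simp
  qed
  fix s assume "s \<in> gens"
  then show "\<alpha>\<beta> (\<alpha>\<beta> (\<alpha>\<beta> s)) = Ad Z s"
  proof (cases rule: gens_cases)
    case (1 x)
    then consider "x = X 1" | "x = X 2" | "x = X 3" | "x = u" by blast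
    then have "\<alpha> (\<alpha> (\<alpha> x)) = u * x * adj u"
    proof cases
      case 4
      then show ?thesis using u_unitary \<omega>3 by (simp add: alpha_u alpha_hom mult.assoc)
    qed (simp_all add: alpha_X alpha_conj del: One_nat_def)
    moreover have "x \<in> A" using 1 gens_A by auto
    ultimately show ?thesis using 1 by (simp add: \<alpha>\<beta>_left alpha_hom left)
  next
    case 2
    then show ?thesis
      using \<omega>3 RR.gU
      by (simp add: \<alpha>\<beta>_right b_g right ot_scale_right nhom_scale[OF \<alpha>\<beta>_hom] ot_N one_A mult.assoc)
  next
    case (3 k)
    have "qc g (U (int k)) (if k = 0 then \<omega> else 1)"
    proof (cases "k = 0")
      case True
      have "\<omega> * cnj \<omega> = 1" by (subst mult.commute) (rule cis_third(4))
      then show ?thesis using qc_flip[OF RR.qg[of 0]] True by simp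
    next
      case False
      then show ?thesis using qc_flip[OF RR.qg[of "int k"]] by simp
    qed
    then have "g * U (int k) * adj g = (if k = 0 then \<omega> else 1) *\<^sub>C U (int k)"
      using qc_Ad[OF _ RR.gU(2)] by (simp add: Ad_def)
    then show ?thesis
      using 3 \<omega>3 by (simp add: \<alpha>\<beta>_right b_U right ot_scale_right nhom_scale[OF \<alpha>\<beta>_hom] ot_N one_A mult.assoc)
  qed
qed

lemma \<gamma>_cube:
  assumes x: "x \<in> N"
  shows "\<gamma> (\<gamma> (\<gamma> x)) = x"
proof -
  note [simp] = x W_in nhom_in[OF \<alpha>\<beta>_hom]
  have W: "\<alpha>\<beta> W = W" by (rule W_fixed[OF \<alpha>\<beta>_hom \<alpha>\<beta>_Z])
  have step: "\<alpha>\<beta> (Ad W y) = Ad W (\<alpha>\<beta> y)" if "y \<in> N" for y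
    using that by (simp add: Ad_def nhom_mult[OF \<alpha>\<beta>_hom] nhom_adj[OF \<alpha>\<beta>_hom] W)
  have AdN: "Ad W y \<in> N" if "y \<in> N" for y using that by (simp add: Ad_def)
  have "\<gamma> (\<gamma> (\<gamma> x)) = Ad W (Ad W (Ad W (\<alpha>\<beta> (\<alpha>\<beta> (\<alpha>\<beta> x)))))"
    by (simp add: \<gamma>_eq AdN step)
  also have "\<dots> = Ad (W * W * W) (Ad Z x)" by (simp add: \<alpha>\<beta>_cube Ad_def mult.assoc)
  also have "\<dots> = adj Z * Z * x * (adj Z * Z)" unfolding W_cube Ad_def by (simp add: mult.assoc)
  finally show ?thesis by (simp add: Z_unitary)
qed

lemma \<psi>_\<gamma>:
  assumes x: "x \<in> N"
  shows "\<psi> (\<gamma> x) = \<gamma> (\<psi> x)"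
proof -
  note [simp] = x W_in nhom_in[OF \<alpha>\<beta>_hom] nhom_in[OF \<psi>_hom]
  have "\<psi> (\<alpha>\<beta> x) = \<alpha>\<beta> (\<psi> x)"
  proof (rule nhom_eqI[OF N_gens nhom_compose[OF \<psi>_hom \<alpha>\<beta>_hom] nhom_compose[OF \<alpha>\<beta>_hom \<psi>_hom] _ x])
    fix s assume "s \<in> gens"
    then show "\<psi> (\<alpha>\<beta> s) = \<alpha>\<beta> (\<psi> s)"
    proof (cases rule: gens_cases)
      case (1 y)
      then have "y \<in> A" using gens_A by auto
      then show ?thesis using 1 by (simp add: \<alpha>\<beta>_left \<psi>_left alpha_hom)
    next
      case 2
      then show ?thesis
        by (simp add: \<psi>_g \<alpha>\<beta>_right b_g gens_R0 ot_scale_right nhom_scale[OF \<psi>_hom] ot_N one_A)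
    next
      case (3 k)
      then show ?thesis
        by (simp add: \<psi>_U \<alpha>\<beta>_right b_U gens_R0 ot_scale_right nhom_scale[OF \<psi>_hom]
            nhom_scale[OF \<alpha>\<beta>_hom] ot_N one_A mult.commute)
    qed
  qed
  then show ?thesis
    by (simp add: \<gamma>_eq Ad_def nhom_mult[OF \<psi>_hom] nhom_adj[OF \<psi>_hom] W_fixed[OF \<psi>_hom \<psi>_Z])
qed

end


section \<open>The Jones invariant of the automorphism\<close>

theorem mainTheorem4:
  fixes t :: "'h::complex_hilbert_space \<Rightarrow> 'k::complex_hilbert_space \<Rightarrow> 'l::complex_hilbert_space"
    and X :: "nat \<Rightarrow> 'h bop" and u :: "'h bop" and e :: "nat \<Rightarrow> 'h bop"
    and \<tau>A :: "'h bop \<Rightarrow> complex" and \<alpha> :: "'h bop \<Rightarrow> 'h bop"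
    and g :: "'k bop" and gp :: "nat \<Rightarrow> 'k bop"
    and U :: "int \<Rightarrow> 'k bop" and Up :: "int \<Rightarrow> nat \<Rightarrow> 'k bop"
    and \<tau>R :: "'k bop \<Rightarrow> complex"
    and \<alpha>\<beta> \<gamma> \<psi> :: "'l bop \<Rightarrow> 'l bop" and A :: "'h bop set" and R0 :: "'k bop set"
    and N :: "'l bop set" and W :: "'l bop"
    and M :: "('l \<times> 'l \<times> 'l) bop set" and \<tau> :: "('l \<times> 'l \<times> 'l) bop \<Rightarrow> complex"
    and \<beta>\<mu> :: "('l \<times> 'l \<times> 'l) bop \<Rightarrow> ('l \<times> 'l \<times> 'l) bop"
  assumes tensor: "hilbert_tensor t"
    and LF: "LF_model X u e \<tau>A" and alpha: "LF_auto X u \<alpha>"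
    and R: "R_model g gp U Up \<tau>R"
    and A_def: "A = LF_alg X u" and R0_def: "R0 = R0_alg g U"
    and N_def: "N = vN_tensor t A R0"
    and alpha_beta: "tensor_aut t A R0 \<alpha> (R0_beta g U) \<alpha>\<beta>"
    and W_def: "W = W_unitary t e gp"
    and gamma_def: "\<gamma> = (\<lambda>x\<in>N. Ad W (\<alpha>\<beta> x))"
    and M_def: "M = crossed_product N \<gamma>"
    and trace: "faithful_normal_trace M \<tau>"
    and trace_tensor: "\<And>x y k. x \<in> A \<Longrightarrow> y \<in> R0 \<Longrightarrow> k < 3 \<Longrightarrow>
      \<tau> (crossed_pi \<gamma> (op_tensor t x y) * crossed_v ^ k) = (if k = 0 then \<tau>A x * \<tau>R y else 0)"
    and psi: "tensor_aut t A R0 (\<lambda>x\<in>A. x) (\<lambda>y\<in>R0. Ad (adj (U 0)) (R0_beta g U y)) \<psi>"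
    and beta_mu_ext: "\<beta>\<mu> \<in> extensional M"
    and beta_mu: "\<And>a :: nat \<Rightarrow> 'l bop. (\<forall>k\<le>2. a k \<in> N) \<Longrightarrow>
      \<beta>\<mu> (\<Sum>k\<le>2. crossed_pi \<gamma> (a k) * crossed_v ^ k) = (\<Sum>k\<le>2. crossed_pi \<gamma> (\<psi> (a k)) * crossed_v ^ k)"
  shows "\<beta>\<mu> \<in> Ct M \<tau> \<inter> Inn_closure M \<tau> \<and>
    quotient_xi M \<beta>\<mu> \<in> carrier (ChiGroup M \<tau>) \<and>
    jones_kappa M \<tau> (quotient_xi M \<beta>\<mu>) = cis (2 * pi / 9)"
proof -
  interpret S: setting t X u e \<tau>A \<alpha> g gp U Up \<tau>R \<alpha>\<beta> \<gamma> \<psi> A R0 N W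
    by (unfold_locales; fact)
  interpret C: crossed N \<gamma>
    by (unfold_locales; (rule S.vN_N | rule S.\<gamma>_hom | erule S.\<gamma>_cube))
  note tr = trace[unfolded M_def]
  have normal: "normal_functional C.M \<tau>" using tr by (simp add: faithful_normal_trace_def)
  have zero_normal: "normal_functional N (\<lambda>_. 0)"
    by (rule normal_functional_cong[OF normal_functional_vector[of N 0 0]]) simp
  interpret CT: crossed_trace N \<gamma> \<tau>
  proof
    show "faithful_normal_trace C.M \<tau>" by (rule tr)
    fix a assume a: "a \<in> N"
    show "\<tau> (C.\<pi> a * C.v) = 0"
    proof (rule S.tensor_normal_eqI[OF S.vN_A S.vN_R0, folded N_def, OF _ zero_normal _ a])
      show "normal_functional N (\<lambda>a. \<tau> (C.\<pi> a * C.v))" by (rule C.coefficient_normal[OF normal C.v_in])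
      show "\<tau> (C.\<pi> (S.ot x y) * C.v) = 0" if "x \<in> A" "y \<in> R0" for x y
        using trace_tensor[OF that, of 1] by simp
    qed
    show "\<tau> (C.\<pi> a * (C.v * C.v)) = 0"
    proof (rule S.tensor_normal_eqI[OF S.vN_A S.vN_R0, folded N_def, OF _ zero_normal _ a])
      show "normal_functional N (\<lambda>a. \<tau> (C.\<pi> a * (C.v * C.v)))"
        by (rule C.coefficient_normal[OF normal vN_mult[OF C.M C.v_in C.v_in]])
      show "\<tau> (C.\<pi> (S.ot x y) * (C.v * C.v)) = 0" if "x \<in> A" "y \<in> R0" for x y
        using trace_tensor[OF that, of 2] by (simp add: power2_eq_square)
    qed
  qed
  have tr_ot: "CT.\<tau>N (S.ot x y) = \<tau>A x * \<tau>R y" if "x \<in> A" "y \<in> R0" for x y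
    using trace_tensor[OF that, of 0] by simp
  have G_Un: "(\<Union>i\<in>{0..3}. {if i = 0 then u else X i}) = {X 1, X 2, X 3, u}"
  proof -
    have "{0..3::nat} = {0, 1, 2, 3}" by auto
    then show ?thesis by auto
  qed
  interpret TF: tensor_free t A \<tau>A "{0..3::nat}" "\<lambda>i. {if i = 0 then u else X i}" N CT.\<tau>N R0 \<tau>R
  proof
    show "vN_algebra A" "vN_algebra R0" by (rule S.vN_A, rule S.vN_R0)
    show "faithful_normal_trace A \<tau>A" using LF by (simp add: LF_model_def A_def)
    show "free_family \<tau>A {0..3} (\<lambda>i. star_alg {if i = 0 then u else X i})" using LF by (simp add: LF_model_def)
    show "A = vN_gen (\<Union>i\<in>{0..3}. {if i = 0 then u else X i})" unfolding G_Un by (simp add: A_def LF_alg_def)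
    show "{if i = 0 then u else X i} \<subseteq> A" if "i \<in> {0..3}" for i :: nat
    proof -
      have "{if i = 0 then u else X i} \<subseteq> {X 1, X 2, X 3, u}" using that unfolding G_Un[symmetric] by blast
      then show ?thesis using S.gens_A by auto
    qed
    show "N = vN_tensor t A R0" by (rule N_def)
    show "CT.\<tau>N (S.ot x y) = \<tau>A x * \<tau>R y" if "x \<in> A" "y \<in> R0" for x y by (rule tr_ot[OF that])
  qed
  have sc: "semicircular \<tau>A (X i)" "adj (X i) = X i" if "i \<in> {1..3}" for i
    using LF that by (auto simp: LF_model_def semicircular_def)
  obtain r1 where r1: "\<And>n m. \<tau>A (cheb n (complex_of_real (2 / r1) *\<^sub>C X 1) * cheb m (complex_of_real (2 / r1) *\<^sub>C X 1))
      = (if n = m then 1 else 0)"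
  proof -
    have "1 \<in> {1..3::nat}" by simp
    from TF.FA.semicircular_cheb[OF S.gens_A(1) sc(1)[OF this]] show thesis using that by metis
  qed
  obtain r2 where r2: "\<And>n m. \<tau>A (cheb n (complex_of_real (2 / r2) *\<^sub>C X 2) * cheb m (complex_of_real (2 / r2) *\<^sub>C X 2))
      = (if n = m then 1 else 0)"
  proof -
    have "2 \<in> {1..3::nat}" by simp
    from TF.FA.semicircular_cheb[OF S.gens_A(2) sc(1)[OF this]] show thesis using that by metis
  qed
  define sX where "sX r i = complex_of_real (2 / r) *\<^sub>C X i" for r and i :: nat
  have sX: "sX r i \<in> star_alg {if i = 0 then u else X i}" "adj (sX r i) = sX r i" if "i \<in> {1..3}" for r i
  proof -
    show "sX r i \<in> star_alg {if i = 0 then u else X i}"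
      unfolding sX_def by (rule star_alg.scale, rule star_alg.gen) (use that in simp)
    show "adj (sX r i) = sX r i" using sc(2)[OF that] by (simp add: sX_def)
  qed
  have pair1: "TF.letter_pair 1 (sX r1 1) j (sX r1 j)" if "j \<in> {1..3}" for j
    using that sX[OF that] sX[of 1] r1 by (simp add: TF.letter_pair_def sX_def)
  have pair2: "TF.letter_pair 2 (sX r2 2) j (sX r2 j)" if "j \<in> {1..3}" for j
    using that sX[OF that] sX[of 2] r2 by (simp add: TF.letter_pair_def sX_def)
  interpret RA: tracial "R_alg g U" \<tau>R
    by standard (use R in \<open>simp_all add: R_model_def R_alg_def vN_algebra_vN_gen\<close>)
  have U_RA: "U k \<in> R_alg g U" for k
    unfolding R_alg_def by (rule subsetD[OF vN_gen_superset]) simp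
  have R0_RA: "y \<in> R_alg g U" if "y \<in> R0" for y
  proof -
    have "R0 \<subseteq> R_alg g U"
      unfolding R0_def R0_alg_def R_alg_def
      by (rule vN_gen_mono_vN[OF vN_algebra_vN_gen]) (rule order_trans[OF _ vN_gen_superset], blast)
    then show ?thesis using that by blast
  qed
  have \<psi>_right: "\<psi> (S.ot 1 y) = S.ot 1 (adj (U 0) * S.b y * U 0)" if "y \<in> R0" for y
    by (rule S.\<psi>_ot[OF S.one_A that])
  have conj_R0: "adj (U 0) * S.b y * U 0 \<in> R0" if "y \<in> R0" for y
    using S.b_in[OF that] S.gens_R0(2)[of 0] by (simp add: vN_mult[OF S.vN_R0] vN_adj[OF S.vN_R0])
  have tr_conj: "\<tau>R (adj (U 0) * S.b y * U 0) = \<tau>R y" if y: "y \<in> R0" for y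
  proof -
    note m = U_RA R0_RA[OF y] R0_RA[OF S.b_in[OF y]]
    have "\<tau>R (adj (U 0) * S.b y * U 0) = \<tau>R (U 0 * (adj (U 0) * S.b y))" using m by (intro RA.tr_comm) auto
    also have "U 0 * (adj (U 0) * S.b y) = S.b y" using S.RR.UU(2) by (simp add: mult.assoc[symmetric])
    also have "\<tau>R (S.b y) = \<tau>R (U (- 1) * y * adj (U (- 1)))" using y by (simp add: S.b_eq Ad_def)
    also have "\<dots> = \<tau>R (adj (U (- 1)) * (U (- 1) * y))" using m by (intro RA.tr_comm) auto
    also have "adj (U (- 1)) * (U (- 1) * y) = y" using S.RR.UU(1) by (simp add: mult.assoc[symmetric])
    finally show ?thesis .
  qed
  have tr_\<psi>: "CT.\<tau>N (\<psi> a) = CT.\<tau>N a" if a: "a \<in> N" for a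
  proof (rule S.tensor_normal_eqI[OF S.vN_A S.vN_R0, folded N_def, OF _ CT.NT.tr_normal _ a])
    show "normal_functional N (\<lambda>a. CT.\<tau>N (\<psi> a))" by (rule nhom_normal[OF S.\<psi>_hom CT.NT.tr_normal])
    show "CT.\<tau>N (\<psi> (S.ot x y)) = CT.\<tau>N (S.ot x y)" if "x \<in> A" "y \<in> R0" for x y
      using that by (simp only: S.\<psi>_ot tr_ot conj_R0 tr_conj)
  qed
  have \<psi>_iso: "CT.nN (\<psi> a) = CT.nN a" if a: "a \<in> N" for a
    using tr_\<psi>[of "adj a * a"] a by (simp add: norm2_def nhom_mult[OF S.\<psi>_hom] nhom_adj[OF S.\<psi>_hom])
  interpret MD: model t A \<tau>A "{0..3::nat}" "\<lambda>i. {if i = 0 then u else X i}" N \<gamma> \<tau> R0 \<tau>R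
    \<alpha>\<beta> \<psi> W S.b "U 0" 1 2 2 3 "sX r1 1" "sX r2 2" "sX r1 2" "sX r2 3"
  proof
    show "W \<in> unitaries N" "nhom N \<alpha>\<beta>" "nhom N \<psi>" by (rule S.W_N, rule S.\<alpha>\<beta>_hom, rule S.\<psi>_hom)
    show "U 0 \<in> unitaries R0" using S.gens_R0(2)[of 0] S.RR.UU by (simp add: unitaries_def)
    show "\<alpha>\<beta> (S.ot (sX r1 1) 1) = S.ot (sX r1 2) 1" "\<alpha>\<beta> (S.ot (sX r2 2) 1) = S.ot (sX r2 3) 1"
      using S.gens_A by (simp_all add: sX_def S.\<alpha>\<beta>_left S.alpha_hom S.alpha_X vN_scale[OF S.vN_A] del: One_nat_def)
    show "TF.letter_pair 1 (sX r1 1) 1 (sX r1 1)" "TF.letter_pair 2 (sX r2 2) 2 (sX r2 2)"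
      "TF.letter_pair 1 (sX r1 1) 2 (sX r1 2)" "TF.letter_pair 2 (sX r2 2) 3 (sX r2 3)"
      by (rule pair1 pair2; simp)+
    show "\<gamma> a = Ad W (\<alpha>\<beta> a)" "CT.nN (\<psi> a) = CT.nN a" if "a \<in> N" for a
      using that by (rule S.\<gamma>_eq, rule \<psi>_iso)
    show "\<alpha>\<beta> (S.ot 1 y) = S.ot 1 (S.b y)" "\<psi> (S.ot 1 y) = S.ot 1 (adj (U 0) * S.b y * U 0)" if "y \<in> R0" for y
      using that by (rule S.\<alpha>\<beta>_right, rule \<psi>_right)
  qed simp_all
  have \<beta>_rep: "\<beta>\<mu> (C.rep a b c) = C.rep (\<psi> a) (\<psi> b) (\<psi> c)" if "a \<in> N" "b \<in> N" "c \<in> N" for a b c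
  proof -
    define f where "f k = (if k = 0 then a else if k = 1 then b else c)" for k :: nat
    have "\<forall>k\<le>2. f k \<in> N" using that by (simp add: f_def)
    from beta_mu[OF this] show ?thesis
      by (simp add: numeral_2_eq_2 f_def C.rep_def)
  qed
  have "\<psi> \<in> Aut N" using psi by (simp add: tensor_aut_def N_def)
  then have bij: "bij_betw \<psi> N N" by (rule Aut_bij)
  have \<beta>A: "\<beta>\<mu> \<in> Aut C.M"
    by (rule CT.coefficientwise_Aut[OF S.\<psi>_hom bij S.\<psi>_\<gamma> beta_mu_ext[unfolded M_def] \<beta>_rep])
  have Ct: "\<beta>\<mu> \<in> Ct C.M \<tau>" by (rule MD.coefficientwise_Ct[OF \<beta>A \<beta>_rep])
  define V where "V n = altprod U (n + 2)" for n
  have V_R0: "V n \<in> R0" for n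
  proof -
    have "altprod U m \<in> R0" for m
      by (induction m) (simp_all add: vN_one[OF S.vN_R0] vN_mult[OF S.vN_R0] vN_adj[OF S.vN_R0] S.gens_R0)
    then show ?thesis unfolding V_def .
  qed
  have VV: "adj (V n) * V n = 1" "V n * adj (V n) = 1" for n
    using S.RR.altprod_unitary unfolding V_def by blast+
  define w where "w n = S.ot 1 (V n)" for n
  have w: "w n \<in> unitaries N" for n
    using VV V_R0 by (simp add: w_def unitaries_def S.ot_N S.one_A S.ot_mult S.ot_one)
  have V_b: "S.b (V n) = V n" for n
    using qc_Ad[OF S.RR.altprod_U_minus_one S.RR.UU(2)] S.b_eq[OF V_R0] by (simp add: V_def del: altprod.simps)
  have w_\<gamma>: "\<gamma> (w n) = w n" for n
  proof -
    have "V n * g = g * V n" using S.RR.altprod_g[of "n + 2"] by (simp add: V_def qc_def del: altprod.simps)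
    then have "S.Z * w n = w n * S.Z" by (simp add: S.Z_def w_def S.ot_mult)
    then have "W * w n = w n * W" by (rule S.W_commute)
    then have "Ad W (w n) = w n" using S.W_unitary by (simp add: Ad_def mult.assoc)
    moreover have "\<alpha>\<beta> (w n) = w n" by (simp add: w_def S.\<alpha>\<beta>_right V_R0 V_b)
    moreover have "w n \<in> N" by (rule CT.NT.unitariesD(1)[OF w])
    ultimately show ?thesis by (simp add: S.\<gamma>_eq)
  qed
  have w_Ad: "Ad (w n) (S.ot x y) = S.ot x (Ad (V n) y)" for n x y
    by (simp add: w_def Ad_def S.ot_mult)
  have lim_N: "(\<lambda>n. CT.nN (Ad (w n) a - \<psi> a)) \<longlonglongrightarrow> 0" if "a \<in> N" for a
  proof (rule CT.NT.Ad_limit_from_generators[OF S.N_gens w S.\<psi>_hom \<psi>_iso _ that])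
    fix s assume "s \<in> S.gens"
    then show "\<forall>\<^sub>F n in sequentially. Ad (w n) s = \<psi> s"
    proof (cases rule: S.gens_cases)
      case (1 x)
      then have "x \<in> A" using S.gens_A by auto
      then show ?thesis using 1 VV(2) by (simp add: w_Ad S.\<psi>_left) (simp add: Ad_def VV)
    next
      case 2
      have "Ad (V n) g = g" for n
        using qc_Ad[OF S.RR.altprod_g[of "n + 2"]] VV(2)[of n] by (simp add: V_def del: altprod.simps)
      then show ?thesis using 2 by (simp add: w_Ad S.\<psi>_g)
    next
      case (3 k)
      have "Ad (w n) s = \<psi> s" if "k + 1 \<le> n" for n
      proof -
        have "Ad (V n) (U (int k)) = alt_scalar (n + 2) k *\<^sub>C U (int k)"
          using qc_Ad[OF S.RR.altprod_U[of "n + 2" k]] VV(2)[of n] by (simp add: V_def del: altprod.simps)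
        moreover have "alt_scalar (n + 2) k = alt_scalar (k + 2) k" using that by (auto simp: alt_scalar_def)
        ultimately show ?thesis using 3 by (simp only: w_Ad S.\<psi>_U S.ot_scale_right)
      qed
      then show ?thesis by (rule eventually_sequentiallyI)
    qed
  qed
  have lim: "(\<lambda>n. CT.n2 (Ad (C.\<pi> (w n)) x - \<beta>\<mu> x)) \<longlonglongrightarrow> 0" if "x \<in> C.M" for x
    by (rule CT.coefficientwise_Ad_limit[OF w w_\<gamma> S.\<psi>_hom \<beta>_rep lim_N that])
  have \<pi>w: "C.\<pi> (w n) \<in> unitaries C.M" for n by (rule CT.\<pi>_unitary[OF w])
  have Inn: "\<beta>\<mu> \<in> Ct C.M \<tau> \<inter> Inn_closure C.M \<tau>"
    using Ct CT.MT.Inn_closureI[OF \<beta>A \<pi>w lim] by blast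
  have eigen: "\<beta>\<mu> (C.\<pi> (w n)) = cis (2 * pi / 9) *\<^sub>C C.\<pi> (w n)" for n
  proof -
    have wN: "w n \<in> N" by (rule CT.NT.unitariesD(1)[OF w])
    have "qc (V n) (U 0) (cis (2 * pi / 9))"
      using S.RR.altprod_U[of "n + 2" 0] by (simp add: V_def alt_scalar_def del: altprod.simps)
    then have "qc (U 0) (V n) (cnj (cis (2 * pi / 9)))" by (rule qc_flip[OF _ cis_third(5)])
    then have "adj (U 0) * V n * U 0 = cis (2 * pi / 9) *\<^sub>C V n"
      using qc_Ad_adj[of "U 0" "V n" "cnj (cis (2 * pi / 9))"] S.RR.UU cis_third(5) by (simp add: mult.commute)
    then have "\<psi> (w n) = cis (2 * pi / 9) *\<^sub>C w n"
      unfolding w_def \<psi>_right[OF V_R0] V_b by (simp add: S.ot_scale_right)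
    moreover have "\<beta>\<mu> (C.rep (w n) 0 0) = C.rep (\<psi> (w n)) 0 0"
      using wN \<beta>_rep[of "w n" 0 0] by (simp add: nhom_zero[OF S.\<psi>_hom S.vN_N])
    ultimately show ?thesis using wN by (simp add: C.rep_\<pi> C.\<pi>_scale)
  qed
  have "jones_kappa C.M \<tau> (quotient_xi C.M \<beta>\<mu>) = cis (2 * pi / 9)"
    by (rule CT.MT.jones_kappa_eqI[OF Inn _ \<pi>w lim eigen]) simp
  then show ?thesis
    unfolding M_def using Inn CT.MT.quotient_xi_in_ChiGroup[OF Inn] by blast
qed


end
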